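(* Let $a,b>0$, $I=[-a,b]$, and let $h:I\to(0,\infty)$ be a continuous function such that: (i) $x=0$ is the only point of global maximum of $h$ on $I$; (ii) $h$ is $C^1$ on $I\setminus\{0\}$, and in a neighborhood of $x=0$ it admits the expansion $$h(x)=\begin{cases} M-c_+x^m+O(x^{m+1}), & x>0,\\ M-c_-|x|^m+O(|x|^{m+1}), & x<0,\end{cases}$$ where $M,m,c_\pm$ are real numbers with $M>0$, $c_\pm>0$, $m\ge 1$. Let $\alpha=2(m+2)^{-1}$ and $j\in\mathbb N$. Let $\widetilde\Psi_{j,\epsilon}$ be the $j$-th normalized (real-valued) eigenfunction of the operator $\mathbf Q_\epsilon$ on $L^2(I)$, and let $X_j$ be the $j$-th normalized (real-valued) eigenfunction of the operator $\mathbf H$ on $L^2(\mathbb R)$, where $\mathbf Q_\epsilon$ and $\mathbf H$ are as defined in the context. If the signs of the eigenfunctions are chosen appropriately, then $$\int_I\left|\widetilde\Psi_{j,\epsilon}(x)-\epsilon^{-\alpha/2}X_j(x\epsilon^{-\alpha})\right|^2dx\to0\qquad\text{as }\epsilon\to0.$$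
   Context: For $\epsilon>0$, $\mathbf Q_\epsilon$ is the self-adjoint operator on $L^2(I)$ $$\mathbf Q_\epsilon u=-\frac{d^2u}{dx^2}+W_\epsilon(x)u,\qquad u(-a)=u(b)=0,$$ associated with the quadratic form $\mathbf q_\epsilon[\chi]=\int_I(\chi'(x)^2+W_\epsilon(x)\chi^2(x))\,dx$ defined on $H^1_0(I)$, where $$W_\epsilon(x)=\frac{\pi^2}{\epsilon^2}\left(\frac1{h^2(x)}-\frac1{M^2}\right)+v(x),\qquad v(x)=\left(\frac{\pi^2}{3}+\frac14\right)\frac{h'(x)^2}{h^2(x)}.$$ $\mathbf H=-\frac{d^2}{dx^2}+q(x)$ is the self-adjoint operator on $L^2(\mathbb R)$ with $q(x)=2\pi^2M^{-3}c_+x^m$ for $x>0$ and $q(x)=2\pi^2M^{-3}c_-|x|^m$ for $x<0$ (defined via its quadratic form). Eigenvalues are enumerated in increasing order and eigenfunctions are normalized in the respective $L^2$ space. The choice of sign of $\widetilde\Psi_{j,\epsilon}$ may depend on $\epsilon$. *)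

theory Defs
  imports "HOL-Analysis.Analysis" "HOL-Library.Landau_Symbols"
begin

text \<open>Elements of \<open>L\<^sup>2(S)\<close> are represented by real functions on the line, of which only the
  restriction to \<open>S\<close> matters; two functions that agree almost everywhere on \<open>S\<close> represent the
  same element.\<close>

definition L2 :: "real set \<Rightarrow> (real \<Rightarrow> real) set" where
  "L2 S = {u. set_borel_measurable lborel S u \<and> set_integrable lborel S (\<lambda>x. (u x)\<^sup>2)}"

definition L2_inner :: "real set \<Rightarrow> (real \<Rightarrow> real) \<Rightarrow> (real \<Rightarrow> real) \<Rightarrow> real" where
  "L2_inner S u w = (LINT x:S|lborel. u x * w x)"

definition L2_norm :: "real set \<Rightarrow> (real \<Rightarrow> real) \<Rightarrow> real" where
  "L2_norm S u = sqrt (L2_inner S u u)"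

definition test_functions :: "real set \<Rightarrow> (real \<Rightarrow> real) set" where
  "test_functions S = {\<phi>. (\<forall>k x. ((deriv ^^ k) \<phi>) differentiable (at x)) \<and>
     (\<exists>K. compact K \<and> K \<subseteq> S \<and> (\<forall>x. x \<notin> K \<longrightarrow> \<phi> x = 0))}"

definition has_weak_deriv :: "real set \<Rightarrow> (real \<Rightarrow> real) \<Rightarrow> (real \<Rightarrow> real) \<Rightarrow> bool" where
  "has_weak_deriv S u g \<longleftrightarrow> (\<forall>\<phi> \<in> test_functions S.
     (LINT x:S|lborel. u x * deriv \<phi> x) = - (LINT x:S|lborel. g x * \<phi> x))"

definition H1 :: "real set \<Rightarrow> (real \<Rightarrow> real) set" where
  "H1 S = {u \<in> L2 S. \<exists>g \<in> L2 S. has_weak_deriv S u g}"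

text \<open>For open \<open>S\<close> and \<open>u \<in> H1 S\<close> the weak derivative is determined up to null sets, so that the
  choice below does not affect any integral in which it occurs.\<close>

definition weak_deriv :: "real set \<Rightarrow> (real \<Rightarrow> real) \<Rightarrow> real \<Rightarrow> real" where
  "weak_deriv S u = (SOME g. g \<in> L2 S \<and> has_weak_deriv S u g)"

definition H10 :: "real set \<Rightarrow> (real \<Rightarrow> real) set" where
  "H10 S = {u \<in> H1 S. \<exists>\<phi>. (\<forall>n::nat. \<phi> n \<in> test_functions S) \<and>
     (\<lambda>n. L2_norm S (\<lambda>x. \<phi> n x - u x)) \<longlonglongrightarrow> 0 \<and>
     (\<lambda>n. L2_norm S (\<lambda>x. deriv (\<phi> n) x - weak_deriv S u x)) \<longlonglongrightarrow> 0}"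

definition schroedinger_form ::
  "real set \<Rightarrow> (real \<Rightarrow> real) \<Rightarrow> (real \<Rightarrow> real) \<Rightarrow> (real \<Rightarrow> real) \<Rightarrow> real" where
  "schroedinger_form S V u w =
     (LINT x:S|lborel. weak_deriv S u x * weak_deriv S w x + V x * u x * w x)"

text \<open>The self-adjoint operator associated with a closed, semibounded symmetric form \<open>q\<close> with
  domain \<open>D\<close>, given by its graph: \<open>form_operator S D q u f\<close> says that \<open>u\<close> lies in the domain of
  the operator and is mapped to \<open>f\<close>.\<close>

definition form_operator ::
  "real set \<Rightarrow> (real \<Rightarrow> real) set \<Rightarrow> ((real \<Rightarrow> real) \<Rightarrow> (real \<Rightarrow> real) \<Rightarrow> real)
     \<Rightarrow> (real \<Rightarrow> real) \<Rightarrow> (real \<Rightarrow> real) \<Rightarrow> bool" where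
  "form_operator S D q u f \<longleftrightarrow>
     u \<in> D \<and> f \<in> L2 S \<and> (\<forall>w\<in>D. q u w = L2_inner S f w)"

text \<open>\<open>u 1, u 2, \<dots>\<close> are the normalized eigenfunctions of \<open>A\<close>, and \<open>ev 1 \<le> ev 2 \<le> \<dots>\<close> the
  eigenvalues, repeated according to multiplicity. The last clause says that the list is
  exhaustive. The values at index 0 are irrelevant.\<close>

definition eigen_enumeration ::
  "real set \<Rightarrow> ((real \<Rightarrow> real) \<Rightarrow> (real \<Rightarrow> real) \<Rightarrow> bool) \<Rightarrow> (nat \<Rightarrow> real)
     \<Rightarrow> (nat \<Rightarrow> real \<Rightarrow> real) \<Rightarrow> bool" where
  "eigen_enumeration S A ev u \<longleftrightarrow>
     (\<forall>j\<ge>1. A (u j) (\<lambda>x. ev j * u j x)) \<and>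
     (\<forall>j\<ge>1. \<forall>k\<ge>1. L2_inner S (u j) (u k) = (if j = k then 1 else 0)) \<and>
     (\<forall>j\<ge>1. \<forall>k\<ge>j. ev j \<le> ev k) \<and>
     (\<forall>\<mu> w. A w (\<lambda>x. \<mu> * w x) \<and> (\<forall>j\<ge>1. L2_inner S (u j) w = 0)
        \<longrightarrow> L2_norm S w = 0)"

text \<open>In \<open>W_pot\<close> the argument \<open>h'\<close> is the derivative of \<open>h\<close>; its value at 0, where \<open>h\<close> need not
  be differentiable, plays no role.\<close>

definition v_pot :: "(real \<Rightarrow> real) \<Rightarrow> (real \<Rightarrow> real) \<Rightarrow> real \<Rightarrow> real" where
  "v_pot h h' x = (pi\<^sup>2 / 3 + 1 / 4) * ((h' x)\<^sup>2 / (h x)\<^sup>2)"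

definition W_pot :: "(real \<Rightarrow> real) \<Rightarrow> (real \<Rightarrow> real) \<Rightarrow> real \<Rightarrow> real \<Rightarrow> real \<Rightarrow> real" where
  "W_pot h h' M \<epsilon> x = pi\<^sup>2 / \<epsilon>\<^sup>2 * (1 / (h x)\<^sup>2 - 1 / M\<^sup>2) + v_pot h h' x"

definition Q_op :: "real \<Rightarrow> real \<Rightarrow> (real \<Rightarrow> real) \<Rightarrow> (real \<Rightarrow> real) \<Rightarrow> real \<Rightarrow> real
    \<Rightarrow> (real \<Rightarrow> real) \<Rightarrow> (real \<Rightarrow> real) \<Rightarrow> bool" where
  "Q_op a b h h' M \<epsilon> = form_operator {-a<..<b} (H10 {-a<..<b})
     (schroedinger_form {-a<..<b} (W_pot h h' M \<epsilon>))"

definition q_pot :: "real \<Rightarrow> real \<Rightarrow> real \<Rightarrow> real \<Rightarrow> real \<Rightarrow> real" where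
  "q_pot M m cp cm x = 2 * pi\<^sup>2 / M ^ 3 * (if x > 0 then cp else cm) * \<bar>x\<bar> powr m"

definition H_op :: "real \<Rightarrow> real \<Rightarrow> real \<Rightarrow> real \<Rightarrow> (real \<Rightarrow> real) \<Rightarrow> (real \<Rightarrow> real) \<Rightarrow> bool" where
  "H_op M m cp cm = form_operator UNIV
     {u \<in> H1 UNIV. set_integrable lborel UNIV (\<lambda>x. q_pot M m cp cm x * (u x)\<^sup>2)}
     (schroedinger_form UNIV (q_pot M m cp cm))"

end

theory Submission
  imports Defs "HOL-Computational_Algebra.Polynomial" "HOL-Library.Diagonal_Subsequence"
begin

text \<open>Put \<open>s = \<epsilon> powr \<alpha>\<close> and \<open>y = x / s\<close>. In the variable \<open>y\<close> the operator \<open>s\<^sup>2 Q\<^sub>\<epsilon>\<close>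
  has the potential \<open>K (s y) |y|\<^sup>m + s\<^sup>2 v (s y)\<close>, where \<open>K\<close> is bounded between positive constants and
  has the one-sided limits \<open>2 \<pi>\<^sup>2 c\<^sub>\<plusminus> / M\<^sup>3\<close> at 0; formally it converges to \<open>H\<close>. The potential \<open>v\<close> is
  integrable, because the form is defined on a parabola that vanishes only at the end points, and since its
  integral scales with \<open>s\<close> it disappears in the limit.

  Rescaled eigenfunctions with bounded rescaled eigenvalues are equicontinuous (the form controls the
  derivative in \<open>L\<^sup>2\<close>) and do not lose mass at infinity (the potential grows there), so a subsequence
  converges to a normalized eigenfunction of \<open>H\<close>. Eigenvalues of \<open>H\<close> are simple, by constancy of
  the Wronskian. The theorem follows by induction on \<open>j\<close>: cutting off and rescaling \<open>X\<^sub>j\<close> gives a trial function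
  for the variational principle of \<open>Q\<^sub>\<epsilon>\<close>, nearly orthogonal to the first \<open>j - 1\<close> eigenfunctions, so the
  limit eigenvalue is at most \<open>\<mu>\<^sub>j\<close>; the limit function is orthogonal to \<open>X\<^sub>1, \<dots>, X\<^sub>j\<^sub>-\<^sub>1\<close>, hence
  must be \<open>\<plusminus> X\<^sub>j\<close>. Thus \<open>|\<langle>\<Psi>\<^sub>j, X\<^sub>j\<rangle>| \<longlongrightarrow> 1\<close> along every sequence, which is the claim up to sign.\<close>

section \<open>Smooth functions and test functions\<close>

text \<open>The scale is forced by \<alpha> = 2 / (m + 2): for s = \<epsilon> powr \<alpha> one has
  s powr (m + 2) = \<epsilon>^2, so that s^2 / \<epsilon>^2 times |s y|^m is exactly |y|^m.

  One obstacle is that \<open>eigen_enumeration\<close> describes the eigenvalues only as an ordered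
  and exhaustive list, not by a variational principle. On the interval the principle is derived: a
  Rayleigh quotient below the j-th eigenvalue, on the complement of the first j - 1 eigenfunctions,
  would lead to a minimizer that is an eigenfunction missing from the list. On the line only
  exhaustiveness, orthogonality and simplicity are used.

  The other obstacle is regularity. The definitions work with functions modulo null sets and with an
  arbitrarily chosen weak derivative, and v is merely integrable. Everything is therefore moved to
  continuous representatives, encoded as primitives (\<open>primitive_on\<close>), for which
  integration by parts, pointwise limits and stretching make sense directly.

  Signs are never chosen along the way: only absolute values of inner products are followed, and the
  sign enters in the last step.\<close>

primrec diff_times :: "nat \<Rightarrow> (real \<Rightarrow> real) \<Rightarrow> bool" where
  "diff_times 0 f \<longleftrightarrow> True"
| "diff_times (Suc n) f \<longleftrightarrow> (\<forall>x. f differentiable (at x)) \<and> diff_times n (deriv f)"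

text \<open>By \<open>smooth_iff_deriv_funpow\<close> this is the condition in
  \<open>test_functions\<close>. The recursive form lets closure under products be proved by
  induction on the order, since the derivative of a product is again a sum of products.\<close>

definition smooth :: "(real \<Rightarrow> real) \<Rightarrow> bool" where
  "smooth f \<longleftrightarrow> (\<forall>n. diff_times n f)"

lemma diff_times_SucI:
  assumes "\<And>x. (f has_real_derivative f' x) (at x)" "diff_times n f'"
  shows "diff_times (Suc n) f"
proof -
  have "deriv f = f'" using assms(1) DERIV_imp_deriv by blast
  then show ?thesis using assms by (auto simp: real_differentiable_def)
qed

lemma diff_times_Suc_derivD:
  assumes "diff_times (Suc n) f"
  shows "(f has_real_derivative deriv f x) (at x)"
  using assms by (auto simp: DERIV_deriv_iff_real_differentiable)

lemma diff_times_Suc: "diff_times (Suc n) f \<Longrightarrow> diff_times n f"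
  by (induction n arbitrary: f) auto

lemma diff_times_const: "diff_times n (\<lambda>x. c)"
  by (induction n arbitrary: c) (auto intro: diff_times_SucI[where f' = "\<lambda>x. 0"])

lemma diff_times_add: "diff_times n f \<Longrightarrow> diff_times n g \<Longrightarrow> diff_times n (\<lambda>x. f x + g x)"
proof (induction n arbitrary: f g)
  case (Suc n)
  show ?case
    using Suc.prems diff_times_Suc_derivD
    by (intro diff_times_SucI[where f' = "\<lambda>x. deriv f x + deriv g x"] Suc.IH DERIV_add) auto
qed simp

lemma diff_times_mult: "diff_times n f \<Longrightarrow> diff_times n g \<Longrightarrow> diff_times n (\<lambda>x. f x * g x)"
proof (induction n arbitrary: f g)
  case (Suc n)
  have "diff_times n f" "diff_times n g" using Suc.prems diff_times_Suc by blast+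
  then have "diff_times n (\<lambda>x. deriv f x * g x + deriv g x * f x)"
    using Suc.prems by (intro diff_times_add Suc.IH) auto
  then show ?case
    using Suc.prems diff_times_Suc_derivD
    by (intro diff_times_SucI[where f' = "\<lambda>x. deriv f x * g x + deriv g x * f x"] DERIV_mult) auto
qed simp

lemma diff_times_affine: "diff_times n f \<Longrightarrow> diff_times n (\<lambda>x. f (k * x + d))"
proof (induction n arbitrary: f)
  case (Suc n)
  have 1: "diff_times n (\<lambda>x. deriv f (k * x + d) * k)"
    using Suc by (intro diff_times_mult diff_times_const) auto
  have 2: "((\<lambda>x. f (k * x + d)) has_real_derivative deriv f (k * x + d) * k) (at x)" for x
    using diff_times_Suc_derivD[OF Suc.prems]
    by (rule DERIV_chain2) (auto intro!: derivative_eq_intros)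
  show ?case
    by (rule diff_times_SucI[OF 2 1])
qed simp

lemma smooth_const: "smooth (\<lambda>x. c)"
  and smooth_add: "smooth f \<Longrightarrow> smooth g \<Longrightarrow> smooth (\<lambda>x. f x + g x)"
  and smooth_mult: "smooth f \<Longrightarrow> smooth g \<Longrightarrow> smooth (\<lambda>x. f x * g x)"
  and smooth_affine: "smooth f \<Longrightarrow> smooth (\<lambda>x. f (k * x + d))"
  by (auto simp: smooth_def diff_times_const diff_times_add diff_times_mult diff_times_affine)

lemma smooth_antideriv:
  assumes "\<And>x. (f has_real_derivative f' x) (at x)" "smooth f'"
  shows "smooth f"
  unfolding smooth_def
proof
  fix n
  show "diff_times n f"
    using assms by (cases n) (auto simp: smooth_def simp del: diff_times.simps(2) intro: diff_times_SucI)
qed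

lemma smooth_deriv: "smooth f \<Longrightarrow> smooth (deriv f)"
  by (metis diff_times.simps(2) smooth_def)

lemma smooth_has_derivative: "smooth f \<Longrightarrow> (f has_real_derivative deriv f x) (at x)"
  by (metis diff_times_Suc_derivD smooth_def)

lemma smooth_continuous: "smooth f \<Longrightarrow> continuous_on S f"
  by (meson DERIV_isCont continuous_at_imp_continuous_on smooth_has_derivative)

lemma smooth_iff_deriv_funpow:
  "smooth f \<longleftrightarrow> (\<forall>k x. (deriv ^^ k) f differentiable (at x))"
proof
  assume f: "smooth f"
  have "smooth ((deriv ^^ k) f)" for k
    by (induction k) (auto simp: f smooth_deriv)
  then show "\<forall>k x. (deriv ^^ k) f differentiable (at x)"
    using smooth_has_derivative real_differentiable_def by blast
next
  assume f: "\<forall>k x. (deriv ^^ k) f differentiable (at x)"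
  have "diff_times n g" if "\<forall>k x. (deriv ^^ k) g differentiable (at x)" for n g
    using that
  proof (induction n arbitrary: g)
    case (Suc n)
    have "(deriv ^^ k) (deriv g) differentiable (at x)" for k x
      using Suc.prems[rule_format, of "Suc k" x] by (simp add: funpow_swap1)
    moreover have "g differentiable (at x)" for x
      using Suc.prems[rule_format, of 0 x] by simp
    ultimately show ?case using Suc.IH by simp
  qed simp
  then show "smooth f" using f by (auto simp: smooth_def)
qed

lemma test_functions_iff:
  "\<phi> \<in> test_functions S \<longleftrightarrow>
     smooth \<phi> \<and> (\<exists>K. compact K \<and> K \<subseteq> S \<and> (\<forall>x. x \<notin> K \<longrightarrow> \<phi> x = 0))"
  by (simp add: test_functions_def smooth_iff_deriv_funpow)

text \<open>Makes the Weierstrass approximants in \<open>H10_approx_C1\<close> usable as factors of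
  test functions.\<close>

lemma smooth_real_polynomial_function:
  assumes "real_polynomial_function p"
  shows "smooth p"
  using assms
proof (induction rule: real_polynomial_function.induct)
  case (linear f)
  then obtain c where "f = (\<lambda>x. x * c)"
    by (meson real_bounded_linear)
  moreover have "smooth (\<lambda>x. x * c)"
    by (rule smooth_antideriv[where f' = "\<lambda>x. c"]) (auto intro!: derivative_eq_intros smooth_const)
  ultimately show ?case by simp
qed (auto intro: smooth_const smooth_add smooth_mult)

text \<open>The functions p(1/x) exp(-1/x), extended by 0. Taking all polynomials at once gives a
  family closed under differentiation, with t^2 (p - p') in place of p, so that smoothness of the
  single function \<open>flat\<close> becomes an induction over the family.\<close>

definition exp_flat :: "real poly \<Rightarrow> real \<Rightarrow> real" where
  "exp_flat p x = (if x > 0 then poly p (1 / x) * exp (- (1 / x)) else 0)"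

lemma poly_times_exp_neg_tendsto_0: "((\<lambda>t::real. poly p t * exp (- t)) \<longlongrightarrow> 0) at_top"
proof -
  have "((\<lambda>t::real. \<Sum>i\<le>degree p. coeff p i * (t ^ i / exp t)) \<longlongrightarrow> (\<Sum>i\<le>degree p. coeff p i * 0)) at_top"
    by (intro tendsto_intros tendsto_power_div_exp_0)
  moreover have "(\<lambda>t::real. \<Sum>i\<le>degree p. coeff p i * (t ^ i / exp t)) = (\<lambda>t. poly p t * exp (- t))"
    by (simp add: poly_altdef sum_distrib_right sum_divide_distrib exp_minus field_simps)
  ultimately show ?thesis by simp
qed

lemma exp_flat_right_0: "((\<lambda>x. exp_flat p x) \<longlongrightarrow> 0) (at_right 0)"
proof -
  have "((\<lambda>x::real. poly p (inverse x) * exp (- inverse x)) \<longlongrightarrow> 0) (at_right 0)"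
    using filterlim_compose[OF poly_times_exp_neg_tendsto_0 filterlim_inverse_at_top_right] .
  then show ?thesis
    by (rule Lim_transform_eventually)
       (auto simp: eventually_at_right_field exp_flat_def inverse_eq_divide intro: exI[of _ 1])
qed

lemma exp_flat_deriv:
  "(exp_flat p has_real_derivative exp_flat ([:0, 0, 1:] * (p - pderiv p)) x) (at x)"
proof -
  let ?q = "[:0, 0, 1:] * (p - pderiv p)"
  consider "x > 0" | "x < 0" | "x = 0" by linarith
  then show ?thesis
  proof cases
    case 1
    have "((\<lambda>x. poly p (1 / x) * exp (- (1 / x))) has_real_derivative
        (poly (pderiv p) (1/x) * (- 1 / x\<^sup>2)) * exp (- (1/x)) +
         exp (- (1/x)) * (1 / x\<^sup>2) * poly p (1 / x)) (at x)"
      using 1 by (intro DERIV_mult DERIV_chain2[OF poly_DERIV])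
                 (auto intro!: derivative_eq_intros simp: power2_eq_square)
    also have "(poly (pderiv p) (1/x) * (- 1 / x\<^sup>2)) * exp (- (1/x)) +
         exp (- (1/x)) * (1 / x\<^sup>2) * poly p (1 / x) = exp_flat ?q x"
      using 1 by (simp add: exp_flat_def field_simps power2_eq_square)
    finally show ?thesis
      by (rule DERIV_cong_ev[THEN iffD1, rotated -1])
         (use 1 in \<open>auto simp: exp_flat_def eventually_at_topological intro!: eventually_nhds[THEN iffD2] exI[of _ "{0<..}"]\<close>)
  next
    case 2
    have "((\<lambda>x. 0) has_real_derivative 0) (at x)" by simp
    then have "((\<lambda>x. 0) has_real_derivative exp_flat ?q x) (at x)"
      using 2 by (simp add: exp_flat_def)
    then show ?thesis
      by (rule DERIV_cong_ev[THEN iffD1, rotated -1])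
         (use 2 in \<open>auto simp: exp_flat_def intro!: eventually_nhds[THEN iffD2] exI[of _ "{..<0}"]\<close>)
  next
    case 3
    \<comment> \<open>For y > 0 the difference quotient at 0 is itself of the form
      \<open>exp_flat\<close>, with the polynomial t p(t), and hence tends to 0.\<close>
    have r: "((\<lambda>y. exp_flat p y / y) \<longlongrightarrow> 0) (at_right 0)"
      using exp_flat_right_0[of "[:0, 1:] * p"]
      by (rule Lim_transform_eventually)
         (auto simp: eventually_at_right_field exp_flat_def intro: exI[of _ 1])
    have l: "((\<lambda>y. exp_flat p y / y) \<longlongrightarrow> 0) (at_left 0)"
      by (rule Lim_transform_eventually[OF tendsto_const])
         (auto simp: eventually_at_left_field exp_flat_def intro: exI[of _ "-1"])
    have "((\<lambda>y. exp_flat p y / y) \<longlongrightarrow> 0) (at 0)"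
      using r l filterlim_split_at by blast
    then show ?thesis
      using 3 by (simp add: DERIV_def exp_flat_def)
  qed
qed

lemma smooth_exp_flat: "smooth (exp_flat p)"
proof -
  have "diff_times n (exp_flat p)" for n
    by (induction n arbitrary: p) (auto simp del: diff_times.simps(2) intro: diff_times_SucI exp_flat_deriv)
  then show ?thesis by (simp add: smooth_def)
qed

definition flat :: "real \<Rightarrow> real" where
  "flat x = (if x > 0 then exp (- (1 / x)) else 0)"

lemma smooth_flat: "smooth flat"
proof -
  have "exp_flat [:1:] = flat" by (rule ext) (simp add: exp_flat_def flat_def)
  then show ?thesis using smooth_exp_flat by metis
qed
 
lemma flat_bounds: "0 \<le> flat x" "flat x \<le> 1"
  by (auto simp: flat_def)

text \<open>Smooth approximation of the indicator of the open interval from below. The shift by 1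
  keeps the support at distance 1/n from both end points, and the factor n sends both arguments to
  infinity, where \<open>flat\<close> tends to 1. For n = 0 this is the zero function.\<close>

definition plateau :: "real \<Rightarrow> real \<Rightarrow> nat \<Rightarrow> real \<Rightarrow> real" where
  "plateau p r n x = flat (real n * (x - p) - 1) * flat (real n * (r - x) - 1)"

lemma plateau_bounds: "0 \<le> plateau p r n x" "plateau p r n x \<le> 1"
  by (auto simp: plateau_def flat_bounds mult_le_one)

lemma plateau_test: "plateau p r n \<in> test_functions {p<..<r}"
proof -
  have "smooth (\<lambda>x. flat (real n * x + (- real n * p - 1)) * flat (- real n * x + (real n * r - 1)))"
    by (intro smooth_mult smooth_affine smooth_flat)
  moreover have "(\<lambda>x. flat (real n * x + (- real n * p - 1)) * flat (- real n * x + (real n * r - 1))) = plateau p r n"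
    by (auto simp: plateau_def algebra_simps)
  ultimately have 1: "smooth (plateau p r n)" by simp
  show ?thesis
  proof (cases "n = 0")
    case True
    then show ?thesis using 1 by (auto simp: test_functions_iff plateau_def flat_def intro!: exI[of _ "{}"])
  next
    case False
    then have "0 < 1 / real n" by simp
    then have "{p + 1 / n..r - 1 / n} \<subseteq> {p<..<r}"
      unfolding subset_iff atLeastAtMost_iff greaterThanLessThan_iff by linarith
    moreover have "compact {p + 1 / n..r - 1 / n}"
      "\<forall>x. x \<notin> {p + 1 / n..r - 1 / n} \<longrightarrow> plateau p r n x = 0"
      using False by (auto simp: plateau_def flat_def field_simps)
    ultimately show ?thesis using 1 by (force simp: test_functions_iff)
  qed
qed

lemma plateau_tendsto: "(\<lambda>n. plateau p r n x) \<longlonglongrightarrow> indicator {p<..<r} x"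
proof (cases "x \<in> {p<..<r}")
  case False
  then have "plateau p r n x = 0" for n
    by (metis (no_types, lifting) plateau_test subsetD test_functions_iff)
  then show ?thesis using False by simp
next
  case True
  have flat_lim: "(flat \<longlongrightarrow> 1) at_top"
  proof (rule Lim_transform_eventually)
    have "((\<lambda>x::real. exp (- inverse x)) \<longlongrightarrow> exp (- 0)) at_top"
      by (intro tendsto_intros tendsto_inverse_0_at_top filterlim_ident)
    then show "((\<lambda>x::real. exp (- inverse x)) \<longlongrightarrow> 1) at_top" by simp
    show "\<forall>\<^sub>F x in at_top. exp (- inverse x) = flat x"
      using eventually_gt_at_top[of 0] by eventually_elim (auto simp: flat_def inverse_eq_divide)
  qed
  have top: "filterlim (\<lambda>n. real n * c - 1) at_top sequentially" if "c > 0" for c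
    using filterlim_tendsto_add_at_top[OF tendsto_const[of "-1"]
       filterlim_at_top_mult_tendsto_pos[OF tendsto_const that filterlim_real_sequentially]]
    by simp
  have "(\<lambda>n. plateau p r n x) \<longlonglongrightarrow> 1 * 1"
    unfolding plateau_def using True
    by (intro tendsto_mult filterlim_compose[OF flat_lim] top) auto
  then show ?thesis using True by simp
qed

section \<open>Closure properties of test functions\<close>

lemma test_functions_mono: "S \<subseteq> T \<Longrightarrow> test_functions S \<subseteq> test_functions T"
  unfolding subset_iff test_functions_iff by blast

lemma test_functions_zero: "\<phi> \<in> test_functions S \<Longrightarrow> x \<notin> S \<Longrightarrow> \<phi> x = 0"
  unfolding test_functions_iff by blast

lemma test_functions_smooth: "\<phi> \<in> test_functions S \<Longrightarrow> smooth \<phi>"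
  by (auto simp: test_functions_iff)

lemma test_functions_add:
  assumes "\<phi> \<in> test_functions S" "\<psi> \<in> test_functions S"
  shows "(\<lambda>x. \<phi> x + \<psi> x) \<in> test_functions S"
proof -
  obtain K L where "compact K" "K \<subseteq> S" "\<forall>x. x \<notin> K \<longrightarrow> \<phi> x = 0"
    "compact L" "L \<subseteq> S" "\<forall>x. x \<notin> L \<longrightarrow> \<psi> x = 0"
    using assms by (auto simp: test_functions_iff)
  then show ?thesis using assms
    by (auto simp: test_functions_iff intro!: smooth_add exI[of _ "K \<union> L"] compact_Un)
qed

lemma test_functions_mult:
  "smooth f \<Longrightarrow> \<phi> \<in> test_functions S \<Longrightarrow> (\<lambda>x. f x * \<phi> x) \<in> test_functions S"
  unfolding test_functions_iff using smooth_mult by (metis mult_zero_right)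

lemma test_functions_cmult: "\<phi> \<in> test_functions S \<Longrightarrow> (\<lambda>x. c * \<phi> x) \<in> test_functions S"
  by (intro test_functions_mult smooth_const)

lemma test_functions_deriv:
  assumes "\<phi> \<in> test_functions S"
  shows "deriv \<phi> \<in> test_functions S"
proof -
  obtain K where K: "compact K" "K \<subseteq> S" "\<forall>x. x \<notin> K \<longrightarrow> \<phi> x = 0"
    using assms by (auto simp: test_functions_iff)
  have "deriv \<phi> x = 0" if "x \<notin> K" for x
  proof -
    have "\<forall>\<^sub>F y in nhds x. \<phi> y = 0"
      using K that eventually_nhds[of _ x] by (auto intro!: exI[of _ "- K"] simp: compact_imp_closed)
    then have "deriv \<phi> x = deriv (\<lambda>x. 0) x"
      by (rule deriv_cong_ev) simp
    then show ?thesis by simp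
  qed
  then show ?thesis using K assms by (auto simp: test_functions_iff smooth_deriv)
qed

section \<open>Absolutely continuous functions as primitives\<close>

text \<open>Local absolute continuity with derivative \<open>g\<close>, the fundamental theorem of
  calculus being taken as the definition. Only integrability of \<open>g\<close> on compact
  subintervals is demanded, so \<open>g\<close> may be unbounded inside S or near its end points;
  this is what a merely integrable potential requires.\<close>

definition primitive_on :: "real set \<Rightarrow> (real \<Rightarrow> real) \<Rightarrow> (real \<Rightarrow> real) \<Rightarrow> bool" where
  "primitive_on S U g \<longleftrightarrow> (\<forall>x\<in>S. \<forall>y\<in>S. x \<le> y \<longrightarrow>
     set_integrable lborel {x..y} g \<and> U y - U x = (LINT t:{x..y}|lborel. g t))"

lemma primitive_onD:
  assumes "primitive_on S U g" "x \<in> S" "y \<in> S" "x \<le> y"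
  shows "set_integrable lborel {x..y} g" "U y - U x = (LINT t:{x..y}|lborel. g t)"
  using assms unfolding primitive_on_def by blast+

lemma primitive_on_mono: "primitive_on S U g \<Longrightarrow> T \<subseteq> S \<Longrightarrow> primitive_on T U g"
  unfolding primitive_on_def by blast

lemma primitive_on_add:
  assumes "primitive_on S U g" "primitive_on S W k"
  shows "primitive_on S (\<lambda>x. U x + W x) (\<lambda>x. g x + k x)"
  using assms unfolding primitive_on_def by (simp add: set_integral_add) (smt (verit))

lemma primitive_on_cmult:
  assumes "primitive_on S U g"
  shows "primitive_on S (\<lambda>x. c * U x) (\<lambda>x. c * g x)"
  using assms unfolding primitive_on_def by (auto simp: right_diff_distrib[symmetric])

lemma primitive_on_diff:
  assumes "primitive_on S U g" "primitive_on S W k"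
  shows "primitive_on S (\<lambda>x. U x - W x) (\<lambda>x. g x - k x)"
  using primitive_on_add[OF assms(1) primitive_on_cmult[OF assms(2), of "-1"]] by simp

lemma primitive_on_const: "primitive_on S (\<lambda>x. c) (\<lambda>x. 0)"
  by (auto simp: primitive_on_def set_integrable_def)

lemma primitive_on_cong_AE:
  assumes U: "primitive_on S U g" and S: "is_interval S" "S \<in> sets borel" and k: "set_borel_measurable lborel S k"
    and gk: "AE x in lborel. x \<in> S \<longrightarrow> g x = k x"
  shows "primitive_on S U k"
  unfolding primitive_on_def
proof (intro ballI impI)
  fix x y assume xy: "x \<in> S" "y \<in> S" "x \<le> y"
  note g = primitive_onD[OF U xy]
  have sub: "{x..y} \<subseteq> S" using S xy unfolding is_interval_1 by (meson atLeastAtMost_iff subsetI)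
  have k': "set_borel_measurable lborel {x..y} k"
  proof -
    have "(\<lambda>t. indicator {x..y} t *\<^sub>R (indicator S t *\<^sub>R k t)) \<in> borel_measurable lborel"
      using k by (auto simp: set_borel_measurable_def)
    also have "(\<lambda>t. indicator {x..y} t *\<^sub>R (indicator S t *\<^sub>R k t)) = (\<lambda>t. indicator {x..y} t *\<^sub>R k t)"
      using sub by (fastforce simp: indicator_def)
    finally show ?thesis by (simp add: set_borel_measurable_def)
  qed
  have g': "set_borel_measurable lborel {x..y} g"
    using g(1) by (simp add: set_integrable_def set_borel_measurable_def borel_measurable_integrable)
  have ae: "AE t in lborel. t \<in> {x..y} \<longrightarrow> k t = g t"
    using gk by eventually_elim (use sub in auto)
  have "set_integrable lborel {x..y} k"
    using g(1) k' by (rule set_integrable_bound) (use ae in eventually_elim, auto)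
  moreover have "(LINT t:{x..y}|lborel. k t) = (LINT t:{x..y}|lborel. g t)"
    unfolding set_lebesgue_integral_def
  proof (rule integral_cong_AE)
    show "AE t in lborel. indicator {x..y} t *\<^sub>R k t = indicator {x..y} t *\<^sub>R g t"
      using ae by eventually_elim (auto simp: indicator_def)
  qed (use k' g' in \<open>auto simp: set_borel_measurable_def\<close>)
  ultimately show "set_integrable lborel {x..y} k \<and> U y - U x = (LINT t:{x..y}|lborel. k t)"
    using g(2) by simp
qed

lemma set_integral_combine:
  fixes g :: "real \<Rightarrow> real"
  assumes "set_integrable lborel {x..z} g" "x \<le> y" "y \<le> z"
  shows "(LINT t:{x..z}|lborel. g t) = (LINT t:{x..y}|lborel. g t) + (LINT t:{y..z}|lborel. g t)"
proof -
  have "{x..y} \<subseteq> {x..z}" "{y..z} \<subseteq> {x..z}" using assms by auto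
  then have "set_integrable lborel {x..y} g" "set_integrable lborel {y..z} g"
    using set_integrable_subset[OF assms(1)] by auto
  moreover have "AE t in lborel. \<not> (t \<in> {x..y} \<and> t \<in> {y..z})"
    using AE_lborel_singleton[of y] by eventually_elim auto
  moreover have "{x..y} \<union> {y..z} = {x..z}" using assms by auto
  ultimately show ?thesis
    using set_integral_Un_AE[of "{x..y}" "{y..z}" lborel g] by simp
qed

lemma primitive_on_ex:
  assumes "\<And>x y. x \<in> S \<Longrightarrow> y \<in> S \<Longrightarrow> x \<le> y \<Longrightarrow> set_integrable lborel {x..y} g"
  shows "\<exists>U. primitive_on S U g"
proof (cases "S = {}")
  case False
  then obtain p where p: "p \<in> S" by blast
  define U where "U x = (if p \<le> x then (LINT t:{p..x}|lborel. g t) else - (LINT t:{x..p}|lborel. g t))" for x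
  have "U y - U x = (LINT t:{x..y}|lborel. g t)" if xy: "x \<in> S" "y \<in> S" "x \<le> y" for x y
  proof -
    consider "p \<le> x" | "x < p" "p \<le> y" | "y < p" by linarith
    then show ?thesis
    proof cases
      case 1
      then show ?thesis using set_integral_combine[of p y g x] assms[of p y] p xy by (simp add: U_def)
    next
      case 2
      then show ?thesis using set_integral_combine[of x y g p] assms[of x y] p xy by (simp add: U_def)
    next
      case 3
      then show ?thesis using set_integral_combine[of x p g y] assms[of x p] p xy by (simp add: U_def)
    qed
  qed
  then show ?thesis using assms unfolding primitive_on_def by blast
qed (simp add: primitive_on_def)

lemma primitive_on_DERIV:
  assumes "\<And>x. (U has_real_derivative g x) (at x)" "continuous_on UNIV g"
  shows "primitive_on S U g"
  unfolding primitive_on_def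
proof (intro ballI impI conjI)
  fix x y :: real assume "x \<le> y"
  have c: "continuous_on {x..y} g" using assms(2) continuous_on_subset by blast
  then show "set_integrable lborel {x..y} g"
    by (rule borel_integrable_atLeastAtMost')
  have "(LINT t|lborel. indicator {x..y} t *\<^sub>R g t) = U y - U x"
    by (rule integral_FTC_Icc[OF \<open>x \<le> y\<close> _ c])
       (use assms(1) in \<open>auto simp: has_real_derivative_iff_has_vector_derivative[symmetric] intro: DERIV_subset\<close>)
  then show "U y - U x = (LINT t:{x..y}|lborel. g t)"
    by (simp add: set_lebesgue_integral_def)
qed

lemma primitive_on_eq_integral:
  assumes "primitive_on {x..y} U g" "t \<in> {x..y}"
  shows "U t = U x + integral {x..t} g"
  using primitive_onD[OF assms(1), of x t] assms(2) set_borel_integral_eq_integral(2)[of "{x..t}" g]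
  by auto

lemma primitive_on_continuous:
  assumes "primitive_on S U g" "{x..y} \<subseteq> S"
  shows "continuous_on {x..y} U"
proof (cases "x \<le> y")
  case True
  have U: "primitive_on {x..y} U g" using assms primitive_on_mono by blast
  have "set_integrable lborel {x..y} g" using primitive_onD(1)[OF U, of x y] True by simp
  then have "continuous_on {x..y} (\<lambda>t. U x + integral {x..t} g)"
    by (intro continuous_intros indefinite_integral_continuous_1 set_borel_integral_eq_integral(1))
  then show ?thesis
    using primitive_on_eq_integral[OF U] by (metis (no_types, lifting) continuous_on_cong)
qed simp

lemma primitive_on_continuous_UNIV: "primitive_on UNIV U g \<Longrightarrow> continuous_on UNIV U"
proof -
  assume U: "primitive_on UNIV U g"
  have "isCont U x" for x
    using continuous_on_interior[OF primitive_on_continuous[OF U, of "x - 1" "x + 1"], of x] by simp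
  then show ?thesis by (simp add: continuous_at_imp_continuous_on)
qed

lemma primitive_on_has_derivative:
  assumes "primitive_on {x..y} U g" "continuous_on {x..y} g" "t \<in> {x..y}"
  shows "(U has_real_derivative g t) (at t within {x..y})"
proof -
  have "((\<lambda>t. U x + integral {x..t} g) has_real_derivative g t) (at t within {x..y})"
    using integral_has_real_derivative[OF assms(2,3)] by (auto intro!: derivative_eq_intros)
  then show ?thesis
    by (rule has_field_derivative_transform_within[OF _ zero_less_one])
       (use assms(3) in \<open>simp_all add: primitive_on_eq_integral[OF assms(1), symmetric]\<close>)
qed

lemma primitive_on_has_derivative_UNIV:
  assumes "primitive_on UNIV U g" "continuous_on UNIV g"
  shows "(U has_real_derivative g t) (at t)"
proof -
  have "(U has_real_derivative g t) (at t within {t - 1..t + 1})"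
    by (intro primitive_on_has_derivative primitive_on_mono[OF assms(1)] continuous_on_subset[OF assms(2)]) auto
  then show ?thesis
    using at_within_interior[of t "{t - 1..t + 1}"] by simp
qed

lemma set_integrable_mult_continuous:
  fixes g W :: "real \<Rightarrow> real"
  assumes "set_integrable lborel {x..y} g" "continuous_on {x..y} W"
  shows "set_integrable lborel {x..y} (\<lambda>t. g t * W t)"
proof -
  have "compact (W ` {x..y})" using assms(2) by (intro compact_continuous_image) auto
  then obtain C where C: "\<And>t. t \<in> {x..y} \<Longrightarrow> \<bar>W t\<bar> \<le> C"
    by (metis bounded_real compact_imp_bounded imageI)
  have g: "(\<lambda>t. indicator {x..y} t *\<^sub>R g t) \<in> borel_measurable lborel"
    using assms(1) by (simp add: set_integrable_def borel_measurable_integrable)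
  have W: "(\<lambda>t. indicator {x..y} t *\<^sub>R W t) \<in> borel_measurable lborel"
    using borel_measurable_continuous_on_indicator[OF _ assms(2)] by simp
  have "(\<lambda>t. (indicator {x..y} t *\<^sub>R g t) * (indicator {x..y} t *\<^sub>R W t)) \<in> borel_measurable lborel"
    using g W by (rule borel_measurable_times)
  also have "(\<lambda>t. (indicator {x..y} t *\<^sub>R g t) * (indicator {x..y} t *\<^sub>R W t)) =
      (\<lambda>t. indicator {x..y} t *\<^sub>R (g t * W t))"
    by (auto simp: indicator_def)
  finally have m: "set_borel_measurable lborel {x..y} (\<lambda>t. g t * W t)"
    by (simp add: set_borel_measurable_def)
  show ?thesis
    by (rule set_integrable_bound[OF set_integrable_mult_right[OF assms(1), of C] m])
       (auto simp: abs_mult intro!: AE_I2, metis C abs_ge_self abs_ge_zero atLeastAtMost_iff mult.commute mult_right_mono order_trans)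
qed

text \<open>Fubini: the two terms are the integrals of a product function over the triangles below
  and above the diagonal, and the diagonal is a null set. This is integration by parts for
  derivatives that are only integrable.\<close>

lemma integral_product_triangles:
  fixes g k :: "real \<Rightarrow> real"
  assumes g: "integrable lborel g" and k: "integrable lborel k"
  shows "(LINT t|lborel. g t * (LINT s|lborel. indicator {..t} s * k s)) +
         (LINT t|lborel. k t * (LINT s|lborel. indicator {..t} s * g s)) =
         (LINT t|lborel. g t) * (LINT t|lborel. k t)"
proof -
  have [measurable]: "g \<in> borel_measurable borel" "k \<in> borel_measurable borel"
    using g k by (auto dest: borel_measurable_integrable)
  have kI: "integrable lborel (\<lambda>s. indicator {..t} s * k s)" "integrable lborel (\<lambda>s. indicator {t..} s * k s)" for t
    using integrable_mult_indicator[OF _ k, of "{..t}"] integrable_mult_indicator[OF _ k, of "{t..}"] by auto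
  have prod: "integrable (lborel \<Otimes>\<^sub>M lborel) (\<lambda>(s, t). g s * k t)"
  proof (rule lborel_pair.Fubini_integrable)
    have "(\<lambda>x. LINT y|lborel. norm (case (x, y) of (s, t) \<Rightarrow> g s * k t)) = (\<lambda>x. \<bar>g x\<bar> * (LINT y|lborel. \<bar>k y\<bar>))"
      by (simp add: abs_mult)
    then show "integrable lborel (\<lambda>x. LINT y|lborel. norm (case (x, y) of (s, t) \<Rightarrow> g s * k t))"
      using g by simp
  qed (use k in auto)
  have tri: "integrable (lborel \<Otimes>\<^sub>M lborel) (\<lambda>(s, t). (indicator {..t} s * g s) * k t)"
    by (rule Bochner_Integration.integrable_bound[OF prod])
       (auto simp: abs_mult indicator_def intro!: AE_I2)
  have "(LINT t|lborel. k t * (LINT s|lborel. indicator {..t} s * g s)) =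
        (LINT t|lborel. LINT s|lborel. (indicator {..t} s * g s) * k t)"
    by (simp add: mult.commute)
  also have "\<dots> = (LINT s|lborel. LINT t|lborel. (indicator {..t} s * g s) * k t)"
    by (rule lborel_pair.Fubini_integral[OF tri])
  also have "\<dots> = (LINT s|lborel. g s * (LINT t|lborel. indicator {s..} t * k t))"
  proof (rule Bochner_Integration.integral_cong[OF refl])
    fix s
    have "(\<lambda>t. (indicator {..t} s * g s) * k t) = (\<lambda>t. g s * (indicator {s..} t * k t))"
      by (auto simp: indicator_def)
    then show "(LINT t|lborel. (indicator {..t} s * g s) * k t) = g s * (LINT t|lborel. indicator {s..} t * k t)"
      by simp
  qed
  finally have 2: "(LINT t|lborel. k t * (LINT s|lborel. indicator {..t} s * g s)) =
     (LINT s|lborel. g s * (LINT t|lborel. indicator {s..} t * k t))" .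
  have meas: "(\<lambda>t. LINT s|lborel. indicator {..t} s * k s) \<in> borel_measurable lborel"
    "(\<lambda>t. LINT s|lborel. indicator {t..} s * k s) \<in> borel_measurable lborel"
    unfolding indicator_def by (measurable; simp)+
  have le: "\<bar>LINT s|lborel. indicator A s * k s\<bar> \<le> (LINT s|lborel. \<bar>k s\<bar>)" if "A \<in> sets lborel" for A
  proof -
    have "\<bar>LINT s|lborel. indicator A s * k s\<bar> \<le> (LINT s|lborel. \<bar>indicator A s * k s\<bar>)"
      using integral_norm_bound[of lborel "\<lambda>s. indicator A s * k s"] by simp
    also have "\<dots> \<le> (LINT s|lborel. \<bar>k s\<bar>)"
      using k that integrable_mult_indicator[OF that k]
      by (intro integral_mono) (auto simp: indicator_def)
    finally show ?thesis .
  qed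
  have int1: "integrable lborel (\<lambda>t. g t * (LINT s|lborel. indicator {..t} s * k s))"
    "integrable lborel (\<lambda>t. g t * (LINT s|lborel. indicator {t..} s * k s))"
    using le meas
    by (auto intro!: Bochner_Integration.integrable_bound[OF integrable_mult_left[OF g, of "LINT s|lborel. \<bar>k s\<bar>"]] AE_I2
       mult_left_mono simp: abs_mult intro: order_trans[OF _ abs_ge_self])
  have split: "(LINT s|lborel. indicator {..t} s * k s) + (LINT s|lborel. indicator {t..} s * k s) = (LINT s|lborel. k s)" for t
  proof -
    have "(LINT s|lborel. indicator {..t} s * k s) + (LINT s|lborel. indicator {t..} s * k s) =
       (LINT s|lborel. indicator {..t} s * k s + indicator {t..} s * k s)"
      using kI by (simp add: Bochner_Integration.integral_add)
    also have "\<dots> = (LINT s|lborel. k s)"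
    proof (rule integral_cong_AE)
      show "AE s in lborel. indicator {..t} s * k s + indicator {t..} s * k s = k s"
        using AE_lborel_singleton[of t] by eventually_elim (auto simp: indicator_def)
    qed auto
    finally show ?thesis .
  qed
  have "(LINT t|lborel. g t * (LINT s|lborel. indicator {..t} s * k s)) +
      (LINT s|lborel. g s * (LINT t|lborel. indicator {s..} t * k t)) =
      (LINT t|lborel. g t * ((LINT s|lborel. indicator {..t} s * k s) + (LINT s|lborel. indicator {t..} s * k s)))"
    using int1 by (simp add: distrib_left Bochner_Integration.integral_add)
  also have "\<dots> = (LINT t|lborel. g t) * (LINT t|lborel. k t)"
    unfolding split by simp
  finally show ?thesis unfolding 2 .
qed

lemma primitive_on_mult:
  assumes U: "primitive_on S U g" and W: "primitive_on S W k" and S: "is_interval S"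
  shows "primitive_on S (\<lambda>x. U x * W x) (\<lambda>x. g x * W x + k x * U x)"
  unfolding primitive_on_def
proof (intro ballI impI conjI)
  fix x y assume xy: "x \<in> S" "y \<in> S" "x \<le> y"
  have sub: "{x..y} \<subseteq> S" using S xy unfolding is_interval_1 by (meson atLeastAtMost_iff subsetI)
  note g = primitive_onD[OF U xy] and k = primitive_onD[OF W xy]
  have i: "set_integrable lborel {x..y} (\<lambda>t. g t * W t)" "set_integrable lborel {x..y} (\<lambda>t. k t * U t)"
    using g k set_integrable_mult_continuous primitive_on_continuous[OF U sub] primitive_on_continuous[OF W sub] by auto
  then show "set_integrable lborel {x..y} (\<lambda>t. g t * W t + k t * U t)" by simp
  define g' k' where "g' t = indicator {x..y} t * g t" and "k' t = indicator {x..y} t * k t" for t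
  have gk': "integrable lborel g'" "integrable lborel k'"
    using g(1) k(1) by (auto simp: g'_def[abs_def] k'_def[abs_def] set_integrable_def)
  have prim: "V t = V x + (LINT s|lborel. indicator {..t} s * (indicator {x..y} s * f s))"
    if V: "primitive_on S V f" and t: "t \<in> {x..y}" for V f t
  proof -
    have "V t - V x = (LINT s:{x..t}|lborel. f s)"
      using primitive_onD(2)[OF V, of x t] sub xy t by auto
    also have "\<dots> = (LINT s|lborel. indicator {..t} s * (indicator {x..y} s * f s))"
      unfolding set_lebesgue_integral_def using t
      by (intro Bochner_Integration.integral_cong) (auto simp: indicator_def)
    finally show ?thesis by simp
  qed
  have eq: "(LINT t:{x..y}|lborel. f t * V t) =
     V x * (LINT t:{x..y}|lborel. f t) + (LINT t|lborel. (indicator {x..y} t * f t) * (LINT s|lborel. indicator {..t} s * (indicator {x..y} s * e s)))"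
    if V: "primitive_on S V e" and f: "set_integrable lborel {x..y} f" for V e f
  proof -
    have c: "continuous_on {x..y} V" by (rule primitive_on_continuous[OF V sub])
    have 1: "(LINT t:{x..y}|lborel. f t * V t) = (LINT t:{x..y}|lborel. f t * V x + f t * (V t - V x))"
      by (intro set_lebesgue_integral_cong) (auto simp: algebra_simps)
    have 2: "set_integrable lborel {x..y} (\<lambda>t. f t * (V t - V x))"
      by (intro set_integrable_mult_continuous f continuous_intros c)
    have "(LINT t:{x..y}|lborel. f t * V t) = V x * (LINT t:{x..y}|lborel. f t) + (LINT t:{x..y}|lborel. f t * (V t - V x))"
      unfolding 1 using f 2 by (subst set_integral_add) (auto simp: mult.commute)
    moreover have "(LINT t:{x..y}|lborel. f t * (V t - V x)) = (LINT t|lborel. (indicator {x..y} t * f t) * (LINT s|lborel. indicator {..t} s * (indicator {x..y} s * e s)))"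
      unfolding set_lebesgue_integral_def
    proof (intro Bochner_Integration.integral_cong refl)
      fix t
      show "indicator {x..y} t *\<^sub>R (f t * (V t - V x)) =
          (indicator {x..y} t * f t) * (LINT s|lborel. indicator {..t} s * (indicator {x..y} s * e s))"
      proof (cases "t \<in> {x..y}")
        case True
        have "V t - V x = (LINT s|lborel. indicator {..t} s * (indicator {x..y} s * e s))"
          using prim[OF V True] by linarith
        then show ?thesis using True by (simp only: indicator_simps) simp
      qed simp
    qed
    ultimately show ?thesis by simp
  qed
  have "(LINT t:{x..y}|lborel. g t * W t + k t * U t) =
     W x * (LINT t:{x..y}|lborel. g t) + U x * (LINT t:{x..y}|lborel. k t) +
     ((LINT t|lborel. g' t * (LINT s|lborel. indicator {..t} s * k' s)) +
      (LINT t|lborel. k' t * (LINT s|lborel. indicator {..t} s * g' s)))"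
    using i eq[OF W g(1)] eq[OF U k(1)] by (simp add: g'_def k'_def)
  also have "\<dots> = W x * (U y - U x) + U x * (W y - W x) + (U y - U x) * (W y - W x)"
    unfolding integral_product_triangles[OF gk'] g(2) k(2)
    by (simp add: g'_def[abs_def] k'_def[abs_def] set_lebesgue_integral_def)
  finally show "U y * W y - U x * W x = (LINT t:{x..y}|lborel. g t * W t + k t * U t)"
    by (simp add: algebra_simps)
qed

lemma primitive_on_scale:
  assumes U: "primitive_on S U g" and s: "s > 0"
  shows "primitive_on {x. s * x \<in> S} (\<lambda>x. U (s * x)) (\<lambda>x. s * g (s * x))"
  unfolding primitive_on_def
proof (intro ballI impI conjI)
  fix x y assume xy: "x \<in> {x. s * x \<in> S}" "y \<in> {x. s * x \<in> S}" "x \<le> y"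
  have "s * x \<le> s * y" using xy s by simp
  note g = primitive_onD[OF U _ _ this]
  have *: "indicator {s * x..s * y} (0 + s * t) = (indicator {x..y} t :: real)" for t
    using s by (auto simp: indicator_def)
  have "integrable lborel (\<lambda>t. indicator {s * x..s * y} (0 + s * t) * g (0 + s * t))"
    using g(1) xy s lborel_integrable_real_affine[of "\<lambda>t. indicator {s * x..s * y} t * g t" s 0]
    by (simp add: set_integrable_def)
  then show "set_integrable lborel {x..y} (\<lambda>x. s * g (s * x))"
    unfolding * by (auto simp: set_integrable_def mult.left_commute)
  have "U (s * y) - U (s * x) = s * (LINT t|lborel. indicator {s * x..s * y} (0 + s * t) * g (0 + s * t))"
    using g(2) xy s lborel_integral_real_affine[of s "\<lambda>t. indicator {s * x..s * y} t * g t" 0]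
    by (simp add: set_lebesgue_integral_def)
  then show "U (s * y) - U (s * x) = (LINT t:{x..y}|lborel. s * g (s * t))"
    unfolding * by (simp add: set_lebesgue_integral_def mult.left_commute[of _ s])
qed

text \<open>A C^1 bump given by an explicit formula: squaring makes the derivative vanish at the
  ends of [-R, R]. It equals 1 only at 0, but tends to 1 pointwise as R grows, and its derivative is
  of size 4 / R. One continuous derivative is enough, because C^1 functions with zero boundary
  values lie in the form domain by \<open>H10_approx_C1\<close>.\<close>

definition cutoff :: "real \<Rightarrow> real \<Rightarrow> real" where
  "cutoff R x = (if \<bar>x\<bar> \<le> R then (1 - (x / R)\<^sup>2)\<^sup>2 else 0)"

definition cutoff_deriv :: "real \<Rightarrow> real \<Rightarrow> real" where
  "cutoff_deriv R x = (if \<bar>x\<bar> \<le> R then - 4 * (1 - (x / R)\<^sup>2) * x / R\<^sup>2 else 0)"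

lemma cutoff_bounds:
  assumes "R > 0"
  shows "0 \<le> cutoff R x" "cutoff R x \<le> 1" "\<bar>cutoff_deriv R x\<bar> \<le> 4 / R"
proof -
  have *: "(x / R)\<^sup>2 \<le> 1" if "\<bar>x\<bar> \<le> R"
    using that assms by (simp add: abs_square_le_1)
  show "0 \<le> cutoff R x" "cutoff R x \<le> 1"
    using * by (auto simp: cutoff_def intro!: power_le_one)
  show "\<bar>cutoff_deriv R x\<bar> \<le> 4 / R"
  proof (cases "\<bar>x\<bar> \<le> R")
    case True
    have "\<bar>1 - (x / R)\<^sup>2\<bar> * \<bar>x\<bar> \<le> 1 * R" using * True assms by (intro mult_mono) auto
    then have "4 * (\<bar>1 - (x / R)\<^sup>2\<bar> * \<bar>x\<bar>) / R\<^sup>2 \<le> 4 * (1 * R) / R\<^sup>2"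
      by (intro divide_right_mono) auto
    moreover have "\<bar>cutoff_deriv R x\<bar> = 4 * (\<bar>1 - (x / R)\<^sup>2\<bar> * \<bar>x\<bar>) / R\<^sup>2"
      using True by (simp only: cutoff_deriv_def if_True abs_mult abs_divide) simp
    ultimately show ?thesis using assms by (simp add: power2_eq_square)
  qed (use assms in \<open>simp add: cutoff_deriv_def\<close>)
qed

lemma continuous_on_cutoff:
  assumes "R > 0"
  shows "continuous_on UNIV (cutoff R)" "continuous_on UNIV (cutoff_deriv R)"
proof -
  have U: "UNIV = {x. \<bar>x\<bar> \<le> R} \<union> {x. \<bar>x\<bar> \<ge> R}" by auto
  have cl: "closed {x::real. \<bar>x\<bar> \<le> R}" "closed {x::real. \<bar>x\<bar> \<ge> R}"
    by (auto intro!: closed_Collect_le continuous_intros)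
  have "continuous_on ({x. \<bar>x\<bar> \<le> R} \<union> {x. \<bar>x\<bar> \<ge> R}) (\<lambda>x. if \<bar>x\<bar> \<le> R then (1 - (x / R)\<^sup>2)\<^sup>2 else 0)"
    using assms by (intro continuous_on_If cl continuous_intros) (auto simp: power_divide[symmetric] power2_eq_iff divide_eq_1_iff abs_if split: if_splits)
  then show "continuous_on UNIV (cutoff R)" unfolding cutoff_def[abs_def] U[symmetric] .
  have "continuous_on ({x. \<bar>x\<bar> \<le> R} \<union> {x. \<bar>x\<bar> \<ge> R}) (\<lambda>x. if \<bar>x\<bar> \<le> R then - 4 * (1 - (x / R)\<^sup>2) * x / R\<^sup>2 else 0)"
    using assms by (intro continuous_on_If cl continuous_intros) (auto simp: power_divide[symmetric] power2_eq_iff divide_eq_1_iff abs_if split: if_splits)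
  then show "continuous_on UNIV (cutoff_deriv R)" unfolding cutoff_deriv_def[abs_def] U[symmetric] .
qed

lemma cutoff_has_derivative:
  assumes R: "R > 0"
  shows "(cutoff R has_real_derivative cutoff_deriv R x) (at x)"
proof -
  \<comment> \<open>The square of the positive part is C^1, so writing the cut-off as m (1 - (x /
    R)^2) replaces a case analysis at both ends of [-R, R] by the single one at 0.\<close>
  define m :: "real \<Rightarrow> real" where "m t = (max 0 t)\<^sup>2" for t
  have m: "(m has_real_derivative 2 * max 0 t) (at t)" for t
  proof -
    consider "t > 0" | "t < 0" | "t = 0" by linarith
    then show ?thesis
    proof cases
      case 1
      have "((\<lambda>t. t\<^sup>2) has_real_derivative 2 * max 0 t) (at t)"
        using 1 by (auto intro!: derivative_eq_intros)
      then show ?thesis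
        by (rule has_field_derivative_transform_within_open[where S = "{0<..}"]) (use 1 in \<open>auto simp: m_def\<close>)
    next
      case 2
      have "((\<lambda>t. 0) has_real_derivative 2 * max 0 t) (at t)"
        using 2 by (auto intro!: derivative_eq_intros)
      then show ?thesis
        by (rule has_field_derivative_transform_within_open[where S = "{..<0}"]) (use 2 in \<open>auto simp: m_def\<close>)
    next
      case 3
      have "((\<lambda>h. max 0 h) \<longlongrightarrow> max 0 (0::real)) (at 0)"
        by (intro tendsto_intros)
      then have lim: "((\<lambda>h::real. max 0 h) \<longlongrightarrow> 0) (at 0)" by simp
      have "max 0 h = m h / h" if "h \<noteq> 0" for h
        using that by (cases "h > 0") (auto simp: m_def power2_eq_square)
      then have "\<forall>\<^sub>F h in at 0. max 0 h = m h / h"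
        by (simp add: eventually_at_filter)
      with lim have "((\<lambda>h::real. m h / h) \<longlongrightarrow> 0) (at 0)"
        by (rule Lim_transform_eventually)
      then show ?thesis using 3 by (simp add: DERIV_def m_def)
    qed
  qed
  have eq: "cutoff R = (\<lambda>x. m (1 - (x / R)\<^sup>2))"
  proof
    fix x
    have "\<bar>x\<bar> \<le> R \<longleftrightarrow> 0 \<le> 1 - (x / R)\<^sup>2"
      using R by (simp add: abs_square_le_1)
    then show "cutoff R x = m (1 - (x / R)\<^sup>2)" by (auto simp: cutoff_def m_def max_def)
  qed
  have "((\<lambda>x. m (1 - (x / R)\<^sup>2)) has_real_derivative 2 * max 0 (1 - (x / R)\<^sup>2) * (- 2 * x / R\<^sup>2)) (at x)"
    by (rule DERIV_chain2[OF m]) (use R in \<open>auto intro!: derivative_eq_intros simp: power2_eq_square\<close>)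
  moreover have "2 * max 0 (1 - (x / R)\<^sup>2) * (- 2 * x / R\<^sup>2) = cutoff_deriv R x"
  proof -
    have "\<bar>x\<bar> \<le> R \<longleftrightarrow> 0 \<le> 1 - (x / R)\<^sup>2"
      using R by (simp add: abs_square_le_1)
    then have mx: "max 0 (1 - (x / R)\<^sup>2) = (if \<bar>x\<bar> \<le> R then 1 - (x / R)\<^sup>2 else 0)"
      by (auto simp: max_def)
    have tt: "2 * t * (- 2 * x / R\<^sup>2) = - 4 * t * x / R\<^sup>2" for t by simp
    show ?thesis unfolding mx tt cutoff_deriv_def by (rule if_split[THEN iffD2]) simp
  qed
  ultimately show ?thesis unfolding eq by simp
qed

lemma cutoff_tendsto:
  "(\<lambda>n. cutoff (real (Suc n)) x) \<longlonglongrightarrow> 1" "(\<lambda>n. cutoff_deriv (real (Suc n)) x) \<longlonglongrightarrow> 0"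
proof -
  have lim: "(\<lambda>n. x / real (Suc n)) \<longlonglongrightarrow> 0" "(\<lambda>n. 4 / real (Suc n)) \<longlonglongrightarrow> 0"
    using LIMSEQ_Suc[OF lim_const_over_n] by auto
  have "(\<lambda>n. (1 - (x / real (Suc n))\<^sup>2)\<^sup>2) \<longlonglongrightarrow> (1 - 0\<^sup>2)\<^sup>2"
    by (intro tendsto_intros lim)
  moreover have "\<forall>\<^sub>F n in sequentially. (1 - (x / real (Suc n))\<^sup>2)\<^sup>2 = cutoff (real (Suc n)) x"
  proof -
    obtain N where "\<bar>x\<bar> \<le> real N" using real_arch_simple by blast
    then have "\<bar>x\<bar> \<le> real (Suc n)" if "n \<ge> N" for n using that by simp
    then show ?thesis by (auto simp: eventually_sequentially cutoff_def simp del: of_nat_Suc)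
  qed
  ultimately show "(\<lambda>n. cutoff (real (Suc n)) x) \<longlonglongrightarrow> 1"
    using Lim_transform_eventually by fastforce
  show "(\<lambda>n. cutoff_deriv (real (Suc n)) x) \<longlonglongrightarrow> 0"
    by (rule Lim_null_comparison[OF _ lim(2)]) (use cutoff_bounds(3) in \<open>auto simp del: of_nat_Suc\<close>)
qed

lemma primitive_cutoff: "R > 0 \<Longrightarrow> primitive_on S (cutoff R) (cutoff_deriv R)"
  by (rule primitive_on_DERIV[OF cutoff_has_derivative continuous_on_cutoff(2)])

text \<open>The boundary terms vanish because an integrable function has arbitrarily small values near
  \<open>\<plusminus>\<infinity>\<close>; cutting off makes this precise without discussing limits.\<close>

lemma integral_eq_0_if_primitive_integrable:
  assumes F: "primitive_on UNIV F f" "integrable lborel F" "integrable lborel f"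
  shows "(LINT x|lborel. f x) = 0"
proof -
  define d where "d n x = f x * cutoff (real (Suc n)) x + cutoff_deriv (real (Suc n)) x * F x" for n x
  have zero: "(LINT x|lborel. d n x) = 0" for n
  proof -
    let ?R = "real (Suc n)"
    have "primitive_on UNIV (\<lambda>x. F x * cutoff ?R x) (d n)"
      unfolding d_def by (rule primitive_on_mult[OF F(1) primitive_cutoff]) auto
    then have "F ?R * cutoff ?R ?R - F (-?R) * cutoff ?R (-?R) = (LINT x:{-?R..?R}|lborel. d n x)"
      by (rule primitive_onD(2)) auto
    moreover have "(LINT x:{-?R..?R}|lborel. d n x) = (LINT x|lborel. d n x)"
      unfolding set_lebesgue_integral_def
      by (intro Bochner_Integration.integral_cong) (auto simp: d_def cutoff_def cutoff_deriv_def indicator_def)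
    moreover have "cutoff ?R ?R = 0" "cutoff ?R (-?R) = 0"
      by (auto simp: cutoff_def power_divide simp del: of_nat_Suc)
    ultimately show ?thesis by simp
  qed
  have meas: "cutoff (real (Suc n)) \<in> borel_measurable borel" "cutoff_deriv (real (Suc n)) \<in> borel_measurable borel" for n
    using continuous_on_cutoff[of "real (Suc n)"] by (auto intro: borel_measurable_continuous_onI)
  have "(\<lambda>n. LINT x|lborel. d n x) \<longlonglongrightarrow> (LINT x|lborel. f x)"
  proof (rule integral_dominated_convergence[where w = "\<lambda>x. \<bar>f x\<bar> + 4 * \<bar>F x\<bar>"])
    show "AE x in lborel. (\<lambda>n. d n x) \<longlonglongrightarrow> f x"
    proof (rule AE_I2)
      fix x
      have "(\<lambda>n. d n x) \<longlonglongrightarrow> f x * 1 + 0 * F x"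
        unfolding d_def by (intro tendsto_intros cutoff_tendsto)
      then show "(\<lambda>n. d n x) \<longlonglongrightarrow> f x" by simp
    qed
    show "AE x in lborel. norm (d n x) \<le> \<bar>f x\<bar> + 4 * \<bar>F x\<bar>" for n
    proof (rule AE_I2)
      fix x
      have R: "real (Suc n) > 0" by simp
      have "\<bar>cutoff_deriv (real (Suc n)) x\<bar> \<le> 4 / real (Suc n)" by (rule cutoff_bounds(3)[OF R])
      also have "\<dots> \<le> 4" by (simp add: field_simps)
      finally have "\<bar>f x * cutoff (real (Suc n)) x\<bar> + \<bar>cutoff_deriv (real (Suc n)) x * F x\<bar> \<le> \<bar>f x\<bar> * 1 + 4 * \<bar>F x\<bar>"
        unfolding abs_mult using cutoff_bounds(1,2)[OF R, of x]
        by (intro add_mono mult_mono) auto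
      then show "norm (d n x) \<le> \<bar>f x\<bar> + 4 * \<bar>F x\<bar>" by (simp add: d_def)
    qed
  qed (use F(2,3) meas borel_measurable_integrable in \<open>auto simp: d_def intro!: borel_measurable_add borel_measurable_times\<close>)
  then show ?thesis by (simp add: zero LIMSEQ_const_iff)
qed

section \<open>Weak derivatives\<close>

text \<open>Compact intervals are all that is ever tested, since by \<open>test_support\<close> a
  test function on an open interval lives on one of them.\<close>

definition loc_integrable :: "real set \<Rightarrow> (real \<Rightarrow> real) \<Rightarrow> bool" where
  "loc_integrable S f \<longleftrightarrow> (\<forall>x y. {x..y} \<subseteq> S \<longrightarrow> set_integrable lborel {x..y} f)"

lemma loc_integrableD: "loc_integrable S f \<Longrightarrow> {x..y} \<subseteq> S \<Longrightarrow> set_integrable lborel {x..y} f"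
  unfolding loc_integrable_def by blast

lemma loc_integrable_cmult: "loc_integrable S f \<Longrightarrow> loc_integrable S (\<lambda>x. c * f x)"
  by (auto simp: loc_integrable_def)

lemma loc_integrable_diff: "loc_integrable S f \<Longrightarrow> loc_integrable S g \<Longrightarrow> loc_integrable S (\<lambda>x. f x - g x)"
  by (auto simp: loc_integrable_def)

lemma loc_integrable_continuous: "(\<And>x y. {x..y} \<subseteq> S \<Longrightarrow> continuous_on {x..y} f) \<Longrightarrow> loc_integrable S f"
  unfolding loc_integrable_def using borel_integrable_atLeastAtMost' by blast

lemma interval_subset: "is_interval S \<Longrightarrow> x \<in> S \<Longrightarrow> y \<in> S \<Longrightarrow> {x..y::real} \<subseteq> S"
  unfolding is_interval_1 by (meson atLeastAtMost_iff subsetI)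

lemma loc_integrable_primitive_ex:
  assumes "loc_integrable S g" "is_interval S"
  shows "\<exists>U. primitive_on S U g"
proof (rule primitive_on_ex)
  fix x y assume "x \<in> S" "y \<in> S"
  then have "{x..y} \<subseteq> S" by (rule interval_subset[OF assms(2)])
  then show "set_integrable lborel {x..y} g" by (rule loc_integrableD[OF assms(1)])
qed

lemma primitive_on_loc_integrable:
  assumes "primitive_on S U g"
  shows "loc_integrable S U" "loc_integrable S g"
proof -
  show "loc_integrable S U" using primitive_on_continuous[OF assms] loc_integrable_continuous by blast
  show "loc_integrable S g"
    unfolding loc_integrable_def
  proof (intro allI impI)
    fix x y assume xy: "{x..y} \<subseteq> S"
    show "set_integrable lborel {x..y} g"
    proof (cases "x \<le> y")
      case True
      then have "x \<in> S" "y \<in> S" using xy by auto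
      then show ?thesis using primitive_onD(1)[OF assms _ _ True] by blast
    qed simp
  qed
qed

text \<open>Openness leaves room to enlarge the hull of the compact support a little on both sides.
  The test function then vanishes at c and d themselves, so that integration by parts over [c, d]
  has no boundary terms.\<close>

lemma test_support:
  assumes \<phi>: "\<phi> \<in> test_functions S" and S: "open S" "is_interval S" "S \<noteq> {}"
  obtains c d where "c < d" "{c..d} \<subseteq> S" "\<And>x. x \<notin> {c<..<d} \<Longrightarrow> \<phi> x = 0"
proof -
  have nbhd: "\<exists>e>0. x - e \<in> S \<and> x + e \<in> S" if xS: "x \<in> S" for x
  proof -
    obtain e where e: "e > 0" "cball x e \<subseteq> S" using open_contains_cball[THEN iffD1, rule_format, OF S(1) xS] by auto
    then have "x - e \<in> cball x e" "x + e \<in> cball x e" by (auto simp: dist_real_def)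
    then have "x - e \<in> S" "x + e \<in> S" using e(2) by (auto dest: subsetD)
    with e(1) show ?thesis by (intro exI[of _ e]) simp
  qed
  obtain K where K: "compact K" "K \<subseteq> S" "\<forall>x. x \<notin> K \<longrightarrow> \<phi> x = 0"
    using \<phi> by (auto simp: test_functions_iff)
  show ?thesis
  proof (cases "K = {}")
    case True
    obtain x where x: "x \<in> S" using S by blast
    obtain e where e: "e > 0" "x - e \<in> S" "x + e \<in> S" using nbhd[OF x] by blast
    then show ?thesis using that[of "x - e" "x + e"] interval_subset[OF S(2) e(2,3)] K(3) True by simp
  next
    case False
    obtain c where c: "c \<in> K" "\<And>x. x \<in> K \<Longrightarrow> c \<le> x" using compact_attains_inf[OF K(1) False] by blast
    obtain d where d: "d \<in> K" "\<And>x. x \<in> K \<Longrightarrow> x \<le> d" using compact_attains_sup[OF K(1) False] by blast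
    obtain e where e: "e > 0" "c - e \<in> S" using nbhd[of c] c K by blast
    obtain e' where e': "e' > 0" "d + e' \<in> S" using nbhd[of d] d K by blast
    have "c \<le> d" using c d by blast
    have "\<phi> x = 0" if x: "x \<notin> {c - e<..<d + e'}" for x
    proof -
      have "x \<notin> K" using x c(2)[of x] d(2)[of x] e(1) e'(1) by auto
      then show ?thesis using K(3) by blast
    qed
    then show ?thesis
      using that[of "c - e" "d + e'"] interval_subset[OF S(2) e(2) e'(2)] \<open>c \<le> d\<close> e(1) e'(1) by simp
  qed
qed

lemma set_integral_restrict:
  fixes f :: "real \<Rightarrow> real"
  assumes "A \<subseteq> B" "\<And>x. x \<in> B \<Longrightarrow> x \<notin> A \<Longrightarrow> f x = 0"
  shows "(LINT x:B|lborel. f x) = (LINT x:A|lborel. f x)"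
    "set_integrable lborel B f \<longleftrightarrow> set_integrable lborel A f"
proof -
  have "indicator B x *\<^sub>R f x = indicator A x *\<^sub>R f x" for x
    using assms by (cases "x \<in> A"; cases "x \<in> B") auto
  then have eq: "(\<lambda>x. indicator B x *\<^sub>R f x) = (\<lambda>x. indicator A x *\<^sub>R f x)" by (rule ext)
  show "(LINT x:B|lborel. f x) = (LINT x:A|lborel. f x)"
    "set_integrable lborel B f \<longleftrightarrow> set_integrable lborel A f"
    unfolding set_lebesgue_integral_def set_integrable_def eq by simp_all
qed

lemma test_mult_integrable:
  assumes f: "loc_integrable S f" and \<phi>: "\<phi> \<in> test_functions S" and S: "open S" "is_interval S"
  shows "set_integrable lborel S (\<lambda>x. f x * \<phi> x)"
proof (cases "S = {}")
  case False
  obtain c d where cd: "c < d" "{c..d} \<subseteq> S" "\<And>x. x \<notin> {c<..<d} \<Longrightarrow> \<phi> x = 0"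
    using test_support[OF \<phi> S False] by blast
  have "set_integrable lborel {c..d} (\<lambda>x. f x * \<phi> x)"
    by (intro set_integrable_mult_continuous loc_integrableD[OF f] cd smooth_continuous test_functions_smooth[OF \<phi>])
  then show ?thesis
    by (subst set_integral_restrict(2)[OF cd(2)]) (use cd(3) in auto)
qed simp

text \<open>The integrals of the plateaus tend to r - p > 0, hence one of them is positive and can
  be normalized.\<close>

lemma bump_ex:
  assumes "p < r"
  obtains \<rho> where "\<rho> \<in> test_functions {p<..<r}" "(LINT x|lborel. \<rho> x) = 1"
proof -
  have m: "plateau p r n \<in> borel_measurable borel" for n
    using smooth_continuous[OF test_functions_smooth[OF plateau_test]] by (rule borel_measurable_continuous_onI)
  have "(\<lambda>n. LINT x|lborel. plateau p r n x) \<longlonglongrightarrow> (LINT x|lborel. indicator {p<..<r} x)"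
  proof (rule integral_dominated_convergence[where w = "indicator {p<..<r}"])
    show "AE x in lborel. norm (plateau p r n x) \<le> indicator {p<..<r} x" for n
    proof (rule AE_I2)
      fix x
      show "norm (plateau p r n x) \<le> indicator {p<..<r} x"
        using plateau_bounds[of p r n x] test_functions_zero[OF plateau_test, of x p r n]
        by (cases "x \<in> {p<..<r}") auto
    qed
    show "integrable lborel (indicator {p<..<r} :: real \<Rightarrow> real)"
      using assms by (simp add: integrable_indicator_iff)
  qed (use m plateau_tendsto in auto)
  then have "(\<lambda>n. LINT x|lborel. plateau p r n x) \<longlonglongrightarrow> r - p"
    using assms by simp
  then have "\<forall>\<^sub>F n in sequentially. (LINT x|lborel. plateau p r n x) > 0"
    by (rule order_tendstoD) (use assms in simp)
  then obtain n where n: "(LINT x|lborel. plateau p r n x) > 0"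
    using eventually_sequentially by auto
  show ?thesis
    by (rule that[OF test_functions_cmult[OF plateau_test[of p r n], of "1 / (LINT x|lborel. plateau p r n x)"]])
       (use n in simp)
qed

text \<open>The primitive normalized to 0 left of the support is constant to the right of it, with
  the total integral as its value; mean zero is therefore exactly what makes the support compact
  again.\<close>

lemma test_antideriv:
  assumes \<psi>: "\<psi> \<in> test_functions S" and S: "open S" "is_interval S" "S \<noteq> {}"
    and int0: "(LINT x|lborel. \<psi> x) = 0"
  obtains \<phi> where "\<phi> \<in> test_functions S" "\<And>x. (\<phi> has_real_derivative \<psi> x) (at x)"
proof -
  obtain c d where cd: "c < d" "{c..d} \<subseteq> S" "\<And>x. x \<notin> {c<..<d} \<Longrightarrow> \<psi> x = 0"
    using test_support[OF \<psi> S] by blast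
  have cont: "continuous_on UNIV \<psi>" by (rule smooth_continuous[OF test_functions_smooth[OF \<psi>]])
  have "loc_integrable UNIV \<psi>" using cont continuous_on_subset by (intro loc_integrable_continuous) blast
  then obtain U where U: "primitive_on UNIV U \<psi>" using loc_integrable_primitive_ex by blast
  define \<phi> where "\<phi> x = U x - U c" for x
  have deriv: "(\<phi> has_real_derivative \<psi> x) (at x)" for x
    unfolding \<phi>_def using primitive_on_has_derivative_UNIV[OF U cont, of x]
    by (auto intro!: derivative_eq_intros)
  have zero: "\<phi> x = 0" if "x \<notin> {c..d}" for x
  proof (cases "x < c")
    case True
    have "(LINT t:{x..c}|lborel. \<psi> t) = (LINT t:{}|lborel. \<psi> t)"
      by (rule set_integral_restrict) (use cd(3) in auto)
    then show ?thesis using primitive_onD(2)[OF U, of x c] True by (simp add: \<phi>_def set_lebesgue_integral_def)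
  next
    case False
    then have x: "x > d" using that by auto
    have "(LINT t:UNIV|lborel. \<psi> t) = (LINT t:{c..x}|lborel. \<psi> t)"
      by (rule set_integral_restrict) (use cd(3) x in auto)
    then show ?thesis using primitive_onD(2)[OF U, of c x] x cd(1) int0
      by (simp add: \<phi>_def set_lebesgue_integral_def)
  qed
  have "smooth \<phi>" by (rule smooth_antideriv[OF deriv test_functions_smooth[OF \<psi>]])
  then have "\<phi> \<in> test_functions S"
    unfolding test_functions_iff using zero cd(2) compact_Icc by blast
  then show ?thesis using deriv that by blast
qed

text \<open>Dynkin's argument: bounded open intervals form an intersection-stable generator of the
  Borel sets, and the sets over which f integrates to 0 are closed under disjoint unions and, thanks
  to \<open>total\<close>, under complements. A function whose integral over every Borel set is 0
  vanishes almost everywhere.\<close>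

lemma AE_0_if_interval_integrals_0:
  fixes f :: "real \<Rightarrow> real"
  assumes f: "integrable lborel f" and 0: "\<And>p r. p < r \<Longrightarrow> (LINT x:{p<..<r}|lborel. f x) = 0"
    and total: "(LINT x|lborel. f x) = 0"
  shows "AE x in lborel. f x = 0"
proof (rule sigma_finite_measure.density_zero[OF sigma_finite_lborel f])
  fix A :: "real set" assume A: "A \<in> sets lborel"
  let ?G = "range (\<lambda>(a, b). {a<..<b::real})"
  have sets: "sets lborel = sigma_sets UNIV ?G"
  proof -
    have "borel = sigma UNIV ?G"
      using borel_eq_box[where 'a = real] by (simp add: box_real)
    then have "sets lborel = sets (sigma UNIV ?G)" by simp
    also have "\<dots> = sigma_sets UNIV ?G" by (rule sets_measure_of) simp
    finally show ?thesis .
  qed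
  have Af: "set_integrable lborel B f" if "B \<in> sigma_sets UNIV ?G" for B
    using integrable_mult_indicator[OF _ f, of B] that sets by (simp add: set_integrable_def)
  have stable: "Int_stable ?G"
  proof (rule Int_stableI)
    fix a b assume "a \<in> ?G" "b \<in> ?G"
    then obtain p r p' r' where "a = {p<..<r}" "b = {p'<..<r'}" by auto
    then have "a \<inter> b = {max p p'<..<min r r'}" by auto
    then show "a \<inter> b \<in> ?G" by auto
  qed
  have A': "A \<in> sigma_sets UNIV ?G" using A sets by simp
  show "set_lebesgue_integral lborel A f = 0"
  proof (rule sigma_sets_induct_disjoint[OF stable _ A', where P = "\<lambda>A. set_lebesgue_integral lborel A f = 0"])
    fix A assume "A \<in> ?G"
    then obtain p r where "A = {p<..<r}" by auto
    then show "set_lebesgue_integral lborel A f = 0"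
      using 0 by (cases "p < r") (auto simp: set_lebesgue_integral_def)
  next
    fix A assume A: "A \<in> sigma_sets UNIV ?G" "set_lebesgue_integral lborel A f = 0"
    have "set_lebesgue_integral lborel (A \<union> (UNIV - A)) f =
        set_lebesgue_integral lborel A f + set_lebesgue_integral lborel (UNIV - A) f"
      by (rule set_integral_Un) (use A Af sigma_sets.Compl[OF A(1)] in auto)
    moreover have "set_lebesgue_integral lborel (A \<union> (UNIV - A)) f = 0"
      using total by (simp add: set_lebesgue_integral_def)
    ultimately show "set_lebesgue_integral lborel (UNIV - A) f = 0" using A by simp
  next
    fix A :: "nat \<Rightarrow> real set"
    assume A: "disjoint_family A" "range A \<subseteq> sigma_sets UNIV ?G" "\<And>i. set_lebesgue_integral lborel (A i) f = 0"
    have "set_lebesgue_integral lborel (\<Union>i. A i) f = (\<Sum>i. set_lebesgue_integral lborel (A i) f)"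
    proof (rule lebesgue_integral_countable_add)
      show "A i \<in> sets lborel" for i using A(2) sets by auto
      show "A i \<inter> A j = {}" if "i \<noteq> j" for i j
        using A(1) that by (auto simp: disjoint_family_on_def)
      have "\<Union> (range A) \<in> sigma_sets UNIV ?G" using A(2) by (intro sigma_sets.Union) auto
      then show "set_integrable lborel (\<Union> (range A)) f" using Af by blast
    qed
    then show "set_lebesgue_integral lborel (\<Union>i. A i) f = 0" using A(3) by simp
  qed (auto simp: set_lebesgue_integral_def)
qed

text \<open>Intervals with rational end points suffice to cover S, so only countably many null sets
  have to be united.\<close>

lemma AE_interval_if_AE_compact:
  assumes S: "open S" and P: "\<And>x y. {x..y} \<subseteq> S \<Longrightarrow> AE t in lborel. t \<in> {x..y::real} \<longrightarrow> P t"
  shows "AE t in lborel. t \<in> S \<longrightarrow> P t"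
proof -
  have "AE t in lborel. \<forall>x\<in>\<rat>. \<forall>y\<in>\<rat>. {x..y} \<subseteq> S \<longrightarrow> t \<in> {x..y} \<longrightarrow> P t"
    using P by (intro AE_ball_countable'[OF _ countable_rat]) (auto intro!: AE_ball_countable'[OF _ countable_rat] simp: AE_impI)
  then show ?thesis
  proof eventually_elim
    case (elim t)
    show ?case
    proof
      assume "t \<in> S"
      then obtain e where e: "e > 0" "cball t e \<subseteq> S" using S open_contains_cball by blast
      obtain x where x: "x \<in> \<rat>" "t - e < x" "x < t" using Rats_dense_in_real[of "t - e" t] e by auto
      obtain y where y: "y \<in> \<rat>" "t < y" "y < t + e" using Rats_dense_in_real[of t "t + e"] e by auto
      have "{x..y} \<subseteq> cball t e" using x y by (auto simp: dist_real_def)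
      then show "P t" using elim x y e(2) by (meson atLeastAtMost_iff less_imp_le order_trans)
    qed
  qed
qed

text \<open>Cutting F down to a compact subinterval gives a function integrable on the line. Testing
  with plateaus and letting them increase to indicators shows, by dominated convergence, that its
  integral over every subinterval vanishes; other intervals are reduced to these by
  clipping.\<close>

lemma fundamental_lemma:
  assumes S: "open S" "is_interval S" and F: "loc_integrable S F"
    and 0: "\<And>\<phi>. \<phi> \<in> test_functions S \<Longrightarrow> (LINT x:S|lborel. F x * \<phi> x) = 0"
  shows "AE x in lborel. x \<in> S \<longrightarrow> F x = 0"
proof (rule AE_interval_if_AE_compact[OF S(1)])
  fix x y assume xy: "{x..y} \<subseteq> S"
  define f where "f t = indicator {x..y} t * F t" for t
  have f: "integrable lborel f"
    using loc_integrableD[OF F xy] by (simp add: f_def[abs_def] set_integrable_def)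
  have inner: "(LINT t:{p<..<r}|lborel. f t) = 0" if pr: "x \<le> p" "r \<le> y" for p r
  proof -
    have sub: "{p<..<r} \<subseteq> {x..y}" using pr by auto
    have [measurable]: "f \<in> borel_measurable borel" "plateau p r n \<in> borel_measurable borel" for n
      using f smooth_continuous[OF test_functions_smooth[OF plateau_test]]
      by (auto dest: borel_measurable_integrable intro: borel_measurable_continuous_onI)
    have "(\<lambda>n. LINT t|lborel. f t * plateau p r n t) \<longlonglongrightarrow> (LINT t|lborel. f t * indicator {p<..<r} t)"
    proof (rule integral_dominated_convergence[where w = "\<lambda>t. \<bar>f t\<bar>"])
      show "AE t in lborel. (\<lambda>n. f t * plateau p r n t) \<longlonglongrightarrow> f t * indicator {p<..<r} t"
        by (intro AE_I2 tendsto_intros plateau_tendsto)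
      show "AE t in lborel. norm (f t * plateau p r n t) \<le> \<bar>f t\<bar>" for n
        using plateau_bounds by (intro AE_I2) (simp add: abs_mult mult_left_le)
    qed (use f in auto)
    moreover have "(LINT t|lborel. f t * plateau p r n t) = 0" for n
    proof -
      have "plateau p r n \<in> test_functions S"
        using plateau_test test_functions_mono sub xy by blast
      then have "0 = (LINT t:S|lborel. F t * plateau p r n t)" using 0 by simp
      also have "\<dots> = (LINT t:{x..y}|lborel. F t * plateau p r n t)"
      proof (rule set_integral_restrict[OF xy])
        fix t assume "t \<notin> {x..y}"
        then have "t \<notin> {p<..<r}" using sub by auto
        then show "F t * plateau p r n t = 0" using test_functions_zero[OF plateau_test] by simp
      qed
      finally show ?thesis by (simp add: set_lebesgue_integral_def f_def mult.assoc)
    qed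
    ultimately have "(LINT t|lborel. f t * indicator {p<..<r} t) = 0"
      by (simp add: LIMSEQ_const_iff)
    then show ?thesis by (simp add: set_lebesgue_integral_def mult.commute)
  qed
  have outer: "(LINT t:{p<..<r}|lborel. f t) = 0" for p r
  proof -
    have "(LINT t:{p<..<r}|lborel. f t) = (LINT t:{max p x<..<min r y}|lborel. f t)"
      unfolding set_lebesgue_integral_def
    proof (rule integral_cong_AE)
      show "AE t in lborel. indicator {p<..<r} t *\<^sub>R f t = indicator {max p x<..<min r y} t *\<^sub>R f t"
        using AE_lborel_singleton[of x] AE_lborel_singleton[of y]
        by eventually_elim (auto simp: f_def indicator_def)
    qed (use f in \<open>auto dest: borel_measurable_integrable\<close>)
    also have "\<dots> = 0" by (rule inner) auto
    finally show ?thesis .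
  qed
  have "(LINT t:{x - 1<..<y + 1}|lborel. f t) = (LINT t|lborel. f t)"
    unfolding set_lebesgue_integral_def
    by (rule Bochner_Integration.integral_cong) (auto simp: f_def indicator_def)
  then have "AE t in lborel. f t = 0"
    using AE_0_if_interval_integrals_0[OF f outer] outer by simp
  then show "AE t in lborel. t \<in> {x..y} \<longrightarrow> F t = 0"
    by eventually_elim (auto simp: f_def)
qed

text \<open>With a bump \<rho> of integral 1 inside S, every test function \<eta> minus (integral of
  \<eta>) times \<rho> has mean 0 and is thus the derivative of a test function. Since F annihilates
  it, F - c annihilates \<eta> for c = integral of F \<rho>, and the fundamental lemma
  applies.\<close>

lemma du_Bois_Reymond:
  assumes S: "open S" "is_interval S" "S \<noteq> {}" and F: "loc_integrable S F"
    and 0: "\<And>\<phi>. \<phi> \<in> test_functions S \<Longrightarrow> (LINT x:S|lborel. F x * deriv \<phi> x) = 0"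
  obtains c where "AE x in lborel. x \<in> S \<longrightarrow> F x = c"
proof -
  obtain z where "z \<in> S" using S by blast
  then obtain e where e: "e > 0" "cball z e \<subseteq> S" using S(1) open_contains_cball by blast
  have "{z - e<..<z + e} \<subseteq> S" using e(2) by (auto simp: subset_iff dist_real_def)
  note sub = test_functions_mono[OF this]
  have "z - e < z + e" using e(1) by simp
  then obtain \<rho> where \<rho>': "\<rho> \<in> test_functions {z - e<..<z + e}" "(LINT x|lborel. \<rho> x) = 1"
    by (rule bump_ex)
  note \<rho> = subsetD[OF sub \<rho>'(1)] \<rho>'(2)
  define c where "c = (LINT x:S|lborel. F x * \<rho> x)"
  have one: "loc_integrable S (\<lambda>x. 1)" by (intro loc_integrable_continuous continuous_intros)
  have "AE x in lborel. x \<in> S \<longrightarrow> F x - c * 1 = 0"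
  proof (rule fundamental_lemma[OF S(1,2) loc_integrable_diff[OF F loc_integrable_cmult[OF one]]])
    fix \<eta> assume \<eta>: "\<eta> \<in> test_functions S"
    define I where "I = (LINT x|lborel. \<eta> x)"
    note int = test_mult_integrable[OF _ _ S(1,2)]
    have full: "(LINT x:S|lborel. 1 * \<theta> x) = (LINT x|lborel. \<theta> x)" "integrable lborel \<theta>"
      if "\<theta> \<in> test_functions S" for \<theta>
    proof -
      have z: "\<theta> x = 0" if "x \<notin> S" for x using test_functions_zero \<open>\<theta> \<in> _\<close> that by blast
      have "(LINT x:UNIV|lborel. 1 * \<theta> x) = (LINT x:S|lborel. 1 * \<theta> x)"
        by (rule set_integral_restrict) (use z in auto)
      then show "(LINT x:S|lborel. 1 * \<theta> x) = (LINT x|lborel. \<theta> x)" by (simp add: set_lebesgue_integral_def)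
      have "set_integrable lborel UNIV (\<lambda>x. 1 * \<theta> x) \<longleftrightarrow> set_integrable lborel S (\<lambda>x. 1 * \<theta> x)"
        by (rule set_integral_restrict) (use z in auto)
      then show "integrable lborel \<theta>" using int[OF one that] by (simp add: set_integrable_def)
    qed
    have test: "(\<lambda>x. \<eta> x + - I * \<rho> x) \<in> test_functions S"
      by (intro test_functions_add test_functions_cmult \<eta> \<rho>)
    have "(LINT x|lborel. \<eta> x + - I * \<rho> x) = 0"
      using full(2)[OF \<eta>] full(2)[OF \<rho>(1)] \<rho>(2) by (simp add: I_def)
    then obtain \<phi> where \<phi>: "\<phi> \<in> test_functions S" "\<And>x. (\<phi> has_real_derivative \<eta> x + - I * \<rho> x) (at x)"
      using test_antideriv[OF test S] by blast
    have "deriv \<phi> x = \<eta> x + - I * \<rho> x" for x using \<phi>(2) DERIV_imp_deriv by blast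
    then have "(LINT x:S|lborel. F x * (\<eta> x + - I * \<rho> x)) = 0" using 0[OF \<phi>(1)] by simp
    moreover have "(LINT x:S|lborel. F x * (\<eta> x + - I * \<rho> x)) = (LINT x:S|lborel. F x * \<eta> x - I * (F x * \<rho> x))"
      by (simp add: algebra_simps)
    ultimately have 1: "(LINT x:S|lborel. F x * \<eta> x) = I * c"
      using int[OF F \<eta>] int[OF F \<rho>(1)] by (simp add: c_def set_integral_diff)
    have "(LINT x:S|lborel. (F x - c * 1) * \<eta> x) = (LINT x:S|lborel. F x * \<eta> x - c * (1 * \<eta> x))"
      by (simp add: algebra_simps)
    also have "\<dots> = (LINT x:S|lborel. F x * \<eta> x) - c * (LINT x:S|lborel. 1 * \<eta> x)"
      using int[OF F \<eta>] int[OF one \<eta>] by (subst set_integral_diff) auto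
    also have "\<dots> = 0" using 1 full(1)[OF \<eta>] by (simp add: I_def)
    finally show "(LINT x:S|lborel. (F x - c * 1) * \<eta> x) = 0" .
  qed
  then show ?thesis using that[of c] by simp
qed

section \<open>Weak derivatives versus primitives\<close>

lemma primitive_on_weak_deriv:
  assumes U: "primitive_on S U g" and S: "open S" "is_interval S"
  shows "has_weak_deriv S U g"
  unfolding has_weak_deriv_def
proof
  fix \<phi> assume \<phi>: "\<phi> \<in> test_functions S"
  show "(LINT x:S|lborel. U x * deriv \<phi> x) = - (LINT x:S|lborel. g x * \<phi> x)"
  proof (cases "S = {}")
    case False
    obtain c d where cd: "c < d" "{c..d} \<subseteq> S" "\<And>x. x \<notin> {c<..<d} \<Longrightarrow> \<phi> x = 0"
      using test_support[OF \<phi> S False] by blast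
    note sm = test_functions_smooth[OF \<phi>]
    have "primitive_on S \<phi> (deriv \<phi>)"
      by (rule primitive_on_DERIV[OF smooth_has_derivative[OF sm] smooth_continuous[OF smooth_deriv[OF sm]]])
    then have "primitive_on S (\<lambda>x. U x * \<phi> x) (\<lambda>x. g x * \<phi> x + deriv \<phi> x * U x)"
      by (rule primitive_on_mult[OF U _ S(2)])
    then have "U d * \<phi> d - U c * \<phi> c = (LINT x:{c..d}|lborel. g x * \<phi> x + deriv \<phi> x * U x)"
      by (rule primitive_onD(2)) (use cd in auto)
    then have "0 = (LINT x:{c..d}|lborel. g x * \<phi> x + deriv \<phi> x * U x)"
      using cd(3)[of c] cd(3)[of d] by simp
    moreover have ints: "set_integrable lborel S (\<lambda>x. g x * \<phi> x)" "set_integrable lborel S (\<lambda>x. U x * deriv \<phi> x)"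
      by (intro test_mult_integrable primitive_on_loc_integrable[OF U] \<phi> test_functions_deriv[OF \<phi>] S)+
    have "deriv \<phi> x = 0" if "x \<notin> {c..d}" for x
    proof -
      have "\<forall>\<^sub>F y in nhds x. \<phi> y = 0"
        using that cd(3) eventually_nhds[of _ x] open_Compl[OF closed_atLeastAtMost, of c d]
        by (intro eventually_nhds[THEN iffD2] exI[of _ "- {c..d}"]) auto
      then have "deriv \<phi> x = deriv (\<lambda>x. 0) x"
        by (rule deriv_cong_ev) simp
      then show ?thesis by simp
    qed
    then have "(LINT x:S|lborel. g x * \<phi> x + deriv \<phi> x * U x) = (LINT x:{c..d}|lborel. g x * \<phi> x + deriv \<phi> x * U x)"
      by (intro set_integral_restrict[OF cd(2)]) (use cd(3) in auto)
    ultimately show ?thesis using ints by (simp add: set_integral_add mult.commute[of "deriv \<phi> _"])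
  qed (simp add: set_lebesgue_integral_def)
qed

lemma weak_deriv_unique:
  assumes "has_weak_deriv S u g" "has_weak_deriv S u k" "loc_integrable S g" "loc_integrable S k"
    and S: "open S" "is_interval S"
  shows "AE x in lborel. x \<in> S \<longrightarrow> g x = k x"
proof -
  have "AE x in lborel. x \<in> S \<longrightarrow> g x - k x = 0"
  proof (rule fundamental_lemma[OF S loc_integrable_diff[OF assms(3,4)]])
    fix \<phi> assume \<phi>: "\<phi> \<in> test_functions S"
    have "(LINT x:S|lborel. (g x - k x) * \<phi> x) = (LINT x:S|lborel. g x * \<phi> x) - (LINT x:S|lborel. k x * \<phi> x)"
      using test_mult_integrable[OF assms(3) \<phi> S] test_mult_integrable[OF assms(4) \<phi> S]
      by (simp add: left_diff_distrib set_integral_diff)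
    also have "\<dots> = 0" using assms(1,2) \<phi> unfolding has_weak_deriv_def by fastforce
    finally show "(LINT x:S|lborel. (g x - k x) * \<phi> x) = 0" .
  qed
  then show ?thesis by simp
qed

text \<open>Subtracting any primitive of g from u leaves a function with weak derivative 0, a
  constant by du Bois-Reymond. This is the passage from functions modulo null sets to continuous
  representatives.\<close>

lemma weak_deriv_primitive:
  assumes w: "has_weak_deriv S u g" and u: "loc_integrable S u" and g: "loc_integrable S g"
    and S: "open S" "is_interval S" "S \<noteq> {}"
  obtains U where "primitive_on S U g" "AE x in lborel. x \<in> S \<longrightarrow> u x = U x"
proof -
  obtain U where U: "primitive_on S U g" using loc_integrable_primitive_ex[OF g S(2)] by blast
  have wU: "has_weak_deriv S U g" by (rule primitive_on_weak_deriv[OF U S(1,2)])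
  note U' = primitive_on_loc_integrable(1)[OF U]
  obtain c where c: "AE x in lborel. x \<in> S \<longrightarrow> u x - U x = c"
  proof (rule du_Bois_Reymond[OF S loc_integrable_diff[OF u U']])
    fix \<phi> assume \<phi>: "\<phi> \<in> test_functions S"
    note \<phi>' = test_functions_deriv[OF \<phi>]
    have "(LINT x:S|lborel. (u x - U x) * deriv \<phi> x) =
        (LINT x:S|lborel. u x * deriv \<phi> x) - (LINT x:S|lborel. U x * deriv \<phi> x)"
      using test_mult_integrable[OF u \<phi>' S(1,2)] test_mult_integrable[OF U' \<phi>' S(1,2)]
      by (simp add: left_diff_distrib set_integral_diff)
    also have "\<dots> = 0" using w wU \<phi> unfolding has_weak_deriv_def by fastforce
    finally show "(LINT x:S|lborel. (u x - U x) * deriv \<phi> x) = 0" .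
  qed
  have "primitive_on S (\<lambda>x. U x + c) (\<lambda>x. g x + 0)"
    by (intro primitive_on_add U primitive_on_const)
  moreover have "AE x in lborel. x \<in> S \<longrightarrow> u x = U x + c"
    using c by eventually_elim auto
  ultimately show ?thesis using that[of "\<lambda>x. U x + c"] by simp
qed

section \<open>The space \<open>L\<^sup>2\<close>\<close>

lemma set_integral_cong_AE_weak:
  fixes f g :: "real \<Rightarrow> real"
  assumes f: "set_borel_measurable lborel S f" and g: "set_borel_measurable lborel S g"
    and ae: "AE x in lborel. x \<in> S \<longrightarrow> f x = g x"
  shows "(LINT x:S|lborel. f x) = (LINT x:S|lborel. g x)"
    and "set_integrable lborel S f \<longleftrightarrow> set_integrable lborel S g"
proof -
  have *: "AE x in lborel. indicator S x *\<^sub>R f x = indicator S x *\<^sub>R g x"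
    using ae by eventually_elim (simp add: indicator_def)
  note m = f[unfolded set_borel_measurable_def] g[unfolded set_borel_measurable_def]
  show "(LINT x:S|lborel. f x) = (LINT x:S|lborel. g x)"
    unfolding set_lebesgue_integral_def by (rule integral_cong_AE[OF m *])
  show "set_integrable lborel S f \<longleftrightarrow> set_integrable lborel S g"
    unfolding set_integrable_def by (rule integrable_cong_AE[OF m *])
qed

lemma set_borel_measurable_mult:
  fixes f g :: "real \<Rightarrow> real"
  assumes "set_borel_measurable lborel S f" "set_borel_measurable lborel S g"
  shows "set_borel_measurable lborel S (\<lambda>x. f x * g x)"
proof -
  have "(\<lambda>x. (indicator S x *\<^sub>R f x) * (indicator S x *\<^sub>R g x)) \<in> borel_measurable lborel"
    using assms unfolding set_borel_measurable_def by (rule borel_measurable_times)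
  also have "(\<lambda>x. (indicator S x *\<^sub>R f x) * (indicator S x *\<^sub>R g x)) = (\<lambda>x. indicator S x *\<^sub>R (f x * g x))"
    by (rule ext) (simp add: indicator_def)
  finally show ?thesis by (simp add: set_borel_measurable_def)
qed

lemma set_borel_measurable_add:
  fixes f g :: "real \<Rightarrow> real"
  assumes "set_borel_measurable lborel S f" "set_borel_measurable lborel S g"
  shows "set_borel_measurable lborel S (\<lambda>x. f x + g x)"
  using borel_measurable_add[OF assms[unfolded set_borel_measurable_def]]
  by (simp add: set_borel_measurable_def distrib_left)

lemma set_borel_measurable_cmult:
  fixes f :: "real \<Rightarrow> real"
  assumes "set_borel_measurable lborel S f"
  shows "set_borel_measurable lborel S (\<lambda>x. c * f x)"
  using borel_measurable_times[OF borel_measurable_const[of c] assms[unfolded set_borel_measurable_def]]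
  by (simp add: set_borel_measurable_def mult.left_commute)

lemma set_borel_measurable_if_borel:
  assumes "f \<in> borel_measurable borel" "S \<in> sets borel"
  shows "set_borel_measurable lborel S (f :: real \<Rightarrow> real)"
  unfolding set_borel_measurable_def using assms by measurable

lemma set_integrable_imp_measurable:
  "set_integrable lborel S f \<Longrightarrow> set_borel_measurable lborel S f"
  unfolding set_integrable_def set_borel_measurable_def by (rule borel_measurable_integrable)

lemma L2_measurable: "u \<in> L2 S \<Longrightarrow> set_borel_measurable lborel S u"
  and L2_square_integrable: "u \<in> L2 S \<Longrightarrow> set_integrable lborel S (\<lambda>x. (u x)\<^sup>2)"
  by (auto simp: L2_def)

lemma L2_mult_integrable:
  assumes u: "u \<in> L2 S" and w: "w \<in> L2 S"
  shows "set_integrable lborel S (\<lambda>x. u x * w x)"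
proof (rule set_integrable_bound)
  show "set_integrable lborel S (\<lambda>x. (u x)\<^sup>2 + (w x)\<^sup>2)"
    using assms L2_square_integrable by auto
  show "set_borel_measurable lborel S (\<lambda>x. u x * w x)"
    using assms by (intro set_borel_measurable_mult L2_measurable)
  have "\<bar>s * t\<bar> \<le> s\<^sup>2 + t\<^sup>2" for s t :: real
  proof -
    have "0 \<le> (\<bar>s\<bar> - \<bar>t\<bar>)\<^sup>2" by simp
    then have "2 * (\<bar>s\<bar> * \<bar>t\<bar>) \<le> s\<^sup>2 + t\<^sup>2" by (simp add: power2_diff)
    moreover have "0 \<le> \<bar>s\<bar> * \<bar>t\<bar>" by simp
    ultimately show ?thesis unfolding abs_mult by linarith
  qed
  then show "AE x in lborel. x \<in> S \<longrightarrow> norm (u x * w x) \<le> norm ((u x)\<^sup>2 + (w x)\<^sup>2)"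
    by (intro AE_I2) simp
qed

lemma L2_add: "u \<in> L2 S \<Longrightarrow> w \<in> L2 S \<Longrightarrow> (\<lambda>x. u x + w x) \<in> L2 S"
proof -
  assume u: "u \<in> L2 S" and w: "w \<in> L2 S"
  have "set_integrable lborel S (\<lambda>x. (u x)\<^sup>2 + (w x)\<^sup>2 + 2 * (u x * w x))"
    using L2_square_integrable[OF u] L2_square_integrable[OF w] L2_mult_integrable[OF u w] by simp
  then have "set_integrable lborel S (\<lambda>x. (u x + w x)\<^sup>2)"
    by (simp add: power2_sum mult.assoc)
  then show ?thesis
    using set_borel_measurable_add[OF L2_measurable[OF u] L2_measurable[OF w]] by (simp add: L2_def)
qed

lemma L2_cmult: "u \<in> L2 S \<Longrightarrow> (\<lambda>x. c * u x) \<in> L2 S"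
  using set_borel_measurable_cmult by (auto simp: L2_def power_mult_distrib)

lemma L2_diff: "u \<in> L2 S \<Longrightarrow> w \<in> L2 S \<Longrightarrow> (\<lambda>x. u x - w x) \<in> L2 S"
  using L2_add[OF _ L2_cmult[of w S "-1"], of u] by simp

lemma L2_zero: "(\<lambda>x. 0) \<in> L2 S"
  by (simp add: L2_def set_borel_measurable_def set_integrable_def)

lemma L2_sum: "(\<And>i. i \<in> I \<Longrightarrow> u i \<in> L2 S) \<Longrightarrow> (\<lambda>x. \<Sum>i\<in>I. u i x) \<in> L2 S"
  by (induction I rule: infinite_finite_induct) (auto intro: L2_add simp: L2_zero)

lemma L2_cong_AE:
  assumes "u \<in> L2 S" "set_borel_measurable lborel S w" "AE x in lborel. x \<in> S \<longrightarrow> u x = w x"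
  shows "w \<in> L2 S"
proof -
  have "set_integrable lborel S (\<lambda>x. w x * w x)"
  proof (rule set_integral_cong_AE_weak(2)[THEN iffD1, OF _ _ _ L2_mult_integrable[OF assms(1,1)]])
    show "AE x in lborel. x \<in> S \<longrightarrow> u x * u x = w x * w x"
      using assms(3) by eventually_elim auto
  qed (use assms in \<open>auto intro: set_borel_measurable_mult L2_measurable\<close>)
  then show ?thesis using assms(2) by (simp add: L2_def power2_eq_square)
qed

lemma L2_inner_cong_AE:
  assumes "u \<in> L2 S" "u' \<in> L2 S" "w \<in> L2 S" "w' \<in> L2 S"
    "AE x in lborel. x \<in> S \<longrightarrow> u x = u' x" "AE x in lborel. x \<in> S \<longrightarrow> w x = w' x"
  shows "L2_inner S u w = L2_inner S u' w'"
  unfolding L2_inner_def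
proof (rule set_integral_cong_AE_weak)
  show "AE x in lborel. x \<in> S \<longrightarrow> u x * w x = u' x * w' x"
    using assms(5,6) by eventually_elim auto
qed (use assms in \<open>auto intro: set_borel_measurable_mult L2_measurable\<close>)

lemma L2_inner_commute: "L2_inner S u w = L2_inner S w u"
  by (simp add: L2_inner_def mult.commute)

lemma L2_inner_add_left:
  "u \<in> L2 S \<Longrightarrow> u' \<in> L2 S \<Longrightarrow> w \<in> L2 S \<Longrightarrow>
    L2_inner S (\<lambda>x. u x + u' x) w = L2_inner S u w + L2_inner S u' w"
  unfolding L2_inner_def using L2_mult_integrable[of u S w] L2_mult_integrable[of u' S w]
  by (simp add: distrib_right set_integral_add)

lemma L2_inner_cmult_left: "L2_inner S (\<lambda>x. c * u x) w = c * L2_inner S u w"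
  unfolding L2_inner_def by (simp add: mult.assoc)

lemma L2_inner_diff_left:
  "u \<in> L2 S \<Longrightarrow> u' \<in> L2 S \<Longrightarrow> w \<in> L2 S \<Longrightarrow>
    L2_inner S (\<lambda>x. u x - u' x) w = L2_inner S u w - L2_inner S u' w"
  unfolding L2_inner_def using L2_mult_integrable[of u S w] L2_mult_integrable[of u' S w]
  by (simp add: left_diff_distrib set_integral_diff)

lemma L2_inner_sum_left:
  "(\<And>i. i \<in> I \<Longrightarrow> u i \<in> L2 S) \<Longrightarrow> w \<in> L2 S \<Longrightarrow>
    L2_inner S (\<lambda>x. \<Sum>i\<in>I. u i x) w = (\<Sum>i\<in>I. L2_inner S (u i) w)"
proof (induction I rule: infinite_finite_induct)
  case (insert i I)
  then show ?case by (simp add: L2_inner_add_left L2_sum)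
qed (simp_all add: L2_inner_def set_lebesgue_integral_def)

lemma L2_inner_nonneg: "0 \<le> L2_inner S u u"
  unfolding L2_inner_def set_lebesgue_integral_def by (rule integral_nonneg_AE) simp

lemma L2_norm_square: "(L2_norm S u)\<^sup>2 = L2_inner S u u"
  by (simp add: L2_norm_def L2_inner_nonneg)

lemma L2_norm_nonneg: "0 \<le> L2_norm S u"
  by (simp add: L2_norm_def L2_inner_nonneg)

text \<open>Evaluation at the minimum t = - q / r. The degenerate case r = 0 must be included, since
  the form Q - \<nu> ip, to which this is applied besides the L^2 product, can vanish on nonzero
  functions. There the value of t is chosen so that p + 2 q t = -1.\<close>

lemma quadratic_nonneg_imp_discriminant:
  fixes p q r :: real
  assumes "\<And>t. 0 \<le> p + 2 * q * t + r * t\<^sup>2" "0 \<le> r"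
  shows "q\<^sup>2 \<le> p * r"
proof (cases "r = 0")
  case True
  have "q = 0"
  proof (rule ccontr)
    assume "q \<noteq> 0"
    then show False using assms(1)[of "- (p + 1) / (2 * q)"] True by simp
  qed
  then show ?thesis using True by simp
next
  case False
  then have "0 \<le> (p + 2 * q * (- q / r) + r * (- q / r)\<^sup>2) * r"
    by (intro mult_nonneg_nonneg assms)
  also have "\<dots> = p * r - q\<^sup>2" using False by (simp add: field_simps power2_eq_square)
  finally show ?thesis by simp
qed

lemma L2_inner_add_cmult:
  assumes "u \<in> L2 S" "w \<in> L2 S"
  shows "L2_inner S (\<lambda>x. u x + t * w x) (\<lambda>x. u x + t * w x) =
    L2_inner S u u + 2 * L2_inner S u w * t + L2_inner S w w * t\<^sup>2"
proof -
  note i = L2_mult_integrable[OF assms(1,1)] L2_mult_integrable[OF assms] L2_mult_integrable[OF assms(2,2)]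
  have "L2_inner S (\<lambda>x. u x + t * w x) (\<lambda>x. u x + t * w x) =
     (LINT x:S|lborel. u x * u x + (2 * t) * (u x * w x) + t\<^sup>2 * (w x * w x))"
    unfolding L2_inner_def by (simp add: algebra_simps power2_eq_square)
  also have "\<dots> = (LINT x:S|lborel. u x * u x + (2 * t) * (u x * w x)) + (LINT x:S|lborel. t\<^sup>2 * (w x * w x))"
    by (rule set_integral_add) (use i in auto)
  also have "(LINT x:S|lborel. u x * u x + (2 * t) * (u x * w x)) =
     (LINT x:S|lborel. u x * u x) + (LINT x:S|lborel. (2 * t) * (u x * w x))"
    by (rule set_integral_add) (use i in auto)
  finally show ?thesis by (simp add: L2_inner_def)
qed

lemma L2_Cauchy_Schwarz_square:
  assumes "u \<in> L2 S" "w \<in> L2 S"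
  shows "(L2_inner S u w)\<^sup>2 \<le> L2_inner S u u * L2_inner S w w"
  using L2_inner_nonneg[of S "\<lambda>x. u x + t * w x" for t]
  by (intro quadratic_nonneg_imp_discriminant L2_inner_nonneg) (simp add: L2_inner_add_cmult[OF assms])

lemma L2_Cauchy_Schwarz:
  assumes "u \<in> L2 S" "w \<in> L2 S"
  shows "\<bar>L2_inner S u w\<bar> \<le> L2_norm S u * L2_norm S w"
  by (rule power2_le_imp_le)
     (use L2_Cauchy_Schwarz_square[OF assms] in \<open>simp_all add: power_mult_distrib L2_norm_square L2_norm_nonneg\<close>)

lemma L2_norm_triangle:
  assumes "u \<in> L2 S" "w \<in> L2 S"
  shows "L2_norm S (\<lambda>x. u x + w x) \<le> L2_norm S u + L2_norm S w"
proof (rule power2_le_imp_le)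
  have "(L2_norm S (\<lambda>x. u x + w x))\<^sup>2 = L2_inner S u u + 2 * L2_inner S u w + L2_inner S w w"
    using L2_inner_add_cmult[OF assms, of 1] by (simp add: L2_norm_square)
  also have "\<dots> \<le> L2_inner S u u + 2 * (L2_norm S u * L2_norm S w) + L2_inner S w w"
    using L2_Cauchy_Schwarz[OF assms] by linarith
  finally show "(L2_norm S (\<lambda>x. u x + w x))\<^sup>2 \<le> (L2_norm S u + L2_norm S w)\<^sup>2"
    by (simp add: power2_sum L2_norm_square mult.assoc)
qed (simp add: L2_norm_nonneg)

lemma L2_norm_cmult: "L2_norm S (\<lambda>x. c * u x) = \<bar>c\<bar> * L2_norm S u"
proof -
  have "L2_inner S (\<lambda>x. c * u x) (\<lambda>x. c * u x) = c\<^sup>2 * L2_inner S u u"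
    unfolding L2_inner_cmult_left by (subst L2_inner_commute) (simp add: L2_inner_cmult_left power2_eq_square)
  then show ?thesis by (simp add: L2_norm_def real_sqrt_mult)
qed

lemma L2_inner_tendsto:
  assumes f: "\<And>n. f n \<in> L2 S" and u: "u \<in> L2 S" and w: "w \<in> L2 S"
    and lim: "(\<lambda>n. L2_norm S (\<lambda>x. f n x - u x)) \<longlonglongrightarrow> 0"
  shows "(\<lambda>n::nat. L2_inner S (f n) w) \<longlonglongrightarrow> L2_inner S u w"
proof -
  have "(\<lambda>n. L2_norm S (\<lambda>x. f n x - u x) * L2_norm S w) \<longlonglongrightarrow> 0 * L2_norm S w"
    by (intro tendsto_mult lim tendsto_const)
  then have "(\<lambda>n. L2_norm S (\<lambda>x. f n x - u x) * L2_norm S w) \<longlonglongrightarrow> 0" by simp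
  moreover have "norm (L2_inner S (f n) w - L2_inner S u w) \<le> L2_norm S (\<lambda>x. f n x - u x) * L2_norm S w" for n
    using L2_Cauchy_Schwarz[OF L2_diff[OF f u] w] L2_inner_diff_left[OF f u w] by simp
  then have "\<forall>\<^sub>F n in sequentially. norm (L2_inner S (f n) w - L2_inner S u w) \<le>
      L2_norm S (\<lambda>x. f n x - u x) * L2_norm S w"
    by (intro always_eventually allI)
  ultimately have "(\<lambda>n. L2_inner S (f n) w - L2_inner S u w) \<longlonglongrightarrow> 0"
    by (rule Lim_null_comparison[rotated])
  then show ?thesis by (simp add: LIM_zero_iff)
qed

lemma L2_norm_0_iff_AE:
  assumes "u \<in> L2 S"
  shows "L2_norm S u = 0 \<longleftrightarrow> (AE x in lborel. x \<in> S \<longrightarrow> u x = 0)"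
proof -
  have "L2_norm S u = 0 \<longleftrightarrow> (LINT x|lborel. indicator S x *\<^sub>R (u x * u x)) = 0"
    by (simp add: L2_norm_def L2_inner_def set_lebesgue_integral_def)
  also have "\<dots> \<longleftrightarrow> (AE x in lborel. indicator S x *\<^sub>R (u x * u x) = 0)"
    using L2_mult_integrable[OF assms assms]
    by (intro integral_nonneg_eq_0_iff_AE) (auto simp: set_integrable_def)
  also have "\<dots> \<longleftrightarrow> (AE x in lborel. x \<in> S \<longrightarrow> u x = 0)"
    by (intro AE_cong) (auto simp: indicator_def)
  finally show ?thesis .
qed

lemma L2_subset:
  assumes "u \<in> L2 S" "T \<subseteq> S" "T \<in> sets borel"
  shows "u \<in> L2 T"
proof -
  have "(\<lambda>x. indicator T x *\<^sub>R (indicator S x *\<^sub>R u x)) \<in> borel_measurable lborel"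
    using assms(3) L2_measurable[OF assms(1)] by (auto simp: set_borel_measurable_def)
  also have "(\<lambda>x. indicator T x *\<^sub>R (indicator S x *\<^sub>R u x)) = (\<lambda>x. indicator T x *\<^sub>R u x)"
    using assms(2) by (intro ext) (auto simp: indicator_def)
  finally show ?thesis
    using set_integrable_subset[OF L2_square_integrable[OF assms(1)], of T] assms
    by (simp add: L2_def set_borel_measurable_def)
qed

lemma L2_inner_mono_set:
  assumes "u \<in> L2 S" "T \<subseteq> S" "T \<in> sets borel"
  shows "L2_inner T u u \<le> L2_inner S u u"
  unfolding L2_inner_def set_lebesgue_integral_def
  using L2_mult_integrable[OF assms(1,1)] L2_mult_integrable[OF L2_subset[OF assms] L2_subset[OF assms]] assms(2)
  by (intro integral_mono) (auto simp: set_integrable_def indicator_def)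

lemma L2_const: "emeasure lborel S < \<infinity> \<Longrightarrow> S \<in> sets borel \<Longrightarrow> (\<lambda>x. c) \<in> L2 S"
  unfolding L2_def set_borel_measurable_def set_integrable_def by auto

lemma L2_loc_integrable:
  assumes "u \<in> L2 S"
  shows "loc_integrable S u"
  unfolding loc_integrable_def
proof (intro allI impI)
  fix x y assume xy: "{x..y} \<subseteq> S"
  have "set_integrable lborel {x..y} (\<lambda>t. u t * 1)"
    by (intro L2_mult_integrable L2_subset[OF assms xy] L2_const) (auto simp: emeasure_lborel_Icc_eq)
  then show "set_integrable lborel {x..y} u" by simp
qed

lemma L2_integral_square_bound:
  assumes "u \<in> L2 S" "{x..y} \<subseteq> S" "x \<le> y"
  shows "(LINT t:{x..y}|lborel. u t)\<^sup>2 \<le> (y - x) * L2_inner S u u"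
proof -
  have u: "u \<in> L2 {x..y}" using L2_subset[OF assms(1,2)] by simp
  have c: "(\<lambda>t. 1) \<in> L2 {x..y}" by (intro L2_const) (auto simp: emeasure_lborel_Icc_eq)
  have "(L2_inner {x..y} u (\<lambda>t. 1))\<^sup>2 \<le> L2_inner {x..y} u u * L2_inner {x..y} (\<lambda>t. 1) (\<lambda>t. 1)"
    by (rule L2_Cauchy_Schwarz_square[OF u c])
  also have "L2_inner {x..y} (\<lambda>t. 1) (\<lambda>t. 1) = y - x"
    using assms(3) by (simp add: L2_inner_def set_lebesgue_integral_def)
  also have "L2_inner {x..y} u u * (y - x) \<le> L2_inner S u u * (y - x)"
    by (intro mult_right_mono L2_inner_mono_set assms) (use assms(3) in auto)
  finally show ?thesis by (simp add: L2_inner_def mult.commute)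
qed

text \<open>Cauchy-Schwarz against the constant 1 on the interval between x and y. It turns a bound
  on the energy into equicontinuity with exponent 1/2.\<close>

lemma primitive_L2_Hoelder:
  assumes U: "primitive_on UNIV U G" and G: "G \<in> L2 UNIV"
  shows "(U x - U y)\<^sup>2 \<le> \<bar>x - y\<bar> * L2_inner UNIV G G"
proof -
  have *: "(U y - U x)\<^sup>2 \<le> (y - x) * L2_inner UNIV G G" if "x \<le> y" for x y
    using L2_integral_square_bound[OF G _ that] primitive_onD(2)[OF U _ _ that] by simp
  show ?thesis using *[of x y] *[of y x] by (cases "x \<le> y") (auto simp: power2_commute)
qed

text \<open>The Arzela-Ascoli argument: a diagonal subsequence converges at all rationals, and
  equicontinuity carries this to every point. Pointwise convergence on the whole line is the form
  needed, because integrals are passed to the limit by dominated convergence or Fatou.\<close>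

lemma pointwise_convergent_subsequence:
  fixes u :: "nat \<Rightarrow> real \<Rightarrow> real"
  assumes bound: "\<And>n x. \<bar>u n x\<bar> \<le> K" and hoelder: "\<And>n x y. (u n x - u n y)\<^sup>2 \<le> C * \<bar>x - y\<bar>"
  obtains r U where "strict_mono (r :: nat \<Rightarrow> nat)" "\<And>x. (\<lambda>n. u (r n) x) \<longlonglongrightarrow> U x"
proof -
  define q :: "nat \<Rightarrow> real" where "q = from_nat_into \<rat>"
  have q: "range q = \<rat>"
    unfolding q_def by (rule range_from_nat_into) (auto simp: countable_rat intro: Rats_0)
  interpret subseqs "\<lambda>n s. convergent (\<lambda>k. u (s k) (q n))"
  proof
    fix n and s :: "nat \<Rightarrow> nat" assume "strict_mono s"
    have "bounded (range (\<lambda>k. u (s k) (q n)))"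
      using bound by (auto intro!: boundedI)
    then obtain l r where "strict_mono r" "((\<lambda>k. u (s k) (q n)) \<circ> r) \<longlonglongrightarrow> l"
      using bounded_imp_convergent_subsequence by blast
    then show "\<exists>r'. strict_mono r' \<and> convergent (\<lambda>k. u ((s \<circ> r') k) (q n))"
      by (auto simp: o_def convergent_def)
  qed
  define r where "r = diagseq"
  have r: "strict_mono r" unfolding r_def by (rule subseq_diagseq)
  have conv_q: "convergent (\<lambda>k. u (r k) (q n))" for n
  proof -
    \<comment> \<open>The diagonal sequence refines the n-th subsequence only from index n + 1 on;
      the finite shift is removed afterwards.\<close>
    have "convergent (\<lambda>k. u ((diagseq \<circ> ((+) (Suc n))) k) (q n))"
    proof (rule diagseq_holds)
      fix r s :: "nat \<Rightarrow> nat" and n assume "strict_mono r" "convergent (\<lambda>k. u (s k) (q n))"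
      then show "convergent (\<lambda>k. u ((s \<circ> r) k) (q n))"
        using convergent_subseq_convergent[of "\<lambda>k. u (s k) (q n)" r] by (simp add: o_def)
    qed
    then have "convergent (\<lambda>k. u (r (k + Suc n)) (q n))" by (simp add: o_def r_def add.commute)
    then show ?thesis
      using convergent_ignore_initial_segment[of "\<lambda>k. u (r k) (q n)" "Suc n"] by simp
  qed
  have C: "0 \<le> C" using order_trans[OF zero_le_power2 hoelder[of 0 1 0]] by simp
  have "convergent (\<lambda>k. u (r k) x)" for x
  proof (rule Cauchy_convergent, rule metric_CauchyI)
    fix e :: real assume e: "e > 0"
    \<comment> \<open>Chosen so that C d < (e / 3)^2; the summand 1 takes care of C = 0.\<close>
    define d where "d = (e / 3)\<^sup>2 / (C + 1)"
    have d: "d > 0" using e C by (simp add: d_def)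
    obtain p where p: "p \<in> \<rat>" "x < p" "p < x + d" using Rats_dense_in_real[of x "x + d"] d by auto
    obtain n where n: "p = q n" using p(1) q by (metis rangeE)
    have near: "\<bar>u k x - u k p\<bar> < e / 3" for k
    proof (rule power2_less_imp_less)
      have "(u k x - u k p)\<^sup>2 \<le> C * \<bar>x - p\<bar>" by (rule hoelder)
      also have "\<dots> \<le> C * d" using p C by (intro mult_left_mono) auto
      also have "\<dots> < (C + 1) * d" using d by (simp add: distrib_right)
      also have "\<dots> = (e / 3)\<^sup>2" using C by (simp add: d_def)
      finally show "\<bar>u k x - u k p\<bar>\<^sup>2 < (e / 3)\<^sup>2" by simp
    qed (use e in simp)
    have "Cauchy (\<lambda>k. u (r k) p)" using conv_q[of n] n convergent_Cauchy by simp
    then obtain N where N: "\<And>k l. k \<ge> N \<Longrightarrow> l \<ge> N \<Longrightarrow> dist (u (r k) p) (u (r l) p) < e / 3"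
      using e metric_CauchyD[of "\<lambda>k. u (r k) p" "e / 3"] by auto
    have "dist (u (r k) x) (u (r l) x) < e" if "k \<ge> N" "l \<ge> N" for k l
      using near[of "r k"] near[of "r l"] N[OF that] unfolding dist_real_def by linarith
    then show "\<exists>N. \<forall>k\<ge>N. \<forall>l\<ge>N. dist (u (r k) x) (u (r l) x) < e" by blast
  qed
  then have "\<exists>U. \<forall>x. (\<lambda>k. u (r k) x) \<longlonglongrightarrow> U x"
    unfolding convergent_def by (rule choice[OF allI])
  then show ?thesis using that r by blast
qed

section \<open>The space \<open>H\<^sup>1\<^sub>0\<close>\<close>

text \<open>Membership in \<open>H10\<close> with an explicit candidate g in the place of the
  arbitrarily chosen \<open>weak_deriv S u\<close>. Sums, multiples and changes on null sets can be
  treated for the pair (u, g) without asking which representative was chosen.\<close>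

definition H10_approx :: "real set \<Rightarrow> (real \<Rightarrow> real) \<Rightarrow> (real \<Rightarrow> real) \<Rightarrow> bool" where
  "H10_approx S u g \<longleftrightarrow> u \<in> L2 S \<and> g \<in> L2 S \<and>
     (\<exists>\<phi>. (\<forall>n::nat. \<phi> n \<in> test_functions S) \<and>
       (\<lambda>n. L2_norm S (\<lambda>x. \<phi> n x - u x)) \<longlonglongrightarrow> 0 \<and>
       (\<lambda>n. L2_norm S (\<lambda>x. deriv (\<phi> n) x - g x)) \<longlonglongrightarrow> 0)"

lemma H10_approxI:
  assumes "u \<in> L2 S" "g \<in> L2 S" "\<And>n::nat. \<phi> n \<in> test_functions S"
    "(\<lambda>n. L2_norm S (\<lambda>x. \<phi> n x - u x)) \<longlonglongrightarrow> 0"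
    "(\<lambda>n. L2_norm S (\<lambda>x. deriv (\<phi> n) x - g x)) \<longlonglongrightarrow> 0"
  shows "H10_approx S u g"
  using assms unfolding H10_approx_def by blast

lemma test_functions_L2:
  assumes \<phi>: "\<phi> \<in> test_functions S" and S: "open S" "is_interval S"
  shows "\<phi> \<in> L2 S"
proof -
  have c: "continuous_on T \<phi>" for T by (rule smooth_continuous[OF test_functions_smooth[OF \<phi>]])
  then have "set_borel_measurable lborel S \<phi>"
    using S(1) by (intro set_borel_measurable_if_borel borel_measurable_continuous_onI) auto
  moreover have "set_integrable lborel S (\<lambda>x. \<phi> x * \<phi> x)"
    by (intro test_mult_integrable loc_integrable_continuous c \<phi> S)
  ultimately show ?thesis by (simp add: L2_def power2_eq_square)
qed

lemma L2_norm_limit_add: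
  assumes f: "\<And>n. f n \<in> L2 S" and e: "\<And>n. e n \<in> L2 S" and u: "u \<in> L2 S" and w: "w \<in> L2 S"
    and lim: "(\<lambda>n. L2_norm S (\<lambda>x. f n x - u x)) \<longlonglongrightarrow> 0" "(\<lambda>n. L2_norm S (\<lambda>x. e n x - w x)) \<longlonglongrightarrow> 0"
  shows "(\<lambda>n::nat. L2_norm S (\<lambda>x. (f n x + e n x) - (u x + w x))) \<longlonglongrightarrow> 0"
proof (rule Lim_null_comparison)
  show "(\<lambda>n. L2_norm S (\<lambda>x. f n x - u x) + L2_norm S (\<lambda>x. e n x - w x)) \<longlonglongrightarrow> 0"
    using tendsto_add[OF lim] by simp
  have "L2_norm S (\<lambda>x. (f n x + e n x) - (u x + w x)) \<le> L2_norm S (\<lambda>x. f n x - u x) + L2_norm S (\<lambda>x. e n x - w x)" for n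
    using L2_norm_triangle[OF L2_diff[OF f u] L2_diff[OF e w], of n n] by (simp add: algebra_simps)
  then show "\<forall>\<^sub>F n in sequentially. norm (L2_norm S (\<lambda>x. (f n x + e n x) - (u x + w x))) \<le>
      L2_norm S (\<lambda>x. f n x - u x) + L2_norm S (\<lambda>x. e n x - w x)"
    by (intro always_eventually allI) (simp add: L2_norm_nonneg)
qed

lemma H10_approx_add:
  assumes "H10_approx S u g" "H10_approx S w k" and S: "open S" "is_interval S"
  shows "H10_approx S (\<lambda>x. u x + w x) (\<lambda>x. g x + k x)"
proof -
  obtain \<phi> where \<phi>: "u \<in> L2 S" "g \<in> L2 S" "\<And>n. \<phi> n \<in> test_functions S"
    "(\<lambda>n. L2_norm S (\<lambda>x. \<phi> n x - u x)) \<longlonglongrightarrow> 0" "(\<lambda>n. L2_norm S (\<lambda>x. deriv (\<phi> n) x - g x)) \<longlonglongrightarrow> 0"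
    using assms(1) unfolding H10_approx_def by blast
  obtain \<psi> where \<psi>: "w \<in> L2 S" "k \<in> L2 S" "\<And>n. \<psi> n \<in> test_functions S"
    "(\<lambda>n. L2_norm S (\<lambda>x. \<psi> n x - w x)) \<longlonglongrightarrow> 0" "(\<lambda>n. L2_norm S (\<lambda>x. deriv (\<psi> n) x - k x)) \<longlonglongrightarrow> 0"
    using assms(2) unfolding H10_approx_def by blast
  have d: "deriv (\<lambda>x. \<phi> n x + \<psi> n x) = (\<lambda>x. deriv (\<phi> n) x + deriv (\<psi> n) x)" for n
    using smooth_has_derivative[OF test_functions_smooth[OF \<phi>(3)]] smooth_has_derivative[OF test_functions_smooth[OF \<psi>(3)]]
    by (intro ext DERIV_imp_deriv DERIV_add)
  show ?thesis
  proof (rule H10_approxI[where \<phi> = "\<lambda>n x. \<phi> n x + \<psi> n x"])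
    show "(\<lambda>n. L2_norm S (\<lambda>x. \<phi> n x + \<psi> n x - (u x + w x))) \<longlonglongrightarrow> 0"
      by (intro L2_norm_limit_add \<phi> \<psi> test_functions_L2 S)
    show "(\<lambda>n. L2_norm S (\<lambda>x. deriv (\<lambda>x. \<phi> n x + \<psi> n x) x - (g x + k x))) \<longlonglongrightarrow> 0"
      unfolding d by (intro L2_norm_limit_add \<phi> \<psi> test_functions_L2 test_functions_deriv S)
  qed (intro L2_add \<phi> \<psi> test_functions_add)+
qed

lemma H10_approx_cmult:
  assumes "H10_approx S u g"
  shows "H10_approx S (\<lambda>x. c * u x) (\<lambda>x. c * g x)"
proof -
  obtain \<phi> where \<phi>: "u \<in> L2 S" "g \<in> L2 S" "\<And>n. \<phi> n \<in> test_functions S"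
    "(\<lambda>n. L2_norm S (\<lambda>x. \<phi> n x - u x)) \<longlonglongrightarrow> 0" "(\<lambda>n. L2_norm S (\<lambda>x. deriv (\<phi> n) x - g x)) \<longlonglongrightarrow> 0"
    using assms(1) unfolding H10_approx_def by blast
  have d: "deriv (\<lambda>x. c * \<phi> n x) = (\<lambda>x. c * deriv (\<phi> n) x)" for n
    using smooth_has_derivative[OF test_functions_smooth[OF \<phi>(3)]]
    by (intro ext DERIV_imp_deriv DERIV_cmult)
  have *: "(\<lambda>n. L2_norm S (\<lambda>x. c * f n x - c * v x)) \<longlonglongrightarrow> 0"
    if "(\<lambda>n. L2_norm S (\<lambda>x. f n x - v x)) \<longlonglongrightarrow> 0" for f v
    using tendsto_mult_left[OF that, of "\<bar>c\<bar>"]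
    by (simp add: L2_norm_cmult[symmetric] right_diff_distrib)
  show ?thesis
  proof (rule H10_approxI[where \<phi> = "\<lambda>n x. c * \<phi> n x"])
    show "(\<lambda>n. L2_norm S (\<lambda>x. deriv (\<lambda>x. c * \<phi> n x) x - c * g x)) \<longlonglongrightarrow> 0"
      unfolding d by (rule *[OF \<phi>(5)])
  qed (intro L2_cmult \<phi> test_functions_cmult *)+
qed

lemma H10_approx_zero: "H10_approx S (\<lambda>x. 0) (\<lambda>x. 0)"
proof (rule H10_approxI[where \<phi> = "\<lambda>n x. 0"])
  show "(\<lambda>x. 0) \<in> test_functions S"
    unfolding test_functions_iff using smooth_const by (auto intro: exI[of _ "{}"])
qed (auto simp: L2_zero L2_norm_def L2_inner_def)

lemma H10_approx_cong_AE:
  assumes "H10_approx S u g" "set_borel_measurable lborel S w" "set_borel_measurable lborel S k"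
    and "AE x in lborel. x \<in> S \<longrightarrow> u x = w x" "AE x in lborel. x \<in> S \<longrightarrow> g x = k x"
    and S: "open S" "is_interval S"
  shows "H10_approx S w k"
proof -
  obtain \<phi> where \<phi>: "u \<in> L2 S" "g \<in> L2 S" "\<And>n. \<phi> n \<in> test_functions S"
    "(\<lambda>n. L2_norm S (\<lambda>x. \<phi> n x - u x)) \<longlonglongrightarrow> 0" "(\<lambda>n. L2_norm S (\<lambda>x. deriv (\<phi> n) x - g x)) \<longlonglongrightarrow> 0"
    using assms(1) unfolding H10_approx_def by blast
  note wk = L2_cong_AE[OF \<phi>(1) assms(2,4)] L2_cong_AE[OF \<phi>(2) assms(3,5)]
  have cong: "L2_norm S (\<lambda>x. f x - v x) = L2_norm S (\<lambda>x. f x - v' x)"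
    if "f \<in> L2 S" "v \<in> L2 S" "v' \<in> L2 S" "AE x in lborel. x \<in> S \<longrightarrow> v x = v' x" for f v v'
  proof -
    have "AE x in lborel. x \<in> S \<longrightarrow> f x - v x = f x - v' x" using that(4) by eventually_elim auto
    then show ?thesis unfolding L2_norm_def
      using L2_inner_cong_AE[OF L2_diff[OF that(1,2)] L2_diff[OF that(1,3)] L2_diff[OF that(1,2)] L2_diff[OF that(1,3)]] by simp
  qed
  note t = test_functions_L2[OF _ S]
  show ?thesis
  proof (rule H10_approxI[OF wk \<phi>(3)])
    show "(\<lambda>n. L2_norm S (\<lambda>x. \<phi> n x - w x)) \<longlonglongrightarrow> 0"
      using \<phi>(4) cong[OF t[OF \<phi>(3)] \<phi>(1) wk(1) assms(4)] by simp
    show "(\<lambda>n. L2_norm S (\<lambda>x. deriv (\<phi> n) x - k x)) \<longlonglongrightarrow> 0"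
      using \<phi>(5) cong[OF t[OF test_functions_deriv[OF \<phi>(3)]] \<phi>(2) wk(2) assms(5)] by simp
  qed
qed

lemma test_functions_weak_deriv:
  assumes "\<phi> \<in> test_functions S" "open S" "is_interval S"
  shows "has_weak_deriv S \<phi> (deriv \<phi>)"
  by (intro primitive_on_weak_deriv primitive_on_DERIV smooth_has_derivative smooth_continuous
        smooth_deriv test_functions_smooth[OF assms(1)] assms(2,3))

lemma H10_approx_weak_deriv:
  assumes "H10_approx S u g" and S: "open S" "is_interval S"
  shows "has_weak_deriv S u g"
  unfolding has_weak_deriv_def
proof
  fix \<psi> assume \<psi>: "\<psi> \<in> test_functions S"
  obtain \<phi> where \<phi>: "u \<in> L2 S" "g \<in> L2 S" "\<And>n. \<phi> n \<in> test_functions S"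
    "(\<lambda>n. L2_norm S (\<lambda>x. \<phi> n x - u x)) \<longlonglongrightarrow> 0" "(\<lambda>n. L2_norm S (\<lambda>x. deriv (\<phi> n) x - g x)) \<longlonglongrightarrow> 0"
    using assms(1) unfolding H10_approx_def by blast
  note t = test_functions_L2[OF _ S]
  have 1: "(\<lambda>n. L2_inner S (\<phi> n) (deriv \<psi>)) \<longlonglongrightarrow> L2_inner S u (deriv \<psi>)"
    by (intro L2_inner_tendsto \<phi> t test_functions_deriv \<psi>)
  have "(\<lambda>n. L2_inner S (deriv (\<phi> n)) \<psi>) \<longlonglongrightarrow> L2_inner S g \<psi>"
    by (intro L2_inner_tendsto \<phi> t test_functions_deriv \<psi>)
  then have "(\<lambda>n. - L2_inner S (deriv (\<phi> n)) \<psi>) \<longlonglongrightarrow> - L2_inner S g \<psi>" by (rule tendsto_minus)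
  moreover have "L2_inner S (\<phi> n) (deriv \<psi>) = - L2_inner S (deriv (\<phi> n)) \<psi>" for n
    using test_functions_weak_deriv[OF \<phi>(3) S] \<psi> unfolding has_weak_deriv_def L2_inner_def by blast
  ultimately have "(\<lambda>n. L2_inner S (\<phi> n) (deriv \<psi>)) \<longlonglongrightarrow> - L2_inner S g \<psi>" by simp
  then show "(LINT x:S|lborel. u x * deriv \<psi> x) = - (LINT x:S|lborel. g x * \<psi> x)"
    using LIMSEQ_unique[OF 1] by (simp add: L2_inner_def)
qed

lemma weak_deriv_AE_eq:
  assumes "u \<in> L2 S" "g \<in> L2 S" "has_weak_deriv S u g" and S: "open S" "is_interval S"
  shows "u \<in> H1 S" "weak_deriv S u \<in> L2 S" "has_weak_deriv S u (weak_deriv S u)"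
    "AE x in lborel. x \<in> S \<longrightarrow> weak_deriv S u x = g x"
proof -
  show "u \<in> H1 S" using assms by (auto simp: H1_def)
  have "\<exists>g. g \<in> L2 S \<and> has_weak_deriv S u g" using assms by blast
  then have *: "weak_deriv S u \<in> L2 S \<and> has_weak_deriv S u (weak_deriv S u)"
    unfolding weak_deriv_def by (rule someI_ex)
  then show "weak_deriv S u \<in> L2 S" "has_weak_deriv S u (weak_deriv S u)" by auto
  show "AE x in lborel. x \<in> S \<longrightarrow> weak_deriv S u x = g x"
    using * assms by (intro weak_deriv_unique[OF _ assms(3)] L2_loc_integrable S) auto
qed

lemma H1_weak_deriv:
  assumes "u \<in> H1 S" "open S" "is_interval S"
  shows "u \<in> L2 S" "weak_deriv S u \<in> L2 S" "has_weak_deriv S u (weak_deriv S u)"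
  using assms weak_deriv_AE_eq[of u S] by (auto simp: H1_def)

text \<open>Weak derivatives are unique almost everywhere, so g may be exchanged for the chosen
  \<open>weak_deriv S u\<close> without disturbing the approximating sequence.\<close>

lemma H10_approx_imp_H10:
  assumes "H10_approx S u g" and S: "open S" "is_interval S"
  shows "u \<in> H10 S" "AE x in lborel. x \<in> S \<longrightarrow> weak_deriv S u x = g x"
proof -
  have ug: "u \<in> L2 S" "g \<in> L2 S" using assms(1) by (auto simp: H10_approx_def)
  note w = weak_deriv_AE_eq[OF ug H10_approx_weak_deriv[OF assms] S]
  show "AE x in lborel. x \<in> S \<longrightarrow> weak_deriv S u x = g x" by (rule w(4))
  have "AE x in lborel. x \<in> S \<longrightarrow> g x = weak_deriv S u x" using w(4) by eventually_elim auto
  then have "H10_approx S u (weak_deriv S u)"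
    by (intro H10_approx_cong_AE[OF assms(1) _ _ _ _ S] L2_measurable w ug) auto
  then show "u \<in> H10 S" using w(1) by (auto simp: H10_def H10_approx_def)
qed

lemma H10_imp_H10_approx:
  assumes "u \<in> H10 S" "open S" "is_interval S"
  shows "H10_approx S u (weak_deriv S u)"
  using assms H1_weak_deriv[of u S] unfolding H10_def H10_approx_def by blast

lemma L2_indicator:
  assumes S: "open S" and k: "k \<in> L2 S"
  shows "(\<lambda>x. indicator S x * k x) \<in> L2 UNIV"
    "L2_inner UNIV (\<lambda>x. indicator S x * k x) (\<lambda>x. indicator S x * k x) = L2_inner S k k"
proof -
  have "(indicator S x * k x)\<^sup>2 = indicator S x * (k x)\<^sup>2" for x by (simp add: indicator_def)
  then show "(\<lambda>x. indicator S x * k x) \<in> L2 UNIV"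
    using k by (simp add: L2_def set_borel_measurable_def set_integrable_def)
  have "(indicator S x * k x) * (indicator S x * k x) = indicator S x * (k x * k x)" for x
    by (simp add: indicator_def)
  then have "(\<lambda>x. (indicator S x * k x) * (indicator S x * k x)) = (\<lambda>x. indicator S x * (k x * k x))"
    by (rule ext)
  then show "L2_inner UNIV (\<lambda>x. indicator S x * k x) (\<lambda>x. indicator S x * k x) = L2_inner S k k"
    unfolding L2_inner_def set_lebesgue_integral_def by (simp only: indicator_UNIV mult_1_left real_scaleR_def)
qed

text \<open>This is where the Dirichlet condition becomes a statement about values. Test functions
  vanish at A, so by the Hoelder estimate L^2 convergence of their derivatives forces them to
  converge at every point of the line to the primitive U of the extended g. Outside S all of them
  are 0, hence U is 0 there, in particular at B.\<close>

lemma H10_approx_primitive: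
  assumes "H10_approx {A<..<B} u g" and AB: "A < B"
  obtains U where "primitive_on UNIV U (\<lambda>x. indicator {A<..<B} x * g x)"
    "\<And>x. x \<notin> {A<..<B} \<Longrightarrow> U x = 0" "AE x in lborel. x \<in> {A<..<B} \<longrightarrow> u x = U x"
proof -
  let ?S = "{A<..<B}"
  have S: "open ?S" "is_interval ?S" by auto
  note t = test_functions_L2[OF _ S]
  obtain \<phi> where \<phi>: "u \<in> L2 ?S" "g \<in> L2 ?S" "\<And>n. \<phi> n \<in> test_functions ?S"
    "(\<lambda>n. L2_norm ?S (\<lambda>x. \<phi> n x - u x)) \<longlonglongrightarrow> 0" "(\<lambda>n. L2_norm ?S (\<lambda>x. deriv (\<phi> n) x - g x)) \<longlonglongrightarrow> 0"
    using assms(1) unfolding H10_approx_def by blast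
  note ext = L2_indicator[OF S(1)]
  define G where "G x = indicator ?S x * g x" for x
  obtain U0 where U0: "primitive_on UNIV U0 G"
    using loc_integrable_primitive_ex[OF L2_loc_integrable[OF ext(1)[OF \<phi>(2)]]]
    unfolding G_def[abs_def] by auto
  \<comment> \<open>Normalized at A only; the value 0 at B comes out of the convergence
    below.\<close>
  define U where "U x = U0 x + - U0 A" for x
  have "primitive_on UNIV U (\<lambda>x. G x + 0)"
    unfolding U_def[abs_def] by (intro primitive_on_add U0 primitive_on_const)
  then have U: "primitive_on UNIV U G" by simp
  have \<phi>d: "deriv (\<phi> n) x = indicator ?S x * deriv (\<phi> n) x" for n x
    using test_functions_zero[OF test_functions_deriv[OF \<phi>(3)], of x n] by (cases "x \<in> ?S") auto
  have \<phi>p: "primitive_on UNIV (\<phi> n) (deriv (\<phi> n))" for n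
    by (intro primitive_on_DERIV smooth_has_derivative smooth_continuous smooth_deriv test_functions_smooth[OF \<phi>(3)])
  define \<delta> where "\<delta> n = L2_norm ?S (\<lambda>x. deriv (\<phi> n) x - g x)" for n
  have close: "(\<phi> n x - U x)\<^sup>2 \<le> \<bar>x - A\<bar> * (\<delta> n)\<^sup>2" for n x
  proof -
    have p: "primitive_on UNIV (\<lambda>x. \<phi> n x - U x) (\<lambda>x. deriv (\<phi> n) x - G x)"
      by (intro primitive_on_diff \<phi>p U)
    have eq: "(\<lambda>x. deriv (\<phi> n) x - G x) = (\<lambda>x. indicator ?S x * (deriv (\<phi> n) x - g x))"
      using \<phi>d unfolding G_def by (auto simp: right_diff_distrib)
    have L: "(\<lambda>x. deriv (\<phi> n) x - g x) \<in> L2 ?S"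
      by (intro L2_diff t test_functions_deriv \<phi>)
    have "((\<phi> n x - U x) - (\<phi> n A - U A))\<^sup>2 \<le> \<bar>x - A\<bar> * L2_inner UNIV (\<lambda>x. deriv (\<phi> n) x - G x) (\<lambda>x. deriv (\<phi> n) x - G x)"
      by (rule primitive_L2_Hoelder[OF p]) (use ext(1)[OF L] eq in simp)
    also have "L2_inner UNIV (\<lambda>x. deriv (\<phi> n) x - G x) (\<lambda>x. deriv (\<phi> n) x - G x) = (\<delta> n)\<^sup>2"
      unfolding eq ext(2)[OF L] \<delta>_def L2_norm_square ..
    also have "\<phi> n A - U A = 0" using test_functions_zero[OF \<phi>(3), of A n] by (simp add: U_def)
    finally show ?thesis by simp
  qed
  have \<delta>: "\<delta> \<longlonglongrightarrow> 0" using \<phi>(5) by (simp add: \<delta>_def[abs_def])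
  have lim: "(\<lambda>n. \<phi> n x) \<longlonglongrightarrow> U x" for x
  proof -
    have "(\<lambda>n. (\<phi> n x - U x)\<^sup>2) \<longlonglongrightarrow> 0"
    proof (rule Lim_null_comparison)
      show "(\<lambda>n. \<bar>x - A\<bar> * (\<delta> n)\<^sup>2) \<longlonglongrightarrow> 0"
        using tendsto_mult_left[OF tendsto_power[OF \<delta>, of 2], of "\<bar>x - A\<bar>"] by simp
      show "\<forall>\<^sub>F n in sequentially. norm ((\<phi> n x - U x)\<^sup>2) \<le> \<bar>x - A\<bar> * (\<delta> n)\<^sup>2"
        using close by (intro always_eventually allI) simp
    qed
    then have "(\<lambda>n. \<phi> n x - U x) \<longlonglongrightarrow> 0" using power_tendsto_0_iff[of 2 "\<lambda>n. \<phi> n x - U x" sequentially] by simp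
    then show ?thesis by (simp add: LIM_zero_iff)
  qed
  have out: "U x = 0" if x: "x \<notin> ?S" for x
  proof -
    have "\<phi> n x = 0" for n by (rule test_functions_zero[OF \<phi>(3) x])
    then show ?thesis using lim[of x] by (simp add: LIMSEQ_const_iff)
  qed
  have Uc: "continuous_on UNIV U" by (rule primitive_on_continuous_UNIV[OF U])
  have Um: "set_borel_measurable lborel ?S U"
    using borel_measurable_continuous_onI[OF Uc] by (intro set_borel_measurable_if_borel) auto
  have UL: "U \<in> L2 ?S"
  proof -
    have "set_integrable lborel {A..B} (\<lambda>x. U x * U x)"
      using Uc continuous_on_subset by (intro borel_integrable_atLeastAtMost' continuous_on_mult) blast+
    then have "set_integrable lborel ?S (\<lambda>x. U x * U x)"
      by (rule set_integrable_subset) auto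
    then show ?thesis using Um by (simp add: L2_def power2_eq_square)
  qed
  have bound: "L2_norm ?S (\<lambda>x. \<phi> n x - U x) \<le> (B - A) * \<delta> n" for n
  proof (rule power2_le_imp_le)
    have L: "(\<lambda>x. \<phi> n x - U x) \<in> L2 ?S" by (intro L2_diff UL t \<phi>)
    have "(L2_norm ?S (\<lambda>x. \<phi> n x - U x))\<^sup>2 = (LINT x:?S|lborel. (\<phi> n x - U x) * (\<phi> n x - U x))"
      by (simp add: L2_norm_square L2_inner_def)
    also have "\<dots> \<le> (LINT x:?S|lborel. (B - A) * (\<delta> n)\<^sup>2)"
    proof (rule set_integral_mono)
      show "set_integrable lborel ?S (\<lambda>x. (\<phi> n x - U x) * (\<phi> n x - U x))" by (rule L2_mult_integrable[OF L L])
      show "set_integrable lborel ?S (\<lambda>x. (B - A) * (\<delta> n)\<^sup>2)"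
        unfolding set_integrable_def using AB by simp
      fix x assume x: "x \<in> ?S"
      have "(\<phi> n x - U x)\<^sup>2 \<le> \<bar>x - A\<bar> * (\<delta> n)\<^sup>2" by (rule close)
      also have "\<dots> \<le> (B - A) * (\<delta> n)\<^sup>2" using x by (intro mult_right_mono) auto
      finally show "(\<phi> n x - U x) * (\<phi> n x - U x) \<le> (B - A) * (\<delta> n)\<^sup>2" by (simp add: power2_eq_square)
    qed
    also have "\<dots> = ((B - A) * \<delta> n)\<^sup>2"
      using AB by (simp add: set_lebesgue_integral_def power2_eq_square)
    finally show "(L2_norm ?S (\<lambda>x. \<phi> n x - U x))\<^sup>2 \<le> ((B - A) * \<delta> n)\<^sup>2" .
    show "0 \<le> (B - A) * \<delta> n" using AB by (simp add: \<delta>_def L2_norm_nonneg)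
  qed
  have "L2_norm ?S (\<lambda>x. u x - U x) \<le> L2_norm ?S (\<lambda>x. \<phi> n x - u x) + (B - A) * \<delta> n" for n
  proof -
    have "L2_norm ?S (\<lambda>x. u x - U x) \<le> L2_norm ?S (\<lambda>x. (-1) * (\<phi> n x - u x)) + L2_norm ?S (\<lambda>x. \<phi> n x - U x)"
      using L2_norm_triangle[OF L2_cmult[OF L2_diff[OF t[OF \<phi>(3)] \<phi>(1)]] L2_diff[OF t[OF \<phi>(3)] UL], of "-1" n n] by simp
    then show ?thesis using bound[of n] unfolding L2_norm_cmult by simp
  qed
  moreover have "(\<lambda>n. L2_norm ?S (\<lambda>x. \<phi> n x - u x) + (B - A) * \<delta> n) \<longlonglongrightarrow> 0"
    using tendsto_add[OF \<phi>(4) tendsto_mult_left[OF \<delta>, of "B - A"]] by simp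
  ultimately have "L2_norm ?S (\<lambda>x. u x - U x) \<le> 0"
    by (intro LIMSEQ_le_const[where X = "\<lambda>n. L2_norm ?S (\<lambda>x. \<phi> n x - u x) + (B - A) * \<delta> n"]) auto
  then have "L2_norm ?S (\<lambda>x. u x - U x) = 0" using L2_norm_nonneg[of ?S "\<lambda>x. u x - U x"] by linarith
  then have "AE x in lborel. x \<in> ?S \<longrightarrow> u x - U x = 0"
    using L2_norm_0_iff_AE[OF L2_diff[OF \<phi>(1) UL]] by simp
  then have "AE x in lborel. x \<in> ?S \<longrightarrow> u x = U x" by eventually_elim auto
  then show ?thesis using that U out unfolding G_def[abs_def] by blast
qed

text \<open>The converse direction, which supplies concrete trial functions. The derivative g is
  approximated by polynomials times plateaus, the mean of these is removed with a fixed bump, and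
  the results are integrated to test functions. Control of U itself follows by integrating from
  A.\<close>

lemma H10_approx_C1:
  assumes U: "primitive_on {A..B} U g" and g: "continuous_on {A..B} g" and AB: "A < B"
    and bc: "U A = 0" "U B = 0"
  shows "H10_approx {A<..<B} U g"
proof -
  let ?S = "{A<..<B}"
  have S: "open ?S" "is_interval ?S" "?S \<noteq> {}" using AB by auto
  have Uc: "continuous_on {A..B} U" by (rule primitive_on_continuous[OF U]) simp
  have L2c: "f \<in> L2 ?S" if f: "continuous_on {A..B} f" for f
  proof -
    have "set_integrable lborel {A..B} (\<lambda>x. (f x)\<^sup>2)" "set_integrable lborel {A..B} f"
      by (intro borel_integrable_atLeastAtMost' continuous_intros f)+
    then have "set_integrable lborel ?S (\<lambda>x. (f x)\<^sup>2)" "set_integrable lborel ?S f"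
      by (auto intro: set_integrable_subset)
    then show ?thesis using set_integrable_imp_measurable by (simp add: L2_def)
  qed
  obtain \<rho> where \<rho>: "\<rho> \<in> test_functions ?S" "(LINT x|lborel. \<rho> x) = 1"
    using bump_ex[OF AB] by blast
  have "\<exists>p. real_polynomial_function p \<and> (\<forall>x\<in>{A..B}. \<bar>g x - p x\<bar> < 1 / real (Suc n))" for n
    using Stone_Weierstrass_real_polynomial_function[OF compact_Icc g, of "1 / real (Suc n)"] by (metis zero_less_divide_1_iff of_nat_0_less_iff zero_less_Suc)
  then obtain p where p: "\<And>n. real_polynomial_function (p n)" "\<And>n x. x \<in> {A..B} \<Longrightarrow> \<bar>g x - p n x\<bar> < 1 / real (Suc n)"
    by metis
  define \<theta> where "\<theta> n x = p n x * plateau A B n x" for n x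
  have \<theta>t: "\<theta> n \<in> test_functions ?S" for n
    unfolding \<theta>_def by (intro test_functions_mult smooth_real_polynomial_function p plateau_test)
  obtain C where C: "\<And>x. x \<in> {A..B} \<Longrightarrow> \<bar>g x\<bar> \<le> C"
    using compact_continuous_image[OF g compact_Icc] by (metis bounded_real compact_imp_bounded imageI)
  have \<theta>b: "\<bar>\<theta> n x\<bar> \<le> C + 1" if x: "x \<in> ?S" for n x
  proof -
    have "1 / real (Suc n) \<le> 1" by (simp add: field_simps)
    moreover have "x \<in> {A..B}" using x by auto
    ultimately have "\<bar>p n x\<bar> \<le> C + 1" using C[of x] p(2)[of x n] by linarith
    then have "\<bar>p n x\<bar> * \<bar>plateau A B n x\<bar> \<le> (C + 1) * 1"
      using plateau_bounds[of A B n x] by (intro mult_mono) auto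
    then show ?thesis by (simp add: \<theta>_def abs_mult)
  qed
  have \<theta>lim: "(\<lambda>n. \<theta> n x) \<longlonglongrightarrow> g x" if x: "x \<in> ?S" for x
  proof -
    have "(\<lambda>n. g x - p n x) \<longlonglongrightarrow> 0"
      by (rule Lim_null_comparison[OF always_eventually LIMSEQ_Suc[OF lim_1_over_n]])
         (use p(2)[of x] x in \<open>auto intro: less_imp_le\<close>)
    then have "(\<lambda>n. g x - (g x - p n x)) \<longlonglongrightarrow> g x - 0" by (intro tendsto_intros)
    then have "(\<lambda>n. p n x) \<longlonglongrightarrow> g x" by simp
    then have "(\<lambda>n. p n x * plateau A B n x) \<longlonglongrightarrow> g x * 1"
      using plateau_tendsto[of A B x] x by (intro tendsto_mult) auto
    then show ?thesis by (simp add: \<theta>_def)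
  qed
  define I where "I n = (LINT x|lborel. \<theta> n x)" for n
  have m: "set_borel_measurable lborel ?S (\<theta> n)" "set_borel_measurable lborel ?S g" for n
    using L2_measurable[OF test_functions_L2[OF \<theta>t S(1,2)]] L2_measurable[OF L2c[OF g]] by auto
  have z: "indicator ?S x *\<^sub>R \<psi> x = \<psi> x" if "\<psi> \<in> test_functions ?S" for \<psi> x
    using test_functions_zero[OF that, of x] by (cases "x \<in> ?S") auto
  have full: "(LINT x:?S|lborel. \<psi> x) = (LINT x|lborel. \<psi> x)" if "\<psi> \<in> test_functions ?S" for \<psi>
    unfolding set_lebesgue_integral_def z[OF that] ..
  have intg: "(LINT x:?S|lborel. g x) = 0"
  proof -
    have "(LINT x:?S|lborel. g x) = (LINT x:{A..B}|lborel. g x)"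
    proof (rule set_integral_cong_set)
      show "set_borel_measurable lborel ?S g" by (rule m)
      show "set_borel_measurable lborel {A..B} g"
        by (intro set_integrable_imp_measurable borel_integrable_atLeastAtMost' g)
      show "AE x in lborel. (x \<in> {A..B}) = (x \<in> ?S)"
        using AE_lborel_singleton[of A] AE_lborel_singleton[of B] by eventually_elim auto
    qed
    also have "\<dots> = 0" using primitive_onD(2)[OF U, of A B] AB bc by simp
    finally show ?thesis .
  qed
  have Ilim: "I \<longlonglongrightarrow> 0"
  proof -
    have "(\<lambda>n. LINT x|lborel. indicator ?S x *\<^sub>R \<theta> n x) \<longlonglongrightarrow> (LINT x|lborel. indicator ?S x *\<^sub>R g x)"
    proof (rule integral_dominated_convergence[where w = "\<lambda>x. indicator ?S x * (C + 1)"])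
      show "AE x in lborel. (\<lambda>n. indicator ?S x *\<^sub>R \<theta> n x) \<longlonglongrightarrow> indicator ?S x *\<^sub>R g x"
        using \<theta>lim by (intro AE_I2) (simp add: indicator_def)
      show "AE x in lborel. norm (indicator ?S x *\<^sub>R \<theta> n x) \<le> indicator ?S x * (C + 1)" for n
        using \<theta>b by (intro AE_I2) (simp add: indicator_def)
    qed (use m AB in \<open>auto simp: set_borel_measurable_def\<close>)
    moreover have "(LINT x|lborel. indicator ?S x *\<^sub>R \<theta> n x) = I n" for n
      by (simp only: I_def z[OF \<theta>t])
    moreover have "(LINT x|lborel. indicator ?S x *\<^sub>R g x) = 0"
      using intg by (simp only: set_lebesgue_integral_def)
    ultimately show ?thesis by simp
  qed
  \<comment> \<open>Removing the mean makes this the derivative of a test function. The correction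
    disappears in the limit, since \<open>I n\<close> tends to the integral of g, which is U B - U A
    = 0.\<close>
  define \<psi> where "\<psi> n x = \<theta> n x + - I n * \<rho> x" for n x
  have \<psi>t: "\<psi> n \<in> test_functions ?S" for n
    unfolding \<psi>_def by (intro test_functions_add test_functions_cmult \<theta>t \<rho>)
  have tint: "integrable lborel \<psi>" if "\<psi> \<in> test_functions ?S" for \<psi>
  proof -
    have "set_integrable lborel ?S (\<lambda>x. 1 * \<psi> x)"
      by (intro test_mult_integrable loc_integrable_continuous continuous_intros that S)
    then show ?thesis by (simp only: set_integrable_def mult_1_left z[OF that])
  qed
  have "(LINT x|lborel. \<psi> n x) = 0" for n
    using tint[OF \<theta>t] tint[OF \<rho>(1)] \<rho>(2) by (simp add: \<psi>_def I_def)
  then have "\<exists>\<phi>. \<phi> \<in> test_functions ?S \<and> (\<forall>x. (\<phi> has_real_derivative \<psi> n x) (at x))" for n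
    using test_antideriv[OF \<psi>t S] by metis
  then obtain \<phi> where \<phi>: "\<And>n. \<phi> n \<in> test_functions ?S" "\<And>n x. (\<phi> n has_real_derivative \<psi> n x) (at x)"
    by metis
  have d\<phi>: "deriv (\<phi> n) = \<psi> n" for n using \<phi>(2) DERIV_imp_deriv by blast
  have gL: "g \<in> L2 ?S" and UL: "U \<in> L2 ?S" using L2c g Uc by auto
  have \<psi>L: "\<psi> n \<in> L2 ?S" for n by (rule test_functions_L2[OF \<psi>t S(1,2)])
  obtain R where R: "\<And>x. \<bar>\<rho> x\<bar> \<le> R"
  proof -
    have "continuous_on {A..B} \<rho>" by (rule smooth_continuous[OF test_functions_smooth[OF \<rho>(1)]])
    then obtain R where R: "\<And>x. x \<in> {A..B} \<Longrightarrow> \<bar>\<rho> x\<bar> \<le> R"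
      by (metis bounded_real compact_Icc compact_continuous_image compact_imp_bounded imageI)
    have "\<bar>\<rho> x\<bar> \<le> R" for x
    proof (cases "x \<in> {A..B}")
      case False
      then have "\<rho> x = 0" using test_functions_zero[OF \<rho>(1)] by auto
      then show ?thesis using R[of A] AB by simp
    qed (use R in auto)
    then show thesis using that by blast
  qed
  obtain D where D: "\<And>n. \<bar>I n\<bar> \<le> D"
    using Bseq_eq_bounded convergent_imp_Bseq[of I] Ilim by (metis BseqE convergentI real_norm_def)
  have b: "\<bar>\<psi> n x - g x\<bar> \<le> (C + 1) + D * R + C" if x: "x \<in> ?S" for n x
  proof -
    have "\<bar>I n * \<rho> x\<bar> \<le> D * R" unfolding abs_mult using D[of n] R[of x] by (intro mult_mono) auto
    moreover have "\<bar>g x\<bar> \<le> C" using C x by auto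
    ultimately show ?thesis using \<theta>b[OF x, of n] unfolding \<psi>_def by linarith
  qed
  have conv: "(\<lambda>n. L2_inner ?S (\<lambda>x. \<psi> n x - g x) (\<lambda>x. \<psi> n x - g x)) \<longlonglongrightarrow> 0"
  proof -
    have "(\<lambda>n. LINT x|lborel. indicator ?S x *\<^sub>R ((\<psi> n x - g x) * (\<psi> n x - g x))) \<longlonglongrightarrow> (LINT x|(lborel :: real measure). (0::real))"
    proof (rule integral_dominated_convergence[where f = "\<lambda>x. 0" and w = "\<lambda>x. indicator ?S x * ((C + 1) + D * R + C)\<^sup>2"])
      show "AE x in lborel. (\<lambda>n. indicator ?S x *\<^sub>R ((\<psi> n x - g x) * (\<psi> n x - g x))) \<longlonglongrightarrow> 0"
      proof (rule AE_I2)
        fix x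
        show "(\<lambda>n. indicator ?S x *\<^sub>R ((\<psi> n x - g x) * (\<psi> n x - g x))) \<longlonglongrightarrow> 0"
        proof (cases "x \<in> ?S")
          case True
          have "(\<lambda>n. \<psi> n x - g x) \<longlonglongrightarrow> (g x + - 0 * \<rho> x) - g x"
            unfolding \<psi>_def by (intro tendsto_intros \<theta>lim True Ilim)
          then have "(\<lambda>n. \<psi> n x - g x) \<longlonglongrightarrow> 0" by simp
          from tendsto_mult[OF this this] show ?thesis using True by simp
        qed simp
      qed
      show "AE x in lborel. norm (indicator ?S x *\<^sub>R ((\<psi> n x - g x) * (\<psi> n x - g x))) \<le> indicator ?S x * ((C + 1) + D * R + C)\<^sup>2" for n
      proof (rule AE_I2)
        fix x
        show "norm (indicator ?S x *\<^sub>R ((\<psi> n x - g x) * (\<psi> n x - g x))) \<le> indicator ?S x * ((C + 1) + D * R + C)\<^sup>2"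
          using power_mono[OF b[of x n], of 2] by (cases "x \<in> ?S") (auto simp: power2_eq_square)
      qed
      show "(\<lambda>x. indicator ?S x *\<^sub>R ((\<psi> n x - g x) * (\<psi> n x - g x))) \<in> borel_measurable lborel" for n
        using set_integrable_imp_measurable[OF L2_mult_integrable[OF L2_diff[OF \<psi>L gL] L2_diff[OF \<psi>L gL]]]
        by (simp add: set_borel_measurable_def)
    qed (use AB in auto)
    then show ?thesis by (simp add: L2_inner_def set_lebesgue_integral_def)
  qed
  then have dlim: "(\<lambda>n. L2_norm ?S (\<lambda>x. \<psi> n x - g x)) \<longlonglongrightarrow> 0"
    unfolding L2_norm_def using tendsto_real_sqrt by fastforce
  have close: "(\<phi> n x - U x)\<^sup>2 \<le> (B - A) * L2_inner ?S (\<lambda>x. \<psi> n x - g x) (\<lambda>x. \<psi> n x - g x)" if x: "x \<in> ?S" for n x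
  proof -
    have "primitive_on {A..B} (\<phi> n) (\<psi> n)"
      by (rule primitive_on_DERIV[OF \<phi>(2)]) (rule smooth_continuous[OF test_functions_smooth[OF \<psi>t]])
    then have pd: "primitive_on {A..B} (\<lambda>x. \<phi> n x - U x) (\<lambda>x. \<psi> n x - g x)" by (rule primitive_on_diff[OF _ U])
    have L: "(\<lambda>t. \<psi> n t - g t) \<in> L2 {A..x}"
    proof -
      have c: "continuous_on {A..x} (\<lambda>t. \<psi> n t - g t)"
        using continuous_on_subset[OF g, of "{A..x}"] x smooth_continuous[OF test_functions_smooth[OF \<psi>t]]
        by (intro continuous_on_diff) auto
      then have "set_integrable lborel {A..x} (\<lambda>t. (\<psi> n t - g t)\<^sup>2)" "set_integrable lborel {A..x} (\<lambda>t. \<psi> n t - g t)"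
        using borel_integrable_atLeastAtMost'[OF c] borel_integrable_atLeastAtMost'[OF continuous_on_power[OF c, of 2]]
        by auto
      then show ?thesis using set_integrable_imp_measurable by (simp add: L2_def)
    qed
    have "(\<phi> n x - U x) - (\<phi> n A - U A) = (LINT t:{A..x}|lborel. \<psi> n t - g t)"
      by (rule primitive_onD(2)[OF pd]) (use x in auto)
    moreover have "\<phi> n A = 0" by (rule test_functions_zero[OF \<phi>(1)]) simp
    ultimately have "(\<phi> n x - U x)\<^sup>2 = (LINT t:{A..x}|lborel. \<psi> n t - g t)\<^sup>2" using bc by simp
    also have "\<dots> \<le> (x - A) * L2_inner {A..x} (\<lambda>x. \<psi> n x - g x) (\<lambda>x. \<psi> n x - g x)"
      by (rule L2_integral_square_bound[OF L]) (use x in auto)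
    also have "L2_inner {A..x} (\<lambda>x. \<psi> n x - g x) (\<lambda>x. \<psi> n x - g x) = L2_inner {A<..x} (\<lambda>x. \<psi> n x - g x) (\<lambda>x. \<psi> n x - g x)"
      unfolding L2_inner_def
    proof (rule set_integral_cong_set)
      show "set_borel_measurable lborel {A..x} (\<lambda>x. (\<psi> n x - g x) * (\<psi> n x - g x))"
        by (intro set_borel_measurable_mult L2_measurable L)
      show "set_borel_measurable lborel {A<..x} (\<lambda>x. (\<psi> n x - g x) * (\<psi> n x - g x))"
        by (intro set_borel_measurable_mult L2_measurable L2_subset[OF L]) auto
      show "AE t in lborel. (t \<in> {A<..x}) = (t \<in> {A..x})"
        using AE_lborel_singleton[of A] by eventually_elim auto
    qed
    also have "(x - A) * \<dots> \<le> (B - A) * L2_inner ?S (\<lambda>x. \<psi> n x - g x) (\<lambda>x. \<psi> n x - g x)"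
      using x by (intro mult_mono L2_inner_mono_set L2_diff \<psi>L gL L2_inner_nonneg) auto
    finally show ?thesis .
  qed
  have "(\<lambda>n. L2_inner ?S (\<lambda>x. \<phi> n x - U x) (\<lambda>x. \<phi> n x - U x)) \<longlonglongrightarrow> 0"
  proof (rule Lim_null_comparison)
    show "(\<lambda>n. (B - A) * ((B - A) * L2_inner ?S (\<lambda>x. \<psi> n x - g x) (\<lambda>x. \<psi> n x - g x))) \<longlonglongrightarrow> 0"
      using tendsto_mult_left[OF tendsto_mult_left[OF conv, of "B - A"], of "B - A"] by simp
    have "L2_inner ?S (\<lambda>x. \<phi> n x - U x) (\<lambda>x. \<phi> n x - U x) \<le>
        (B - A) * ((B - A) * L2_inner ?S (\<lambda>x. \<psi> n x - g x) (\<lambda>x. \<psi> n x - g x))" for n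
    proof -
      let ?c = "(B - A) * L2_inner ?S (\<lambda>x. \<psi> n x - g x) (\<lambda>x. \<psi> n x - g x)"
      have L: "(\<lambda>x. \<phi> n x - U x) \<in> L2 ?S" by (intro L2_diff UL test_functions_L2[OF \<phi>(1) S(1,2)])
      have "L2_inner ?S (\<lambda>x. \<phi> n x - U x) (\<lambda>x. \<phi> n x - U x) \<le> (LINT x:?S|lborel. ?c)"
        unfolding L2_inner_def
      proof (rule set_integral_mono)
        show "set_integrable lborel ?S (\<lambda>x. (\<phi> n x - U x) * (\<phi> n x - U x))" by (rule L2_mult_integrable[OF L L])
      qed (use AB close in \<open>auto simp: set_integrable_def power2_eq_square L2_inner_def\<close>)
      also have "\<dots> = (B - A) * ?c" using AB by (simp add: set_lebesgue_integral_def)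
      finally show ?thesis .
    qed
    then show "\<forall>\<^sub>F n in sequentially. norm (L2_inner ?S (\<lambda>x. \<phi> n x - U x) (\<lambda>x. \<phi> n x - U x)) \<le>
        (B - A) * ((B - A) * L2_inner ?S (\<lambda>x. \<psi> n x - g x) (\<lambda>x. \<psi> n x - g x))"
      by (intro always_eventually allI) (simp add: L2_inner_nonneg)
  qed
  then have "(\<lambda>n. L2_norm ?S (\<lambda>x. \<phi> n x - U x)) \<longlonglongrightarrow> 0"
    unfolding L2_norm_def using tendsto_real_sqrt by fastforce
  then show ?thesis
    using dlim by (intro H10_approxI[OF UL gL \<phi>(1)]) (simp_all add: d\<phi>)
qed

section \<open>Schroedinger operators on a bounded interval\<close>

lemma primitive_on_continuous_open:
  assumes "primitive_on S U g" "open S"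
  shows "continuous_on S U"
proof -
  have "isCont U x" if x: "x \<in> S" for x
  proof -
    obtain e where e: "e > 0" "cball x e \<subseteq> S"
      using open_contains_cball[THEN iffD1, rule_format, OF assms(2) x] by auto
    then have "{x - e..x + e} \<subseteq> S" by (auto simp: subset_iff dist_real_def)
    from continuous_on_interior[OF primitive_on_continuous[OF assms(1) this], of x] show ?thesis
      using e(1) by simp
  qed
  then show ?thesis by (simp add: continuous_at_imp_continuous_on)
qed

lemma primitive_on_integral_from:
  assumes "set_integrable lborel {A..B} f"
  shows "primitive_on {A..B} (\<lambda>x. LINT t:{A..x}|lborel. f t) f"
  unfolding primitive_on_def
proof (intro ballI impI conjI)
  fix x y assume xy: "x \<in> {A..B}" "y \<in> {A..B}" "x \<le> y"
  show "set_integrable lborel {x..y} f" by (rule set_integrable_subset[OF assms]) (use xy in auto)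
  have "set_integrable lborel {A..y} f" by (rule set_integrable_subset[OF assms]) (use xy in auto)
  then show "(LINT t:{A..y}|lborel. f t) - (LINT t:{A..x}|lborel. f t) = (LINT t:{x..y}|lborel. f t)"
    using set_integral_combine[of A y f x] xy by simp
qed

lemma set_integral_Icc_Ioo:
  fixes f :: "real \<Rightarrow> real"
  shows "(LINT x:{A..B}|lborel. indicator {A<..<B} x * f x) = (LINT x:{A<..<B}|lborel. f x)"
    "set_integrable lborel {A..B} (\<lambda>x. indicator {A<..<B} x * f x) \<longleftrightarrow> set_integrable lborel {A<..<B} f"
proof -
  have "(\<lambda>x. indicator {A..B} x *\<^sub>R (indicator {A<..<B} x * f x)) = (\<lambda>x. indicator {A<..<B} x *\<^sub>R f x)"
    by (rule ext) (simp add: indicator_def)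
  then show "(LINT x:{A..B}|lborel. indicator {A<..<B} x * f x) = (LINT x:{A<..<B}|lborel. f x)"
    "set_integrable lborel {A..B} (\<lambda>x. indicator {A<..<B} x * f x) \<longleftrightarrow> set_integrable lborel {A<..<B} f"
    by (simp_all add: set_lebesgue_integral_def set_integrable_def)
qed

text \<open>Nonnegativity and integrability are all that is available for \<open>W_pot\<close>,
  whose part \<open>v_pot\<close> may be unbounded near 0. In one dimension they suffice, as
  elements of \<open>H10\<close> have bounded continuous representatives.\<close>

locale schroedinger_interval =
  fixes A B :: real and V :: "real \<Rightarrow> real"
  assumes AB: "A < B"
    and V_nonneg: "\<And>x. x \<in> {A<..<B} \<Longrightarrow> 0 \<le> V x"
    and V_integrable: "set_integrable lborel {A<..<B} V"
begin

abbreviation "S \<equiv> {A<..<B}"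
abbreviation "Q \<equiv> schroedinger_form S V"
abbreviation "ip \<equiv> L2_inner S"

lemma S: "open S" "is_interval S" "S \<noteq> {}" "S \<in> sets borel" using AB by auto

text \<open>\<open>U\<close> is the continuous representative of \<open>u\<close>, extended by 0, and \<open>g\<close> its derivative.\<close>

definition elem :: "(real \<Rightarrow> real) \<Rightarrow> (real \<Rightarrow> real) \<Rightarrow> (real \<Rightarrow> real) \<Rightarrow> bool" where
  "elem u U g \<longleftrightarrow> H10_approx S u g \<and> primitive_on UNIV U (\<lambda>x. indicator S x * g x) \<and>
     (\<forall>x. x \<notin> S \<longrightarrow> U x = 0) \<and> (AE x in lborel. x \<in> S \<longrightarrow> u x = U x)"

lemma elem_ex_approx:
  assumes "H10_approx S u g"
  shows "\<exists>U. elem u U g"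
proof -
  obtain U where "primitive_on UNIV U (\<lambda>x. indicator S x * g x)" "\<And>x. x \<notin> S \<Longrightarrow> U x = 0"
    "AE x in lborel. x \<in> S \<longrightarrow> u x = U x"
    by (rule H10_approx_primitive[OF assms AB], rule that)
  then have "elem u U g" using assms by (simp add: elem_def)
  then show ?thesis by blast
qed

lemma elem_ex: "u \<in> H10 S \<Longrightarrow> \<exists>U g. elem u U g"
  using elem_ex_approx H10_imp_H10_approx S by blast

lemma elemD:
  assumes "elem u U g"
  shows "u \<in> H10 S" "u \<in> L2 S" "g \<in> L2 S" "H10_approx S u g"
    "AE x in lborel. x \<in> S \<longrightarrow> weak_deriv S u x = g x"
    "weak_deriv S u \<in> L2 S"
    "primitive_on UNIV U (\<lambda>x. indicator S x * g x)" "\<And>x. x \<notin> S \<Longrightarrow> U x = 0"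
    "AE x in lborel. x \<in> S \<longrightarrow> u x = U x"
    "continuous_on UNIV U" "U \<in> borel_measurable borel" "U \<in> L2 S"
proof -
  show H: "H10_approx S u g" and U: "primitive_on UNIV U (\<lambda>x. indicator S x * g x)"
    and "\<And>x. x \<notin> S \<Longrightarrow> U x = 0" and ae: "AE x in lborel. x \<in> S \<longrightarrow> u x = U x"
    using assms by (auto simp: elem_def)
  show "u \<in> H10 S" "AE x in lborel. x \<in> S \<longrightarrow> weak_deriv S u x = g x"
    using H10_approx_imp_H10[OF H S(1,2)] by auto
  show u: "u \<in> L2 S" "g \<in> L2 S" using H by (auto simp: H10_approx_def)
  show "weak_deriv S u \<in> L2 S"
    using weak_deriv_AE_eq(2)[OF u H10_approx_weak_deriv[OF H S(1,2)] S(1,2)] .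
  show c: "continuous_on UNIV U" by (rule primitive_on_continuous_UNIV[OF U])
  then show m: "U \<in> borel_measurable borel" by (rule borel_measurable_continuous_onI)
  show "U \<in> L2 S" by (rule L2_cong_AE[OF u(1) set_borel_measurable_if_borel[OF m S(4)] ae])
qed

lemma elem_add:
  assumes "elem u U g" "elem w W k"
  shows "elem (\<lambda>x. u x + w x) (\<lambda>x. U x + W x) (\<lambda>x. g x + k x)"
  unfolding elem_def
proof (intro conjI allI impI)
  show "H10_approx S (\<lambda>x. u x + w x) (\<lambda>x. g x + k x)"
    by (intro H10_approx_add elemD(4)[OF assms(1)] elemD(4)[OF assms(2)] S)
  show "primitive_on UNIV (\<lambda>x. U x + W x) (\<lambda>x. indicator S x * (g x + k x))"
    using primitive_on_add[OF elemD(7)[OF assms(1)] elemD(7)[OF assms(2)]] by (simp add: distrib_left)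
  show "AE x in lborel. x \<in> S \<longrightarrow> u x + w x = U x + W x"
    using elemD(9)[OF assms(1)] elemD(9)[OF assms(2)] by eventually_elim auto
qed (use elemD(8)[OF assms(1)] elemD(8)[OF assms(2)] in auto)

lemma elem_cmult:
  assumes "elem u U g"
  shows "elem (\<lambda>x. c * u x) (\<lambda>x. c * U x) (\<lambda>x. c * g x)"
  unfolding elem_def
proof (intro conjI allI impI)
  show "H10_approx S (\<lambda>x. c * u x) (\<lambda>x. c * g x)"
    by (intro H10_approx_cmult elemD(4)[OF assms(1)])
  show "primitive_on UNIV (\<lambda>x. c * U x) (\<lambda>x. indicator S x * (c * g x))"
    using primitive_on_cmult[OF elemD(7)[OF assms(1)], of c] by (simp add: mult.left_commute)
  show "AE x in lborel. x \<in> S \<longrightarrow> c * u x = c * U x"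
    using elemD(9)[OF assms(1)] by eventually_elim auto
qed (use elemD(8)[OF assms(1)] in auto)

lemma V_mult_integrable:
  assumes "F \<in> borel_measurable borel" "\<And>x. x \<in> S \<Longrightarrow> \<bar>F x\<bar> \<le> C"
  shows "set_integrable lborel S (\<lambda>x. V x * F x)"
proof (rule set_integrable_bound)
  show "set_integrable lborel S (\<lambda>x. C * V x)" using V_integrable by simp
  show "set_borel_measurable lborel S (\<lambda>x. V x * F x)"
    by (intro set_borel_measurable_mult set_integrable_imp_measurable[OF V_integrable]
        set_borel_measurable_if_borel assms(1) S)
  have "\<bar>V x * F x\<bar> \<le> \<bar>C * V x\<bar>" if x: "x \<in> S" for x
  proof -
    have "\<bar>V x * F x\<bar> = V x * \<bar>F x\<bar>" using V_nonneg[OF x] by (simp add: abs_mult)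
    also have "\<dots> \<le> V x * C" by (intro mult_left_mono assms x V_nonneg)
    finally show ?thesis by (simp add: mult.commute)
  qed
  then show "AE x in lborel. x \<in> S \<longrightarrow> norm (V x * F x) \<le> norm (C * V x)" by (intro AE_I2) simp
qed

lemma continuous_bounded_S:
  assumes "continuous_on UNIV (F :: real \<Rightarrow> real)"
  obtains C where "\<And>x. x \<in> {A..B} \<Longrightarrow> \<bar>F x\<bar> \<le> C"
proof -
  have "compact (F ` {A..B})" using assms continuous_on_subset by (intro compact_continuous_image) auto
  then obtain C where "\<forall>y \<in> F ` {A..B}. \<bar>y\<bar> \<le> C" using compact_imp_bounded bounded_real by metis
  then show ?thesis using that by blast
qed

lemma V_mult_integrable_continuous:
  assumes "continuous_on UNIV F"
  shows "set_integrable lborel S (\<lambda>x. V x * F x)"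
proof -
  obtain C where C: "\<And>x. x \<in> {A..B} \<Longrightarrow> \<bar>F x\<bar> \<le> C" using continuous_bounded_S[OF assms] by blast
  show ?thesis
    by (rule V_mult_integrable[OF borel_measurable_continuous_onI[OF assms], of C]) (use C in auto)
qed

text \<open>Trades u and the chosen weak derivative for the continuous representative and an
  explicit g. With U and W continuous, the potential term is integrable although V is only in L^1,
  and the two parts of the integral may be separated.\<close>

lemma Q_eq:
  assumes u: "elem u U g" and w: "elem w W k"
  shows "Q u w = ip g k + (LINT x:S|lborel. V x * (U x * W x))"
proof -
  note u' = elemD[OF u] and w' = elemD[OF w]
  have VUW: "set_integrable lborel S (\<lambda>x. V x * (U x * W x))"
    by (intro V_mult_integrable_continuous continuous_on_mult u' w')
  have m: "set_borel_measurable lborel S (\<lambda>x. weak_deriv S u x * weak_deriv S w x + V x * u x * w x)"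
    by (intro set_borel_measurable_add set_borel_measurable_mult L2_measurable u' w' set_integrable_imp_measurable[OF V_integrable])
  have gk: "set_integrable lborel S (\<lambda>x. g x * k x)" by (rule L2_mult_integrable[OF u'(3) w'(3)])
  have "Q u w = (LINT x:S|lborel. g x * k x + V x * (U x * W x))"
    unfolding schroedinger_form_def
  proof (rule set_integral_cong_AE_weak(1)[OF m])
    show "set_borel_measurable lborel S (\<lambda>x. g x * k x + V x * (U x * W x))"
      by (intro set_integrable_imp_measurable set_integral_add(1) gk VUW)
    show "AE x in lborel. x \<in> S \<longrightarrow>
        weak_deriv S u x * weak_deriv S w x + V x * u x * w x = g x * k x + V x * (U x * W x)"
      using u'(5) u'(9) w'(5) w'(9) by eventually_elim auto
  qed
  also have "\<dots> = ip g k + (LINT x:S|lborel. V x * (U x * W x))"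
    unfolding L2_inner_def by (rule set_integral_add(2)[OF gk VUW])
  finally show ?thesis .
qed

lemma ip_eq:
  assumes u: "elem u U g" and w: "elem w W k"
  shows "ip u w = ip U W"
  by (rule L2_inner_cong_AE) (use elemD[OF u] elemD[OF w] in auto)

lemma Q_commute:
  assumes "u \<in> H10 S" "w \<in> H10 S"
  shows "Q u w = Q w u"
  unfolding schroedinger_form_def by (simp add: ac_simps)

lemma H10_add: "u \<in> H10 S \<Longrightarrow> w \<in> H10 S \<Longrightarrow> (\<lambda>x. u x + w x) \<in> H10 S"
  using elem_ex elem_add elemD(1) by meson

lemma H10_cmult: "u \<in> H10 S \<Longrightarrow> (\<lambda>x. c * u x) \<in> H10 S"
  using elem_ex elem_cmult elemD(1) by meson

lemma H10_L2: "u \<in> H10 S \<Longrightarrow> u \<in> L2 S"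
  using elem_ex elemD(2) by meson

lemma Q_add_left:
  assumes "u \<in> H10 S" "w \<in> H10 S" "y \<in> H10 S"
  shows "Q (\<lambda>x. u x + w x) y = Q u y + Q w y"
proof -
  obtain U g where u: "elem u U g" using elem_ex[OF assms(1)] by blast
  obtain W k where w: "elem w W k" using elem_ex[OF assms(2)] by blast
  obtain Y l where y: "elem y Y l" using elem_ex[OF assms(3)] by blast
  note u' = elemD[OF u] and w' = elemD[OF w] and y' = elemD[OF y]
  have "(LINT x:S|lborel. V x * ((U x + W x) * Y x)) =
      (LINT x:S|lborel. V x * (U x * Y x) + V x * (W x * Y x))"
    by (simp add: algebra_simps)
  also have "\<dots> = (LINT x:S|lborel. V x * (U x * Y x)) + (LINT x:S|lborel. V x * (W x * Y x))"
    by (intro set_integral_add(2) V_mult_integrable_continuous continuous_on_mult u' w' y')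
  finally show ?thesis
    unfolding Q_eq[OF elem_add[OF u w] y] Q_eq[OF u y] Q_eq[OF w y] L2_inner_add_left[OF u'(3) w'(3) y'(3)]
    by simp
qed

lemma Q_cmult_left:
  assumes "u \<in> H10 S" "w \<in> H10 S"
  shows "Q (\<lambda>x. c * u x) w = c * Q u w"
proof -
  obtain U g where u: "elem u U g" using elem_ex[OF assms(1)] by blast
  obtain W k where w: "elem w W k" using elem_ex[OF assms(2)] by blast
  have "(LINT x:S|lborel. V x * (c * U x * W x)) = (LINT x:S|lborel. c * (V x * (U x * W x)))"
    by (simp add: ac_simps)
  then show ?thesis
    unfolding Q_eq[OF elem_cmult[OF u] w] Q_eq[OF u w] L2_inner_cmult_left
    by (simp add: distrib_left)
qed

lemma Q_lower:
  assumes u: "elem u U g"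
  shows "ip g g \<le> Q u u" "(LINT x:S|lborel. V x * (U x * U x)) \<le> Q u u" "0 \<le> Q u u"
proof -
  have "0 \<le> (LINT x:S|lborel. V x * (U x * U x))"
    unfolding set_lebesgue_integral_def
    by (intro integral_nonneg_AE AE_I2) (auto simp: indicator_def V_nonneg)
  then show "ip g g \<le> Q u u" "(LINT x:S|lborel. V x * (U x * U x)) \<le> Q u u" "0 \<le> Q u u"
    unfolding Q_eq[OF u u] using L2_inner_nonneg[of S g] by auto
qed

lemma Q_nonneg: "u \<in> H10 S \<Longrightarrow> 0 \<le> Q u u"
  using elem_ex Q_lower(3) by meson

lemma elem_Hoelder:
  assumes u: "elem u U g"
  shows "(U x - U y)\<^sup>2 \<le> \<bar>x - y\<bar> * ip g g"
  using primitive_L2_Hoelder[OF elemD(7)[OF u] L2_indicator(1)[OF S(1) elemD(3)[OF u]], of x y]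
  unfolding L2_indicator(2)[OF S(1) elemD(3)[OF u]] .

lemma elem_bound:
  assumes u: "elem u U g"
  shows "(U x)\<^sup>2 \<le> (B - A) * ip g g"
proof (cases "x \<in> S")
  case True
  have "U A = 0" by (rule elemD(8)[OF u]) simp
  then have "(U x)\<^sup>2 \<le> \<bar>x - A\<bar> * ip g g" using elem_Hoelder[OF u, of x A] by simp
  also have "\<dots> \<le> (B - A) * ip g g" using True by (intro mult_right_mono L2_inner_nonneg) auto
  finally show ?thesis .
next
  case False
  then show ?thesis using elemD(8)[OF u] AB L2_inner_nonneg[of S g] by simp
qed

text \<open>Together with \<open>Q_lower\<close> it makes the form equivalent to the Dirichlet
  energy: the sup bound \<open>elem_bound\<close> is integrated against V. The constant reappears as
  \<open>M\<close> in the construction of minimizers.\<close>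

lemma Q_upper:
  assumes u: "elem u U g"
  shows "Q u u \<le> (1 + (B - A) * (LINT x:S|lborel. V x)) * ip g g"
proof -
  have "(LINT x:S|lborel. V x * (U x * U x)) \<le> (LINT x:S|lborel. V x * ((B - A) * ip g g))"
  proof (rule set_integral_mono)
    show "set_integrable lborel S (\<lambda>x. V x * (U x * U x))"
      by (intro V_mult_integrable_continuous continuous_on_mult elemD(10)[OF u])
    show "set_integrable lborel S (\<lambda>x. V x * ((B - A) * ip g g))" using V_integrable by simp
    show "V x * (U x * U x) \<le> V x * ((B - A) * ip g g)" if "x \<in> S" for x
      using elem_bound[OF u, of x] V_nonneg[OF that] by (intro mult_left_mono) (auto simp: power2_eq_square)
  qed
  moreover have "(LINT x:S|lborel. V x * c) = (LINT x:S|lborel. V x) * c" for c by simp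
  ultimately show ?thesis unfolding Q_eq[OF u u] by (simp add: distrib_right distrib_left ac_simps del: set_integral_mult_left)
qed

lemma elem_C1:
  assumes U: "primitive_on {A..B} U g" and g: "continuous_on {A..B} g" and bc: "U A = 0" "U B = 0"
  shows "elem U (\<lambda>x. indicator S x * U x) g"
proof -
  have H: "H10_approx S U g" by (rule H10_approx_C1[OF U g AB bc])
  obtain W where W: "elem U W g" using elem_ex_approx[OF H] by blast
  have "W x = indicator S x * U x" for x
  proof (cases "x \<in> S")
    case True
    have "W x - W A = (LINT t:{A..x}|lborel. indicator S t * g t)"
      by (rule primitive_onD(2)[OF elemD(7)[OF W]]) (use True in auto)
    also have "\<dots> = (LINT t:{A..x}|lborel. g t)"
    proof (rule set_integral_cong_AE_weak(1))
      have i: "set_integrable lborel {A..x} g"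
        by (rule borel_integrable_atLeastAtMost'[OF continuous_on_subset[OF g]]) (use True in auto)
      then show "set_borel_measurable lborel {A..x} g" by (rule set_integrable_imp_measurable)
      show "set_borel_measurable lborel {A..x} (\<lambda>t. indicator S t * g t)"
        by (intro set_borel_measurable_mult set_integrable_imp_measurable[OF i] set_borel_measurable_if_borel) auto
      show "AE t in lborel. t \<in> {A..x} \<longrightarrow> indicator S t * g t = g t"
        using AE_lborel_singleton[of A] by eventually_elim (use True in \<open>auto simp: indicator_def\<close>)
    qed
    also have "\<dots> = U x - U A" by (rule primitive_onD(2)[OF U, symmetric]) (use True in auto)
    finally show ?thesis using True bc elemD(8)[OF W, of A] by simp
  next
    case False
    then show ?thesis using elemD(8)[OF W] by simp
  qed
  then have "W = (\<lambda>x. indicator S x * U x)" by (rule ext)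
  then show ?thesis using W by simp
qed

text \<open>Tested with test functions, the eigenvalue equation says that g has the weak derivative
  (V - \<nu>) U, which is integrable because U is continuous. Hence g has an absolutely continuous
  representative H, and U is C^1 in the open interval even where V is unbounded.\<close>

lemma eigenfunction_regularity:
  assumes op: "form_operator S (H10 S) Q u (\<lambda>x. \<nu> * u x)" and u: "elem u U g"
  obtains H where "primitive_on S U H" "primitive_on S H (\<lambda>x. (V x - \<nu>) * U x)"
    "H \<in> L2 S" "ip H H = ip g g" "continuous_on S H"
proof -
  note u' = elemD[OF u]
  have VU: "set_integrable lborel S (\<lambda>x. V x * U x)"
    by (intro V_mult_integrable_continuous u')
  have UI: "set_integrable lborel S U"
    using L2_mult_integrable[OF u'(12) L2_const[of S 1]] AB by (simp add: emeasure_lborel_Ioo)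
  have f: "set_integrable lborel S (\<lambda>x. (V x - \<nu>) * U x)"
    using set_integral_diff(1)[OF VU set_integrable_mult_right[OF UI, of \<nu>]] by (simp add: left_diff_distrib)
  have floc: "loc_integrable S (\<lambda>x. (V x - \<nu>) * U x)"
    unfolding loc_integrable_def using set_integrable_subset[OF f] by simp
  have "has_weak_deriv S g (\<lambda>x. (V x - \<nu>) * U x)"
    unfolding has_weak_deriv_def
  proof
    fix \<phi> assume \<phi>: "\<phi> \<in> test_functions S"
    have \<phi>H: "H10_approx S \<phi> (deriv \<phi>)"
      by (rule H10_approxI[where \<phi> = "\<lambda>n. \<phi>"])
         (auto intro: test_functions_L2 test_functions_deriv \<phi> S simp: L2_norm_def L2_inner_def)
    have z: "\<phi> x = 0" if "x \<notin> S" for x using test_functions_zero[OF \<phi> that] .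
    have \<phi>E: "elem \<phi> \<phi> (deriv \<phi>)"
      unfolding elem_def
    proof (intro conjI \<phi>H)
      have "primitive_on UNIV \<phi> (deriv \<phi>)"
        by (intro primitive_on_DERIV smooth_has_derivative smooth_continuous smooth_deriv test_functions_smooth[OF \<phi>])
      moreover have "indicator S x * deriv \<phi> x = deriv \<phi> x" for x
        using test_functions_zero[OF test_functions_deriv[OF \<phi>], of x] by (cases "x \<in> S") auto
      then have "(\<lambda>x. indicator S x * deriv \<phi> x) = deriv \<phi>" by (rule ext)
      ultimately show "primitive_on UNIV \<phi> (\<lambda>x. indicator S x * deriv \<phi> x)" by (simp only:)
    qed (use z in auto)
    have "Q u \<phi> = ip (\<lambda>x. \<nu> * u x) \<phi>"
      using op elemD(1)[OF \<phi>E] unfolding form_operator_def by blast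
    then have "ip g (deriv \<phi>) + (LINT x:S|lborel. V x * (U x * \<phi> x)) = \<nu> * ip U \<phi>"
      unfolding Q_eq[OF u \<phi>E] L2_inner_cmult_left ip_eq[OF u \<phi>E] .
    moreover have "(LINT x:S|lborel. (V x - \<nu>) * U x * \<phi> x) = (LINT x:S|lborel. V x * (U x * \<phi> x)) - \<nu> * ip U \<phi>"
    proof -
      have "(LINT x:S|lborel. (V x - \<nu>) * U x * \<phi> x) = (LINT x:S|lborel. V x * (U x * \<phi> x) - \<nu> * (U x * \<phi> x))"
        by (simp add: algebra_simps)
      also have "\<dots> = (LINT x:S|lborel. V x * (U x * \<phi> x)) - (LINT x:S|lborel. \<nu> * (U x * \<phi> x))"
        by (intro set_integral_diff(2) V_mult_integrable_continuous continuous_on_mult u' elemD(10)[OF \<phi>E]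
             set_integrable_mult_right L2_mult_integrable elemD(12)[OF \<phi>E])
      finally show ?thesis by (simp add: L2_inner_def)
    qed
    ultimately show "(LINT x:S|lborel. g x * deriv \<phi> x) = - (LINT x:S|lborel. (V x - \<nu>) * U x * \<phi> x)"
      by (simp add: L2_inner_def)
  qed
  then obtain H where H: "primitive_on S H (\<lambda>x. (V x - \<nu>) * U x)" "AE x in lborel. x \<in> S \<longrightarrow> g x = H x"
    using weak_deriv_primitive[OF _ L2_loc_integrable[OF u'(3)] floc S(1,2,3)] by blast
  have Hc: "continuous_on S H" by (rule primitive_on_continuous_open[OF H(1) S(1)])
  have Hm: "set_borel_measurable lborel S H"
    using borel_measurable_continuous_on_indicator[OF S(4) Hc] by (simp add: set_borel_measurable_def)
  have HL: "H \<in> L2 S" by (rule L2_cong_AE[OF u'(3) Hm H(2)])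
  have "primitive_on S U H"
  proof (rule primitive_on_cong_AE[OF primitive_on_mono[OF u'(7) subset_UNIV] S(2,4) Hm])
    show "AE x in lborel. x \<in> S \<longrightarrow> indicator S x * g x = H x"
      using H(2) by eventually_elim auto
  qed
  moreover have "ip H H = ip g g"
  proof (rule L2_inner_cong_AE[OF HL u'(3) HL u'(3)])
    show "AE x in lborel. x \<in> S \<longrightarrow> H x = g x" using H(2) by eventually_elim auto
    then show "AE x in lborel. x \<in> S \<longrightarrow> H x = g x" .
  qed
  ultimately show ?thesis using that H(1) HL Hc by blast
qed

lemma eigen_enumerationD:
  assumes "eigen_enumeration S (form_operator S (H10 S) Q) ev \<psi>" "i \<ge> 1"
  shows "\<psi> i \<in> H10 S" "\<And>w. w \<in> H10 S \<Longrightarrow> Q (\<psi> i) w = ev i * ip (\<psi> i) w" "ip (\<psi> i) (\<psi> i) = 1"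
    "0 \<le> ev i" "form_operator S (H10 S) Q (\<psi> i) (\<lambda>x. ev i * \<psi> i x)"
proof -
  show *: "form_operator S (H10 S) Q (\<psi> i) (\<lambda>x. ev i * \<psi> i x)"
    using assms unfolding eigen_enumeration_def by blast
  show H: "\<psi> i \<in> H10 S" using * unfolding form_operator_def by blast
  show q: "Q (\<psi> i) w = ev i * ip (\<psi> i) w" if "w \<in> H10 S" for w
    using * that unfolding form_operator_def L2_inner_cmult_left by blast
  show o: "ip (\<psi> i) (\<psi> i) = 1" using assms unfolding eigen_enumeration_def by auto
  show "0 \<le> ev i" using Q_nonneg[OF H] q[OF H] o by simp
qed

end

section \<open>The variational principle on a bounded interval\<close>

lemma set_integral_tendsto_bounded:
  fixes f :: "nat \<Rightarrow> real \<Rightarrow> real"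
  assumes w: "set_integrable lborel S w" and m: "\<And>n. set_borel_measurable lborel S (f n)"
    and lim: "\<And>x. x \<in> S \<Longrightarrow> (\<lambda>n. f n x) \<longlonglongrightarrow> F x"
    and bound: "\<And>n x. x \<in> S \<Longrightarrow> \<bar>f n x\<bar> \<le> w x"
  shows "(\<lambda>n. LINT x:S|lborel. f n x) \<longlonglongrightarrow> (LINT x:S|lborel. F x)"
    "set_integrable lborel S F"
proof -
  have lim': "AE x in lborel. (\<lambda>n. indicator S x *\<^sub>R f n x) \<longlonglongrightarrow> indicator S x *\<^sub>R F x"
    using lim by (intro AE_I2) (simp add: indicator_def)
  have b': "AE x in lborel. norm (indicator S x *\<^sub>R f n x) \<le> indicator S x *\<^sub>R w x" for n
    using bound by (intro AE_I2) (simp add: indicator_def)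
  have m': "(\<lambda>x. indicator S x *\<^sub>R f n x) \<in> borel_measurable lborel" for n
    using m by (simp add: set_borel_measurable_def)
  have "(\<lambda>x. indicator S x *\<^sub>R F x) \<in> borel_measurable lborel"
    by (rule borel_measurable_LIMSEQ_metric[where f = "\<lambda>n x. indicator S x *\<^sub>R f n x"])
       (use m' lim in \<open>simp_all add: indicator_def\<close>)
  note D = this m' w[unfolded set_integrable_def] lim' b'
  show "(\<lambda>n. LINT x:S|lborel. f n x) \<longlonglongrightarrow> (LINT x:S|lborel. F x)"
    unfolding set_lebesgue_integral_def by (rule integral_dominated_convergence[OF D])
  show "set_integrable lborel S F"
    unfolding set_integrable_def by (rule integrable_dominated_convergence[OF D])
qed

context schroedinger_interval
begin

text \<open>The form Q - \<nu> ip is known to be nonnegative only on the complement of finitely many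
  eigenfunctions, not on all of \<open>H10\<close>; hence positivity is asked for only on the line u
  + t w and at w.\<close>

lemma nonneg_form_Cauchy_Schwarz:
  assumes u: "u \<in> H10 S" and w: "w \<in> H10 S"
    and pos: "\<And>t. \<nu> * ip (\<lambda>x. u x + t * w x) (\<lambda>x. u x + t * w x) \<le> Q (\<lambda>x. u x + t * w x) (\<lambda>x. u x + t * w x)"
    and posw: "\<nu> * ip w w \<le> Q w w"
  shows "(Q u w - \<nu> * ip u w)\<^sup>2 \<le> (Q u u - \<nu> * ip u u) * (Q w w - \<nu> * ip w w)"
proof (rule quadratic_nonneg_imp_discriminant)
  fix t
  have tw: "(\<lambda>x. t * w x) \<in> H10 S" by (rule H10_cmult[OF w])
  have utw: "(\<lambda>x. u x + t * w x) \<in> H10 S" by (rule H10_add[OF u tw])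
  have "Q (\<lambda>x. u x + t * w x) (\<lambda>x. u x + t * w x) = Q u (\<lambda>x. u x + t * w x) + t * Q w (\<lambda>x. u x + t * w x)"
    unfolding Q_add_left[OF u tw utw] Q_cmult_left[OF w utw] ..
  also have "Q u (\<lambda>x. u x + t * w x) = Q u u + t * Q w u"
    unfolding Q_commute[OF u utw] Q_add_left[OF u tw u] Q_cmult_left[OF w u] ..
  also have "Q w (\<lambda>x. u x + t * w x) = Q u w + t * Q w w"
    unfolding Q_commute[OF w utw] Q_add_left[OF u tw w] Q_cmult_left[OF w w] ..
  finally have "Q (\<lambda>x. u x + t * w x) (\<lambda>x. u x + t * w x) = Q u u + 2 * Q u w * t + Q w w * t\<^sup>2"
    using Q_commute[OF u w] by (simp add: algebra_simps power2_eq_square)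
  then show "0 \<le> (Q u u - \<nu> * ip u u) + 2 * (Q u w - \<nu> * ip u w) * t + (Q w w - \<nu> * ip w w) * t\<^sup>2"
    using pos[of t] unfolding L2_inner_add_cmult[OF H10_L2[OF u] H10_L2[OF w]] by (simp add: algebra_simps)
qed (use posw in simp)

text \<open>Eigenfunctions are orthogonal for the inner product and for Q at once. Subtracting the
  components of w along them therefore changes neither pairing with an orthogonal z, and it lowers
  the energy by the sum of ev i (ip (\<psi> i) w)^2, which is nonnegative because Q is.\<close>

lemma orthogonal_projection:
  assumes fin: "finite I" and \<psi>H: "\<And>i. i \<in> I \<Longrightarrow> \<psi> i \<in> H10 S"
    and \<psi>Q: "\<And>i w. i \<in> I \<Longrightarrow> w \<in> H10 S \<Longrightarrow> Q (\<psi> i) w = ev i * ip (\<psi> i) w"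
    and on: "\<And>i k. i \<in> I \<Longrightarrow> k \<in> I \<Longrightarrow> ip (\<psi> i) (\<psi> k) = (if i = k then 1 else 0)"
    and wH: "w \<in> H10 S"
  shows "\<exists>y\<in>H10 S. (\<forall>i\<in>I. ip y (\<psi> i) = 0) \<and>
    (\<forall>z\<in>H10 S. (\<forall>i\<in>I. ip z (\<psi> i) = 0) \<longrightarrow> Q y z = Q w z \<and> ip y z = ip w z) \<and>
    Q y y \<le> Q w w \<and> ip y y = ip w w - (\<Sum>i\<in>I. (ip (\<psi> i) w)\<^sup>2)"
proof -
  have ev0: "0 \<le> ev i" if "i \<in> I" for i
    using Q_nonneg[OF \<psi>H[OF that]] \<psi>Q[OF that \<psi>H[OF that]] on[OF that that] by simp
  define a where "a i = ip (\<psi> i) w" for i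
  define y where "y x = w x - (\<Sum>i\<in>I. a i * \<psi> i x)" for x
  have sumH: "(\<lambda>x. \<Sum>i\<in>J. a i * \<psi> i x) \<in> H10 S" and sumQ: "z \<in> H10 S \<Longrightarrow> Q (\<lambda>x. \<Sum>i\<in>J. a i * \<psi> i x) z = (\<Sum>i\<in>J. a i * (ev i * ip (\<psi> i) z))"
    if "J \<subseteq> I" for J z
  proof -
    have "finite J" using fin that finite_subset by blast
    then have "(\<lambda>x. \<Sum>i\<in>J. a i * \<psi> i x) \<in> H10 S \<and>
        (z \<in> H10 S \<longrightarrow> Q (\<lambda>x. \<Sum>i\<in>J. a i * \<psi> i x) z = (\<Sum>i\<in>J. a i * (ev i * ip (\<psi> i) z)))"
      using that
    proof (induction J rule: finite_induct)
      case empty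
      have "(\<lambda>x. 0) \<in> H10 S" using H10_approx_imp_H10(1)[OF H10_approx_zero S(1,2)] .
      moreover have "Q (\<lambda>x. 0) z = 0" if "z \<in> H10 S"
        using Q_cmult_left[OF that that, of 0] by simp
      ultimately show ?case by simp
    next
      case (insert i J)
      have i: "(\<lambda>x. a i * \<psi> i x) \<in> H10 S" by (rule H10_cmult[OF \<psi>H]) (use insert in auto)
      have J: "(\<lambda>x. \<Sum>i\<in>J. a i * \<psi> i x) \<in> H10 S" using insert by auto
      show ?case
      proof (intro conjI impI)
        show "(\<lambda>x. \<Sum>i\<in>insert i J. a i * \<psi> i x) \<in> H10 S"
          using H10_add[OF i J] insert(1,2) by simp
        assume z: "z \<in> H10 S"
        have "Q (\<lambda>x. a i * \<psi> i x + (\<Sum>i\<in>J. a i * \<psi> i x)) z = a i * (ev i * ip (\<psi> i) z) + (\<Sum>i\<in>J. a i * (ev i * ip (\<psi> i) z))"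
          using Q_add_left[OF i J z] Q_cmult_left[OF \<psi>H z, of i "a i"] \<psi>Q[OF _ z, of i] insert z by simp
        then show "Q (\<lambda>x. \<Sum>i\<in>insert i J. a i * \<psi> i x) z = (\<Sum>i\<in>insert i J. a i * (ev i * ip (\<psi> i) z))"
          using insert(1,2) by simp
      qed
    qed
    then show "(\<lambda>x. \<Sum>i\<in>J. a i * \<psi> i x) \<in> H10 S"
      "z \<in> H10 S \<Longrightarrow> Q (\<lambda>x. \<Sum>i\<in>J. a i * \<psi> i x) z = (\<Sum>i\<in>J. a i * (ev i * ip (\<psi> i) z))" by auto
  qed
  have msumH: "(\<lambda>x. (-1) * (\<Sum>i\<in>I. a i * \<psi> i x)) \<in> H10 S" by (rule H10_cmult[OF sumH]) simp
  have y_alt: "y = (\<lambda>x. w x + (-1) * (\<Sum>i\<in>I. a i * \<psi> i x))" by (rule ext) (simp add: y_def)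
  have yH: "y \<in> H10 S" unfolding y_alt by (rule H10_add[OF wH msumH])
  have Qy: "Q y z = Q w z - (\<Sum>i\<in>I. a i * (ev i * ip (\<psi> i) z))" if z: "z \<in> H10 S" for z
    unfolding y_alt Q_add_left[OF wH msumH z] Q_cmult_left[OF sumH[OF order_refl] z] sumQ[OF order_refl z] by simp
  have ipy: "ip y z = ip w z - (\<Sum>i\<in>I. a i * ip (\<psi> i) z)" if z: "z \<in> L2 S" for z
  proof -
    have "ip y z = ip w z - ip (\<lambda>x. \<Sum>i\<in>I. a i * \<psi> i x) z"
      unfolding y_def[abs_def] by (intro L2_inner_diff_left H10_L2 wH z sumH order_refl)
    also have "ip (\<lambda>x. \<Sum>i\<in>I. a i * \<psi> i x) z = (\<Sum>i\<in>I. ip (\<lambda>x. a i * \<psi> i x) z)"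
      by (intro L2_inner_sum_left L2_cmult H10_L2 \<psi>H z)
    finally show ?thesis by (simp add: L2_inner_cmult_left)
  qed
  have yperp: "ip y (\<psi> i) = 0" if i: "i \<in> I" for i
  proof -
    have "(\<Sum>l\<in>I. a l * ip (\<psi> l) (\<psi> i)) = (\<Sum>l\<in>I. if l = i then a i else 0)"
      by (intro sum.cong) (use on i in auto)
    then show ?thesis
      using ipy[OF H10_L2[OF \<psi>H[OF i]]] fin i by (simp add: a_def L2_inner_commute)
  qed
  have same: "Q y z = Q w z \<and> ip y z = ip w z" if z: "z \<in> H10 S" "\<And>i. i \<in> I \<Longrightarrow> ip z (\<psi> i) = 0" for z
    using Qy[OF z(1)] ipy[OF H10_L2[OF z(1)]] z(2) by (simp add: L2_inner_commute)
  have "Q y y = Q w y" using same[OF yH yperp] by simp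
  also have "\<dots> = Q w w - (\<Sum>i\<in>I. a i * (ev i * a i))"
    using Qy[OF wH] Q_commute[OF wH yH] by (simp add: a_def)
  also have "\<dots> \<le> Q w w"
  proof -
    have "0 \<le> a i * (ev i * a i)" if "i \<in> I" for i
      using mult_nonneg_nonneg[OF ev0[OF that] zero_le_square[of "a i"]] by (simp add: mult.left_commute)
    then have "0 \<le> (\<Sum>i\<in>I. a i * (ev i * a i))" by (rule sum_nonneg)
    then show ?thesis by linarith
  qed
  finally have "Q y y \<le> Q w w" .
  moreover have "ip y y = ip w w - (\<Sum>i\<in>I. (ip (\<psi> i) w)\<^sup>2)"
    using same[OF yH yperp] ipy[OF H10_L2[OF wH]] by (simp add: a_def power2_eq_square L2_inner_commute)
  ultimately show ?thesis using yH yperp same by blast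
qed

text \<open>The direct method: a minimizing sequence has a subsequence whose continuous representatives
  converge pointwise. Integrating the equation once shows that its derivatives converge up to an
  error \<open>k n\<close> which the Cauchy-Schwarz inequality for the nonnegative form \<open>Q - \<nu> ip\<close> controls,
  so that the limit is a \<open>C\<^sup>1\<close> solution of the Euler-Lagrange equation.\<close>

lemma minimizer_exists:
  assumes fin: "finite I" and \<psi>H: "\<And>i. i \<in> I \<Longrightarrow> \<psi> i \<in> H10 S"
    and \<psi>Q: "\<And>i w. i \<in> I \<Longrightarrow> w \<in> H10 S \<Longrightarrow> Q (\<psi> i) w = ev i * ip (\<psi> i) w"
    and on: "\<And>i k. i \<in> I \<Longrightarrow> k \<in> I \<Longrightarrow> ip (\<psi> i) (\<psi> k) = (if i = k then 1 else 0)"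
    and \<nu>0: "0 \<le> \<nu>"
    and low: "\<And>w. w \<in> H10 S \<Longrightarrow> (\<And>i. i \<in> I \<Longrightarrow> ip w (\<psi> i) = 0) \<Longrightarrow> \<nu> * ip w w \<le> Q w w"
    and inf: "\<And>e. e > 0 \<Longrightarrow> \<exists>w \<in> H10 S. (\<forall>i\<in>I. ip w (\<psi> i) = 0) \<and> ip w w = 1 \<and> Q w w < \<nu> + e"
  obtains Z where "Z \<in> H10 S" "\<And>i. i \<in> I \<Longrightarrow> ip Z (\<psi> i) = 0" "ip Z Z = 1"
    "\<And>w. w \<in> H10 S \<Longrightarrow> Q Z w = \<nu> * ip Z w"
proof -
  have ev0: "0 \<le> ev i" if "i \<in> I" for i
    using Q_nonneg[OF \<psi>H[OF that]] \<psi>Q[OF that \<psi>H[OF that]] on[OF that that] by simp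
  have "\<exists>w U g. elem w U g \<and> (\<forall>i\<in>I. ip w (\<psi> i) = 0) \<and> ip w w = 1 \<and> Q w w < \<nu> + 1 / real (Suc n)" for n
  proof -
    have "1 / real (Suc n) > 0" by simp
    from inf[OF this] obtain w where "w \<in> H10 S" "\<forall>i\<in>I. ip w (\<psi> i) = 0" "ip w w = 1" "Q w w < \<nu> + 1 / real (Suc n)"
      by blast
    then show ?thesis using elem_ex[of w] by blast
  qed
  then obtain w0 U0 g0 where w0: "\<And>n. elem (w0 n) (U0 n) (g0 n)"
    "\<And>n i. i \<in> I \<Longrightarrow> ip (w0 n) (\<psi> i) = 0" "\<And>n. ip (w0 n) (w0 n) = 1"
    "\<And>n. Q (w0 n) (w0 n) < \<nu> + 1 / real (Suc n)"
    by metis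
  define K where "K = \<nu> + 1"
  have g0: "ip (g0 n) (g0 n) \<le> K" for n
  proof -
    have "1 / real (Suc n) \<le> 1" by (simp add: field_simps)
    then show ?thesis using Q_lower(1)[OF w0(1), of n] w0(4)[of n] unfolding K_def by linarith
  qed
  define C where "C = sqrt ((B - A) * K)"
  have K0: "0 \<le> K" using \<nu>0 by (simp add: K_def)
  have U0b: "\<bar>U0 n x\<bar> \<le> C" for n x
  proof -
    have "(U0 n x)\<^sup>2 \<le> (B - A) * K"
      using elem_bound[OF w0(1), of n x] g0[of n] AB by (meson diff_ge_0_iff_ge less_imp_le mult_left_mono order_trans)
    then show ?thesis unfolding C_def using real_sqrt_le_mono by fastforce
  qed
  have U0h: "(U0 n x - U0 n y)\<^sup>2 \<le> K * \<bar>x - y\<bar>" for n x y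
    using elem_Hoelder[OF w0(1), of n x y] mult_left_mono[OF g0[of n], of "\<bar>x - y\<bar>"] by (simp add: mult.commute)
  obtain r U where r: "strict_mono r" and lim0: "\<And>x. (\<lambda>n. U0 (r n) x) \<longlonglongrightarrow> U x"
    using pointwise_convergent_subsequence[of U0 C K] U0b U0h by blast
  define u W0 g where "u n = w0 (r n)" and "W0 n = U0 (r n)" and "g n = g0 (r n)" for n
  have e: "elem (u n) (W0 n) (g n)" and perp: "i \<in> I \<Longrightarrow> ip (u n) (\<psi> i) = 0" and nrm: "ip (u n) (u n) = 1"
    and W0b: "\<bar>W0 n x\<bar> \<le> C" and lim: "(\<lambda>n. W0 n x) \<longlonglongrightarrow> U x" for n i x
    unfolding u_def W0_def g_def using w0 U0b lim0 by auto
  note e' = elemD[OF e]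
  define \<delta> where "\<delta> n = Q (u n) (u n) - \<nu>" for n
  have \<delta>0: "0 \<le> \<delta> n" for n
    using low[OF e'(1)[of n]] perp nrm[of n] by (simp add: \<delta>_def)
  have \<delta>lim: "\<delta> \<longlonglongrightarrow> 0"
  proof (rule Lim_null_comparison)
    show "(\<lambda>n. 1 / real (Suc (r n))) \<longlonglongrightarrow> 0"
      using LIMSEQ_subseq_LIMSEQ[OF LIMSEQ_Suc[OF lim_1_over_n] r] by (simp add: o_def)
    show "\<forall>\<^sub>F n in sequentially. norm (\<delta> n) \<le> 1 / real (Suc (r n))"
    proof (intro always_eventually allI)
      fix n
      show "norm (\<delta> n) \<le> 1 / real (Suc (r n))"
        using \<delta>0[of n] w0(4)[of "r n"] unfolding real_norm_def \<delta>_def u_def by linarith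
    qed
  qed
  \<comment> \<open>The constant of \<open>Q_upper\<close>, bounding Q w w by M times the Dirichlet
    energy of w.\<close>
  define M where "M = 1 + (B - A) * (LINT x:S|lborel. V x)"
  have VI0: "0 \<le> (LINT x:S|lborel. V x)"
    unfolding set_lebesgue_integral_def
    by (intro integral_nonneg_AE AE_I2) (auto simp: indicator_def V_nonneg)
  have M0: "1 \<le> M" using VI0 AB by (simp add: M_def)
  have C0: "0 \<le> C" using order_trans[OF abs_ge_zero U0b[of 0 0]] .
  have UC: "\<bar>U x\<bar> \<le> C" for x
    using tendsto_rabs[OF lim[of x]] W0b by (intro LIMSEQ_le_const2[where X = "\<lambda>n. \<bar>W0 n x\<bar>"]) auto
  have Um: "U \<in> borel_measurable borel"
    by (rule borel_measurable_LIMSEQ_metric[of W0]) (use e'(11) lim in auto)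
  \<comment> \<open>The right-hand side of the Euler-Lagrange equation Z'' = (V - \<nu>) F, extended
    by 0 so that it can be integrated from the end point A.\<close>
  define p where "p F t = indicator S t * ((V t - \<nu>) * F t)" for F :: "real \<Rightarrow> real" and t
  define P where "P F x = (LINT t:{A..x}|lborel. p F t)" for F x
  have one: "set_integrable lborel S (\<lambda>x. c)" for c :: real
    using AB by (simp add: set_integrable_def)
  have pI: "set_integrable lborel S (\<lambda>t. (V t - \<nu>) * F t)" if "F \<in> borel_measurable borel" "\<And>x. \<bar>F x\<bar> \<le> C" for F
  proof -
    have "set_integrable lborel S (\<lambda>t. \<nu> * F t)"
      by (intro set_integrable_mult_right set_integrable_bound[OF one[of C]] set_borel_measurable_if_borel that S AE_I2)
         (use that C0 in auto)
    from set_integral_diff(1)[OF V_mult_integrable[OF that] this] show ?thesis by (simp add: left_diff_distrib)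
  qed
  have pI': "set_integrable lborel {A..B} (p F)" if "F \<in> borel_measurable borel" "\<And>x. \<bar>F x\<bar> \<le> C" for F
    unfolding p_def set_integral_Icc_Ioo(2) by (rule pI[OF that])
  have Pp: "primitive_on {A..B} (P F) (p F)" if "F \<in> borel_measurable borel" "\<And>x. \<bar>F x\<bar> \<le> C" for F
    unfolding P_def by (rule primitive_on_integral_from[OF pI'[OF that]])
  have Pc: "continuous_on {A..B} (P F)" if "F \<in> borel_measurable borel" "\<And>x. \<bar>F x\<bar> \<le> C" for F
    using primitive_on_continuous[OF Pp[OF that]] by simp
  note W0m = e'(11)
  define D where "D = (LINT t:{A..B}|lborel. indicator S t * ((V t + \<nu>) * C))"
  have domI: "set_integrable lborel {A..B} (\<lambda>t. indicator S t * ((V t + \<nu>) * C))"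
    unfolding set_integral_Icc_Ioo(2)
    by (intro set_integrable_mult_left set_integral_add(1) V_integrable one)
  have pb: "\<bar>p F t\<bar> \<le> indicator S t * ((V t + \<nu>) * C)" if "\<And>x. \<bar>F x\<bar> \<le> C" for F t
  proof (cases "t \<in> S")
    case True
    have "\<bar>V t - \<nu>\<bar> \<le> V t + \<nu>" using V_nonneg[OF True] \<nu>0 by simp
    then have "\<bar>V t - \<nu>\<bar> * \<bar>F t\<bar> \<le> (V t + \<nu>) * C" using that[of t] V_nonneg[OF True] \<nu>0 by (intro mult_mono) auto
    then show ?thesis using True by (simp add: p_def abs_mult)
  qed (simp add: p_def)
  have Plim: "(\<lambda>n. P (W0 n) x) \<longlonglongrightarrow> P U x" if x: "x \<in> {A..B}" for x
    unfolding P_def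
  proof (rule set_integral_tendsto_bounded(1))
    show "set_integrable lborel {A..x} (\<lambda>t. indicator S t * ((V t + \<nu>) * C))"
      by (rule set_integrable_subset[OF domI]) (use x in auto)
    show "set_borel_measurable lborel {A..x} (p (W0 n))" for n
    proof (rule set_integrable_imp_measurable)
      show "set_integrable lborel {A..x} (p (W0 n))"
        by (rule set_integrable_subset[OF pI'[OF W0m W0b]]) (use x in auto)
    qed
    show "(\<lambda>n. p (W0 n) t) \<longlonglongrightarrow> p U t" for t
      unfolding p_def by (intro tendsto_intros lim)
    show "\<bar>p (W0 n) t\<bar> \<le> indicator S t * ((V t + \<nu>) * C)" for n t
      by (rule pb[OF W0b])
  qed
  have Pb: "\<bar>P F x\<bar> \<le> D" if F: "F \<in> borel_measurable borel" "\<And>x. \<bar>F x\<bar> \<le> C" and x: "x \<in> {A..B}" for F x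
  proof -
    have i: "set_integrable lborel {A..x} (p F)" by (rule set_integrable_subset[OF pI'[OF F]]) (use x in auto)
    have d: "set_integrable lborel {A..x} (\<lambda>t. indicator S t * ((V t + \<nu>) * C))"
      by (rule set_integrable_subset[OF domI]) (use x in auto)
    have "\<bar>P F x\<bar> \<le> (LINT t:{A..x}|lborel. \<bar>p F t\<bar>)"
      unfolding P_def set_lebesgue_integral_def
      using integral_norm_bound[of lborel "\<lambda>t. indicator {A..x} t *\<^sub>R p F t"] by (simp add: abs_mult)
    also have "\<dots> \<le> (LINT t:{A..x}|lborel. indicator S t * ((V t + \<nu>) * C))"
      by (rule set_integral_mono[OF set_integrable_abs[OF i] d]) (rule pb[OF F(2)])
    also have "\<dots> \<le> D"
      unfolding D_def set_lebesgue_integral_def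
    proof (rule integral_mono[OF d[unfolded set_integrable_def] domI[unfolded set_integrable_def]])
      fix t
      have "0 \<le> indicator S t * ((V t + \<nu>) * C)"
        using V_nonneg[of t] \<nu>0 C0 by (cases "t \<in> S") auto
      then show "indicator {A..x} t *\<^sub>R (indicator S t * ((V t + \<nu>) * C)) \<le> indicator {A..B} t *\<^sub>R (indicator S t * ((V t + \<nu>) * C))"
        using x by (auto simp: indicator_def)
    qed
    finally show ?thesis .
  qed
  \<comment> \<open>The integration constant for Z', chosen so that P F + c F has mean 0 and its
    primitive \<open>Z F\<close> vanishes at B as well as at A.\<close>
  define c where "c F = - (LINT x:{A..B}|lborel. P F x) / (B - A)" for F
  have one': "set_integrable lborel {A..x} (\<lambda>x. c)" for c x :: real
    by (simp add: set_integrable_def integrable_indicator_iff emeasure_lborel_Icc_eq)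
  have clim: "(\<lambda>n. c (W0 n)) \<longlonglongrightarrow> c U"
    unfolding c_def
  proof (intro tendsto_divide tendsto_minus tendsto_const set_integral_tendsto_bounded(1)[OF one'[of B D]])
    show "set_borel_measurable lborel {A..B} (P (W0 n))" for n
      by (intro set_integrable_imp_measurable borel_integrable_atLeastAtMost' Pc W0m W0b)
  qed (use Plim Pb[OF W0m W0b] AB in auto)
  define Z where "Z F x = (LINT t:{A..x}|lborel. P F t + c F)" for F x
  have PcC: "continuous_on {A..B} (\<lambda>t. P F t + c F)" if "F \<in> borel_measurable borel" "\<And>x. \<bar>F x\<bar> \<le> C" for F
    by (intro continuous_intros Pc that)
  have Zp: "primitive_on {A..B} (Z F) (\<lambda>t. P F t + c F)" if "F \<in> borel_measurable borel" "\<And>x. \<bar>F x\<bar> \<le> C" for F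
    unfolding Z_def by (intro primitive_on_integral_from borel_integrable_atLeastAtMost' PcC that)
  have ZA: "Z F A = 0" for F
  proof -
    have "(LINT t:{A..A}|lborel. P F t + c F) = (LINT t:{A..A}|lborel. 0)"
      unfolding set_lebesgue_integral_def
    proof (rule integral_cong_AE)
      show "AE x in lborel. indicator {A..A} x *\<^sub>R (P F x + c F) = indicator {A..A} x *\<^sub>R (0::real)"
        using AE_lborel_singleton[of A] by eventually_elim auto
      have "(\<lambda>x. indicator {A..A} x *\<^sub>R (P F x + c F)) = (\<lambda>x. indicator {A} x * (P F A + c F))"
        by (rule ext) (simp add: indicator_def)
      then show "(\<lambda>x. indicator {A..A} x *\<^sub>R (P F x + c F)) \<in> borel_measurable lborel" by simp
    qed simp
    then show ?thesis by (simp add: Z_def)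
  qed
  have ZB: "Z F B = 0" if "F \<in> borel_measurable borel" "\<And>x. \<bar>F x\<bar> \<le> C" for F
  proof -
    have "Z F B = (LINT t:{A..B}|lborel. P F t) + (LINT t:{A..B}|lborel. c F)"
      unfolding Z_def by (intro set_integral_add(2) borel_integrable_atLeastAtMost' Pc that one')
    also have "(LINT t:{A..B}|lborel. c F) = (B - A) * c F"
      using AB by (simp add: set_lebesgue_integral_def)
    finally show ?thesis using AB by (simp add: c_def)
  qed
  have Ze: "elem (Z F) (\<lambda>x. indicator S x * Z F x) (\<lambda>t. P F t + c F)" if "F \<in> borel_measurable borel" "\<And>x. \<bar>F x\<bar> \<le> C" for F
    by (rule elem_C1[OF Zp[OF that] PcC[OF that] ZA ZB[OF that]])
  \<comment> \<open>The weak form of (Z F)'' = (V - \<nu>) F. The boundary terms vanish because the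
    second factor Y is zero at A and B.\<close>
  have parts: "(LINT x:S|lborel. (V x - \<nu>) * F x * Y x) + ip (\<lambda>t. P F t + c F) k = 0"
    if F: "F \<in> borel_measurable borel" "\<And>x. \<bar>F x\<bar> \<le> C" and y: "elem y Y k" for F y Y k
  proof -
    note y' = elemD[OF y]
    have prod: "primitive_on {A..B} (\<lambda>x. (P F x + c F) * Y x) (\<lambda>x. (p F x + 0) * Y x + (indicator S x * k x) * (P F x + c F))"
      by (intro primitive_on_mult primitive_on_add Pp F primitive_on_const primitive_on_mono[OF y'(7)]) auto
    have "(P F B + c F) * Y B - (P F A + c F) * Y A =
        (LINT x:{A..B}|lborel. (p F x + 0) * Y x + (indicator S x * k x) * (P F x + c F))"
      by (rule primitive_onD(2)[OF prod]) (use AB in auto)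
    also have "\<dots> = (LINT x:{A..B}|lborel. indicator S x * ((V x - \<nu>) * F x * Y x + k x * (P F x + c F)))"
      by (simp add: p_def algebra_simps)
    also have "\<dots> = (LINT x:S|lborel. (V x - \<nu>) * F x * Y x + k x * (P F x + c F))"
      by (rule set_integral_Icc_Ioo)
    also have "\<dots> = (LINT x:S|lborel. (V x - \<nu>) * F x * Y x) + (LINT x:S|lborel. k x * (P F x + c F))"
    proof (rule set_integral_add(2))
      obtain CY where CY: "\<And>x. x \<in> {A..B} \<Longrightarrow> \<bar>Y x\<bar> \<le> CY" using continuous_bounded_S[OF y'(10)] by blast
      show "set_integrable lborel S (\<lambda>x. (V x - \<nu>) * F x * Y x)"
      proof (rule set_integrable_subset[where A = "{A..B}", THEN set_integrable_cong[THEN iffD1, rotated -1]])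
        show "set_integrable lborel {A..B} (\<lambda>x. p F x * Y x)"
          by (rule set_integrable_mult_continuous[OF pI'[OF F] continuous_on_subset[OF y'(10)]]) auto
      qed (auto simp: p_def)
      show "set_integrable lborel S (\<lambda>x. k x * (P F x + c F))"
        by (intro L2_mult_integrable y'(3) elemD(3)[OF Ze[OF F]])
    qed
    finally show ?thesis
      using y'(8)[of A] y'(8)[of B] by (simp add: L2_inner_def mult.commute)
  qed
  \<comment> \<open>The derivative of \<open>w n\<close>, the difference between the minimizing
    function \<open>u n\<close> and the function \<open>Z (W0 n)\<close> that would equal it if the
    Euler-Lagrange equation held exactly.\<close>
  define k where "k n t = g n t - (P (W0 n) t + c (W0 n))" for n t
  define w where "w n x = u n x - Z (W0 n) x" for n x
  define Y where "Y n x = W0 n x - indicator S x * Z (W0 n) x" for n x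
  have zn: "elem (Z (W0 n)) (\<lambda>x. indicator S x * Z (W0 n) x) (\<lambda>t. P (W0 n) t + c (W0 n))" for n
    by (rule Ze[OF W0m W0b])
  have we: "elem (w n) (Y n) (k n)" for n
    using elem_add[OF e[of n] elem_cmult[OF zn[of n], of "-1"]]
    by (simp add: w_def[abs_def] Y_def[abs_def] k_def[abs_def] algebra_simps)
  \<comment> \<open>The defect \<open>w n\<close> is used as its own test function: by
    \<open>parts\<close> the potential term cancels against the derivative of
    \<open>Z (W0 n)\<close>, leaving the squared norm of \<open>k n\<close>.\<close>
  have B_eq: "Q (u n) (w n) - \<nu> * ip (u n) (w n) = ip (k n) (k n)" for n
  proof -
    note w' = elemD[OF we]
    have 1: "(LINT x:S|lborel. V x * (W0 n x * Y n x)) - \<nu> * ip (W0 n) (Y n) = (LINT x:S|lborel. (V x - \<nu>) * W0 n x * Y n x)"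
    proof -
      have "(LINT x:S|lborel. (V x - \<nu>) * W0 n x * Y n x) = (LINT x:S|lborel. V x * (W0 n x * Y n x) - \<nu> * (W0 n x * Y n x))"
        by (simp add: algebra_simps)
      also have "\<dots> = (LINT x:S|lborel. V x * (W0 n x * Y n x)) - (LINT x:S|lborel. \<nu> * (W0 n x * Y n x))"
        by (intro set_integral_diff(2) V_mult_integrable_continuous continuous_on_mult e'(10) w'(10)
            set_integrable_mult_right L2_mult_integrable e'(12) w'(12))
      finally show ?thesis by (simp add: L2_inner_def)
    qed
    have "Q (u n) (w n) - \<nu> * ip (u n) (w n) = ip (g n) (k n) + (LINT x:S|lborel. (V x - \<nu>) * W0 n x * Y n x)"
      unfolding Q_eq[OF e we] ip_eq[OF e we] 1[symmetric] by simp
    also have "\<dots> = ip (g n) (k n) - ip (\<lambda>t. P (W0 n) t + c (W0 n)) (k n)"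
      using parts[OF W0m W0b we[of n], of n] by linarith
    also have "\<dots> = ip (k n) (k n)"
      using L2_inner_diff_left[OF e'(3)[of n] elemD(3)[OF zn[of n]] w'(3)[of n]]
      by (simp add: k_def[abs_def])
    finally show ?thesis .
  qed
  \<comment> \<open>The function \<open>w n\<close> need not be orthogonal to the \<psi> i, so it is
    replaced by its projection y, which pairs with \<open>u n\<close> in the same way.
    Cauchy-Schwarz for Q - \<nu> ip, together with \<open>Q_upper\<close>, then bounds the square of
    ip (k n) (k n) by \<delta> n M times the same quantity.\<close>
  have kb: "ip (k n) (k n) \<le> \<delta> n * M" for n
  proof -
    have wH: "w n \<in> H10 S" by (rule elemD(1)[OF we])
    have uH: "u n \<in> H10 S" by (rule e'(1))
    have "\<exists>y\<in>H10 S. (\<forall>i\<in>I. ip y (\<psi> i) = 0) \<and>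
        (\<forall>z\<in>H10 S. (\<forall>i\<in>I. ip z (\<psi> i) = 0) \<longrightarrow> Q y z = Q (w n) z \<and> ip y z = ip (w n) z) \<and>
        Q y y \<le> Q (w n) (w n) \<and> ip y y = ip (w n) (w n) - (\<Sum>i\<in>I. (ip (\<psi> i) (w n))\<^sup>2)"
      by (rule orthogonal_projection[OF fin \<psi>H \<psi>Q on wH])
    then obtain y where y: "y \<in> H10 S" "\<forall>i\<in>I. ip y (\<psi> i) = 0"
        "\<forall>z\<in>H10 S. (\<forall>i\<in>I. ip z (\<psi> i) = 0) \<longrightarrow> Q y z = Q (w n) z \<and> ip y z = ip (w n) z"
        "Q y y \<le> Q (w n) (w n)" "ip y y = ip (w n) (w n) - (\<Sum>i\<in>I. (ip (\<psi> i) (w n))\<^sup>2)"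
      by blast
    note yH = y(1) and yperp = y(2)[rule_format]
    have "Q y (u n) = Q (w n) (u n)" "ip y (u n) = ip (w n) (u n)"
      using y(3) uH perp by auto
    then have h1: "Q (u n) y - \<nu> * ip (u n) y = ip (k n) (k n)"
      using B_eq[of n] Q_commute[OF uH yH] Q_commute[OF uH wH] by (simp add: L2_inner_commute)
    have h2: "(Q (u n) y - \<nu> * ip (u n) y)\<^sup>2 \<le> (Q (u n) (u n) - \<nu> * ip (u n) (u n)) * (Q y y - \<nu> * ip y y)"
    proof (rule nonneg_form_Cauchy_Schwarz[OF uH yH])
      fix t
      show "\<nu> * ip (\<lambda>x. u n x + t * y x) (\<lambda>x. u n x + t * y x) \<le> Q (\<lambda>x. u n x + t * y x) (\<lambda>x. u n x + t * y x)"
      proof (rule low[OF H10_add[OF uH H10_cmult[OF yH]]])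
        fix i assume i: "i \<in> I"
        show "ip (\<lambda>x. u n x + t * y x) (\<psi> i) = 0"
          using L2_inner_add_left[OF H10_L2[OF uH] L2_cmult[OF H10_L2[OF yH]] H10_L2[OF \<psi>H[OF i]]]
            perp[OF i] yperp[OF i] by (simp add: L2_inner_cmult_left)
      qed
    qed (rule low[OF yH yperp])
    have h3: "Q y y \<le> M * ip (k n) (k n)"
      using y(4) Q_upper[OF we, of n] unfolding M_def by linarith
    have "Q (u n) (u n) - \<nu> * ip (u n) (u n) = \<delta> n" using nrm[of n] by (simp add: \<delta>_def)
    with h1 h2 have "(ip (k n) (k n))\<^sup>2 \<le> \<delta> n * (Q y y - \<nu> * ip y y)" by simp
    also have "\<dots> \<le> \<delta> n * (M * ip (k n) (k n) - \<nu> * ip y y)"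
      by (intro mult_left_mono diff_right_mono h3 \<delta>0)
    also have "\<dots> \<le> \<delta> n * (M * ip (k n) (k n))"
      using \<nu>0 L2_inner_nonneg[of S y] \<delta>0[of n] by (intro mult_left_mono) auto
    finally have *: "ip (k n) (k n) * ip (k n) (k n) \<le> (\<delta> n * M) * ip (k n) (k n)"
      by (simp add: power2_eq_square mult.assoc)
    show ?thesis
    proof (cases "ip (k n) (k n) = 0")
      case True
      then show ?thesis using \<delta>0[of n] M0 by simp
    next
      case False
      then have "ip (k n) (k n) > 0" using L2_inner_nonneg[of S "k n"] by linarith
      with * show ?thesis by simp
    qed
  qed
  have Ylim: "(\<lambda>n. Y n x) \<longlonglongrightarrow> 0" for x
  proof -
    have "(\<lambda>n. (Y n x)\<^sup>2) \<longlonglongrightarrow> 0"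
    proof (rule Lim_null_comparison)
      show "(\<lambda>n. (B - A) * (\<delta> n * M)) \<longlonglongrightarrow> 0"
        using tendsto_mult_left[OF tendsto_mult_right[OF \<delta>lim, of M], of "B - A"] by simp
      have "(Y n x)\<^sup>2 \<le> (B - A) * (\<delta> n * M)" for n
        using elem_bound[OF we, of n x] mult_left_mono[OF kb[of n], of "B - A"] AB by linarith
      then show "\<forall>\<^sub>F n in sequentially. norm ((Y n x)\<^sup>2) \<le> (B - A) * (\<delta> n * M)"
        by (intro always_eventually allI) simp
    qed
    then show ?thesis using power_tendsto_0_iff[of 2 "\<lambda>n. Y n x" sequentially] by simp
  qed
  have Zlim: "(\<lambda>n. Z (W0 n) x) \<longlonglongrightarrow> Z U x" if x: "x \<in> {A..B}" for x
    unfolding Z_def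
  proof (rule set_integral_tendsto_bounded(1)[OF one'[of x "D + (\<bar>c U\<bar> + (SUP n. \<bar>c (W0 n)\<bar>))"]])
    have "bdd_above (range (\<lambda>n. \<bar>c (W0 n)\<bar>))"
      using convergent_imp_Bseq[OF convergentI[OF clim]] by (auto simp: Bseq_def intro: bdd_aboveI2)
    then have cs: "\<bar>c (W0 n)\<bar> \<le> (SUP n. \<bar>c (W0 n)\<bar>)" for n by (rule cSUP_upper[OF UNIV_I])
    show "\<bar>P (W0 n) t + c (W0 n)\<bar> \<le> D + (\<bar>c U\<bar> + (SUP n. \<bar>c (W0 n)\<bar>))" if "t \<in> {A..x}" for n t
    proof -
      have "t \<in> {A..B}" using that x by auto
      then have "\<bar>P (W0 n) t\<bar> \<le> D" by (rule Pb[OF W0m W0b])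
      then show ?thesis using cs[of n] by linarith
    qed
    show "set_borel_measurable lborel {A..x} (\<lambda>t. P (W0 n) t + c (W0 n))" for n
      by (intro set_integrable_imp_measurable borel_integrable_atLeastAtMost' continuous_on_subset[OF PcC[OF W0m W0b]])
         (use x in auto)
    show "(\<lambda>n. P (W0 n) t + c (W0 n)) \<longlonglongrightarrow> P U t + c U" if "t \<in> {A..x}" for t
      by (intro tendsto_add Plim clim) (use that x in auto)
  qed
  \<comment> \<open>The defects tend to 0 and Z passes to the pointwise limit, so the limit U solves
    the twice integrated Euler-Lagrange equation exactly.\<close>
  have UZ: "U x = Z U x" if x: "x \<in> S" for x
  proof -
    have "(\<lambda>n. Y n x + Z (W0 n) x) \<longlonglongrightarrow> 0 + Z U x" by (intro tendsto_add Ylim Zlim) (use x in auto)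
    moreover have "Y n x + Z (W0 n) x = W0 n x" for n using x by (simp add: Y_def)
    ultimately show ?thesis using LIMSEQ_unique[OF lim[of x]] by simp
  qed
  have ZE: "elem (Z U) (\<lambda>x. indicator S x * Z U x) (\<lambda>t. P U t + c U)" by (rule Ze[OF Um UC])
  note z' = elemD[OF ZE]
  have QZ: "Q (Z U) y = \<nu> * ip (Z U) y" if "y \<in> H10 S" for y
  proof -
    obtain Y k where y: "elem y Y k" using elem_ex[OF \<open>y \<in> H10 S\<close>] by blast
    note y' = elemD[OF y]
    have "(LINT x:S|lborel. (V x - \<nu>) * U x * Y x) = (LINT x:S|lborel. V x * ((indicator S x * Z U x) * Y x) - \<nu> * ((indicator S x * Z U x) * Y x))"
      by (rule set_lebesgue_integral_cong) (use UZ in \<open>auto simp: algebra_simps\<close>)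
    also have "\<dots> = (LINT x:S|lborel. V x * ((indicator S x * Z U x) * Y x)) - (LINT x:S|lborel. \<nu> * ((indicator S x * Z U x) * Y x))"
      by (intro set_integral_diff(2) V_mult_integrable_continuous continuous_on_mult[OF z'(10) y'(10)]
          set_integrable_mult_right L2_mult_integrable z'(12) y'(12))
    also have "(LINT x:S|lborel. \<nu> * ((indicator S x * Z U x) * Y x)) = \<nu> * ip (Z U) y"
      unfolding ip_eq[OF ZE y] by (simp add: L2_inner_def)
    finally show ?thesis using parts[OF Um UC y] unfolding Q_eq[OF ZE y] by linarith
  qed
  have ZL: "ip (Z U) f = ip U f" for f
    unfolding L2_inner_def by (rule set_lebesgue_integral_cong) (use UZ in auto)
  have ipnrm: "ip (W0 n) (W0 n) = 1" for n using ip_eq[OF e e] nrm by simp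
  have "(\<lambda>n. ip (W0 n) (W0 n)) \<longlonglongrightarrow> ip U U"
    unfolding L2_inner_def
  proof (rule set_integral_tendsto_bounded(1)[OF one[of "C * C"]])
    show "set_borel_measurable lborel S (\<lambda>x. W0 n x * W0 n x)" for n
      by (intro set_borel_measurable_mult set_borel_measurable_if_borel W0m S)
    show "\<bar>W0 n x * W0 n x\<bar> \<le> C * C" for n x
      unfolding abs_mult by (intro mult_mono W0b C0) auto
  qed (intro tendsto_mult lim)
  then have "ip U U = 1" using ipnrm by (simp add: LIMSEQ_const_iff)
  moreover have "ip (Z U) (Z U) = ip U U" by (metis ZL L2_inner_commute)
  ultimately have "ip (Z U) (Z U) = 1" by simp
  moreover have "ip (Z U) (\<psi> i) = 0" if i: "i \<in> I" for i
  proof -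
    have L: "\<psi> i \<in> L2 S" by (rule H10_L2[OF \<psi>H[OF i]])
    have "(\<lambda>n. ip (W0 n) (\<psi> i)) \<longlonglongrightarrow> ip U (\<psi> i)"
      unfolding L2_inner_def
    proof (rule set_integral_tendsto_bounded(1))
      have "set_integrable lborel S (\<lambda>x. \<psi> i x * 1)"
        by (intro L2_mult_integrable L L2_const) (use AB in \<open>auto simp: emeasure_lborel_Ioo\<close>)
      then show "set_integrable lborel S (\<lambda>x. C * \<bar>\<psi> i x\<bar>)" by (auto intro: set_integrable_abs)
      show "set_borel_measurable lborel S (\<lambda>x. W0 n x * \<psi> i x)" for n
        by (intro set_borel_measurable_mult set_borel_measurable_if_borel W0m S L2_measurable L)
      show "\<bar>W0 n x * \<psi> i x\<bar> \<le> C * \<bar>\<psi> i x\<bar>" for n x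
        unfolding abs_mult by (intro mult_right_mono W0b) auto
    qed (intro tendsto_mult lim tendsto_const)
    moreover have "ip (W0 n) (\<psi> i) = 0" for n
    proof -
      have "ip (W0 n) (\<psi> i) = ip (u n) (\<psi> i)"
      proof (rule L2_inner_cong_AE)
        show "AE x in lborel. x \<in> S \<longrightarrow> W0 n x = u n x"
          using e'(9)[of n] by eventually_elim auto
      qed (use e' L in auto)
      then show ?thesis using perp[OF i] by simp
    qed
    ultimately show ?thesis unfolding ZL by (simp add: LIMSEQ_const_iff)
  qed
  ultimately show ?thesis using that[of "Z U"] z'(1) QZ by blast
qed

text \<open>If a Rayleigh quotient on the complement of the first j - 1 eigenfunctions were below
  \<open>ev j\<close>, so would be the infimum \<nu>, and the direct method would yield a normalized
  eigenfunction Z for \<nu>. It would be orthogonal to the whole list, contradicting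
  exhaustiveness.\<close>

lemma min_max:
  assumes E: "eigen_enumeration S (form_operator S (H10 S) Q) ev \<psi>" and j: "j \<ge> 1"
    and u: "u \<in> H10 S" and perp: "\<And>i. i \<in> {1..<j} \<Longrightarrow> ip u (\<psi> i) = 0"
  shows "ev j * ip u u \<le> Q u u"
proof (rule ccontr)
  assume neg: "\<not> ev j * ip u u \<le> Q u u"
  define T where "T = {w \<in> H10 S. (\<forall>i\<in>{1..<j}. ip w (\<psi> i) = 0) \<and> ip w w = 1}"
  define \<nu> where "\<nu> = Inf ((\<lambda>w. Q w w) ` T)"
  note d = eigen_enumerationD[OF E]
  have on: "ip (\<psi> i) (\<psi> k) = (if i = k then 1 else 0)" if "i \<ge> 1" "k \<ge> 1" for i k
    using E that unfolding eigen_enumeration_def by blast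
  have mono: "ev i \<le> ev k" if "i \<ge> 1" "k \<ge> i" for i k
    using E that unfolding eigen_enumeration_def by blast
  have scale: "Q w w / ip w w \<in> (\<lambda>w. Q w w) ` T"
    if w: "w \<in> H10 S" "\<And>i. i \<in> {1..<j} \<Longrightarrow> ip w (\<psi> i) = 0" "ip w w > 0" for w
  proof -
    define c where "c = 1 / sqrt (ip w w)"
    have c: "c * (c * ip w w) = 1" "c * c = 1 / ip w w" using w(3) by (simp_all add: c_def)
    have cw: "(\<lambda>x. c * w x) \<in> H10 S" by (rule H10_cmult[OF w(1)])
    have "ip (\<lambda>x. c * w x) (\<lambda>x. c * w x) = c * (c * ip w w)"
      unfolding L2_inner_cmult_left by (subst L2_inner_commute) (simp add: L2_inner_cmult_left)
    moreover have "Q (\<lambda>x. c * w x) (\<lambda>x. c * w x) = c * (c * Q w w)"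
      unfolding Q_cmult_left[OF w(1) cw] Q_commute[OF w(1) cw] Q_cmult_left[OF w(1) w(1)] ..
    ultimately have "Q w w / ip w w = Q (\<lambda>x. c * w x) (\<lambda>x. c * w x)" "(\<lambda>x. c * w x) \<in> T"
      using cw w(2) c by (simp_all add: T_def L2_inner_cmult_left mult.assoc[symmetric])
    then show ?thesis by (rule image_eqI[where f = "\<lambda>w. Q w w" and x = "\<lambda>x. c * w x"])
  qed
  have bdd: "bdd_below ((\<lambda>w. Q w w) ` T)"
    using Q_nonneg by (intro bdd_belowI[of _ 0]) (auto simp: T_def)
  have upos: "ip u u > 0"
    using L2_inner_nonneg[of S u] neg Q_nonneg[OF u] by (cases "ip u u = 0") auto
  note su = scale[OF u perp upos]
  have ne: "(\<lambda>w. Q w w) ` T \<noteq> {}" using su by blast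
  have \<nu>0: "0 \<le> \<nu>"
    unfolding \<nu>_def by (rule cInf_greatest[OF ne]) (use Q_nonneg in \<open>auto simp: T_def\<close>)
  have "\<nu> \<le> Q u u / ip u u"
    unfolding \<nu>_def
    by (rule cInf_lower[OF su bdd])
  then have \<nu>j: "\<nu> < ev j"
    using neg upos by (simp add: field_simps) (smt (verit) mult.commute pos_divide_less_eq)
  obtain Z where Z: "Z \<in> H10 S" "\<And>i. i \<in> {1..<j} \<Longrightarrow> ip Z (\<psi> i) = 0" "ip Z Z = 1"
    "\<And>w. w \<in> H10 S \<Longrightarrow> Q Z w = \<nu> * ip Z w"
  proof (rule minimizer_exists[where I = "{1..<j}" and \<psi> = \<psi> and ev = ev and \<nu> = \<nu>])
    show "\<nu> * ip w w \<le> Q w w" if w: "w \<in> H10 S" "\<And>i. i \<in> {1..<j} \<Longrightarrow> ip w (\<psi> i) = 0" for w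
    proof (cases "ip w w = 0")
      case True
      then show ?thesis using Q_nonneg[OF w(1)] by simp
    next
      case False
      then have pos: "ip w w > 0" using L2_inner_nonneg[of S w] by linarith
      have "Q w w / ip w w \<in> (\<lambda>w. Q w w) ` T" 
        by (rule scale[OF w pos])
      then have "\<nu> \<le> Q w w / ip w w" unfolding \<nu>_def by (rule cInf_lower[OF _ bdd])
      then show ?thesis using pos by (simp add: field_simps)
    qed
    show "\<exists>w\<in>H10 S. (\<forall>i\<in>{1..<j}. ip w (\<psi> i) = 0) \<and> ip w w = 1 \<and> Q w w < \<nu> + e" if "e > 0" for e
    proof -
      have "\<nu> < \<nu> + e" using that by simp
      then obtain y where "y \<in> (\<lambda>w. Q w w) ` T" "y < \<nu> + e"
        unfolding \<nu>_def using cInf_lessD[OF ne] by blast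
      then show ?thesis unfolding T_def by blast
    qed
  qed (use d on \<nu>0 in auto)
  \<comment> \<open>For i < j by construction of Z; for i at least j because symmetry of Q makes
    eigenfunctions for the different eigenvalues \<nu> < ev j \<le> ev i orthogonal.\<close>
  have "ip (\<psi> i) Z = 0" if i: "i \<ge> 1" for i
  proof (cases "i < j")
    case True
    then show ?thesis using Z(2)[of i] i by (simp add: L2_inner_commute)
  next
    case False
    have "ev i * ip (\<psi> i) Z = \<nu> * ip (\<psi> i) Z"
      using d(2)[OF i Z(1)] Z(4)[OF d(1)[OF i]] Q_commute[OF Z(1) d(1)[OF i]] by (simp add: L2_inner_commute)
    moreover have "\<nu> < ev i" using \<nu>j mono[OF j, of i] False by linarith
    ultimately show ?thesis by simp
  qed
  moreover have "form_operator S (H10 S) Q Z (\<lambda>x. \<nu> * Z x)"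
    unfolding form_operator_def using Z(1,4) L2_cmult[OF H10_L2[OF Z(1)]] by (simp add: L2_inner_cmult_left)
  ultimately have "L2_norm S Z = 0"
    using E unfolding eigen_enumeration_def by blast
  then show False using Z(3) L2_norm_square[of S Z] by simp
qed

text \<open>The form of the principle that suits trial functions which are only nearly orthogonal to
  the lower eigenfunctions: the failure of orthogonality is charged to the norm on the left, while
  projecting does not raise the energy.\<close>

lemma min_max_projected:
  assumes E: "eigen_enumeration S (form_operator S (H10 S) Q) ev \<psi>" and j: "j \<ge> 1" and w: "w \<in> H10 S"
  shows "ev j * (ip w w - (\<Sum>i\<in>{1..<j}. (ip (\<psi> i) w)\<^sup>2)) \<le> Q w w"
proof -
  note d = eigen_enumerationD[OF E]
  have on: "ip (\<psi> i) (\<psi> k) = (if i = k then 1 else 0)" if "i \<in> {1..<j}" "k \<in> {1..<j}" for i k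
    using E that unfolding eigen_enumeration_def by auto
  have \<psi>H: "\<psi> i \<in> H10 S" and \<psi>Q: "z \<in> H10 S \<Longrightarrow> Q (\<psi> i) z = ev i * ip (\<psi> i) z" if "i \<in> {1..<j}" for i z
    using d(1,2)[of i] that by auto
  have "\<exists>y\<in>H10 S. (\<forall>i\<in>{1..<j}. ip y (\<psi> i) = 0) \<and>
        (\<forall>z\<in>H10 S. (\<forall>i\<in>{1..<j}. ip z (\<psi> i) = 0) \<longrightarrow> Q y z = Q w z \<and> ip y z = ip w z) \<and>
        Q y y \<le> Q w w \<and> ip y y = ip w w - (\<Sum>i\<in>{1..<j}. (ip (\<psi> i) w)\<^sup>2)"
      by (rule orthogonal_projection[OF finite_atLeastLessThan \<psi>H \<psi>Q on w])
    then obtain y where y: "y \<in> H10 S" "\<forall>i\<in>{1..<j}. ip y (\<psi> i) = 0"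
        "\<forall>z\<in>H10 S. (\<forall>i\<in>{1..<j}. ip z (\<psi> i) = 0) \<longrightarrow> Q y z = Q w z \<and> ip y z = ip w z"
        "Q y y \<le> Q w w" "ip y y = ip w w - (\<Sum>i\<in>{1..<j}. (ip (\<psi> i) w)\<^sup>2)"
      by blast
  show ?thesis using min_max[OF E j y(1) y(2)[rule_format]] y(4,5) by simp
qed

end

section \<open>Schroedinger operators on the line\<close>

locale schroedinger_line =
  fixes q :: "real \<Rightarrow> real"
  assumes q_cont: "continuous_on UNIV q" and q_nonneg: "\<And>x. 0 \<le> q x"
begin

abbreviation "fdom \<equiv> {u \<in> H1 UNIV. set_integrable lborel UNIV (\<lambda>x. q x * (u x)\<^sup>2)}"
abbreviation "QL \<equiv> schroedinger_form UNIV q"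
abbreviation "ipl \<equiv> L2_inner UNIV"

definition finite_energy :: "(real \<Rightarrow> real) \<Rightarrow> (real \<Rightarrow> real) \<Rightarrow> bool" where
  "finite_energy U g \<longleftrightarrow> primitive_on UNIV U g \<and> U \<in> L2 UNIV \<and> g \<in> L2 UNIV \<and>
     integrable lborel (\<lambda>x. q x * (U x * U x))"

text \<open>The eigenvalue equation as a first order system U' = H, H' = (q - \<mu>) U with finite
  energy. Up to null sets this is the same as being an eigenfunction of the form operator, by
  \<open>eigenfunction_solution\<close> and \<open>solution_eigenfunction\<close>.\<close>

definition solution :: "real \<Rightarrow> (real \<Rightarrow> real) \<Rightarrow> (real \<Rightarrow> real) \<Rightarrow> bool" where
  "solution \<mu> U H \<longleftrightarrow> finite_energy U H \<and> primitive_on UNIV H (\<lambda>x. (q x - \<mu>) * U x)"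

lemma q_measurable [measurable]: "q \<in> borel_measurable borel"
  by (rule borel_measurable_continuous_onI[OF q_cont])

lemma L2_UNIV_measurable: "u \<in> L2 UNIV \<Longrightarrow> u \<in> borel_measurable borel"
  by (auto dest: L2_measurable simp: set_borel_measurable_def)

lemma L2_UNIV_integrable_mult: "u \<in> L2 UNIV \<Longrightarrow> w \<in> L2 UNIV \<Longrightarrow> integrable lborel (\<lambda>x. u x * w x)"
  using L2_mult_integrable[of u UNIV w] by (simp add: set_integrable_def)

lemma ipl_eq: "ipl u w = (LINT x|lborel. u x * w x)"
  by (simp add: L2_inner_def set_lebesgue_integral_def)

lemma finite_energyD:
  assumes "finite_energy U g"
  shows "primitive_on UNIV U g" "U \<in> L2 UNIV" "g \<in> L2 UNIV" "integrable lborel (\<lambda>x. q x * (U x * U x))"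
    "U \<in> borel_measurable borel" "g \<in> borel_measurable borel" "continuous_on UNIV U"
  using assms L2_UNIV_measurable primitive_on_continuous_UNIV unfolding finite_energy_def by blast+

lemma solutionD:
  assumes "solution \<mu> U H"
  shows "finite_energy U H" "primitive_on UNIV H (\<lambda>x. (q x - \<mu>) * U x)" "continuous_on UNIV H"
  using assms primitive_on_continuous_UNIV unfolding solution_def by blast+

lemma q_mult_integrable:
  assumes U: "finite_energy U g" and W: "finite_energy W k"
  shows "integrable lborel (\<lambda>x. q x * (U x * W x))"
proof (rule Bochner_Integration.integrable_bound)
  show "integrable lborel (\<lambda>x. q x * (U x * U x) + q x * (W x * W x))"
    by (intro Bochner_Integration.integrable_add finite_energyD(4)[OF U] finite_energyD(4)[OF W])
  show "(\<lambda>x. q x * (U x * W x)) \<in> borel_measurable lborel"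
    using finite_energyD(5)[OF U] finite_energyD(5)[OF W] by measurable
  have "\<bar>s * t\<bar> \<le> s * s + t * t" for s t :: real
  proof -
    have "0 \<le> (\<bar>s\<bar> - \<bar>t\<bar>)\<^sup>2" by simp
    then have "2 * (\<bar>s\<bar> * \<bar>t\<bar>) \<le> s * s + t * t" by (simp add: power2_diff) (simp add: power2_eq_square)
    moreover have "0 \<le> \<bar>s\<bar> * \<bar>t\<bar>" by simp
    ultimately show ?thesis unfolding abs_mult by linarith
  qed
  then have "q x * \<bar>U x * W x\<bar> \<le> q x * (U x * U x + W x * W x)" for x
    by (intro mult_left_mono q_nonneg)
  then show "AE x in lborel. norm (q x * (U x * W x)) \<le> norm (q x * (U x * U x) + q x * (W x * W x))"
    using q_nonneg by (intro AE_I2) (simp add: abs_mult distrib_left)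
qed

section \<open>Eigenfunctions on the line as solutions of the differential equation\<close>

lemma dom_finite_energy:
  assumes "u \<in> fdom"
  obtains U where "finite_energy U (weak_deriv UNIV u)" "AE x in lborel. u x = U x"
proof -
  have u: "u \<in> L2 UNIV" "weak_deriv UNIV u \<in> L2 UNIV" "has_weak_deriv UNIV u (weak_deriv UNIV u)"
    using H1_weak_deriv[of u UNIV] assms by auto
  obtain U where U: "primitive_on UNIV U (weak_deriv UNIV u)" "AE x in lborel. x \<in> UNIV \<longrightarrow> u x = U x"
    by (rule weak_deriv_primitive[OF u(3) L2_loc_integrable[OF u(1)] L2_loc_integrable[OF u(2)]]) auto
  have ae: "AE x in lborel. u x = U x" using U(2) by simp
  have Um: "U \<in> borel_measurable borel"
    by (rule borel_measurable_continuous_onI[OF primitive_on_continuous_UNIV[OF U(1)]])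
  have UL: "U \<in> L2 UNIV"
    by (rule L2_cong_AE[OF u(1) set_borel_measurable_if_borel[OF Um] U(2)]) simp
  have [measurable]: "u \<in> borel_measurable borel" "U \<in> borel_measurable borel"
    using L2_UNIV_measurable[OF u(1)] Um by auto
  have "integrable lborel (\<lambda>x. q x * (u x)\<^sup>2)" using assms by (simp add: set_integrable_def)
  moreover have "integrable lborel (\<lambda>x. q x * (u x)\<^sup>2) \<longleftrightarrow> integrable lborel (\<lambda>x. q x * (U x * U x))"
  proof (rule integrable_cong_AE)
    show "AE x in lborel. q x * (u x)\<^sup>2 = q x * (U x * U x)"
      using ae by eventually_elim (simp add: power2_eq_square)
  qed auto
  ultimately have "finite_energy U (weak_deriv UNIV u)" using U(1) UL u(2) by (simp add: finite_energy_def)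
  then show ?thesis using that ae by blast
qed

lemma finite_energy_dom:
  assumes U: "finite_energy U g"
  shows "U \<in> fdom" "AE x in lborel. weak_deriv UNIV U x = g x"
proof -
  note U' = finite_energyD[OF U]
  have "has_weak_deriv UNIV U g" by (rule primitive_on_weak_deriv[OF U'(1)]) auto
  note w = weak_deriv_AE_eq[OF U'(2,3) this]
  show "U \<in> fdom" using w(1) U'(4) by (simp add: set_integrable_def power2_eq_square)
  show "AE x in lborel. weak_deriv UNIV U x = g x" using w(4) by simp
qed

lemma QL_eq:
  assumes U: "finite_energy U g" "AE x in lborel. u x = U x" "AE x in lborel. weak_deriv UNIV u x = g x"
    "u \<in> fdom"
    and W: "finite_energy W k" "AE x in lborel. w x = W x" "AE x in lborel. weak_deriv UNIV w x = k x"
    "w \<in> fdom"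
  shows "QL u w = ipl g k + (LINT x|lborel. q x * (U x * W x))"
proof -
  have [measurable]: "u \<in> borel_measurable borel" "w \<in> borel_measurable borel"
    "weak_deriv UNIV u \<in> borel_measurable borel" "weak_deriv UNIV w \<in> borel_measurable borel"
    using H1_weak_deriv[of u UNIV] H1_weak_deriv[of w UNIV] U(4) W(4) L2_UNIV_measurable by auto
  note [measurable] = finite_energyD(5,6)[OF U(1)] finite_energyD(5,6)[OF W(1)]
  have "QL u w = (LINT x|lborel. weak_deriv UNIV u x * weak_deriv UNIV w x + q x * u x * w x)"
    by (simp add: schroedinger_form_def set_lebesgue_integral_def)
  also have "\<dots> = (LINT x|lborel. g x * k x + q x * (U x * W x))"
  proof (rule integral_cong_AE)
    show "AE x in lborel. weak_deriv UNIV u x * weak_deriv UNIV w x + q x * u x * w x = g x * k x + q x * (U x * W x)"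
      using U(2,3) W(2,3) by eventually_elim simp
  qed auto
  also have "\<dots> = ipl g k + (LINT x|lborel. q x * (U x * W x))"
    unfolding ipl_eq
    by (intro Bochner_Integration.integral_add L2_UNIV_integrable_mult q_mult_integrable[OF U(1) W(1)] finite_energyD(3)[OF U(1)] finite_energyD(3)[OF W(1)])
  finally show ?thesis .
qed

lemma test_functions_finite_energy:
  assumes \<phi>: "\<phi> \<in> test_functions UNIV"
  shows "finite_energy \<phi> (deriv \<phi>)"
proof -
  have "set_integrable lborel UNIV (\<lambda>x. (q x * \<phi> x) * \<phi> x)"
    by (intro test_mult_integrable \<phi> loc_integrable_continuous continuous_on_mult continuous_on_subset[OF q_cont]
        smooth_continuous[OF test_functions_smooth[OF \<phi>]]) auto
  then show ?thesis
    unfolding finite_energy_def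
    using test_functions_L2[OF \<phi>] test_functions_L2[OF test_functions_deriv[OF \<phi>]]
      primitive_on_DERIV[OF smooth_has_derivative[OF test_functions_smooth[OF \<phi>]] smooth_continuous[OF smooth_deriv[OF test_functions_smooth[OF \<phi>]]], of UNIV]
    by (simp add: set_integrable_def mult.assoc)
qed

lemma eigenfunction_solution:
  assumes op: "form_operator UNIV fdom QL u (\<lambda>x. \<mu> * u x)"
  obtains U H where "solution \<mu> U H" "AE x in lborel. u x = U x"
proof -
  have u: "u \<in> fdom" using op unfolding form_operator_def by blast
  obtain U where U0: "finite_energy U (weak_deriv UNIV u)" and uU: "AE x in lborel. u x = U x"
    by (rule dom_finite_energy[OF u], rule that)
  define g where "g = weak_deriv UNIV u"
  have U: "finite_energy U g" using U0 by (simp add: g_def)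
  note U' = finite_energyD[OF U]
  have c: "continuous_on UNIV (\<lambda>x. (q x - \<mu>) * U x)" by (intro continuous_intros q_cont U')
  have floc: "loc_integrable UNIV (\<lambda>x. (q x - \<mu>) * U x)"
    by (intro loc_integrable_continuous continuous_on_subset[OF c]) auto
  have "has_weak_deriv UNIV g (\<lambda>x. (q x - \<mu>) * U x)"
    unfolding has_weak_deriv_def
  proof
    fix \<phi> assume \<phi>: "\<phi> \<in> test_functions UNIV"
    have f: "finite_energy \<phi> (deriv \<phi>)" by (rule test_functions_finite_energy[OF \<phi>])
    note f' = finite_energyD[OF f] and fd = finite_energy_dom[OF f]
    have "QL u \<phi> = ipl (\<lambda>x. \<mu> * u x) \<phi>" using op fd(1) unfolding form_operator_def by blast
    moreover have "QL u \<phi> = ipl g (deriv \<phi>) + (LINT x|lborel. q x * (U x * \<phi> x))"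
      by (rule QL_eq[OF U uU _ u f _ fd(2,1)]) (simp_all add: g_def)
    moreover have "ipl u \<phi> = ipl U \<phi>"
      by (rule L2_inner_cong_AE) (use u H1_weak_deriv[of u UNIV] U' f' uU in auto)
    ultimately have 1: "ipl g (deriv \<phi>) + (LINT x|lborel. q x * (U x * \<phi> x)) = \<mu> * (LINT x|lborel. U x * \<phi> x)"
      by (simp add: L2_inner_cmult_left ipl_eq)
    have "(LINT x|lborel. (q x - \<mu>) * U x * \<phi> x) = (LINT x|lborel. q x * (U x * \<phi> x) - \<mu> * (U x * \<phi> x))"
      by (simp add: algebra_simps)
    also have "\<dots> = (LINT x|lborel. q x * (U x * \<phi> x)) - (LINT x|lborel. \<mu> * (U x * \<phi> x))"
      by (intro Bochner_Integration.integral_diff q_mult_integrable[OF U f] integrable_mult_right L2_UNIV_integrable_mult U' f')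
    finally show "(LINT x:UNIV|lborel. g x * deriv \<phi> x) = - (LINT x:UNIV|lborel. (q x - \<mu>) * U x * \<phi> x)"
      using 1 by (simp add: ipl_eq set_lebesgue_integral_def)
  qed
  then obtain H where H: "primitive_on UNIV H (\<lambda>x. (q x - \<mu>) * U x)" "AE x in lborel. x \<in> UNIV \<longrightarrow> g x = H x"
    using weak_deriv_primitive[OF _ L2_loc_integrable[OF U'(3)] floc open_UNIV is_interval_univ UNIV_not_empty] by blast
  have Hm: "set_borel_measurable lborel UNIV H"
    by (intro set_borel_measurable_if_borel borel_measurable_continuous_onI primitive_on_continuous_UNIV[OF H(1)]) simp
  have "H \<in> L2 UNIV" by (rule L2_cong_AE[OF U'(3) Hm H(2)])
  moreover have "primitive_on UNIV U H"
    by (rule primitive_on_cong_AE[OF U'(1) is_interval_univ _ Hm H(2)]) simp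
  ultimately have "solution \<mu> U H" using U'(2,4) H(1) by (simp add: solution_def finite_energy_def)
  then show ?thesis using that uU by blast
qed

lemma L2_UNIV_mult_continuous_integrable:
  assumes "finite_energy U g" "finite_energy W k"
  shows "integrable lborel (\<lambda>x. (q x - \<mu>) * U x * W x)"
proof -
  have "integrable lborel (\<lambda>x. q x * (U x * W x) - \<mu> * (U x * W x))"
    by (intro Bochner_Integration.integrable_diff q_mult_integrable[OF assms] integrable_mult_right
        L2_UNIV_integrable_mult finite_energyD(2)[OF assms(1)] finite_energyD(2)[OF assms(2)])
  then show ?thesis by (simp add: algebra_simps)
qed

text \<open>The product H W and its derivative are both integrable, so the derivative integrates to
  0 and nothing is left over at infinity. Allowing every W of finite energy, instead of compactly
  supported ones only, avoids a density argument for the form domain.\<close>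

lemma solution_weak_form:
  assumes U: "solution \<mu> U H" and W: "finite_energy W k"
  shows "ipl H k + (LINT x|lborel. q x * (U x * W x)) = \<mu> * ipl U W"
proof -
  note U' = solutionD[OF U] and W' = finite_energyD[OF W]
  note E = finite_energyD[OF U'(1)]
  have p: "primitive_on UNIV (\<lambda>x. H x * W x) (\<lambda>x. (q x - \<mu>) * U x * W x + k x * H x)"
    by (rule primitive_on_mult[OF U'(2) W'(1)]) simp
  have i: "integrable lborel (\<lambda>x. (q x - \<mu>) * U x * W x)" "integrable lborel (\<lambda>x. k x * H x)"
    by (intro L2_UNIV_mult_continuous_integrable[OF U'(1) W] L2_UNIV_integrable_mult W' E)+
  have "(LINT x|lborel. (q x - \<mu>) * U x * W x + k x * H x) = 0"
    by (rule integral_eq_0_if_primitive_integrable[OF p]) (intro L2_UNIV_integrable_mult E W' Bochner_Integration.integrable_add i)+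
  then have "(LINT x|lborel. (q x - \<mu>) * U x * W x) + ipl H k = 0"
    using i by (simp add: ipl_eq mult.commute)
  moreover have "(LINT x|lborel. (q x - \<mu>) * U x * W x) = (LINT x|lborel. q x * (U x * W x) - \<mu> * (U x * W x))"
    by (simp add: algebra_simps)
  moreover have "\<dots> = (LINT x|lborel. q x * (U x * W x)) - (LINT x|lborel. \<mu> * (U x * W x))"
    by (intro Bochner_Integration.integral_diff q_mult_integrable[OF U'(1) W] integrable_mult_right L2_UNIV_integrable_mult E W')
  ultimately show ?thesis by (simp add: ipl_eq)
qed

lemma solution_eigenfunction:
  assumes U: "solution \<mu> U H"
  shows "form_operator UNIV fdom QL U (\<lambda>x. \<mu> * U x)"
  unfolding form_operator_def
proof (intro conjI ballI)
  note U' = solutionD[OF U]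
  note E = finite_energyD[OF U'(1)] and D = finite_energy_dom[OF U'(1)]
  show "U \<in> fdom" by (rule D)
  show "(\<lambda>x. \<mu> * U x) \<in> L2 UNIV" by (rule L2_cmult[OF E(2)])
  fix w assume w: "w \<in> fdom"
  obtain W where W: "finite_energy W (weak_deriv UNIV w)" "AE x in lborel. w x = W x"
    by (rule dom_finite_energy[OF w], rule that)
  have "QL U w = ipl H (weak_deriv UNIV w) + (LINT x|lborel. q x * (U x * W x))"
    by (rule QL_eq[OF U'(1) _ D(2,1) W _ w]) auto
  also have "\<dots> = \<mu> * ipl U W" by (rule solution_weak_form[OF U W(1)])
  also have "ipl U W = ipl U w"
  proof (rule L2_inner_cong_AE)
    show "AE x in lborel. x \<in> UNIV \<longrightarrow> W x = w x" using W(2) by eventually_elim auto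
  qed (use E finite_energyD[OF W(1)] H1_weak_deriv[of w UNIV] w in auto)
  finally show "QL U w = ipl (\<lambda>x. \<mu> * U x) w" by (simp add: L2_inner_cmult_left)
qed

section \<open>Orthogonality and simplicity of eigenvalues on the line\<close>

lemma solutions_orthogonal:
  assumes U: "solution \<mu> U H" and W: "solution \<nu> W K" and ne: "\<mu> \<noteq> \<nu>"
  shows "ipl U W = 0"
proof -
  have "\<mu> * ipl U W = \<nu> * ipl W U"
    using solution_weak_form[OF U solutionD(1)[OF W]] solution_weak_form[OF W solutionD(1)[OF U]]
    by (simp add: ipl_eq ac_simps)
  then show ?thesis using ne by (simp add: ipl_eq mult.commute)
qed

text \<open>A Gronwall argument for E = z^2 + y^2. From 2 |z y| \<le> E follows |E'| \<le> L E on
  [-|x|, |x|]; hence exp (- L t) E decreases to the right of 0 and exp (L t) E increases to the left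
  of it, and E 0 = 0 forces E x \<le> 0.\<close>

lemma ode_zero_unique:
  assumes z: "primitive_on UNIV z y" "primitive_on UNIV y (\<lambda>x. (q x - \<mu>) * z x)" and 0: "z 0 = 0" "y 0 = 0"
  shows "z x = 0"
proof -
  have zc: "continuous_on UNIV z" and yc: "continuous_on UNIV y"
    using z primitive_on_continuous_UNIV by blast+
  have dz: "(z has_real_derivative y t) (at t)" for t
    by (rule primitive_on_has_derivative_UNIV[OF z(1) yc])
  have dy: "(y has_real_derivative (q t - \<mu>) * z t) (at t)" for t
    by (rule primitive_on_has_derivative_UNIV[OF z(2)]) (intro continuous_intros q_cont zc)
  define E where "E t = z t * z t + y t * y t" for t
  define E' where "E' t = 2 * (z t * y t) * (1 + q t - \<mu>)" for t
  have dE: "(E has_real_derivative E' t) (at t)" for t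
    unfolding E_def E'_def
    by (rule derivative_eq_intros dz dy refl)+ (simp add: algebra_simps)
  define R where "R = \<bar>x\<bar>"
  have "continuous_on {-R..R} (\<lambda>t. 1 + q t - \<mu>)"
    by (intro continuous_intros continuous_on_subset[OF q_cont]) auto
  then have "compact ((\<lambda>t. 1 + q t - \<mu>) ` {-R..R})" by (rule compact_continuous_image) simp
  then obtain L where L: "\<And>t. t \<in> {-R..R} \<Longrightarrow> \<bar>1 + q t - \<mu>\<bar> \<le> L"
    by (meson bounded_real compact_imp_bounded imageI)
  have E'b: "\<bar>E' t\<bar> \<le> L * E t" if t: "t \<in> {-R..R}" for t
  proof -
    have "0 \<le> (\<bar>z t\<bar> - \<bar>y t\<bar>)\<^sup>2" by simp
    then have "2 * (\<bar>z t\<bar> * \<bar>y t\<bar>) \<le> E t" by (simp add: E_def power2_diff) (simp add: power2_eq_square)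
    moreover have "0 \<le> L" using L[OF t] by linarith
    ultimately have "(2 * (\<bar>z t\<bar> * \<bar>y t\<bar>)) * \<bar>1 + q t - \<mu>\<bar> \<le> E t * L"
      using L[OF t] by (intro mult_mono) (auto simp: E_def)
    then show ?thesis by (simp add: E'_def abs_mult mult.commute)
  qed
  have E0: "E 0 = 0" using 0 by (simp add: E_def)
  have "E x \<le> 0"
  proof (cases "0 \<le> x")
    case True
    have "exp (- L * x) * E x \<le> exp (- L * 0) * E 0"
    proof (rule DERIV_nonpos_imp_nonincreasing[OF True])
      fix t assume t: "0 \<le> t" "t \<le> x"
      have "((\<lambda>t. exp (- L * t) * E t) has_real_derivative exp (- L * t) * (E' t - L * E t)) (at t)"
        by (rule derivative_eq_intros dE refl)+ (simp add: algebra_simps)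
      moreover have "exp (- L * t) * (E' t - L * E t) \<le> 0"
        using E'b[of t] t by (intro mult_nonneg_nonpos) (auto simp: R_def)
      ultimately show "\<exists>d. ((\<lambda>t. exp (- L * t) * E t) has_real_derivative d) (at t) \<and> d \<le> 0" by blast
    qed
    then show ?thesis using E0 by (simp add: mult_le_0_iff)
  next
    case False
    then have "x \<le> 0" by simp
    have "exp (L * x) * E x \<le> exp (L * 0) * E 0"
    proof (rule DERIV_nonneg_imp_nondecreasing[OF \<open>x \<le> 0\<close>])
      fix t assume t: "x \<le> t" "t \<le> 0"
      have "((\<lambda>t. exp (L * t) * E t) has_real_derivative exp (L * t) * (E' t + L * E t)) (at t)"
        by (rule derivative_eq_intros dE refl)+ (simp add: algebra_simps)
      moreover have "0 \<le> exp (L * t) * (E' t + L * E t)"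
        using E'b[of t] t by (intro mult_nonneg_nonneg) (auto simp: R_def)
      ultimately show "\<exists>d. ((\<lambda>t. exp (L * t) * E t) has_real_derivative d) (at t) \<and> 0 \<le> d" by blast
    qed
    then show ?thesis using E0 by (simp add: mult_le_0_iff)
  qed
  then have "z x * z x \<le> 0" using zero_le_square[of "y x"] unfolding E_def by linarith
  then have "z x * z x = 0" using zero_le_square[of "z x"] by linarith
  then show ?thesis by simp
qed

text \<open>The Wronskian of two solutions for the same \<open>\<mu>\<close> is constant and integrable, hence 0.\<close>

lemma solutions_simple:
  assumes U: "solution \<mu> U H" and W: "solution \<mu> W K" and 1: "ipl U U = 1" "ipl W W = 1"
  shows "\<bar>ipl U W\<bar> = 1"
proof -
  note U' = solutionD[OF U] and W' = solutionD[OF W]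
  note E = finite_energyD[OF U'(1)] and F = finite_energyD[OF W'(1)]
  define w where "w x = H x * W x - K x * U x" for x
  have "primitive_on UNIV w (\<lambda>x. ((q x - \<mu>) * U x * W x + K x * H x) - ((q x - \<mu>) * W x * U x + H x * K x))"
    unfolding w_def by (intro primitive_on_diff primitive_on_mult U' W' E F) auto
  then have wp: "primitive_on UNIV w (\<lambda>x. 0)" by (simp add: algebra_simps)
  have wi: "integrable lborel w"
    unfolding w_def by (intro Bochner_Integration.integrable_diff L2_UNIV_integrable_mult E F)
  have wc: "w x = w 0" for x
    using primitive_onD(2)[OF wp, of 0 x] primitive_onD(2)[OF wp, of x 0] by (cases "0 \<le> x") auto
  have w0: "w 0 = 0"
  proof (rule ccontr)
    assume "w 0 \<noteq> 0"
    have "integrable lborel (\<lambda>x::real. w 0)" using wi wc by (metis (no_types, lifting) Bochner_Integration.integrable_cong)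
    then have "(\<integral>\<^sup>+x. ennreal \<bar>w 0\<bar> \<partial>(lborel :: real measure)) < \<infinity>" by (simp only: integrable_iff_bounded real_norm_def)
    then show False using \<open>w 0 \<noteq> 0\<close> by (simp add: ennreal_mult_top)
  qed
  \<comment> \<open>The Wronskian vanishes at 0, so the initial data (U 0, H 0) and (W 0, K 0) are
    linearly dependent; the cases exhibit a nontrivial relation. By uniqueness for the initial value
    problem it then holds on the whole line.\<close>
  have "\<exists>\<alpha> \<beta>. (\<alpha> \<noteq> 0 \<or> \<beta> \<noteq> 0) \<and> \<alpha> * U 0 + \<beta> * W 0 = 0 \<and> \<alpha> * H 0 + \<beta> * K 0 = 0"
  proof (cases "U 0 = 0 \<and> H 0 = 0")
    case True
    then show ?thesis by (intro exI[of _ 1] exI[of _ 0]) simp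
  next
    case False
    show ?thesis
    proof (cases "U 0 = 0")
      case True
      then have "W 0 = 0" using False w0 by (simp add: w_def)
      then show ?thesis using True False by (intro exI[of _ "K 0"] exI[of _ "- H 0"]) simp
    next
      case ne: False
      then show ?thesis using w0 by (intro exI[of _ "W 0"] exI[of _ "- U 0"]) (simp add: w_def mult.commute)
    qed
  qed
  then obtain \<alpha> \<beta> where ab: "\<alpha> \<noteq> 0 \<or> \<beta> \<noteq> 0" "\<alpha> * U 0 + \<beta> * W 0 = 0" "\<alpha> * H 0 + \<beta> * K 0 = 0"
    by blast
  have z0: "\<alpha> * U x + \<beta> * W x = 0" for x
  proof (rule ode_zero_unique[where z = "\<lambda>x. \<alpha> * U x + \<beta> * W x" and y = "\<lambda>x. \<alpha> * H x + \<beta> * K x" and \<mu> = \<mu>])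
    show "primitive_on UNIV (\<lambda>x. \<alpha> * U x + \<beta> * W x) (\<lambda>x. \<alpha> * H x + \<beta> * K x)"
      by (intro primitive_on_add primitive_on_cmult E F)
    have "primitive_on UNIV (\<lambda>x. \<alpha> * H x + \<beta> * K x) (\<lambda>x. \<alpha> * ((q x - \<mu>) * U x) + \<beta> * ((q x - \<mu>) * W x))"
      by (intro primitive_on_add primitive_on_cmult U' W')
    then show "primitive_on UNIV (\<lambda>x. \<alpha> * H x + \<beta> * K x) (\<lambda>x. (q x - \<mu>) * (\<alpha> * U x + \<beta> * W x))"
      by (simp add: algebra_simps)
  qed (use ab in auto)
  have lin: "\<alpha> * ipl U f + \<beta> * ipl W f = 0" if f: "f \<in> L2 UNIV" for f
  proof -
    have "ipl (\<lambda>x. \<alpha> * U x + \<beta> * W x) f = \<alpha> * ipl U f + \<beta> * ipl W f"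
      using L2_inner_add_left[OF L2_cmult[OF E(2)] L2_cmult[OF F(2)] f] by (simp add: L2_inner_cmult_left)
    then show ?thesis unfolding z0 by (simp add: ipl_eq)
  qed
  define c where "c = ipl U W"
  \<comment> \<open>The relation paired with U and with W. Since (\<alpha>, \<beta>) is nonzero, the
    determinant 1 - c^2 of this system must vanish.\<close>
  have "\<alpha> + \<beta> * c = 0" "\<alpha> * c + \<beta> = 0"
    using lin[OF E(2)] lin[OF F(2)] 1 by (simp_all add: c_def ipl_eq mult.commute)
  then have "\<alpha> * (1 - c * c) = 0" "\<beta> * (1 - c * c) = 0" by algebra+
  then have "c * c = 1" using ab(1) by auto
  then have "\<bar>c\<bar>\<^sup>2 = 1\<^sup>2" by (simp add: power2_eq_square)
  then have "\<bar>c\<bar> = 1" by (simp add: power2_eq_1_iff abs_if split: if_splits)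
  then show ?thesis by (simp add: c_def)
qed

text \<open>The cut-off solutions are C^1 with compact support, and so become admissible on the
  interval after compression. The derivative of the cut-off is of order 1 / R, hence the energy
  tends to that of the solution, which \<open>solution_weak_form\<close> identifies as \<mu> times
  the squared norm.\<close>

lemma solution_cutoff_limits:
  assumes U: "solution \<mu> U H"
  defines "w n x \<equiv> cutoff (real (Suc n)) x * U x"
    and "k n x \<equiv> cutoff_deriv (real (Suc n)) x * U x + cutoff (real (Suc n)) x * H x"
  shows "primitive_on UNIV (w n) (k n)" "continuous_on UNIV (k n)" "continuous_on UNIV (w n)"
    and "(\<lambda>n. (LINT x|lborel. k n x * k n x) + (LINT x|lborel. q x * (w n x * w n x))) \<longlonglongrightarrow> \<mu> * ipl U U"
    and "(\<lambda>n. LINT x|lborel. (w n x - U x) * (w n x - U x)) \<longlonglongrightarrow> 0"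
proof -
  note U' = solutionD[OF U]
  note E = finite_energyD[OF U'(1)]
  have pos: "real (Suc n) > 0" for n by simp
  note cc = continuous_on_cutoff[OF pos]
  show p: "primitive_on UNIV (w n) (k n)" for n
  proof -
    have "primitive_on UNIV (\<lambda>x. cutoff (real (Suc n)) x * U x)
       (\<lambda>x. cutoff_deriv (real (Suc n)) x * U x + H x * cutoff (real (Suc n)) x)"
      by (rule primitive_on_mult[OF primitive_cutoff[OF pos] E(1)]) simp
    then show ?thesis unfolding w_def[abs_def] k_def[abs_def] by (simp add: mult.commute)
  qed
  show kc: "continuous_on UNIV (k n)" for n
    unfolding k_def[abs_def] by (intro continuous_intros cc E U')
  show wc: "continuous_on UNIV (w n)" for n
    unfolding w_def[abs_def] by (intro continuous_intros cc E)
  have [measurable]: "k n \<in> borel_measurable borel" "w n \<in> borel_measurable borel" for n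
    by (intro borel_measurable_continuous_onI kc wc)+
  note [measurable] = E(5,6)
  have wb: "\<bar>w n x\<bar> \<le> \<bar>U x\<bar>" for n x
    using cutoff_bounds(1,2)[OF pos, of n x] by (simp add: w_def abs_mult mult_left_le_one_le)
  \<comment> \<open>The radius is at least 1, so the derivative of the cut-off is at most 4; then (4
    |U| + |H|)^2 \<le> 32 U^2 + 2 H^2 gives a dominating function independent of n.\<close>
  have kb: "k n x * k n x \<le> 32 * (U x * U x) + 2 * (H x * H x)" for n x
  proof -
    have "\<bar>cutoff_deriv (real (Suc n)) x\<bar> \<le> 4 / real (Suc n)" by (rule cutoff_bounds(3)[OF pos])
    also have "\<dots> \<le> 4" by (simp add: field_simps)
    finally have "\<bar>cutoff_deriv (real (Suc n)) x * U x\<bar> \<le> 4 * \<bar>U x\<bar>"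
      by (simp add: abs_mult mult_right_mono)
    moreover have "\<bar>cutoff (real (Suc n)) x * H x\<bar> \<le> \<bar>H x\<bar>"
      using cutoff_bounds(1,2)[OF pos, of n x] by (simp add: abs_mult mult_left_le_one_le)
    ultimately have "\<bar>k n x\<bar> \<le> 4 * \<bar>U x\<bar> + \<bar>H x\<bar>" unfolding k_def by linarith
    then have "\<bar>k n x\<bar>\<^sup>2 \<le> (4 * \<bar>U x\<bar> + \<bar>H x\<bar>)\<^sup>2" by (intro power_mono) auto
    also have "\<dots> \<le> 2 * (4 * \<bar>U x\<bar>)\<^sup>2 + 2 * \<bar>H x\<bar>\<^sup>2"
      using zero_le_power2[of "4 * \<bar>U x\<bar> - \<bar>H x\<bar>"] unfolding power2_diff power2_sum by linarith
    finally show ?thesis by (simp add: power2_eq_square)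
  qed
  have wlim: "(\<lambda>n. w n x) \<longlonglongrightarrow> U x" for x
    using tendsto_mult[OF cutoff_tendsto(1) tendsto_const[of "U x"]] by (simp add: w_def)
  have klim: "(\<lambda>n. k n x) \<longlonglongrightarrow> H x" for x
    using tendsto_add[OF tendsto_mult[OF cutoff_tendsto(2) tendsto_const[of "U x"]]
        tendsto_mult[OF cutoff_tendsto(1) tendsto_const[of "H x"]]] by (simp add: k_def)
  have 1: "(\<lambda>n. LINT x|lborel. k n x * k n x) \<longlonglongrightarrow> (LINT x|lborel. H x * H x)"
  proof (rule integral_dominated_convergence[where w = "\<lambda>x. 32 * (U x * U x) + 2 * (H x * H x)"])
    show "integrable lborel (\<lambda>x. 32 * (U x * U x) + 2 * (H x * H x))"
      by (intro Bochner_Integration.integrable_add integrable_mult_right L2_UNIV_integrable_mult E)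
    show "AE x in lborel. norm (k n x * k n x) \<le> 32 * (U x * U x) + 2 * (H x * H x)" for n
      using kb by (intro AE_I2) simp
    show "AE x in lborel. (\<lambda>n. k n x * k n x) \<longlonglongrightarrow> H x * H x"
      by (intro AE_I2 tendsto_mult klim)
  qed auto
  have sq: "w n x * w n x \<le> U x * U x" for n x
    using mult_mono[OF wb[of n x] wb[of n x]] by simp
  have 2: "(\<lambda>n. LINT x|lborel. q x * (w n x * w n x)) \<longlonglongrightarrow> (LINT x|lborel. q x * (U x * U x))"
  proof (rule integral_dominated_convergence[where w = "\<lambda>x. q x * (U x * U x)"])
    show "AE x in lborel. norm (q x * (w n x * w n x)) \<le> q x * (U x * U x)" for n
      using sq q_nonneg by (intro AE_I2) (simp add: mult_left_mono)
    show "AE x in lborel. (\<lambda>n. q x * (w n x * w n x)) \<longlonglongrightarrow> q x * (U x * U x)"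
      by (intro AE_I2 tendsto_mult wlim tendsto_const)
  qed (use E in auto)
  have "(LINT x|lborel. H x * H x) + (LINT x|lborel. q x * (U x * U x)) = \<mu> * ipl U U"
    using solution_weak_form[OF U U'(1)] by (simp add: ipl_eq)
  then show "(\<lambda>n. (LINT x|lborel. k n x * k n x) + (LINT x|lborel. q x * (w n x * w n x))) \<longlonglongrightarrow> \<mu> * ipl U U"
    using tendsto_add[OF 1 2] by simp
  have "(\<lambda>n. LINT x|lborel. (w n x - U x) * (w n x - U x)) \<longlonglongrightarrow> (LINT x|(lborel :: real measure). (0::real))"
  proof (rule integral_dominated_convergence[where f = "\<lambda>x. 0" and w = "\<lambda>x. 4 * (U x * U x)"])
    show "integrable lborel (\<lambda>x. 4 * (U x * U x))" by (intro integrable_mult_right L2_UNIV_integrable_mult E)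
    show "AE x in lborel. norm ((w n x - U x) * (w n x - U x)) \<le> 4 * (U x * U x)" for n
    proof (rule AE_I2)
      fix x
      have "\<bar>w n x - U x\<bar> \<le> 2 * \<bar>U x\<bar>" using wb[of n x] by linarith
      from mult_mono[OF this this] show "norm ((w n x - U x) * (w n x - U x)) \<le> 4 * (U x * U x)" by simp
    qed
    show "AE x in lborel. (\<lambda>n. (w n x - U x) * (w n x - U x)) \<longlonglongrightarrow> 0"
    proof (rule AE_I2)
      fix x
      have "(\<lambda>n. w n x - U x) \<longlonglongrightarrow> 0" using tendsto_diff[OF wlim[of x] tendsto_const[of "U x"]] by simp
      from tendsto_mult[OF this this] show "(\<lambda>n. (w n x - U x) * (w n x - U x)) \<longlonglongrightarrow> 0" by simp
    qed
  qed auto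
  then show "(\<lambda>n. LINT x|lborel. (w n x - U x) * (w n x - U x)) \<longlonglongrightarrow> 0" by simp
qed

end

section \<open>The semiclassical limit\<close>

text \<open>Fatou's lemma, stated for Bochner integrals. It gives the pointwise limit of stretched
  eigenfunctions its finite energy.\<close>

lemma integrable_limit_bounded:
  fixes f :: "nat \<Rightarrow> real \<Rightarrow> real"
  assumes i: "\<And>n. integrable lborel (f n)" and nn: "\<And>n x. 0 \<le> f n x"
    and lim: "\<And>x. (\<lambda>n. f n x) \<longlonglongrightarrow> F x" and bound: "\<And>n. (LINT x|lborel. f n x) \<le> C"
  shows "integrable lborel F" "(LINT x|lborel. F x) \<le> C"
proof -
  have [measurable]: "f n \<in> borel_measurable borel" for n
    using borel_measurable_integrable[OF i] by simp
  have Fm [measurable]: "F \<in> borel_measurable borel"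
    by (rule borel_measurable_LIMSEQ_metric[of f]) (use lim in auto)
  have F0: "0 \<le> F x" for x using LIMSEQ_le_const[OF lim] nn by blast
  have C0: "0 \<le> C" using order_trans[OF integral_nonneg_AE bound, of 0] nn by simp
  have "(\<integral>\<^sup>+x. ennreal (F x) \<partial>lborel) = (\<integral>\<^sup>+x. liminf (\<lambda>n. ennreal (f n x)) \<partial>lborel)"
  proof (rule nn_integral_cong)
    fix x
    show "ennreal (F x) = liminf (\<lambda>n. ennreal (f n x))"
      by (rule lim_imp_Liminf[symmetric, OF _ tendsto_ennrealI[OF lim]]) simp
  qed
  also have "\<dots> \<le> liminf (\<lambda>n. \<integral>\<^sup>+x. ennreal (f n x) \<partial>lborel)"
    by (rule nn_integral_liminf) measurable
  also have "\<dots> \<le> liminf (\<lambda>n. ennreal C)"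
  proof (intro Liminf_mono always_eventually allI)
    fix n
    have "(\<integral>\<^sup>+x. ennreal (f n x) \<partial>lborel) = ennreal (LINT x|lborel. f n x)"
      by (rule nn_integral_eq_integral[OF i]) (use nn in simp)
    then show "(\<integral>\<^sup>+x. ennreal (f n x) \<partial>lborel) \<le> ennreal C" using bound ennreal_leI by simp
  qed
  also have "\<dots> = ennreal C" by (rule Liminf_const) simp
  finally have le: "(\<integral>\<^sup>+x. ennreal (F x) \<partial>lborel) \<le> ennreal C" .
  show Fi: "integrable lborel F"
    by (rule integrableI_nonneg) (use F0 le_less_trans[OF le ennreal_less_top] in auto)
  have "(\<integral>\<^sup>+x. ennreal (F x) \<partial>lborel) = ennreal (LINT x|lborel. F x)"
    by (rule nn_integral_eq_integral[OF Fi]) (use F0 in simp)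
  then show "(LINT x|lborel. F x) \<le> C" using le C0 by (simp add: ennreal_le_iff)
qed

lemma integral_scale:
  fixes f :: "real \<Rightarrow> real"
  assumes "s > 0"
  shows "(LINT x|lborel. f x) = s * (LINT y|lborel. f (s * y))"
    "integrable lborel (\<lambda>y. f (s * y)) \<longleftrightarrow> integrable lborel f"
  using lborel_integral_real_affine[of s f 0] lborel_integrable_real_affine_iff[of s f 0] assms by auto

text \<open>Otherwise |u| would exceed 1 on all of [x, x + 1] by the Hoelder bound, and the squared
  norm would exceed 1. Unlike \<open>elem_bound\<close>, the estimate does not involve the length of
  the interval, which grows like 1 / s under stretching.\<close>

lemma Hoelder_sup_bound:
  assumes h: "\<And>x y. (u x - u y)\<^sup>2 \<le> \<bar>x - y\<bar> * L" and i: "integrable lborel (\<lambda>x. u x * u x)"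
    and n: "(LINT x|lborel. u x * u x) \<le> 1"
  shows "\<bar>u x\<bar> \<le> sqrt L + 1"
proof (rule ccontr)
  assume "\<not> \<bar>u x\<bar> \<le> sqrt L + 1"
  then have gt: "\<bar>u x\<bar> - sqrt L > 1" by simp
  have L0: "0 \<le> L" using order_trans[OF zero_le_power2 h[of 0 1]] by simp
  have "(\<bar>u x\<bar> - sqrt L) * (\<bar>u x\<bar> - sqrt L) \<le> u y * u y" if y: "y \<in> {x..x + 1}" for y
  proof -
    have "(u x - u y)\<^sup>2 \<le> \<bar>x - y\<bar> * L" by (rule h)
    also have "\<dots> \<le> 1 * L" using y L0 by (intro mult_right_mono) auto
    finally have "\<bar>u x - u y\<bar> \<le> sqrt L" by (simp add: real_le_rsqrt)
    then have "\<bar>u x\<bar> - sqrt L \<le> \<bar>u y\<bar>" by linarith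
    with gt have "(\<bar>u x\<bar> - sqrt L) * (\<bar>u x\<bar> - sqrt L) \<le> \<bar>u y\<bar> * \<bar>u y\<bar>" by (intro mult_mono) auto
    then show ?thesis by simp
  qed
  then have "(LINT y|lborel. indicator {x..x + 1} y * ((\<bar>u x\<bar> - sqrt L) * (\<bar>u x\<bar> - sqrt L))) \<le> (LINT y|lborel. u y * u y)"
    by (intro integral_mono i integrable_mult_left)
       (auto simp: integrable_indicator_iff emeasure_lborel_Icc_eq split: split_indicator)
  then have "(\<bar>u x\<bar> - sqrt L) * (\<bar>u x\<bar> - sqrt L) \<le> 1" using n by simp
  moreover have "1 * 1 < (\<bar>u x\<bar> - sqrt L) * (\<bar>u x\<bar> - sqrt L)" using gt by (intro mult_strict_mono) auto
  ultimately show False by simp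
qed

text \<open>K stands for pi^2 (1 / h^2 - 1 / M^2) / |x|^m, the main part of the potential with its
  zero at 0 divided out. Positive bounds from below and above hold on the whole interval, which
  confines the eigenfunctions and dominates the potential; the one-sided limits at 0 are the
  coefficients of the limit operator.\<close>

locale semiclassical_limit =
  fixes a b m k0 k1 \<kappa>p \<kappa>m :: real and K v :: "real \<Rightarrow> real"
  assumes ab: "a > 0" "b > 0" and m: "m > 0" and k0: "k0 > 0"
    and K_measurable: "set_borel_measurable lborel {-a<..<b} K"
    and K_bounds: "\<And>x. x \<in> {-a<..<b} \<Longrightarrow> k0 \<le> K x" "\<And>x. x \<in> {-a<..<b} \<Longrightarrow> K x \<le> k1"
    and K_right: "(K \<longlongrightarrow> \<kappa>p) (at_right 0)" and K_left: "(K \<longlongrightarrow> \<kappa>m) (at_left 0)"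
    and \<kappa>: "0 \<le> \<kappa>p" "0 \<le> \<kappa>m"
    and v_nonneg: "\<And>x. x \<in> {-a<..<b} \<Longrightarrow> 0 \<le> v x"
    and v_integrable: "set_integrable lborel {-a<..<b} v"
begin

abbreviation "I0 \<equiv> {-a<..<b}"

definition W :: "real \<Rightarrow> real \<Rightarrow> real" where
  "W s x = K x * \<bar>x\<bar> powr m / s powr (m + 2) + v x"

definition q :: "real \<Rightarrow> real" where
  "q x = (if x > 0 then \<kappa>p else \<kappa>m) * \<bar>x\<bar> powr m"

lemma continuous_abs_powr: "continuous_on T (\<lambda>x::real. \<bar>x\<bar> powr m)"
  using m by (intro continuous_on_powr' continuous_intros) auto

lemma abs_powr_measurable [measurable]: "(\<lambda>x::real. \<bar>x\<bar> powr m) \<in> borel_measurable borel"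
  by (rule borel_measurable_continuous_onI[OF continuous_abs_powr])

lemma q_continuous: "continuous_on UNIV q"
proof -
  have "q x = \<kappa>p * (max 0 x) powr m + \<kappa>m * (max 0 (- x)) powr m" for x
    using m by (cases "x > 0") (auto simp: q_def max_def)
  moreover have "continuous_on UNIV (\<lambda>x. \<kappa>p * (max 0 x) powr m + \<kappa>m * (max 0 (- x)) powr m)"
    using m by (intro continuous_intros continuous_on_powr') auto
  ultimately show ?thesis by simp
qed

sublocale schroedinger_line q
  by unfold_locales (use q_continuous \<kappa> in \<open>auto simp: q_def\<close>)

lemma q_le: "q x \<le> max \<kappa>p \<kappa>m * \<bar>x\<bar> powr m"
  unfolding q_def by (intro mult_right_mono) auto

lemma k1: "0 \<le> k1"
  using K_bounds[of 0] ab k0 by auto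

lemma Kpow_integrable: "set_integrable lborel I0 (\<lambda>x. K x * \<bar>x\<bar> powr m)"
proof (rule set_integrable_bound)
  show "set_integrable lborel I0 (\<lambda>x. k1 * \<bar>x\<bar> powr m)"
    using borel_integrable_atLeastAtMost'[OF continuous_abs_powr, of "-a" b]
    by (intro set_integrable_mult_right) (rule set_integrable_subset, auto)
  show "set_borel_measurable lborel I0 (\<lambda>x. K x * \<bar>x\<bar> powr m)"
    by (intro set_borel_measurable_mult K_measurable set_borel_measurable_if_borel) auto
  show "AE x in lborel. x \<in> I0 \<longrightarrow> norm (K x * \<bar>x\<bar> powr m) \<le> norm (k1 * \<bar>x\<bar> powr m)"
  proof (intro AE_I2 impI)
    fix x assume x: "x \<in> I0"
    have "\<bar>K x\<bar> \<le> \<bar>k1\<bar>" using K_bounds[OF x] k0 by linarith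
    then show "norm (K x * \<bar>x\<bar> powr m) \<le> norm (k1 * \<bar>x\<bar> powr m)"
      unfolding real_norm_def abs_mult by (rule mult_right_mono) simp
  qed
qed

lemma interval: "s > 0 \<Longrightarrow> schroedinger_interval (-a) b (W s)"
proof unfold_locales
  assume s: "s > 0"
  show "- a < b" using ab by simp
  show "0 \<le> W s x" if x: "x \<in> I0" for x
    unfolding W_def using K_bounds[OF x] k0 v_nonneg[OF x] s
    by (intro add_nonneg_nonneg divide_nonneg_nonneg mult_nonneg_nonneg) auto
  show "set_integrable lborel I0 (W s)"
    unfolding W_def[abs_def] using Kpow_integrable v_integrable by (intro set_integral_add(1)) auto
qed

text \<open>\<open>V\<close> is the potential \<open>W s\<close> seen in the stretched variable \<open>y = x / s\<close>.\<close>

definition V :: "real \<Rightarrow> real \<Rightarrow> real" where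
  "V s y = K (s * y) * \<bar>y\<bar> powr m + s\<^sup>2 * v (s * y)"

lemma V_eq: "s > 0 \<Longrightarrow> V s y = s\<^sup>2 * W s (s * y)"
proof -
  assume s: "s > 0"
  have "s powr (m + 2) = s powr m * s\<^sup>2" using s by (simp add: powr_add)
  moreover have "\<bar>s * y\<bar> powr m = s powr m * \<bar>y\<bar> powr m" using s by (simp add: abs_mult powr_mult)
  ultimately show ?thesis using s by (simp add: V_def W_def field_simps)
qed

text \<open>What the limit passage uses of an eigenfunction in the stretched variable. \<Lambda> is
  the stretched eigenvalue, and it bounds three parts of the energy: the Hoelder constant
  (equicontinuity), the mass weighted with |y|^m (no loss at infinity), and the L^2 norm of the
  derivative H, which is meaningful only inside the stretched interval.\<close>

definition scaled :: "real \<Rightarrow> real \<Rightarrow> (real \<Rightarrow> real) \<Rightarrow> (real \<Rightarrow> real) \<Rightarrow> bool" where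
  "scaled s \<Lambda> u H \<longleftrightarrow> 0 < s \<and> 0 \<le> \<Lambda> \<and> continuous_on UNIV u \<and>
     (\<forall>x y. (u x - u y)\<^sup>2 \<le> \<bar>x - y\<bar> * \<Lambda>) \<and> (\<forall>y. s * y \<notin> I0 \<longrightarrow> u y = 0) \<and>
     u \<in> L2 UNIV \<and> ipl u u = 1 \<and>
     integrable lborel (\<lambda>y. \<bar>y\<bar> powr m * (u y * u y)) \<and>
     k0 * (LINT y|lborel. \<bar>y\<bar> powr m * (u y * u y)) \<le> \<Lambda> \<and>
     primitive_on {y. s * y \<in> I0} u H \<and>
     primitive_on {y. s * y \<in> I0} H (\<lambda>y. (V s y - \<Lambda>) * u y) \<and>
     integrable lborel (\<lambda>y. indicator I0 (s * y) * (H y * H y)) \<and>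
     (LINT y|lborel. indicator I0 (s * y) * (H y * H y)) \<le> \<Lambda>"

text \<open>The factor sqrt s makes the stretching unitary; each derivative brings another factor s,
  so that squared norms of derivatives are multiplied by s^2 and the eigenvalue l by s^2. All bounds
  then follow from Q \<psi> \<psi> = l. The last clause is the same change of variables for inner
  products.\<close>

lemma scaled_eigenfunction:
  assumes s: "s > 0"
    and op: "form_operator I0 (H10 I0) (schroedinger_form I0 (W s)) \<psi> (\<lambda>x. l * \<psi> x)"
    and nrm: "L2_inner I0 \<psi> \<psi> = 1"
  obtains u H where "scaled s (s\<^sup>2 * l) u H" "AE x in lborel. x \<in> I0 \<longrightarrow> \<psi> x = u (x / s) / sqrt s"
    "\<And>f. f \<in> borel_measurable borel \<Longrightarrow>
       (LINT x:I0|lborel. \<psi> x * (f (x / s) / sqrt s)) = (LINT y|lborel. u y * f y)"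
proof -
  interpret schroedinger_interval "-a" b "W s" by (rule interval[OF s])
  have \<psi>H: "\<psi> \<in> H10 I0" using op unfolding form_operator_def by blast
  obtain U g where e: "elem \<psi> U g" using elem_ex[OF \<psi>H] by blast
  note e' = elemD[OF e]
  obtain H0 where H0: "primitive_on I0 U H0" "primitive_on I0 H0 (\<lambda>x. (W s x - l) * U x)"
    "H0 \<in> L2 I0" "L2_inner I0 H0 H0 = L2_inner I0 g g" "continuous_on I0 H0"
    by (rule eigenfunction_regularity[OF op e], rule that)
  have Ql: "schroedinger_form I0 (W s) \<psi> \<psi> = l"
    using op \<psi>H nrm unfolding form_operator_def L2_inner_cmult_left by auto
  have l0: "0 \<le> l" using Q_lower(3)[OF e] Ql by simp
  have gl: "L2_inner I0 g g \<le> l" and WU: "(LINT x:I0|lborel. W s x * (U x * U x)) \<le> l"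
    using Q_lower(1,2)[OF e] Ql by auto
  define u where "u y = sqrt s * U (s * y)" for y
  define H where "H y = s * sqrt s * H0 (s * y)" for y
  have ss: "sqrt s * sqrt s = s" using s by simp
  have uu: "u y * u y = s * (U (s * y) * U (s * y))" for y
    using ss by (simp add: u_def algebra_simps)
  have [measurable]: "U \<in> borel_measurable borel" by (rule e'(11))
  have Uind: "(LINT x:I0|lborel. U x * f x) = (LINT x|lborel. U x * f x)" for f
    unfolding set_lebesgue_integral_def
    by (intro Bochner_Integration.integral_cong) (use e'(8) in \<open>auto simp: indicator_def\<close>)
  have UU: "integrable lborel (\<lambda>x. U x * U x)" "(LINT x|lborel. U x * U x) = 1"
  proof -
    have "(\<lambda>x. indicator I0 x *\<^sub>R (U x * U x)) = (\<lambda>x. U x * U x)"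
      by (rule ext) (use e'(8) in \<open>auto simp: indicator_def\<close>)
    then show "integrable lborel (\<lambda>x. U x * U x)"
      using L2_mult_integrable[OF e'(12,12)] by (simp add: set_integrable_def)
    show "(LINT x|lborel. U x * U x) = 1"
      using nrm ip_eq[OF e e] Uind[of U] by (simp add: L2_inner_def)
  qed
  have uc: "continuous_on UNIV u"
    unfolding u_def by (intro continuous_intros continuous_on_compose2[OF e'(10)]) auto
  then have um: "u \<in> borel_measurable borel" by (rule borel_measurable_continuous_onI)
  have uui: "integrable lborel (\<lambda>y. u y * u y)" "(LINT y|lborel. u y * u y) = 1"
    using UU integral_scale[OF s, of "\<lambda>x. U x * U x"] unfolding uu by simp_all
  have uL: "u \<in> L2 UNIV"
    using uui um by (simp add: L2_def set_borel_measurable_def set_integrable_def power2_eq_square)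
  have hoelder: "(u x - u y)\<^sup>2 \<le> \<bar>x - y\<bar> * (s\<^sup>2 * l)" for x y
  proof -
    have "(u x - u y)\<^sup>2 = s * (U (s * x) - U (s * y))\<^sup>2"
      using s by (simp add: u_def right_diff_distrib[symmetric] power_mult_distrib)
    also have "\<dots> \<le> s * (\<bar>s * x - s * y\<bar> * L2_inner I0 g g)"
      using s by (intro mult_left_mono elem_Hoelder[OF e]) auto
    also have "\<dots> \<le> s * (\<bar>s * x - s * y\<bar> * l)"
      using s by (intro mult_left_mono gl) auto
    also have "\<bar>s * x - s * y\<bar> = s * \<bar>x - y\<bar>" using s by (simp add: right_diff_distrib[symmetric] abs_mult)
    finally show ?thesis by (simp add: power2_eq_square ac_simps)
  qed
  have out: "u y = 0" if "s * y \<notin> I0" for y using e'(8)[OF that] by (simp add: u_def)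
  have powU: "integrable lborel (\<lambda>x. \<bar>x\<bar> powr m * (U x * U x))"
    "k0 * (LINT x|lborel. \<bar>x\<bar> powr m * (U x * U x)) \<le> s powr (m + 2) * l"
  proof -
    have i: "set_integrable lborel I0 (\<lambda>x. \<bar>x\<bar> powr m * (U x * U x))"
    proof (rule set_integrable_subset[where A = "{-a..b}"])
      show "set_integrable lborel {-a..b} (\<lambda>x. \<bar>x\<bar> powr m * (U x * U x))"
        by (intro borel_integrable_atLeastAtMost' continuous_on_mult continuous_abs_powr continuous_on_subset[OF e'(10)]) auto
    qed auto
    have eq: "(\<lambda>x. indicator I0 x *\<^sub>R (\<bar>x\<bar> powr m * (U x * U x))) = (\<lambda>x. \<bar>x\<bar> powr m * (U x * U x))"
      by (rule ext) (use e'(8) in \<open>auto simp: indicator_def\<close>)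
    show "integrable lborel (\<lambda>x. \<bar>x\<bar> powr m * (U x * U x))" using i unfolding set_integrable_def eq .
    have "k0 * (LINT x|lborel. \<bar>x\<bar> powr m * (U x * U x)) = (LINT x:I0|lborel. k0 * (\<bar>x\<bar> powr m * (U x * U x)))"
      by (simp add: set_lebesgue_integral_def[of _ _ "\<lambda>x. \<bar>x\<bar> powr m * (U x * U x)"] eq[unfolded real_scaleR_def])
    also have "\<dots> \<le> (LINT x:I0|lborel. s powr (m + 2) * (W s x * (U x * U x)))"
    proof (rule set_integral_mono)
      show "set_integrable lborel I0 (\<lambda>x. k0 * (\<bar>x\<bar> powr m * (U x * U x)))" using i by simp
      show "set_integrable lborel I0 (\<lambda>x. s powr (m + 2) * (W s x * (U x * U x)))"
        by (intro set_integrable_mult_right V_mult_integrable_continuous continuous_on_mult e'(10))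
      fix x assume x: "x \<in> I0"
      have "k0 * \<bar>x\<bar> powr m \<le> K x * \<bar>x\<bar> powr m" by (intro mult_right_mono K_bounds x) auto
      also have "\<dots> \<le> s powr (m + 2) * W s x"
        using s v_nonneg[OF x] by (simp add: W_def distrib_left)
      finally have "k0 * \<bar>x\<bar> powr m * (U x * U x) \<le> s powr (m + 2) * W s x * (U x * U x)"
        by (rule mult_right_mono) simp
      then show "k0 * (\<bar>x\<bar> powr m * (U x * U x)) \<le> s powr (m + 2) * (W s x * (U x * U x))" by (simp add: mult.assoc)
    qed
    also have "\<dots> \<le> s powr (m + 2) * l" using WU by (simp add: mult_left_mono)
    finally show "k0 * (LINT x|lborel. \<bar>x\<bar> powr m * (U x * U x)) \<le> s powr (m + 2) * l" .
  qed
  have powu: "\<bar>y\<bar> powr m * (u y * u y) = s * s powr (- m) * (\<bar>s * y\<bar> powr m * (U (s * y) * U (s * y)))" for y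
    unfolding uu using s by (simp add: abs_mult powr_mult powr_minus field_simps)
  have powi: "integrable lborel (\<lambda>y. \<bar>y\<bar> powr m * (u y * u y))"
    unfolding powu using powU(1) integral_scale(2)[OF s, of "\<lambda>x. \<bar>x\<bar> powr m * (U x * U x)"] by simp
  have powb: "k0 * (LINT y|lborel. \<bar>y\<bar> powr m * (u y * u y)) \<le> s\<^sup>2 * l"
  proof -
    have "(LINT y|lborel. \<bar>y\<bar> powr m * (u y * u y)) = s powr (- m) * (LINT x|lborel. \<bar>x\<bar> powr m * (U x * U x))"
      unfolding powu using integral_scale(1)[OF s, of "\<lambda>x. \<bar>x\<bar> powr m * (U x * U x)"] by simp
    then have "k0 * (LINT y|lborel. \<bar>y\<bar> powr m * (u y * u y)) = s powr (- m) * (k0 * (LINT x|lborel. \<bar>x\<bar> powr m * (U x * U x)))"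
      by simp
    also have "\<dots> \<le> s powr (- m) * (s powr (m + 2) * l)" by (intro mult_left_mono powU(2)) simp
    also have "\<dots> = s\<^sup>2 * l"
    proof -
      have "s powr (- m) * s powr (m + 2) = s powr 2" by (simp add: powr_add[symmetric])
      then show ?thesis using s by (simp add: mult.assoc[symmetric])
    qed
    finally show ?thesis .
  qed
  have p1: "primitive_on {y. s * y \<in> I0} u H"
    using primitive_on_cmult[OF primitive_on_scale[OF H0(1) s], of "sqrt s"]
    by (simp add: u_def[abs_def] H_def[abs_def] ac_simps)
  have p2: "primitive_on {y. s * y \<in> I0} H (\<lambda>y. (V s y - s\<^sup>2 * l) * u y)"
  proof -
    have "(V s y - s\<^sup>2 * l) * u y = s * sqrt s * (s * ((W s (s * y) - l) * U (s * y)))" for y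
      unfolding V_eq[OF s] u_def by (simp add: algebra_simps power2_eq_square)
    then show ?thesis
      using primitive_on_cmult[OF primitive_on_scale[OF H0(2) s], of "s * sqrt s"] by (simp add: H_def[abs_def])
  qed
  have HH: "indicator I0 (s * y) * (H y * H y) = s\<^sup>2 * s * (indicator I0 (s * y) * (H0 (s * y) * H0 (s * y)))" for y
  proof -
    have "H y * H y = s\<^sup>2 * s * (H0 (s * y) * H0 (s * y))"
    proof -
      have "H y * H y = (s * s) * (sqrt s * sqrt s) * (H0 (s * y) * H0 (s * y))" by (simp only: H_def ac_simps)
      then show ?thesis unfolding ss by (simp add: power2_eq_square)
    qed
    then show ?thesis by simp
  qed
  have HHi: "integrable lborel (\<lambda>x. indicator I0 x * (H0 x * H0 x))"
    using L2_mult_integrable[OF H0(3,3)] by (simp add: set_integrable_def)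
  have Hi: "integrable lborel (\<lambda>y. indicator I0 (s * y) * (H y * H y))"
    unfolding HH using HHi integral_scale(2)[OF s, of "\<lambda>x. indicator I0 x * (H0 x * H0 x)"] by simp
  have Hb: "(LINT y|lborel. indicator I0 (s * y) * (H y * H y)) \<le> s\<^sup>2 * l"
  proof -
    have "(LINT y|lborel. indicator I0 (s * y) * (H y * H y)) = s\<^sup>2 * (LINT x|lborel. indicator I0 x * (H0 x * H0 x))"
      unfolding HH using integral_scale(1)[OF s, of "\<lambda>x. indicator I0 x * (H0 x * H0 x)"] by (simp add: mult.assoc)
    also have "(LINT x|lborel. indicator I0 x * (H0 x * H0 x)) = L2_inner I0 H0 H0"
      by (simp add: L2_inner_def set_lebesgue_integral_def)
    also have "s\<^sup>2 * L2_inner I0 H0 H0 \<le> s\<^sup>2 * l" using H0(4) gl by (intro mult_left_mono) auto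
    finally show ?thesis .
  qed
  have "scaled s (s\<^sup>2 * l) u H"
    unfolding scaled_def using s l0 uc hoelder out uL uui(2) powi powb p1 p2 Hi Hb by (simp add: ipl_eq)
  moreover have \<psi>u: "AE x in lborel. x \<in> I0 \<longrightarrow> \<psi> x = u (x / s) / sqrt s"
    using e'(9) by eventually_elim (use s in \<open>simp add: u_def\<close>)
  moreover have "(LINT x:I0|lborel. \<psi> x * (f (x / s) / sqrt s)) = (LINT y|lborel. u y * f y)"
    if f: "f \<in> borel_measurable borel" for f
  proof -
    have "(LINT x:I0|lborel. \<psi> x * (f (x / s) / sqrt s)) = (LINT x:I0|lborel. U x * (f (x / s) / sqrt s))"
    proof (rule set_integral_cong_AE_weak(1))
      have fm: "set_borel_measurable lborel I0 (\<lambda>x. f (x / s) / sqrt s)"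
        using f by (intro set_borel_measurable_if_borel) auto
      show "set_borel_measurable lborel I0 (\<lambda>x. \<psi> x * (f (x / s) / sqrt s))"
        by (intro set_borel_measurable_mult fm L2_measurable e'(2))
      show "set_borel_measurable lborel I0 (\<lambda>x. U x * (f (x / s) / sqrt s))"
        by (intro set_borel_measurable_mult fm L2_measurable e'(12))
      show "AE x in lborel. x \<in> I0 \<longrightarrow> \<psi> x * (f (x / s) / sqrt s) = U x * (f (x / s) / sqrt s)"
        using e'(9) by eventually_elim auto
    qed
    also have "\<dots> = s * (LINT y|lborel. U (s * y) * (f ((s * y) / s) / sqrt s))"
      unfolding Uind by (rule integral_scale(1)[OF s])
    also have "\<dots> = (LINT y|lborel. s * (U (s * y) * (f y / sqrt s)))" using s by simp
    also have "\<dots> = (LINT y|lborel. u y * f y)"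
    proof (rule Bochner_Integration.integral_cong[OF refl])
      fix y
      have "s / sqrt s = sqrt s" using s by (simp add: real_div_sqrt)
      then show "s * (U (s * y) * (f y / sqrt s)) = u y * f y"
        unfolding u_def by (metis (no_types, opaque_lifting) mult.commute mult.left_commute times_divide_eq_right)
    qed
    finally show ?thesis .
  qed
  ultimately show ?thesis using that by blast
qed

end

lemma tendsto_offset_iff:
  fixes X :: "nat \<Rightarrow> real"
  assumes "\<And>n. n \<ge> N \<Longrightarrow> X n = Y n" "Y \<longlonglongrightarrow> l"
  shows "X \<longlonglongrightarrow> l"
  by (rule Lim_transform_eventually[OF assms(2)]) (use assms(1) in \<open>auto simp: eventually_sequentially intro!: exI[of _ N]\<close>)

context semiclassical_limit
begin

lemma scaledD:
  assumes "scaled s \<Lambda> u H"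
  shows "0 < s" "0 \<le> \<Lambda>" "continuous_on UNIV u" "(u x - u y)\<^sup>2 \<le> \<bar>x - y\<bar> * \<Lambda>"
    "s * y \<notin> I0 \<Longrightarrow> u y = 0" "u \<in> L2 UNIV" "ipl u u = 1"
    "integrable lborel (\<lambda>y. \<bar>y\<bar> powr m * (u y * u y))"
    "k0 * (LINT y|lborel. \<bar>y\<bar> powr m * (u y * u y)) \<le> \<Lambda>"
    "primitive_on {y. s * y \<in> I0} u H"
    "primitive_on {y. s * y \<in> I0} H (\<lambda>y. (V s y - \<Lambda>) * u y)"
    "integrable lborel (\<lambda>y. indicator I0 (s * y) * (H y * H y))"
    "(LINT y|lborel. indicator I0 (s * y) * (H y * H y)) \<le> \<Lambda>"
    "u \<in> borel_measurable borel"
  using assms borel_measurable_continuous_onI[of u] unfolding scaled_def by blast+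

lemma scaled_bound:
  assumes "scaled s \<Lambda> u H" "\<Lambda> \<le> L"
  shows "\<bar>u x\<bar> \<le> sqrt L + 1"
proof -
  note d = scaledD[OF assms(1)]
  have "\<bar>u x\<bar> \<le> sqrt \<Lambda> + 1"
    by (rule Hoelder_sup_bound[OF d(4)]) (use d(6,7) L2_UNIV_integrable_mult in \<open>auto simp: ipl_eq\<close>)
  then show ?thesis using real_sqrt_le_mono[OF assms(2)] by linarith
qed

section \<open>Passage to the limit in the stretched equation\<close>

lemma eventually_in_I0:
  assumes s0: "s \<longlonglongrightarrow> 0" and spos: "\<And>n::nat. 0 < s n"
  shows "\<exists>N. \<forall>n\<ge>N. \<forall>y. \<bar>y\<bar> \<le> R \<longrightarrow> s n * y \<in> I0"
proof -
  have "(\<lambda>n. s n * R) \<longlonglongrightarrow> 0 * R" by (intro tendsto_mult s0 tendsto_const)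
  then have "(\<lambda>n. s n * R) \<longlonglongrightarrow> 0" by simp
  from order_tendstoD(2)[OF this, of "min a b"] ab have "\<forall>\<^sub>F n in sequentially. s n * R < min a b" by simp
  then obtain N where N: "\<And>n. n \<ge> N \<Longrightarrow> s n * R < min a b" by (auto simp: eventually_sequentially)
  have "s n * y \<in> I0" if "n \<ge> N" "\<bar>y\<bar> \<le> R" for n y
  proof -
    have "\<bar>s n * y\<bar> \<le> s n * R" using that(2) spos[of n] by (simp add: abs_mult)
    also have "\<dots> < min a b" by (rule N[OF that(1)])
    finally show ?thesis by auto
  qed
  then show ?thesis by blast
qed

text \<open>K is controlled on I0 only; the extension by 0 is measurable on the line and bounded by
  \<open>k1\<close>, as dominated convergence in the stretched variable requires.\<close>

definition K' :: "real \<Rightarrow> real" where "K' x = indicator I0 x * K x"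

lemma K'_measurable [measurable]: "K' \<in> borel_measurable borel"
  using K_measurable by (simp add: K'_def[abs_def] set_borel_measurable_def)

lemma K'_bound: "\<bar>K' x\<bar> \<le> k1"
proof (cases "x \<in> I0")
  case True
  then show ?thesis using K_bounds[OF True] k0 by (simp add: K'_def)
qed (simp add: K'_def k1)

text \<open>For fixed t the point s n t reaches 0 from the side given by the sign of t, so the
  one-sided limits of K apply. At t = 0 the factor |t|^m vanishes.\<close>

lemma K'_tendsto:
  assumes s0: "s \<longlonglongrightarrow> 0" and spos: "\<And>n::nat. 0 < s n"
  shows "(\<lambda>n. K' (s n * t) * \<bar>t\<bar> powr m) \<longlonglongrightarrow> q t"
proof -
  obtain N where N: "\<And>n y. n \<ge> N \<Longrightarrow> \<bar>y\<bar> \<le> \<bar>t\<bar> \<Longrightarrow> s n * y \<in> I0" using eventually_in_I0[OF s0 spos] by blast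
  have eq: "K' (s n * t) * \<bar>t\<bar> powr m = K (s n * t) * \<bar>t\<bar> powr m" if "n \<ge> N" for n
    using N[OF that, of t] by (simp add: K'_def)
  have st: "(\<lambda>n. s n * t) \<longlonglongrightarrow> 0" using tendsto_mult[OF s0 tendsto_const[of t]] by simp
  have "(\<lambda>n. K (s n * t) * \<bar>t\<bar> powr m) \<longlonglongrightarrow> q t"
  proof (cases "t = 0")
    case True
    then show ?thesis by (simp add: q_def)
  next
    case False
    show ?thesis
    proof (cases "t > 0")
      case True
      have "filterlim (\<lambda>n. s n * t) (at_right 0) sequentially"
        unfolding filterlim_at
      proof (intro conjI st always_eventually allI)
        fix n
        have "0 < s n * t" by (rule mult_pos_pos[OF spos True])
        then show "s n * t \<in> {0<..}" "s n * t \<noteq> 0" unfolding greaterThan_iff by linarith+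
      qed
      from filterlim_compose[OF K_right this] show ?thesis
        using True unfolding q_def by (intro tendsto_mult tendsto_const) simp
    next
      case neg: False
      have "filterlim (\<lambda>n. s n * t) (at_left 0) sequentially"
        unfolding filterlim_at
      proof (intro conjI st always_eventually allI)
        fix n
        have "s n * t < 0" by (rule mult_pos_neg[OF spos]) (use neg False in simp)
        then show "s n * t \<in> {..<0}" "s n * t \<noteq> 0" unfolding lessThan_iff by linarith+
      qed
      from filterlim_compose[OF K_left this] show ?thesis
        using neg unfolding q_def by (intro tendsto_mult tendsto_const) simp
    qed
  qed
  then show ?thesis by (rule tendsto_offset_iff[where N = N, rotated]) (rule eq)
qed

lemma v_scaled:
  assumes s: "0 < s"
  shows "integrable lborel (\<lambda>y. indicator I0 (s * y) * v (s * y))"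
    "(LINT y|lborel. indicator I0 (s * y) * v (s * y)) = (LINT x:I0|lborel. v x) / s"
    "0 \<le> indicator I0 (s * y) * v (s * y)"
proof -
  have "integrable lborel (\<lambda>x. indicator I0 x * v x)" using v_integrable by (simp add: set_integrable_def)
  then show "integrable lborel (\<lambda>y. indicator I0 (s * y) * v (s * y))"
    using integral_scale(2)[OF s, of "\<lambda>x. indicator I0 x * v x"] by simp
  show "(LINT y|lborel. indicator I0 (s * y) * v (s * y)) = (LINT x:I0|lborel. v x) / s"
    using integral_scale(1)[OF s, of "\<lambda>x. indicator I0 x * v x"] s
    by (simp add: set_lebesgue_integral_def)
  show "0 \<le> indicator I0 (s * y) * v (s * y)" using v_nonneg[of "s * y"] by (simp add: indicator_def)
qed

lemma v_integral_nonneg: "0 \<le> (LINT x:I0|lborel. v x)"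
  unfolding set_lebesgue_integral_def
  by (intro integral_nonneg_AE AE_I2) (auto simp: indicator_def v_nonneg)

text \<open>The part \<open>v\<close> of the potential, of which only integrability is known, disappears in the limit
  because its stretched \<open>L\<^sup>1\<close> norm is \<open>s * \<parallel>v\<parallel>\<close>.\<close>

lemma v_part_bound:
  assumes s: "0 < s" and F: "F \<in> borel_measurable borel" "\<And>y. \<bar>F y\<bar> \<le> C" and A: "A \<in> sets borel"
  shows "set_integrable lborel A (\<lambda>y. s\<^sup>2 * (indicator I0 (s * y) * v (s * y)) * F y)"
    "\<bar>LINT y:A|lborel. s\<^sup>2 * (indicator I0 (s * y) * v (s * y)) * F y\<bar> \<le> C * (LINT x:I0|lborel. v x) * s"
proof -
  define w where "w y = indicator I0 (s * y) * v (s * y)" for y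
  have vi: "integrable lborel w" and vv: "0 \<le> w y" and wI: "(LINT y|lborel. w y) = (LINT x:I0|lborel. v x) / s" for y
    using v_scaled[OF s] by (simp_all add: w_def[abs_def])
  have vm: "w \<in> borel_measurable borel" using borel_measurable_integrable[OF vi] by simp
  have C0: "0 \<le> C" using order_trans[OF abs_ge_zero F(2)[of 0]] .
  have le: "norm (indicator A y *\<^sub>R (s\<^sup>2 * w y * F y)) \<le> s\<^sup>2 * C * w y" for y
  proof -
    have "\<bar>s\<^sup>2 * w y * F y\<bar> = s\<^sup>2 * w y * \<bar>F y\<bar>" using vv[of y] by (simp add: abs_mult)
    also have "\<dots> \<le> s\<^sup>2 * w y * C" using vv[of y] by (intro mult_left_mono F(2)) auto
    finally have *: "\<bar>s\<^sup>2 * w y * F y\<bar> \<le> s\<^sup>2 * C * w y" by (simp add: ac_simps)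
    have "0 \<le> s\<^sup>2 * C * w y" using C0 vv[of y] by (intro mult_nonneg_nonneg) auto
    with * show ?thesis by (cases "y \<in> A") auto
  qed
  have dom: "integrable lborel (\<lambda>y. s\<^sup>2 * C * w y)" by (rule integrable_mult_right[OF vi])
  have i: "integrable lborel (\<lambda>y. indicator A y *\<^sub>R (s\<^sup>2 * w y * F y))"
  proof (rule Bochner_Integration.integrable_bound[OF dom])
    show "(\<lambda>y. indicator A y *\<^sub>R (s\<^sup>2 * w y * F y)) \<in> borel_measurable lborel"
      using vm F(1) A by (intro borel_measurable_scaleR borel_measurable_times borel_measurable_const borel_measurable_indicator) auto
    show "AE y in lborel. norm (indicator A y *\<^sub>R (s\<^sup>2 * w y * F y)) \<le> norm (s\<^sup>2 * C * w y)"
      using order_trans[OF le abs_ge_self] by (intro AE_I2) (simp only: real_norm_def)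
  qed
  then show "set_integrable lborel A (\<lambda>y. s\<^sup>2 * (indicator I0 (s * y) * v (s * y)) * F y)"
    by (simp only: set_integrable_def w_def)
  have "\<bar>LINT y|lborel. indicator A y *\<^sub>R (s\<^sup>2 * w y * F y)\<bar> \<le> (LINT y|lborel. norm (indicator A y *\<^sub>R (s\<^sup>2 * w y * F y)))"
    using integral_norm_bound[of lborel "\<lambda>y. indicator A y *\<^sub>R (s\<^sup>2 * w y * F y)"] by (simp only: real_norm_def)
  also have "\<dots> \<le> (LINT y|lborel. s\<^sup>2 * C * w y)"
    by (rule integral_mono[OF integrable_norm[OF i] dom le])
  also have "\<dots> = s\<^sup>2 * C * ((LINT x:I0|lborel. v x) / s)"
    unfolding wI[symmetric] by (rule integral_mult_right_zero)
  also have "\<dots> = C * (LINT x:I0|lborel. v x) * s" using s by (simp add: power2_eq_square field_simps)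
  finally show "\<bar>LINT y:A|lborel. s\<^sup>2 * (indicator I0 (s * y) * v (s * y)) * F y\<bar> \<le> C * (LINT x:I0|lborel. v x) * s"
    by (simp only: set_lebesgue_integral_def w_def)
qed

text \<open>The equation is passed to the limit in integrated form. Of the second derivatives, the
  part with K is locally bounded and converges pointwise, the part with v has integrals of order s;
  hence the increments of \<open>H n\<close> converge, then \<open>H n\<close> itself, then the
  increments of \<open>u n\<close>. The mass bound with weight |y|^m turns pointwise into L^2
  convergence.\<close>

lemma solutions_limit:
  fixes s \<Lambda> :: "nat \<Rightarrow> real" and u H :: "nat \<Rightarrow> real \<Rightarrow> real"
  assumes sc: "\<And>n. scaled (s n) (\<Lambda> n) (u n) (H n)" and s0: "s \<longlonglongrightarrow> 0" and \<Lambda>L: "\<And>n. \<Lambda> n \<le> L"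
    and \<Lambda>lim: "\<Lambda> \<longlonglongrightarrow> l" and ulim: "\<And>x. (\<lambda>n. u n x) \<longlonglongrightarrow> U x"
  shows "\<exists>H'. solution l U H'" "ipl U U = 1"
    "\<And>f. f \<in> L2 UNIV \<Longrightarrow> (\<lambda>n. ipl (u n) f) \<longlonglongrightarrow> ipl U f"
proof -
  note d = scaledD[OF sc]
  have spos: "0 < s n" for n by (rule d(1))
  define C where "C = sqrt L + 1"
  have ub: "\<bar>u n x\<bar> \<le> C" for n x unfolding C_def by (rule scaled_bound[OF sc \<Lambda>L])
  have L0: "0 \<le> L" using d(2)[of 0] \<Lambda>L[of 0] by linarith
  have C0: "0 \<le> C" using L0 by (simp add: C_def)
  have [measurable]: "u n \<in> borel_measurable borel" for n by (rule d(14))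
  have Um [measurable]: "U \<in> borel_measurable borel"
    by (rule borel_measurable_LIMSEQ_metric[of u]) (use ulim d(14) in auto)
  have Uh: "(U x - U y)\<^sup>2 \<le> \<bar>x - y\<bar> * L" for x y
  proof (rule LIMSEQ_le_const2)
    show "(\<lambda>n. (u n x - u n y)\<^sup>2) \<longlonglongrightarrow> (U x - U y)\<^sup>2" by (intro tendsto_intros ulim)
    have "(u n x - u n y)\<^sup>2 \<le> \<bar>x - y\<bar> * L" for n
      using d(4)[of n x y] mult_left_mono[OF \<Lambda>L[of n], of "\<bar>x - y\<bar>"] by linarith
    then show "\<exists>N. \<forall>n\<ge>N. (u n x - u n y)\<^sup>2 \<le> \<bar>x - y\<bar> * L" by blast
  qed
  have Ub: "\<bar>U x\<bar> \<le> C" for x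
    using tendsto_rabs[OF ulim[of x]] ub by (intro LIMSEQ_le_const2[where X = "\<lambda>n. \<bar>u n x\<bar>"]) auto
  \<comment> \<open>the second derivatives, cut off outside the stretched interval\<close>
  define F1 where "F1 n t = (K' (s n * t) * \<bar>t\<bar> powr m - \<Lambda> n) * u n t" for n t
  define F2 where "F2 n t = (s n)\<^sup>2 * (indicator I0 (s n * t) * v (s n * t)) * u n t" for n t
  have F: "(V (s n) t - \<Lambda> n) * u n t = F1 n t + F2 n t" if "s n * t \<in> I0" for n t
    using that by (simp add: V_def F1_def F2_def K'_def algebra_simps)
  define G where "G t = (q t - l) * U t" for t
  define c1 where "c1 R = (k1 * R powr m + L) * C" for R
  have F1b: "\<bar>F1 n t\<bar> \<le> c1 R" if "\<bar>t\<bar> \<le> R" for n t R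
  proof -
    have "\<bar>t\<bar> powr m \<le> R powr m" using that m by (intro powr_mono2) auto
    then have "\<bar>K' (s n * t)\<bar> * \<bar>t\<bar> powr m \<le> k1 * R powr m"
      by (intro mult_mono K'_bound k1) auto
    then have "\<bar>K' (s n * t) * \<bar>t\<bar> powr m\<bar> \<le> k1 * R powr m" by (simp add: abs_mult)
    then have "\<bar>K' (s n * t) * \<bar>t\<bar> powr m - \<Lambda> n\<bar> \<le> k1 * R powr m + L" using d(2)[of n] \<Lambda>L[of n] by linarith
    then show ?thesis unfolding F1_def c1_def abs_mult by (rule mult_mono[OF _ ub]) (use k1 L0 in auto)
  qed
  have F1m [measurable]: "F1 n \<in> borel_measurable borel" for n
    unfolding F1_def by measurable
  have cI: "set_integrable lborel {x..y} (\<lambda>t. c)" for x y c :: real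
    by (simp add: set_integrable_def integrable_indicator_iff emeasure_lborel_Icc_eq)
  have absR: "\<bar>t\<bar> \<le> \<bar>x\<bar> + \<bar>y\<bar>" if "t \<in> {x..y}" for t x y :: real using that by auto
  have F1i: "set_integrable lborel {x..y} (F1 n)" for n x y
  proof (rule set_integrable_bound[OF cI[of x y "c1 (\<bar>x\<bar> + \<bar>y\<bar>)"]])
    show "set_borel_measurable lborel {x..y} (F1 n)" by (rule set_borel_measurable_if_borel) auto
    show "AE t in lborel. t \<in> {x..y} \<longrightarrow> norm (F1 n t) \<le> norm (c1 (\<bar>x\<bar> + \<bar>y\<bar>))"
      using F1b[OF absR] by (intro AE_I2 impI) (metis abs_ge_self order_trans real_norm_def)
  qed
  note F2 = v_part_bound[OF spos d(14) ub, of "{x..y}" for x y]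
  define v1 where "v1 = (LINT x:I0|lborel. v x)"
  have F2i: "set_integrable lborel {x..y} (F2 n)" and F2b: "\<bar>LINT t:{x..y}|lborel. F2 n t\<bar> \<le> C * v1 * s n" for n x y
    using F2[of x y n n] by (simp_all add: F2_def[abs_def] v1_def)
  define D where "D n x y = (LINT t:{x..y}|lborel. F1 n t + F2 n t)" for n x y
  define D' where "D' x y = (LINT t:{x..y}|lborel. G t)" for x y
  have Deq: "D n x y = (LINT t:{x..y}|lborel. F1 n t) + (LINT t:{x..y}|lborel. F2 n t)" for n x y
    unfolding D_def by (rule set_integral_add(2)[OF F1i F2i])
  have F1lim: "(\<lambda>n. LINT t:{x..y}|lborel. F1 n t) \<longlonglongrightarrow> D' x y" and Gi: "set_integrable lborel {x..y} G" for x y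
  proof -
    have lim: "(\<lambda>n. F1 n t) \<longlonglongrightarrow> G t" for t
      unfolding F1_def G_def by (intro tendsto_intros K'_tendsto s0 spos \<Lambda>lim ulim)
    have meas: "set_borel_measurable lborel {x..y} (F1 n)" for n by (rule set_borel_measurable_if_borel) auto
    note T = set_integral_tendsto_bounded[OF cI[of x y "c1 (\<bar>x\<bar> + \<bar>y\<bar>)"] meas lim F1b[OF absR]]
    show "(\<lambda>n. LINT t:{x..y}|lborel. F1 n t) \<longlonglongrightarrow> D' x y" unfolding D'_def by (rule T(1))
    show "set_integrable lborel {x..y} G" by (rule T(2))
  qed
  have F2lim: "(\<lambda>n. LINT t:{x..y}|lborel. F2 n t) \<longlonglongrightarrow> 0" for x y
  proof (rule Lim_null_comparison)
    show "\<forall>\<^sub>F n in sequentially. norm (LINT t:{x..y}|lborel. F2 n t) \<le> C * v1 * s n"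
      using F2b by (intro always_eventually allI) simp
    show "(\<lambda>n. C * v1 * s n) \<longlonglongrightarrow> 0" using tendsto_mult_left[OF s0, of "C * v1"] by simp
  qed
  have Dlim: "(\<lambda>n. D n x y) \<longlonglongrightarrow> D' x y" for x y
    unfolding Deq using tendsto_add[OF F1lim F2lim] by simp
  obtain sb where sb: "\<And>n. s n \<le> sb"
    using convergent_imp_Bseq[OF convergentI[OF s0]] unfolding Bseq_def by (metis abs_le_D1 real_norm_def)
  define c2 where "c2 R = c1 R * R + C * v1 * sb" for R
  have v10: "0 \<le> v1" unfolding v1_def by (rule v_integral_nonneg)
  have Db: "\<bar>D n x y\<bar> \<le> c2 R" if xy: "-R \<le> x" "x \<le> y" "y \<le> R" "y - x \<le> R" for n x y R
  proof -
    have "0 \<le> c1 R" using order_trans[OF abs_ge_zero F1b[of x R]] xy by auto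
    have "\<bar>LINT t:{x..y}|lborel. F1 n t\<bar> \<le> (LINT t:{x..y}|lborel. \<bar>F1 n t\<bar>)"
      unfolding set_lebesgue_integral_def
      using integral_norm_bound[of lborel "\<lambda>t. indicator {x..y} t *\<^sub>R F1 n t"] by (simp add: abs_mult)
    also have "\<dots> \<le> (LINT t:{x..y}|lborel. c1 R)"
    proof (rule set_integral_mono[OF set_integrable_abs[OF F1i] cI])
      fix t assume "t \<in> {x..y}"
      then have "\<bar>t\<bar> \<le> R" using xy by auto
      then show "\<bar>F1 n t\<bar> \<le> c1 R" by (rule F1b)
    qed
    also have "\<dots> = (y - x) * c1 R" using xy by (simp add: set_lebesgue_integral_def)
    also have "\<dots> \<le> R * c1 R" using xy \<open>0 \<le> c1 R\<close> by (intro mult_right_mono) auto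
    finally have 1: "\<bar>LINT t:{x..y}|lborel. F1 n t\<bar> \<le> c1 R * R" by (simp add: mult.commute)
    have "C * v1 * s n \<le> C * v1 * sb" using sb C0 v10 by (intro mult_left_mono) auto
    with 1 F2b[of x y n] show ?thesis unfolding Deq c2_def by linarith
  qed
  have Hstep: "H n y - H n x = D n x y" if "s n * x \<in> I0" "s n * y \<in> I0" "x \<le> y" for n x y
  proof -
    have "H n y - H n x = (LINT t:{x..y}|lborel. (V (s n) t - \<Lambda> n) * u n t)"
      by (rule primitive_onD(2)[OF d(11)]) (use that in auto)
    also have "\<dots> = D n x y"
      unfolding D_def
    proof (rule set_lebesgue_integral_cong)
      show "\<forall>t. t \<in> {x..y} \<longrightarrow> (V (s n) t - \<Lambda> n) * u n t = F1 n t + F2 n t"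
      proof (intro allI impI F)
        fix t assume "t \<in> {x..y}"
        then have "s n * x \<le> s n * t" "s n * t \<le> s n * y" using spos[of n] by auto
        then show "s n * t \<in> I0" using that by auto
      qed
    qed simp
    finally show ?thesis .
  qed
  obtain N1 where N1: "\<And>n y. n \<ge> N1 \<Longrightarrow> \<bar>y\<bar> \<le> 1 \<Longrightarrow> s n * y \<in> I0" using eventually_in_I0[OF s0 spos] by blast
  have Dc: "continuous_on {0..1} (\<lambda>t. D n 0 t)" for n
  proof -
    have "primitive_on {0..1} (\<lambda>t. D n 0 t) (\<lambda>t. F1 n t + F2 n t)"
      unfolding D_def by (intro primitive_on_integral_from set_integral_add(1) F1i F2i)
    then show ?thesis using primitive_on_continuous by blast
  qed
  \<comment> \<open>The increments determine \<open>H n\<close> only up to a constant. The constant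
    is recovered from u n 1 - u n 0, which is \<open>H n 0\<close> plus the integral of the
    increments over [0, 1].\<close>
  define h0 where "h0 = U 1 - U 0 - (LINT t:{0..1}|lborel. D' 0 t)"
  have H0lim: "(\<lambda>n. H n 0) \<longlonglongrightarrow> h0"
  proof (rule tendsto_offset_iff)
    have "(\<lambda>n. LINT t:{0..1}|lborel. D n 0 t) \<longlonglongrightarrow> (LINT t:{0..1}|lborel. D' 0 t)"
    proof (rule set_integral_tendsto_bounded(1)[OF cI[of 0 1 "c2 1"]])
      show "set_borel_measurable lborel {0..1} (\<lambda>t. D n 0 t)" for n
        by (intro set_integrable_imp_measurable borel_integrable_atLeastAtMost' Dc)
      show "\<bar>D n 0 t\<bar> \<le> c2 1" if "t \<in> {0..1}" for n t
        by (rule Db) (use that in auto)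
    qed (rule Dlim)
    then show "(\<lambda>n. u n 1 - u n 0 - (LINT t:{0..1}|lborel. D n 0 t)) \<longlonglongrightarrow> h0"
      unfolding h0_def by (intro tendsto_diff ulim)
    show "H n 0 = u n 1 - u n 0 - (LINT t:{0..1}|lborel. D n 0 t)" if n: "n \<ge> N1" for n
    proof -
      have "u n 1 - u n 0 = (LINT t:{0..1}|lborel. H n t)"
        by (rule primitive_onD(2)[OF d(10)]) (use N1[OF n, of 0] N1[OF n, of 1] in auto)
      also have "\<dots> = (LINT t:{0..1}|lborel. H n 0 + D n 0 t)"
      proof (rule set_lebesgue_integral_cong)
        show "\<forall>t. t \<in> {0..1} \<longrightarrow> H n t = H n 0 + D n 0 t"
        proof (intro allI impI)
          fix t :: real assume "t \<in> {0..1}"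
          then show "H n t = H n 0 + D n 0 t"
            using Hstep[of n 0 t] N1[OF n, of 0] N1[OF n, of t] by auto
        qed
      qed simp
      also have "\<dots> = (LINT t:{0..1::real}|lborel. H n 0) + (LINT t:{0..1}|lborel. D n 0 t)"
        by (rule set_integral_add(2)[OF cI borel_integrable_atLeastAtMost'[OF Dc]])
      also have "(LINT t:{0..1::real}|lborel. H n 0) = H n 0"
        by (simp add: set_lebesgue_integral_def)
      finally show ?thesis by simp
    qed
  qed
  define H' where "H' t = (if 0 \<le> t then h0 + D' 0 t else h0 - D' t 0)" for t
  \<comment> \<open>Agrees with \<open>H n\<close> inside the stretched interval, but converges at
    every point and for all n, while nothing is known about \<open>H n\<close> outside.\<close>
  define Hn where "Hn n t = (if 0 \<le> t then H n 0 + D n 0 t else H n 0 - D n t 0)" for n t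
  have Hn: "H n t = Hn n t" if "s n * t \<in> I0" for n t
  proof -
    have "s n * 0 \<in> I0" using ab by simp
    then show ?thesis using Hstep[of n 0 t] Hstep[of n t 0] that unfolding Hn_def by (cases "0 \<le> t") auto
  qed
  have Hnlim: "(\<lambda>n. Hn n t) \<longlonglongrightarrow> H' t" for t
    unfolding Hn_def H'_def using H0lim Dlim by (cases "0 \<le> t") (auto intro: tendsto_add tendsto_diff)
  have Hlim: "(\<lambda>n. H n t) \<longlonglongrightarrow> H' t" for t
  proof -
    obtain N where N: "\<And>n y. n \<ge> N \<Longrightarrow> \<bar>y\<bar> \<le> \<bar>t\<bar> \<Longrightarrow> s n * y \<in> I0" using eventually_in_I0[OF s0 spos] by blast
    show ?thesis by (rule tendsto_offset_iff[OF Hn Hnlim]) (use N[of _ t] in auto)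
  qed
  have pH': "primitive_on UNIV H' (\<lambda>x. (q x - l) * U x)"
    unfolding primitive_on_def
  proof (intro ballI impI conjI)
    fix x y :: real assume xy: "x \<le> y"
    show "set_integrable lborel {x..y} (\<lambda>x. (q x - l) * U x)" using Gi unfolding G_def .
    obtain N where N: "\<And>n z. n \<ge> N \<Longrightarrow> \<bar>z\<bar> \<le> \<bar>x\<bar> + \<bar>y\<bar> \<Longrightarrow> s n * z \<in> I0" using eventually_in_I0[OF s0 spos] by blast
    have "(\<lambda>n. H n y - H n x) \<longlonglongrightarrow> D' x y"
      by (rule tendsto_offset_iff[OF Hstep Dlim]) (use N[of _ x] N[of _ y] xy in auto)
    moreover have "(\<lambda>n. H n y - H n x) \<longlonglongrightarrow> H' y - H' x" by (intro tendsto_diff Hlim)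
    ultimately show "H' y - H' x = (LINT t:{x..y}|lborel. (q t - l) * U t)"
      using LIMSEQ_unique unfolding D'_def G_def by blast
  qed
  have H'c: "continuous_on UNIV H'" by (rule primitive_on_continuous_UNIV[OF pH'])
  have H'm [measurable]: "H' \<in> borel_measurable borel" by (rule borel_measurable_continuous_onI[OF H'c])
  obtain hb where hb: "\<And>n. \<bar>H n 0\<bar> \<le> hb"
    using convergent_imp_Bseq[OF convergentI[OF H0lim]] unfolding Bseq_def by (metis real_norm_def)
  have pU: "primitive_on UNIV U H'"
    unfolding primitive_on_def
  proof (intro ballI impI conjI)
    fix x y :: real assume xy: "x \<le> y"
    show "set_integrable lborel {x..y} H'"
      by (rule borel_integrable_atLeastAtMost'[OF continuous_on_subset[OF H'c]]) simp
    define R where "R = \<bar>x\<bar> + \<bar>y\<bar>"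
    obtain N where N: "\<And>n z. n \<ge> N \<Longrightarrow> \<bar>z\<bar> \<le> R \<Longrightarrow> s n * z \<in> I0" using eventually_in_I0[OF s0 spos] by blast
    \<comment> \<open>Dominated convergence wants integrability for every index, so the finitely
      many n for which [x, y] is not yet inside the stretched interval are dropped.\<close>
    have eq: "u (n + N) y - u (n + N) x = (LINT t:{x..y}|lborel. H (n + N) t)"
      and i: "set_integrable lborel {x..y} (H (n + N))" for n
      using primitive_onD[OF d(10)[of "n + N"], of x y] N[of "n + N" x] N[of "n + N" y] xy
      by (auto simp: R_def)
    have "(\<lambda>n. LINT t:{x..y}|lborel. H (n + N) t) \<longlonglongrightarrow> (LINT t:{x..y}|lborel. H' t)"
    proof (rule set_integral_tendsto_bounded(1)[OF cI[of x y "hb + c2 R"]])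
      show "set_borel_measurable lborel {x..y} (H (n + N))" for n by (rule set_integrable_imp_measurable[OF i])
      show "(\<lambda>n. H (n + N) t) \<longlonglongrightarrow> H' t" for t by (rule LIMSEQ_ignore_initial_segment[OF Hlim])
      show "\<bar>H (n + N) t\<bar> \<le> hb + c2 R" if t: "t \<in> {x..y}" for n t
      proof -
        have tR: "\<bar>t\<bar> \<le> R" using t by (auto simp: R_def)
        have "\<bar>D (n + N) 0 t\<bar> \<le> c2 R" if "0 \<le> t" by (rule Db) (use that tR in auto)
        moreover have "\<bar>D (n + N) t 0\<bar> \<le> c2 R" if "\<not> 0 \<le> t" by (rule Db) (use that tR in auto)
        ultimately have "\<bar>Hn (n + N) t\<bar> \<le> hb + c2 R"
          using hb[of "n + N"] unfolding Hn_def by (cases "0 \<le> t") auto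
        then show ?thesis using Hn[OF N[OF _ tR], of "n + N"] by simp
      qed
    qed
    then have "(\<lambda>n. u (n + N) y - u (n + N) x) \<longlonglongrightarrow> (LINT t:{x..y}|lborel. H' t)" unfolding eq .
    moreover have "(\<lambda>n. u (n + N) y - u (n + N) x) \<longlonglongrightarrow> U y - U x"
      by (intro tendsto_diff LIMSEQ_ignore_initial_segment[OF ulim])
    ultimately show "U y - U x = (LINT t:{x..y}|lborel. H' t)" using LIMSEQ_unique by blast
  qed
  \<comment> \<open>the limit has finite energy by Fatou's lemma\<close>
  have Hlim2: "(\<lambda>n. indicator I0 (s n * t) * (H n t * H n t)) \<longlonglongrightarrow> H' t * H' t" for t
  proof -
    obtain N where N: "\<And>n y. n \<ge> N \<Longrightarrow> \<bar>y\<bar> \<le> \<bar>t\<bar> \<Longrightarrow> s n * y \<in> I0" using eventually_in_I0[OF s0 spos] by blast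
    show ?thesis
      by (rule tendsto_offset_iff[where N = N and Y = "\<lambda>n. H n t * H n t"]) (use N[of _ t] Hlim in \<open>auto intro: tendsto_mult\<close>)
  qed
  have H'i: "integrable lborel (\<lambda>t. H' t * H' t)"
    by (rule integrable_limit_bounded(1)[OF d(12) _ Hlim2 order_trans[OF d(13) \<Lambda>L]]) simp
  have uu1: "(LINT x|lborel. u n x * u n x) = 1" for n using d(7)[of n] by (simp add: ipl_eq)
  have Ui: "integrable lborel (\<lambda>t. U t * U t)"
  proof (rule integrable_limit_bounded(1))
    show "integrable lborel (\<lambda>t. u n t * u n t)" for n by (rule L2_UNIV_integrable_mult[OF d(6) d(6)])
    show "(LINT x|lborel. u n x * u n x) \<le> 1" for n using uu1 by simp
  qed (auto intro: tendsto_mult ulim)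
  have pb: "(LINT y|lborel. \<bar>y\<bar> powr m * (u n y * u n y)) \<le> L / k0" for n
  proof -
    have "k0 * (LINT y|lborel. \<bar>y\<bar> powr m * (u n y * u n y)) \<le> L" by (rule order_trans[OF d(9) \<Lambda>L])
    then show ?thesis using k0 by (simp add: field_simps)
  qed
  have Upow: "integrable lborel (\<lambda>t. \<bar>t\<bar> powr m * (U t * U t))"
    and Upowb: "(LINT t|lborel. \<bar>t\<bar> powr m * (U t * U t)) \<le> L / k0"
  proof -
    have lim: "(\<lambda>n. \<bar>t\<bar> powr m * (u n t * u n t)) \<longlonglongrightarrow> \<bar>t\<bar> powr m * (U t * U t)" for t
      by (intro tendsto_mult tendsto_const ulim)
    note T = integrable_limit_bounded[OF d(8) _ lim pb]
    show "integrable lborel (\<lambda>t. \<bar>t\<bar> powr m * (U t * U t))" by (rule T(1)) simp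
    show "(LINT t|lborel. \<bar>t\<bar> powr m * (U t * U t)) \<le> L / k0" by (rule T(2)) simp
  qed
  have UL: "U \<in> L2 UNIV" and H'L: "H' \<in> L2 UNIV"
    using Ui H'i by (simp_all add: L2_def set_borel_measurable_def set_integrable_def power2_eq_square)
  have qU: "integrable lborel (\<lambda>x. q x * (U x * U x))"
  proof (rule Bochner_Integration.integrable_bound)
    show "integrable lborel (\<lambda>x. max \<kappa>p \<kappa>m * (\<bar>x\<bar> powr m * (U x * U x)))" by (rule integrable_mult_right[OF Upow])
    show "(\<lambda>x. q x * (U x * U x)) \<in> borel_measurable lborel" by measurable
    have "q x * (U x * U x) \<le> max \<kappa>p \<kappa>m * \<bar>x\<bar> powr m * (U x * U x)" for x
      by (intro mult_right_mono q_le) simp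
    then have "\<bar>q x * (U x * U x)\<bar> \<le> \<bar>max \<kappa>p \<kappa>m * (\<bar>x\<bar> powr m * (U x * U x))\<bar>" for x
      using q_nonneg[of x] by (simp add: mult.assoc order_trans[OF _ abs_ge_self])
    then show "AE x in lborel. norm (q x * (U x * U x)) \<le> norm (max \<kappa>p \<kappa>m * (\<bar>x\<bar> powr m * (U x * U x)))"
      by (intro AE_I2) (simp only: real_norm_def)
  qed
  have "solution l U H'" unfolding solution_def finite_energy_def using pU UL H'L qU pH' by blast
  then show "\<exists>H'. solution l U H'" by blast
  \<comment> \<open>\<open>L\<^sup>2\<close> convergence: dominated convergence on bounded intervals, and a uniform bound for the tails\<close>
  have e0: "(\<lambda>n. ipl (\<lambda>x. u n x - U x) (\<lambda>x. u n x - U x)) \<longlonglongrightarrow> 0"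
  proof (rule LIMSEQ_I)
    fix e :: real assume e: "e > 0"
    \<comment> \<open>R is chosen with R powr m = X. Outside [-R, R] the squared difference is at
      most 2 / R powr m times the weighted masses, which are at most L / k0 each; this adds up to (e
      / 2) L / (L + 1). The summand 1 covers L = 0.\<close>
    define X where "X = 8 * (L + 1) / (k0 * e)"
    have X: "X > 0" using L0 k0 e by (simp add: X_def)
    define R where "R = X powr (1 / m)"
    have R: "R > 0" "R powr m = X"
      using X m by (simp_all add: R_def powr_powr)
    define loc where "loc n = (LINT x:{-R..R}|lborel. (u n x - U x) * (u n x - U x))" for n
    have "loc \<longlonglongrightarrow> (LINT x:{-R..R}|lborel. 0)"
      unfolding loc_def[abs_def]
    proof (rule set_integral_tendsto_bounded(1)[OF cI[of "-R" R "(2 * C) * (2 * C)"]])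
      show "set_borel_measurable lborel {-R..R} (\<lambda>x. (u n x - U x) * (u n x - U x))" for n
        by (rule set_borel_measurable_if_borel) auto
      show "(\<lambda>n. (u n x - U x) * (u n x - U x)) \<longlonglongrightarrow> 0" for x
      proof -
        have "(\<lambda>n. u n x - U x) \<longlonglongrightarrow> 0" using tendsto_diff[OF ulim[of x] tendsto_const[of "U x"]] by simp
        from tendsto_mult[OF this this] show ?thesis by simp
      qed
      show "\<bar>(u n x - U x) * (u n x - U x)\<bar> \<le> (2 * C) * (2 * C)" for n x
        unfolding abs_mult using ub[of n x] Ub[of x] C0 by (intro mult_mono) auto
    qed
    then have "loc \<longlonglongrightarrow> 0" by simp
    then obtain N where N: "\<And>n. n \<ge> N \<Longrightarrow> loc n < e / 2"
      using order_tendstoD(2)[of loc 0 sequentially "e / 2"] e by (auto simp: eventually_sequentially)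
    have "ipl (\<lambda>x. u n x - U x) (\<lambda>x. u n x - U x) < e" if n: "n \<ge> N" for n
    proof -
      let ?p = "\<lambda>x. \<bar>x\<bar> powr m * (u n x * u n x) + \<bar>x\<bar> powr m * (U x * U x)"
      have p0: "0 \<le> ?p x" for x by (intro add_nonneg_nonneg mult_nonneg_nonneg[OF powr_ge_zero] zero_le_square)
      have pt: "(u n x - U x) * (u n x - U x) \<le> indicator {-R..R} x * ((u n x - U x) * (u n x - U x)) + 2 / R powr m * ?p x" for x
      proof (cases "x \<in> {-R..R}")
        case True
        have "0 \<le> 2 / R powr m * ?p x" using R(1) p0[of x] by (intro mult_nonneg_nonneg) auto
        then show ?thesis using True by simp
      next
        case False
        then have "R powr m \<le> \<bar>x\<bar> powr m" using R(1) m by (intro powr_mono2) auto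
        then have "1 \<le> \<bar>x\<bar> powr m / R powr m" using R(1) by simp
        then have "1 * (2 * (u n x * u n x + U x * U x)) \<le> (\<bar>x\<bar> powr m / R powr m) * (2 * (u n x * u n x + U x * U x))"
          by (intro mult_right_mono) auto
        moreover have "(u n x - U x) * (u n x - U x) \<le> 2 * (u n x * u n x + U x * U x)"
          using zero_le_square[of "u n x + U x"] by (simp add: algebra_simps)
        ultimately show ?thesis using False by (simp add: algebra_simps add_divide_distrib)
      qed
      have di: "integrable lborel (\<lambda>x. (u n x - U x) * (u n x - U x))"
        by (intro L2_UNIV_integrable_mult L2_diff d(6) UL)
      have i1: "integrable lborel (\<lambda>x. indicator {-R..R} x * ((u n x - U x) * (u n x - U x)))"
        using integrable_mult_indicator[OF _ di, of "{-R..R}"] by simp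
      have i2: "integrable lborel (\<lambda>x. 2 / R powr m * ?p x)"
        by (intro integrable_mult_right Bochner_Integration.integrable_add d(8) Upow)
      have "ipl (\<lambda>x. u n x - U x) (\<lambda>x. u n x - U x) \<le> (LINT x|lborel. indicator {-R..R} x * ((u n x - U x) * (u n x - U x)) + 2 / R powr m * ?p x)"
        unfolding ipl_eq by (rule integral_mono[OF di Bochner_Integration.integrable_add[OF i1 i2] pt])
      also have "\<dots> = loc n + (LINT x|lborel. 2 / R powr m * ?p x)"
        unfolding Bochner_Integration.integral_add[OF i1 i2] by (simp add: loc_def set_lebesgue_integral_def)
      also have "(LINT x|lborel. 2 / R powr m * ?p x) = 2 / R powr m * (LINT x|lborel. ?p x)"
        by (rule integral_mult_right_zero)
      also have "(LINT x|lborel. ?p x) = (LINT x|lborel. \<bar>x\<bar> powr m * (u n x * u n x)) + (LINT x|lborel. \<bar>x\<bar> powr m * (U x * U x))"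
        by (rule Bochner_Integration.integral_add[OF d(8) Upow])
      also have "2 / R powr m * \<dots> \<le> 2 / R powr m * (L / k0 + L / k0)"
        using R(1) by (intro mult_left_mono add_mono pb Upowb) auto
      also have "\<dots> = (e / 2) * (L / (L + 1))"
        unfolding R(2) X_def using k0 e L0 by (simp add: field_simps)
      also have "\<dots> \<le> (e / 2) * 1" using e L0 by (intro mult_left_mono) auto
      finally show ?thesis using N[OF n] by linarith
    qed
    then show "\<exists>N. \<forall>n\<ge>N. norm (ipl (\<lambda>x. u n x - U x) (\<lambda>x. u n x - U x) - 0) < e"
      using L2_inner_nonneg by (intro exI[of _ N]) simp
  qed
  have nlim: "(\<lambda>n. L2_norm UNIV (\<lambda>x. u n x - U x)) \<longlonglongrightarrow> 0"
    using tendsto_real_sqrt[OF e0] by (simp add: L2_norm_def[abs_def])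
  show conv: "(\<lambda>n. ipl (u n) f) \<longlonglongrightarrow> ipl U f" if "f \<in> L2 UNIV" for f
    by (rule L2_inner_tendsto[OF d(6) UL that nlim])
  \<comment> \<open>The left side tends to 0 and the right side to 1 - ipl U U; so the limit keeps
    norm 1.\<close>
  have eq: "ipl (\<lambda>x. u n x - U x) (\<lambda>x. u n x - U x) = 1 - 2 * ipl (u n) U + ipl U U" for n
    using L2_inner_add_cmult[OF d(6) UL, of n "-1"] d(7)[of n] by simp
  have "(\<lambda>n. ipl (\<lambda>x. u n x - U x) (\<lambda>x. u n x - U x)) \<longlonglongrightarrow> 1 - 2 * ipl U U + ipl U U"
    unfolding eq by (intro tendsto_intros conv UL)
  from LIMSEQ_unique[OF e0 this] show "ipl U U = 1" by simp
qed

text \<open>Two successive subsequences: one for the bounded stretched eigenvalues, and one, by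
  equicontinuity, for the functions. Everything else is \<open>solutions_limit\<close>.\<close>

lemma solutions_compact:
  fixes s \<Lambda> :: "nat \<Rightarrow> real" and u H :: "nat \<Rightarrow> real \<Rightarrow> real"
  assumes sc: "\<And>n. scaled (s n) (\<Lambda> n) (u n) (H n)" and s0: "s \<longlonglongrightarrow> 0" and \<Lambda>L: "\<And>n. \<Lambda> n \<le> L"
  shows "\<exists>r l U H'. strict_mono (r :: nat \<Rightarrow> nat) \<and> (\<lambda>n. \<Lambda> (r n)) \<longlonglongrightarrow> l \<and> solution l U H' \<and> ipl U U = 1 \<and>
    (\<forall>f\<in>L2 UNIV. (\<lambda>n. ipl (u (r n)) f) \<longlonglongrightarrow> ipl U f)"
proof -
  note d = scaledD[OF sc]
  have "bounded (range \<Lambda>)" using d(2) \<Lambda>L by (intro boundedI[of _ L]) auto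
  then obtain l r1 where r1: "strict_mono r1" "(\<Lambda> \<circ> r1) \<longlonglongrightarrow> l"
    using bounded_imp_convergent_subsequence by blast
  have b: "\<bar>u (r1 n) x\<bar> \<le> sqrt L + 1" for n x by (rule scaled_bound[OF sc \<Lambda>L])
  have h: "(u (r1 n) x - u (r1 n) y)\<^sup>2 \<le> L * \<bar>x - y\<bar>" for n x y
    using d(4)[of "r1 n" x y] mult_left_mono[OF \<Lambda>L[of "r1 n"], of "\<bar>x - y\<bar>"] by (simp add: mult.commute)
  obtain r2 U where r2: "strict_mono r2" "\<And>x. (\<lambda>n. u (r1 (r2 n)) x) \<longlonglongrightarrow> U x"
    by (rule pointwise_convergent_subsequence[of "\<lambda>n. u (r1 n)", OF b h], rule that)
  define r where "r = r1 \<circ> r2"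
  have r: "strict_mono r" unfolding r_def by (rule strict_mono_o[OF r1(1) r2(1)])
  have \<Lambda>lim: "(\<lambda>n. \<Lambda> (r n)) \<longlonglongrightarrow> l" using LIMSEQ_subseq_LIMSEQ[OF r1(2) r2(1)] by (simp add: r_def o_def)
  have slim: "(\<lambda>n. s (r n)) \<longlonglongrightarrow> 0" using LIMSEQ_subseq_LIMSEQ[OF s0 r] by (simp add: o_def)
  have ulim: "(\<lambda>n. u (r n) x) \<longlonglongrightarrow> U x" for x using r2(2) by (simp add: r_def)
  note T = solutions_limit[of "\<lambda>n. s (r n)" "\<lambda>n. \<Lambda> (r n)" "\<lambda>n. u (r n)" "\<lambda>n. H (r n)", OF sc slim \<Lambda>L \<Lambda>lim ulim]
  obtain H' where "solution l U H'" using T(1) by blast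
  then show ?thesis using r \<Lambda>lim T(2,3) by blast
qed

end

section \<open>Convergence of the eigenfunctions\<close>

text \<open>The families are indexed by the stretching factor s instead of \<epsilon>; the theorem
  inserts \<epsilon> = s powr ((m + 2) / 2).\<close>

locale semiclassical_eigen = semiclassical_limit +
  fixes lam :: "real \<Rightarrow> nat \<Rightarrow> real" and \<Psi> :: "real \<Rightarrow> nat \<Rightarrow> real \<Rightarrow> real"
    and mu :: "nat \<Rightarrow> real" and X :: "nat \<Rightarrow> real \<Rightarrow> real"
  assumes E: "\<And>s. s > 0 \<Longrightarrow>
      eigen_enumeration I0 (form_operator I0 (H10 I0) (schroedinger_form I0 (W s))) (lam s) (\<Psi> s)"
    and EX: "eigen_enumeration UNIV (form_operator UNIV fdom QL) mu X"
begin

definition good :: "real \<Rightarrow> nat \<Rightarrow> (real \<Rightarrow> real) \<Rightarrow> (real \<Rightarrow> real) \<Rightarrow> bool" where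
  "good s i u H \<longleftrightarrow> scaled s (s\<^sup>2 * lam s i) u H \<and>
     (AE x in lborel. x \<in> I0 \<longrightarrow> \<Psi> s i x = u (x / s) / sqrt s) \<and>
     (\<forall>f. f \<in> borel_measurable borel \<longrightarrow>
       (LINT x:I0|lborel. \<Psi> s i x * (f (x / s) / sqrt s)) = (LINT y|lborel. u y * f y))"

text \<open>Choice fixes one continuous stretched representative for each s and i, so that sequences
  of them can be formed along any s tending to 0.\<close>

definition us :: "real \<Rightarrow> nat \<Rightarrow> real \<Rightarrow> real" where
  "us s i = (SOME u. \<exists>H. good s i u H)"

definition Xs :: "nat \<Rightarrow> real \<Rightarrow> real" where
  "Xs i = (SOME U. \<exists>H. solution (mu i) U H \<and> (AE x in lborel. X i x = U x))"

lemma good_us: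
  assumes s: "s > 0" and i: "i \<ge> 1"
  shows "\<exists>H. good s i (us s i) H"
proof -
  interpret schroedinger_interval "-a" b "W s" by (rule interval[OF s])
  note d = eigen_enumerationD[OF E[OF s] i]
  have "\<exists>u H. good s i u H"
    by (rule scaled_eigenfunction[OF s d(5) d(3)]) (auto simp: good_def)
  then show ?thesis unfolding us_def by (rule someI_ex)
qed

lemma usD:
  assumes s: "s > 0" and i: "i \<ge> 1"
  shows "us s i \<in> L2 UNIV" "us s i \<in> borel_measurable borel" "0 \<le> lam s i"
    "\<exists>H. scaled s (s\<^sup>2 * lam s i) (us s i) H"
    "f \<in> borel_measurable borel \<Longrightarrow>
       (LINT x:I0|lborel. \<Psi> s i x * (f (x / s) / sqrt s)) = ipl (us s i) f"
    "AE x in lborel. x \<in> I0 \<longrightarrow> \<Psi> s i x = us s i (x / s) / sqrt s"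
proof -
  obtain H where H: "good s i (us s i) H" using good_us[OF s i] by blast
  then have sc: "scaled s (s\<^sup>2 * lam s i) (us s i) H" by (simp add: good_def)
  note d = scaledD[OF sc]
  show "us s i \<in> L2 UNIV" "us s i \<in> borel_measurable borel" by (rule d(6), rule d(14))
  show "0 \<le> lam s i" using d(2) s by (simp add: zero_le_mult_iff)
  show "\<exists>H. scaled s (s\<^sup>2 * lam s i) (us s i) H" using sc by blast
  show "(LINT x:I0|lborel. \<Psi> s i x * (f (x / s) / sqrt s)) = ipl (us s i) f" if "f \<in> borel_measurable borel"
    using H that by (simp add: good_def ipl_eq)
  show "AE x in lborel. x \<in> I0 \<longrightarrow> \<Psi> s i x = us s i (x / s) / sqrt s" using H by (simp add: good_def)
qed

lemma us_orthonormal: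
  assumes s: "s > 0" and i: "i \<ge> 1" and k: "k \<ge> 1"
  shows "ipl (us s i) (us s k) = (if i = k then 1 else 0)"
proof -
  interpret schroedinger_interval "-a" b "W s" by (rule interval[OF s])
  note di = eigen_enumerationD[OF E[OF s] i] and dk = eigen_enumerationD[OF E[OF s] k]
  have L: "\<Psi> s i \<in> L2 I0" "\<Psi> s k \<in> L2 I0" using H10_L2 di(1) dk(1) by auto
  have m: "set_borel_measurable lborel I0 (\<lambda>x. us s k (x / s) / sqrt s)"
  proof (rule set_borel_measurable_if_borel)
    note [measurable] = usD(2)[OF s k]
    show "(\<lambda>x. us s k (x / s) / sqrt s) \<in> borel_measurable borel" by measurable
  qed simp
  have "ipl (us s i) (us s k) = (LINT x:I0|lborel. \<Psi> s i x * (us s k (x / s) / sqrt s))"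
    by (rule usD(5)[OF s i usD(2)[OF s k], symmetric])
  also have "\<dots> = (LINT x:I0|lborel. \<Psi> s i x * \<Psi> s k x)"
  proof (rule set_integral_cong_AE_weak(1))
    show "AE x in lborel. x \<in> I0 \<longrightarrow> \<Psi> s i x * (us s k (x / s) / sqrt s) = \<Psi> s i x * \<Psi> s k x"
      using usD(6)[OF s k] by eventually_elim auto
  qed (intro set_borel_measurable_mult L2_measurable L m)+
  also have "\<dots> = (if i = k then 1 else 0)"
    using E[OF s] i k unfolding eigen_enumeration_def L2_inner_def by blast
  finally show ?thesis .
qed

lemma XsD:
  assumes i: "i \<ge> 1"
  shows "\<exists>H. solution (mu i) (Xs i) H" "AE x in lborel. X i x = Xs i x" "Xs i \<in> L2 UNIV" "X i \<in> L2 UNIV"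
proof -
  have op: "form_operator UNIV fdom QL (X i) (\<lambda>x. mu i * X i x)"
    using EX i unfolding eigen_enumeration_def by blast
  have "\<exists>U H. solution (mu i) U H \<and> (AE x in lborel. X i x = U x)"
    by (rule eigenfunction_solution[OF op]) blast
  then have "\<exists>H. solution (mu i) (Xs i) H \<and> (AE x in lborel. X i x = Xs i x)"
    unfolding Xs_def by (rule someI_ex)
  then obtain H where H: "solution (mu i) (Xs i) H" and ae: "AE x in lborel. X i x = Xs i x" by blast
  then show "\<exists>H. solution (mu i) (Xs i) H" "AE x in lborel. X i x = Xs i x" by blast+
  show "Xs i \<in> L2 UNIV" by (rule finite_energyD(2)[OF solutionD(1)[OF H]])
  have "X i \<in> H1 UNIV" using op unfolding form_operator_def by blast
  then show "X i \<in> L2 UNIV" by (rule H1_weak_deriv) auto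
qed

lemma ipl_X:
  assumes "i \<ge> 1" "f \<in> L2 UNIV"
  shows "ipl (X i) f = ipl (Xs i) f"
proof (rule L2_inner_cong_AE)
  show "AE x in lborel. x \<in> UNIV \<longrightarrow> X i x = Xs i x"
    using XsD(2)[OF assms(1)] by eventually_elim auto
qed (use XsD[OF assms(1)] assms in auto)

lemma Xs_orthonormal:
  assumes i: "i \<ge> 1" and k: "k \<ge> 1"
  shows "ipl (Xs i) (Xs k) = (if i = k then 1 else 0)"
proof -
  have "ipl (Xs i) (Xs k) = ipl (X i) (X k)"
    using ipl_X[OF i XsD(3)[OF k]] ipl_X[OF k XsD(4)[OF i]] by (simp add: L2_inner_commute)
  also have "\<dots> = (if i = k then 1 else 0)" using EX i k unfolding eigen_enumeration_def by blast
  finally show ?thesis .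
qed

lemma mu_mono: "1 \<le> i \<Longrightarrow> i \<le> k \<Longrightarrow> mu i \<le> mu k"
  using EX unfolding eigen_enumeration_def by blast

lemma Xs_exhaustive:
  assumes U: "solution l U H" and perp: "\<And>i. i \<ge> 1 \<Longrightarrow> ipl (Xs i) U = 0"
  shows "ipl U U = 0"
proof -
  have UL: "U \<in> L2 UNIV" by (rule finite_energyD(2)[OF solutionD(1)[OF U]])
  have "\<forall>i\<ge>1. ipl (X i) U = 0" using ipl_X[OF _ UL] perp by simp
  then have "L2_norm UNIV U = 0"
    using EX solution_eigenfunction[OF U] unfolding eigen_enumeration_def by blast
  then show ?thesis using L2_norm_square[of UNIV U] by simp
qed

text \<open>As x is orthogonal to f, the inner product of u with f does not change when x is added
  or subtracted; with the right sign the sum has squared norm 2 - 2 |ipl u x|, and Cauchy-Schwarz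
  applies. The bound is insensitive to signs, so it works before any sign of an eigenfunction is
  fixed. It serves in both directions: for \<open>us\<close> near \<open>Xs\<close> against the
  trial function, and with the roles exchanged.\<close>

lemma unit_vectors_close:
  assumes L: "u \<in> L2 UNIV" "x \<in> L2 UNIV" "f \<in> L2 UNIV" and 1: "ipl u u = 1" "ipl x x = 1" and 0: "ipl x f = 0"
  shows "(ipl u f)\<^sup>2 \<le> (2 - 2 * \<bar>ipl u x\<bar>) * ipl f f"
proof -
  define \<sigma> :: real where "\<sigma> = (if 0 \<le> ipl u x then - 1 else 1)"
  have \<sigma>: "2 * ipl u x * \<sigma> = - 2 * \<bar>ipl u x\<bar>" "\<sigma>\<^sup>2 = 1" by (auto simp: \<sigma>_def)
  have "ipl (\<lambda>y. u y + \<sigma> * x y) f = ipl u f"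
    using L2_inner_add_left[OF L(1) L2_cmult[OF L(2)] L(3)] 0 by (simp add: L2_inner_cmult_left)
  moreover have "ipl (\<lambda>y. u y + \<sigma> * x y) (\<lambda>y. u y + \<sigma> * x y) = 2 - 2 * \<bar>ipl u x\<bar>"
    unfolding L2_inner_add_cmult[OF L(1,2)] 1 \<sigma> by simp
  ultimately show ?thesis
    using L2_Cauchy_Schwarz_square[OF L2_add[OF L(1) L2_cmult[OF L(2)]] L(3), of \<sigma>] by simp
qed

text \<open>\<open>min_max_projected\<close> for w compressed to x = s y and multiplied by s^2; the
  condition on s R keeps the compressed support inside I0. The last summand is the contribution of
  v, of order s. The integrability assertion provides the dominating function for the limit of the
  potential term.\<close>

lemma trial_bound:
  assumes s: "s > 0" and R: "s * R < min a b" and j: "j \<ge> 1"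
    and w: "primitive_on UNIV w k" "continuous_on UNIV k" "k \<in> L2 UNIV"
    and w0: "\<And>y. \<bar>y\<bar> \<ge> R \<Longrightarrow> w y = 0" and wC: "\<And>y. \<bar>w y\<bar> \<le> C"
  shows "s\<^sup>2 * lam s j * (ipl w w - (\<Sum>i\<in>{1..<j}. (ipl (us s i) w)\<^sup>2)) \<le>
     ipl k k + (LINT y|lborel. K' (s * y) * \<bar>y\<bar> powr m * (w y * w y)) + C * C * (LINT x:I0|lborel. v x) * s"
    and "integrable lborel (\<lambda>y. k1 * (\<bar>y\<bar> powr m * (w y * w y)))"
proof -
  interpret schroedinger_interval "-a" b "W s" by (rule interval[OF s])
  have wc: "continuous_on UNIV w" by (rule primitive_on_continuous_UNIV[OF w(1)])
  have [measurable]: "w \<in> borel_measurable borel" "k \<in> borel_measurable borel"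
    using wc w(2) by (auto intro: borel_measurable_continuous_onI)
  have wI: "w (x / s) = 0" if "x \<notin> I0" for x
  proof (rule w0)
    have "min a b \<le> \<bar>x\<bar>" using that ab by auto
    then have "s * R \<le> \<bar>x\<bar>" using R by linarith
    then show "R \<le> \<bar>x / s\<bar>" using s by (simp add: field_simps)
  qed
  define ws where "ws x = w (x / s) / sqrt s" for x
  define ks where "ks x = k (x / s) / (s * sqrt s)" for x
  have ss: "sqrt s * sqrt s = s" using s by simp
  have p: "primitive_on {-a..b} ws ks"
  proof -
    have "1 / s > 0" using s by simp
    from primitive_on_cmult[OF primitive_on_scale[OF w(1) this], of "1 / sqrt s"]
    have "primitive_on UNIV ws ks" by (simp add: ws_def[abs_def] ks_def[abs_def] field_simps)
    then show ?thesis by (rule primitive_on_mono) simp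
  qed
  have ksc: "continuous_on {-a..b} ks"
    unfolding ks_def using s by (intro continuous_intros continuous_on_compose2[OF w(2)]) auto
  have bc: "ws (-a) = 0" "ws b = 0" using wI[of "-a"] wI[of b] by (simp_all add: ws_def)
  have wsI: "(\<lambda>x. indicator I0 x * ws x) = ws"
  proof
    fix x
    show "indicator I0 x * ws x = ws x" using wI[of x] by (cases "x \<in> I0") (auto simp: ws_def)
  qed
  have e: "elem ws ws ks" using elem_C1[OF p ksc bc] unfolding wsI .
  note e' = elemD[OF e]
  have mm: "lam s j * (ip ws ws - (\<Sum>i\<in>{1..<j}. (ip (\<Psi> s i) ws)\<^sup>2)) \<le> Q ws ws"
    by (rule min_max_projected[OF E[OF s] j e'(1)])
  have restrict: "(LINT x:I0|lborel. f x * ws x) = (LINT x|lborel. f x * ws x)" for f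
    unfolding set_lebesgue_integral_def
  proof (rule Bochner_Integration.integral_cong[OF refl])
    fix x show "indicator I0 x *\<^sub>R (f x * ws x) = f x * ws x"
      using wI[of x] by (cases "x \<in> I0") (auto simp: ws_def)
  qed
  have ww: "ws (s * y) * ws (s * y) = (w y * w y) / s" for y using s ss by (simp add: ws_def)
  have "ip ws ws = (LINT x|lborel. ws x * ws x)" unfolding L2_inner_def by (rule restrict)
  also have "\<dots> = s * (LINT y|lborel. (w y * w y) / s)" unfolding integral_scale(1)[OF s, of "\<lambda>x. ws x * ws x"] ww ..
  also have "\<dots> = ipl w w" using s by (simp add: ipl_eq)
  finally have n: "ip ws ws = ipl w w" .
  have i: "ip (\<Psi> s i) ws = ipl (us s i) w" if "i \<in> {1..<j}" for i
    using usD(5)[OF s, of i w] that by (simp add: L2_inner_def ws_def)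
  have kI: "integrable lborel (\<lambda>y. k y * k y)" by (rule L2_UNIV_integrable_mult[OF w(3,3)])
  have kk: "s\<^sup>2 * ip ks ks \<le> ipl k k"
  proof -
    have kks: "ks (s * y) * ks (s * y) = (k y * k y) / (s\<^sup>2 * s)" for y
      using s ss by (simp add: ks_def power2_eq_square field_simps)
    have "ip ks ks = s * (LINT y|lborel. indicator I0 (s * y) * ((k y * k y) / (s\<^sup>2 * s)))"
      unfolding L2_inner_def set_lebesgue_integral_def real_scaleR_def
      using integral_scale(1)[OF s, of "\<lambda>x. indicator I0 x * (ks x * ks x)"] by (simp only: kks)
    also have "\<dots> = (LINT y|lborel. indicator I0 (s * y) * (k y * k y)) / s\<^sup>2"
    proof -
      have "(\<lambda>y. indicator I0 (s * y) * ((k y * k y) / (s\<^sup>2 * s))) = (\<lambda>y. (indicator I0 (s * y) * (k y * k y)) / (s\<^sup>2 * s))"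
        by (rule ext) simp
      then show ?thesis using s by simp
    qed
    finally have "s\<^sup>2 * ip ks ks = (LINT y|lborel. indicator I0 (s * y) * (k y * k y))" using s by simp
    also have "\<dots> \<le> (LINT y|lborel. k y * k y)"
    proof (rule integral_mono[OF _ kI])
      show "integrable lborel (\<lambda>y. indicator I0 (s * y) * (k y * k y))"
        by (rule Bochner_Integration.integrable_bound[OF kI]) (auto simp: indicator_def)
    qed (simp add: indicator_def)
    finally show ?thesis by (simp add: ipl_eq)
  qed
  have R0: "w y = 0" if "y \<notin> {-\<bar>R\<bar>..\<bar>R\<bar>}" for y by (rule w0) (use that in auto)
  show kpi: "integrable lborel (\<lambda>y. k1 * (\<bar>y\<bar> powr m * (w y * w y)))"
  proof -
    have "set_integrable lborel {-\<bar>R\<bar>..\<bar>R\<bar>} (\<lambda>y. k1 * (\<bar>y\<bar> powr m * (w y * w y)))"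
      by (intro borel_integrable_atLeastAtMost' continuous_on_mult continuous_on_const continuous_abs_powr continuous_on_subset[OF wc]) auto
    moreover have "(\<lambda>y. indicator {-\<bar>R\<bar>..\<bar>R\<bar>} y *\<^sub>R (k1 * (\<bar>y\<bar> powr m * (w y * w y)))) = (\<lambda>y. k1 * (\<bar>y\<bar> powr m * (w y * w y)))"
    proof
      fix y show "indicator {-\<bar>R\<bar>..\<bar>R\<bar>} y *\<^sub>R (k1 * (\<bar>y\<bar> powr m * (w y * w y))) = k1 * (\<bar>y\<bar> powr m * (w y * w y))"
        using R0[of y] by (cases "y \<in> {-\<bar>R\<bar>..\<bar>R\<bar>}") auto
    qed
    ultimately show ?thesis unfolding set_integrable_def by (simp only:)
  qed
  have kpi': "integrable lborel (\<lambda>y. K' (s * y) * \<bar>y\<bar> powr m * (w y * w y))"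
  proof (rule Bochner_Integration.integrable_bound[OF kpi])
    show "(\<lambda>y. K' (s * y) * \<bar>y\<bar> powr m * (w y * w y)) \<in> borel_measurable lborel" by measurable
    have "\<bar>K' (s * y)\<bar> * (\<bar>y\<bar> powr m * (w y * w y)) \<le> k1 * (\<bar>y\<bar> powr m * (w y * w y))" for y
      by (intro mult_right_mono K'_bound) simp
    then show "AE y in lborel. norm (K' (s * y) * \<bar>y\<bar> powr m * (w y * w y)) \<le> norm (k1 * (\<bar>y\<bar> powr m * (w y * w y)))"
      using k1 by (intro AE_I2) (simp add: abs_mult mult.assoc)
  qed
  have C0: "0 \<le> C" using order_trans[OF abs_ge_zero wC[of 0]] .
  have wwC: "\<bar>w y * w y\<bar> \<le> C * C" for y unfolding abs_mult using wC C0 by (intro mult_mono) auto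
  have "(\<lambda>y. w y * w y) \<in> borel_measurable borel" by measurable
  note vp = v_part_bound[OF s this wwC, of UNIV]
  have "s\<^sup>2 * (LINT x:I0|lborel. W s x * (ws x * ws x)) =
     (LINT y|lborel. K' (s * y) * \<bar>y\<bar> powr m * (w y * w y)) + (LINT y:UNIV|lborel. s\<^sup>2 * (indicator I0 (s * y) * v (s * y)) * (w y * w y))"
  proof -
    have pt: "s * (indicator I0 (s * y) * (W s (s * y) * (ws (s * y) * ws (s * y)))) =
        (K' (s * y) * \<bar>y\<bar> powr m * (w y * w y) + s\<^sup>2 * (indicator I0 (s * y) * v (s * y)) * (w y * w y)) / s\<^sup>2" for y
    proof -
      have "s\<^sup>2 * W s (s * y) = K (s * y) * \<bar>y\<bar> powr m + s\<^sup>2 * v (s * y)" using V_eq[OF s, of y] by (simp add: V_def)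
      then have "W s (s * y) = (K (s * y) * \<bar>y\<bar> powr m + s\<^sup>2 * v (s * y)) / s\<^sup>2" using s by (simp add: field_simps)
      then show ?thesis unfolding ww using s by (simp add: K'_def indicator_def field_simps)
    qed
    have "s * (LINT y|lborel. indicator I0 (s * y) * (W s (s * y) * (ws (s * y) * ws (s * y)))) =
       (LINT y|lborel. (K' (s * y) * \<bar>y\<bar> powr m * (w y * w y) + s\<^sup>2 * (indicator I0 (s * y) * v (s * y)) * (w y * w y)) / s\<^sup>2)"
      unfolding pt[symmetric] by (rule integral_mult_right_zero[symmetric])
    also have "\<dots> = (LINT y|lborel. K' (s * y) * \<bar>y\<bar> powr m * (w y * w y) + s\<^sup>2 * (indicator I0 (s * y) * v (s * y)) * (w y * w y)) / s\<^sup>2"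
      by (rule integral_divide_zero)
    also have "(LINT y|lborel. K' (s * y) * \<bar>y\<bar> powr m * (w y * w y) + s\<^sup>2 * (indicator I0 (s * y) * v (s * y)) * (w y * w y)) =
      (LINT y|lborel. K' (s * y) * \<bar>y\<bar> powr m * (w y * w y)) + (LINT y|lborel. s\<^sup>2 * (indicator I0 (s * y) * v (s * y)) * (w y * w y))"
      by (rule Bochner_Integration.integral_add[OF kpi']) (use vp(1) in \<open>simp add: set_integrable_def\<close>)
    finally show ?thesis
      using s integral_scale(1)[OF s, of "\<lambda>x. indicator I0 x * (W s x * (ws x * ws x))"]
      by (simp add: set_lebesgue_integral_def)
  qed
  moreover have "(LINT y:UNIV|lborel. s\<^sup>2 * (indicator I0 (s * y) * v (s * y)) * (w y * w y)) \<le> C * C * (LINT x:I0|lborel. v x) * s"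
    using vp(2) by simp
  ultimately have pot: "s\<^sup>2 * (LINT x:I0|lborel. W s x * (ws x * ws x)) \<le>
     (LINT y|lborel. K' (s * y) * \<bar>y\<bar> powr m * (w y * w y)) + C * C * (LINT x:I0|lborel. v x) * s" by linarith
  have sum: "(\<Sum>i\<in>{1..<j}. (ip (\<Psi> s i) ws)\<^sup>2) = (\<Sum>i\<in>{1..<j}. (ipl (us s i) w)\<^sup>2)"
    by (intro sum.cong refl) (simp add: i)
  have "s\<^sup>2 * (lam s j * (ip ws ws - (\<Sum>i\<in>{1..<j}. (ip (\<Psi> s i) ws)\<^sup>2))) \<le> s\<^sup>2 * Q ws ws"
    by (intro mult_left_mono mm) simp
  also have "\<dots> = s\<^sup>2 * ip ks ks + s\<^sup>2 * (LINT x:I0|lborel. W s x * (ws x * ws x))"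
    unfolding Q_eq[OF e e] by (rule distrib_left)
  finally show "s\<^sup>2 * lam s j * (ipl w w - (\<Sum>i\<in>{1..<j}. (ipl (us s i) w)\<^sup>2)) \<le>
     ipl k k + (LINT y|lborel. K' (s * y) * \<bar>y\<bar> powr m * (w y * w y)) + C * C * (LINT x:I0|lborel. v x) * s"
    using kk pot unfolding n sum by (simp only: mult.assoc)
qed

text \<open>The absolute value removes the arbitrary sign. Quantifying over all sequences lets the
  induction hypothesis be used along subsequences.\<close>

definition conv :: "nat \<Rightarrow> bool" where
  "conv i \<longleftrightarrow> (\<forall>s :: nat \<Rightarrow> real. (\<forall>n. 0 < s n) \<longrightarrow> s \<longlonglongrightarrow> 0 \<longrightarrow> (\<lambda>n. \<bar>ipl (us (s n) i) (Xs i)\<bar>) \<longlonglongrightarrow> 1)"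

text \<open>Two limits in a fixed order: first the cut-off radius is chosen so large that the
  limiting quotient A N / den N lies below mu j + \<eta>, then s tends to 0 with the trial function
  fixed. The induction hypothesis makes the trial function nearly orthogonal to the lower
  eigenfunctions of the interval problem.\<close>

lemma eigenvalue_upper_bound:
  fixes s :: "nat \<Rightarrow> real"
  assumes j: "j \<ge> 1" and IH: "\<And>i. i \<in> {1..<j} \<Longrightarrow> conv i"
    and s: "\<And>n. 0 < s n" "s \<longlonglongrightarrow> 0" and \<eta>: "\<eta> > 0"
  shows "\<forall>\<^sub>F n in sequentially. (s n)\<^sup>2 * lam (s n) j \<le> mu j + \<eta>"
proof -
  obtain H where sol: "solution (mu j) (Xs j) H" using XsD(1)[OF j] by blast
  define U where "U = Xs j"
  have U: "solution (mu j) U H" and U1: "ipl U U = 1" using sol Xs_orthonormal[OF j j] by (simp_all add: U_def)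
  note E' = finite_energyD[OF solutionD(1)[OF U]]
  define w where "w N x = cutoff (real (Suc N)) x * U x" for N x
  define k where "k N x = cutoff_deriv (real (Suc N)) x * U x + cutoff (real (Suc N)) x * H x" for N x
  note cl = solution_cutoff_limits[OF U, folded w_def k_def]
  have wL: "w N \<in> L2 UNIV" and kL: "k N \<in> L2 UNIV" for N
  proof -
    have p: "real (Suc N) > 0" by simp
    have m: "w N \<in> borel_measurable borel" "k N \<in> borel_measurable borel"
      using cl(2,3) by (auto intro: borel_measurable_continuous_onI)
    have z: "w N x = 0" "k N x = 0" if "x \<notin> {- real (Suc N)..real (Suc N)}" for x
      using that by (auto simp: w_def k_def cutoff_def cutoff_deriv_def)
    have "f \<in> L2 UNIV" if f: "continuous_on UNIV f" "\<And>x. x \<notin> {- real (Suc N)..real (Suc N)} \<Longrightarrow> f x = 0" for f :: "real \<Rightarrow> real"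
    proof -
      have "set_integrable lborel {- real (Suc N)..real (Suc N)} (\<lambda>x. (f x)\<^sup>2)"
        by (intro borel_integrable_atLeastAtMost' continuous_intros continuous_on_subset[OF f(1)]) auto
      then have "set_integrable lborel UNIV (\<lambda>x. (f x)\<^sup>2)"
        by (subst set_integral_restrict(2)[of "{- real (Suc N)..real (Suc N)}"]) (use f(2) in auto)
      then show ?thesis
        using borel_measurable_continuous_onI[OF f(1)] by (simp add: L2_def set_borel_measurable_def)
    qed
    then show "w N \<in> L2 UNIV" "k N \<in> L2 UNIV" using cl(2,3) z by blast+
  qed
  define A where "A N = ipl (k N) (k N) + (LINT x|lborel. q x * (w N x * w N x))" for N
  define B where "B N = ipl (\<lambda>x. w N x - U x) (\<lambda>x. w N x - U x)" for N
  have Alim: "A \<longlonglongrightarrow> mu j" using cl(4) U1 by (simp add: A_def[abs_def] ipl_eq)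
  have Blim: "B \<longlonglongrightarrow> 0" using cl(5) by (simp add: B_def[abs_def] ipl_eq)
  have nlim: "(\<lambda>N. ipl (w N) (w N)) \<longlonglongrightarrow> 1"
  proof -
    have n0: "(\<lambda>N. L2_norm UNIV (\<lambda>x. w N x - U x)) \<longlonglongrightarrow> 0"
      using tendsto_real_sqrt[OF Blim] by (simp add: B_def L2_norm_def[abs_def])
    have 1: "(\<lambda>N. ipl (w N) U) \<longlonglongrightarrow> ipl U U" by (rule L2_inner_tendsto[OF wL E'(2) E'(2) n0])
    have "B N = ipl (w N) (w N) - 2 * ipl (w N) U + ipl U U" for N
      using L2_inner_add_cmult[OF wL E'(2), of N "-1"] by (simp add: B_def)
    then have eq: "ipl (w N) (w N) = B N + 2 * ipl (w N) U - 1" for N using U1 by simp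
    have "(\<lambda>N. B N + 2 * ipl (w N) U - 1) \<longlonglongrightarrow> 0 + 2 * ipl U U - 1" by (intro tendsto_intros Blim 1)
    then show ?thesis unfolding eq using U1 by simp
  qed
  \<comment> \<open>The squared norm of the trial function less the loss caused by cutting off: for
    each of fewer than j indices, (p + r)^2 \<le> 2 p^2 + 2 r^2 contributes at most 2 B N.\<close>
  define den where "den N = ipl (w N) (w N) - 2 * real j * B N" for N
  have "(\<lambda>N. (mu j + \<eta>) * den N - A N) \<longlonglongrightarrow> (mu j + \<eta>) * (1 - 2 * real j * 0) - mu j"
    unfolding den_def by (intro tendsto_intros nlim Blim Alim)
  then have "(\<lambda>N. (mu j + \<eta>) * den N - A N) \<longlonglongrightarrow> \<eta>" by simp
  \<comment> \<open>As N grows, den N tends to 1 and A N to mu j, so the margin tends to \<eta> > 0.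
    From here on N is fixed.\<close>
  from order_tendstoD(1)[OF this \<eta>] obtain N where N: "(mu j + \<eta>) * den N - A N > 0"
    by (auto simp: eventually_sequentially)
  have mu0: "0 \<le> mu j"
  proof -
    have "0 \<le> (LINT x|lborel. q x * (U x * U x))" by (intro integral_nonneg_AE AE_I2) (simp add: q_nonneg)
    then show ?thesis using solution_weak_form[OF U solutionD(1)[OF U]] L2_inner_nonneg[of UNIV H] U1 by simp
  qed
  have A0: "0 \<le> A N"
    unfolding A_def by (intro add_nonneg_nonneg L2_inner_nonneg integral_nonneg_AE AE_I2) (simp add: q_nonneg)
  have den0: "den N > 0"
  proof (rule ccontr)
    assume "\<not> den N > 0"
    then have "(mu j + \<eta>) * den N \<le> 0" using mu0 \<eta> by (intro mult_nonneg_nonpos) auto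
    then show False using N A0 by linarith
  qed
  let ?R = "real (Suc N)"
  have w0: "w N y = 0" if "\<bar>y\<bar> \<ge> ?R" for y
  proof (cases "\<bar>y\<bar> = ?R")
    case True
    then have "(y / ?R)\<^sup>2 = 1" by (simp add: power_divide) (metis power2_abs of_nat_Suc power2_eq_1_iff divide_self_if True nonzero_divide_eq_eq power_not_zero abs_of_nat nat.distinct(1) of_nat_eq_0_iff)
    then show ?thesis by (simp add: w_def cutoff_def)
  next
    case False
    then have "\<not> \<bar>y\<bar> \<le> ?R" using that by linarith
    then show ?thesis by (simp add: w_def cutoff_def del: of_nat_Suc)
  qed
  obtain C where C: "\<And>y. \<bar>w N y\<bar> \<le> C"
  proof -
    have "compact (w N ` {-?R..?R})" using cl(3) continuous_on_subset by (intro compact_continuous_image) blast+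
    then obtain C where C: "\<And>y. y \<in> {-?R..?R} \<Longrightarrow> \<bar>w N y\<bar> \<le> C" by (metis bounded_real compact_imp_bounded imageI)
    have "\<bar>w N y\<bar> \<le> C" for y
    proof (cases "y \<in> {-?R..?R}")
      case False
      then have "w N y = 0" using w0[of y] by auto
      then show ?thesis using C[of 0] by auto
    qed (rule C)
    then show ?thesis using that by blast
  qed
  define rhs where "rhs n = ipl (k N) (k N) + (LINT y|lborel. K' (s n * y) * \<bar>y\<bar> powr m * (w N y * w N y)) + C * C * (LINT x:I0|lborel. v x) * s n" for n
  \<comment> \<open>Subtracts the rest of the failure of orthogonality: twice the bound 2 - 2 |ipl
    (us i) (Xs i)| of \<open>unit_vectors_close\<close> for each i < j. It vanishes in the limit by
    the induction hypothesis.\<close>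
  define dn where "dn n = den N - 4 * (\<Sum>i\<in>{1..<j}. 1 - \<bar>ipl (us (s n) i) (Xs i)\<bar>)" for n
  have "(\<lambda>n. s n * ?R) \<longlonglongrightarrow> 0 * ?R" by (intro tendsto_mult s tendsto_const)
  then have "(\<lambda>n. s n * ?R) \<longlonglongrightarrow> 0" by simp
  from order_tendstoD(2)[OF this, of "min a b"] ab have small: "\<forall>\<^sub>F n in sequentially. s n * ?R < min a b" by simp
  have rhslim: "rhs \<longlonglongrightarrow> A N"
  proof -
    \<comment> \<open>A single index with the support inside I0 is enough, because the dominating
      function does not depend on s.\<close>
    obtain n0 where n0: "s n0 * ?R < min a b" using small by (auto simp: eventually_sequentially)
    note dom = trial_bound(2)[OF s(1) n0 j cl(1,2) kL w0 C]
    have [measurable]: "w N \<in> borel_measurable borel" by (rule borel_measurable_continuous_onI[OF cl(3)])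
    have "(\<lambda>n. LINT y|lborel. K' (s n * y) * \<bar>y\<bar> powr m * (w N y * w N y)) \<longlonglongrightarrow> (LINT y|lborel. q y * (w N y * w N y))"
    proof (rule integral_dominated_convergence[OF _ _ dom])
      show "AE y in lborel. (\<lambda>n. K' (s n * y) * \<bar>y\<bar> powr m * (w N y * w N y)) \<longlonglongrightarrow> q y * (w N y * w N y)"
        by (intro AE_I2 tendsto_mult[OF K'_tendsto tendsto_const] s)
      have "\<bar>K' (s n * y)\<bar> * (\<bar>y\<bar> powr m * (w N y * w N y)) \<le> k1 * (\<bar>y\<bar> powr m * (w N y * w N y))" for n y
        by (intro mult_right_mono K'_bound) simp
      then show "AE y in lborel. norm (K' (s n * y) * \<bar>y\<bar> powr m * (w N y * w N y)) \<le> k1 * (\<bar>y\<bar> powr m * (w N y * w N y))" for n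
        by (intro AE_I2) (simp add: abs_mult mult.assoc)
    qed measurable
    then have "rhs \<longlonglongrightarrow> ipl (k N) (k N) + (LINT y|lborel. q y * (w N y * w N y)) + C * C * (LINT x:I0|lborel. v x) * 0"
      unfolding rhs_def by (intro tendsto_intros s)
    then show ?thesis by (simp add: A_def)
  qed
  have dnlim: "dn \<longlonglongrightarrow> den N"
  proof -
    have "(\<lambda>n. \<bar>ipl (us (s n) i) (Xs i)\<bar>) \<longlonglongrightarrow> 1" if "i \<in> {1..<j}" for i
      using IH[OF that] s unfolding conv_def by blast
    then have "dn \<longlonglongrightarrow> den N - 4 * (\<Sum>i\<in>{1..<j}. 1 - 1)"
      unfolding dn_def by (intro tendsto_diff tendsto_const tendsto_mult tendsto_sum) auto
    then show ?thesis by simp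
  qed
  have "(\<lambda>n. (mu j + \<eta>) * dn n - rhs n) \<longlonglongrightarrow> (mu j + \<eta>) * den N - A N"
    by (intro tendsto_intros dnlim rhslim)
  from order_tendstoD(1)[OF this N] order_tendstoD(1)[OF dnlim den0] small
  show ?thesis
  proof eventually_elim
    case (elim n)
    note sn = s(1)[of n]
    have L0: "0 \<le> (s n)\<^sup>2 * lam (s n) j" using usD(3)[OF sn j] by simp
    have ci: "(ipl (us (s n) i) (w N))\<^sup>2 \<le> 2 * B N + 4 * (1 - \<bar>ipl (us (s n) i) (Xs i)\<bar>)" if i: "i \<in> {1..<j}" for i
    proof -
      have i1: "i \<ge> 1" using i by simp
      note ui = usD(1)[OF sn i1]
      have un: "ipl (us (s n) i) (us (s n) i) = 1" using us_orthonormal[OF sn i1 i1] by simp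
      have "ipl (Xs i) U = 0" using Xs_orthonormal[OF i1 j] i by (simp add: U_def)
      from unit_vectors_close[OF ui XsD(3)[OF i1] E'(2) un _ this] Xs_orthonormal[OF i1 i1]
      have p: "(ipl (us (s n) i) U)\<^sup>2 \<le> 2 - 2 * \<bar>ipl (us (s n) i) (Xs i)\<bar>" using U1 by simp
      have r: "(ipl (us (s n) i) (\<lambda>x. w N x - U x))\<^sup>2 \<le> B N"
        using L2_Cauchy_Schwarz_square[OF ui L2_diff[OF wL E'(2)], of N] un by (simp add: B_def)
      have "ipl (us (s n) i) (w N) = ipl (us (s n) i) U + ipl (us (s n) i) (\<lambda>x. w N x - U x)"
        using L2_inner_diff_left[OF wL E'(2) ui, of N] by (simp add: L2_inner_commute)
      then have "(ipl (us (s n) i) (w N))\<^sup>2 \<le> 2 * (ipl (us (s n) i) U)\<^sup>2 + 2 * (ipl (us (s n) i) (\<lambda>x. w N x - U x))\<^sup>2"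
        using zero_le_power2[of "ipl (us (s n) i) U - ipl (us (s n) i) (\<lambda>x. w N x - U x)"]
        by (simp add: power2_sum power2_diff)
      then show ?thesis using p r by (simp add: algebra_simps)
    qed
    have B0: "0 \<le> B N" unfolding B_def by (rule L2_inner_nonneg)
    have "(\<Sum>i\<in>{1..<j}. (ipl (us (s n) i) (w N))\<^sup>2) \<le> (\<Sum>i\<in>{1..<j}. 2 * B N + 4 * (1 - \<bar>ipl (us (s n) i) (Xs i)\<bar>))"
      by (rule sum_mono) (rule ci)
    also have "\<dots> = real (j - 1) * (2 * B N) + 4 * (\<Sum>i\<in>{1..<j}. 1 - \<bar>ipl (us (s n) i) (Xs i)\<bar>)"
      by (simp only: sum.distrib sum_distrib_left[symmetric]) simp
    also have "\<dots> \<le> real j * (2 * B N) + 4 * (\<Sum>i\<in>{1..<j}. 1 - \<bar>ipl (us (s n) i) (Xs i)\<bar>)"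
      using B0 by (intro add_right_mono mult_right_mono) auto
    finally have "dn n \<le> ipl (w N) (w N) - (\<Sum>i\<in>{1..<j}. (ipl (us (s n) i) (w N))\<^sup>2)"
      unfolding dn_def den_def by simp
    then have "(s n)\<^sup>2 * lam (s n) j * dn n \<le> (s n)\<^sup>2 * lam (s n) j * (ipl (w N) (w N) - (\<Sum>i\<in>{1..<j}. (ipl (us (s n) i) (w N))\<^sup>2))"
      by (rule mult_left_mono[OF _ L0])
    also have "\<dots> \<le> rhs n" unfolding rhs_def by (rule trial_bound(1)[OF sn elim(3) j cl(1,2) kL w0 C])
    also have "\<dots> \<le> (mu j + \<eta>) * dn n" using elim(1) by simp
    finally show "(s n)\<^sup>2 * lam (s n) j \<le> mu j + \<eta>" using elim(2) by simp
  qed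
qed

text \<open>Were the claim false, some subsequence would stay away from 1. The upper bound keeps its
  stretched eigenvalues bounded, so a further subsequence converges to a normalized solution U; that
  U is shown to be X j up to sign, which contradicts the distance.\<close>

lemma conv_step:
  assumes j: "j \<ge> 1" and IH: "\<And>i. i \<in> {1..<j} \<Longrightarrow> conv i"
  shows "conv j"
  unfolding conv_def
proof (intro allI impI)
  fix s :: "nat \<Rightarrow> real" assume s: "\<forall>n. 0 < s n" "s \<longlonglongrightarrow> 0"
  show "(\<lambda>n. \<bar>ipl (us (s n) j) (Xs j)\<bar>) \<longlonglongrightarrow> 1"
  proof (rule ccontr)
    assume "\<not> ?thesis"
    then obtain e where e: "e > 0" "\<not> (\<forall>\<^sub>F n in sequentially. dist \<bar>ipl (us (s n) j) (Xs j)\<bar> 1 < e)"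
      unfolding tendsto_iff by blast
    have "\<exists>r0 :: nat \<Rightarrow> nat. strict_mono r0 \<and> (\<forall>n. \<not> dist \<bar>ipl (us (s (r0 n)) j) (Xs j)\<bar> 1 < e)"
      by (rule not_eventually_sequentiallyD[OF e(2)])
    then obtain r0 where r0: "strict_mono (r0 :: nat \<Rightarrow> nat)" "\<And>n. \<not> dist \<bar>ipl (us (s (r0 n)) j) (Xs j)\<bar> 1 < e"
      by (elim exE conjE) (rule that, assumption, erule spec)
    have s0: "(\<lambda>n. s (r0 n)) \<longlonglongrightarrow> 0" using LIMSEQ_subseq_LIMSEQ[OF s(2) r0(1)] by (simp add: o_def)
    have "\<forall>\<^sub>F n in sequentially. (s (r0 n))\<^sup>2 * lam (s (r0 n)) j \<le> mu j + 1"
      by (rule eigenvalue_upper_bound[OF j IH _ s0]) (use s in auto)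
    then obtain N where N: "\<And>n. n \<ge> N \<Longrightarrow> (s (r0 n))\<^sup>2 * lam (s (r0 n)) j \<le> mu j + 1"
      by (auto simp: eventually_sequentially)
    define t where "t n = s (r0 (n + N))" for n
    have t: "0 < t n" for n using s by (simp add: t_def)
    have t0: "t \<longlonglongrightarrow> 0" unfolding t_def by (rule LIMSEQ_ignore_initial_segment[OF s0])
    have far: "\<not> dist \<bar>ipl (us (t n) j) (Xs j)\<bar> 1 < e" for n using r0(2) by (simp add: t_def)
    have "\<forall>n. \<exists>H. scaled (t n) ((t n)\<^sup>2 * lam (t n) j) (us (t n) j) H" using usD(4)[OF t j] by blast
    then obtain H where H: "\<And>n. scaled (t n) ((t n)\<^sup>2 * lam (t n) j) (us (t n) j) (H n)" by metis
    have "(t n)\<^sup>2 * lam (t n) j \<le> mu j + 1" for n using N[of "n + N"] by (simp add: t_def)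
    from solutions_compact[OF H t0 this]
    obtain r l U H' where r: "strict_mono (r :: nat \<Rightarrow> nat)" and l: "(\<lambda>n. (t (r n))\<^sup>2 * lam (t (r n)) j) \<longlonglongrightarrow> l"
      and U: "solution l U H'" "ipl U U = 1" and Uf: "\<forall>f\<in>L2 UNIV. (\<lambda>n. ipl (us (t (r n)) j) f) \<longlonglongrightarrow> ipl U f"
      by blast
    have tr: "(\<lambda>n. t (r n)) \<longlonglongrightarrow> 0" using LIMSEQ_subseq_LIMSEQ[OF t0 r] by (simp add: o_def)
    have UL: "U \<in> L2 UNIV" by (rule finite_energyD(2)[OF solutionD(1)[OF U(1)]])
    have l_le: "l \<le> mu j"
    proof (rule field_le_epsilon)
      fix \<eta> :: real assume "\<eta> > 0"
      from eigenvalue_upper_bound[OF j IH t tr this] obtain M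
        where "\<And>n. n \<ge> M \<Longrightarrow> (t (r n))\<^sup>2 * lam (t (r n)) j \<le> mu j + \<eta>" by (auto simp: eventually_sequentially)
      then show "l \<le> mu j + \<eta>" by (intro LIMSEQ_le_const2[OF l]) blast
    qed
    \<comment> \<open>\<open>us i\<close> and \<open>us j\<close> are orthogonal, and
      \<open>us i\<close> approaches \<open>Xs i\<close> up to sign by the induction hypothesis;
      hence the inner product of \<open>us j\<close> with \<open>Xs i\<close> tends to 0.\<close>
    have perp: "ipl (Xs i) U = 0" if i: "i \<in> {1..<j}" for i
    proof -
      have i1: "i \<ge> 1" and ij: "i \<noteq> j" using i by auto
      note Xi = XsD(3)[OF i1]
      have "(\<lambda>n. (ipl (us (t (r n)) j) (Xs i))\<^sup>2) \<longlonglongrightarrow> 0"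
      proof (rule Lim_null_comparison)
        have "(\<lambda>n. \<bar>ipl (us (t (r n)) i) (Xs i)\<bar>) \<longlonglongrightarrow> 1"
          by (rule IH[OF i, unfolded conv_def, rule_format, of "\<lambda>n. t (r n)"]) (rule t, rule tr)
        from tendsto_diff[OF tendsto_const[of 2] tendsto_mult_left[OF this, of 2]]
        show "(\<lambda>n. 2 - 2 * \<bar>ipl (us (t (r n)) i) (Xs i)\<bar>) \<longlonglongrightarrow> 0" by simp
        have "(ipl (us (t (r n)) j) (Xs i))\<^sup>2 \<le> 2 - 2 * \<bar>ipl (us (t (r n)) i) (Xs i)\<bar>" for n
        proof -
          note tn = t[of "r n"]
          have "ipl (us (t (r n)) i) (us (t (r n)) j) = 0" using us_orthonormal[OF tn i1 j] ij by simp
          from unit_vectors_close[OF Xi usD(1)[OF tn i1] usD(1)[OF tn j] _ _ this]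
          show ?thesis
            using us_orthonormal[OF tn i1 i1] us_orthonormal[OF tn j j] Xs_orthonormal[OF i1 i1] by (simp add: L2_inner_commute)
        qed
        then show "\<forall>\<^sub>F n in sequentially. norm ((ipl (us (t (r n)) j) (Xs i))\<^sup>2) \<le> 2 - 2 * \<bar>ipl (us (t (r n)) i) (Xs i)\<bar>"
          by (intro always_eventually allI) simp
      qed
      moreover have "(\<lambda>n. (ipl (us (t (r n)) j) (Xs i))\<^sup>2) \<longlonglongrightarrow> (ipl U (Xs i))\<^sup>2"
        by (intro tendsto_power) (use Uf Xi in blast)
      ultimately have "(ipl U (Xs i))\<^sup>2 = 0" using LIMSEQ_unique by blast
      then show ?thesis by (simp add: L2_inner_commute)
    qed
    \<comment> \<open>If l < mu j, then U is also orthogonal to every \<open>Xs i\<close> with i at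
      least j, since mu i \<ge> mu j > l. It would be orthogonal to the whole list although it has
      norm 1.\<close>
    have "l = mu j"
    proof (rule ccontr)
      assume ne: "l \<noteq> mu j"
      have "ipl (Xs i) U = 0" if i: "i \<ge> 1" for i
      proof (cases "i < j")
        case True
        then show ?thesis using perp i by simp
      next
        case False
        then have "mu i \<noteq> l" using mu_mono[OF j, of i] l_le ne by simp
        then show ?thesis using XsD(1)[OF i] solutions_orthogonal[OF _ U(1)] by blast
      qed
      then have "ipl U U = 0" by (rule Xs_exhaustive[OF U(1)])
      then show False using U(2) by simp
    qed
    moreover obtain HX where "solution (mu j) (Xs j) HX" using XsD(1)[OF j] by blast
    ultimately have "\<bar>ipl U (Xs j)\<bar> = 1"
      using solutions_simple[OF _ _ U(2)] U(1) Xs_orthonormal[OF j j] by auto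
    then have "(\<lambda>n. \<bar>ipl (us (t (r n)) j) (Xs j)\<bar>) \<longlonglongrightarrow> 1"
      using tendsto_rabs[OF Uf[rule_format, OF XsD(3)[OF j]]] by simp
    then have "\<forall>\<^sub>F n in sequentially. dist \<bar>ipl (us (t (r n)) j) (Xs j)\<bar> 1 < e"
      using e(1) unfolding tendsto_iff by blast
    then show False using far by (auto simp: eventually_sequentially)
  qed
qed

lemma conv_all: "j \<ge> 1 \<Longrightarrow> conv j"
proof (induction j rule: less_induct)
  case (less j)
  show ?case by (rule conv_step[OF less.prems]) (use less.IH in auto)
qed

theorem eigenfunctions_converge:
  assumes j: "j \<ge> 1"
  shows "((\<lambda>s. \<bar>LINT x:I0|lborel. \<Psi> s j x * (X j (x / s) / sqrt s)\<bar>) \<longlongrightarrow> 1) (at_right 0)"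
proof (rule tendsto_at_right_sequentially[of 0 1])
  fix s :: "nat \<Rightarrow> real" assume s: "\<And>n. 0 < s n" "s \<longlonglongrightarrow> 0"
  have m: "X j \<in> borel_measurable borel" by (rule L2_UNIV_measurable[OF XsD(4)[OF j]])
  have "(LINT x:I0|lborel. \<Psi> (s n) j x * (X j (x / s n) / sqrt (s n))) = ipl (us (s n) j) (Xs j)" for n
    using usD(5)[OF s(1) j m] ipl_X[OF j usD(1)[OF s(1) j]] by (simp add: L2_inner_commute)
  then show "(\<lambda>n. \<bar>LINT x:I0|lborel. \<Psi> (s n) j x * (X j (x / s n) / sqrt (s n))\<bar>) \<longlonglongrightarrow> 1"
    using conv_all[OF j] s unfolding conv_def by simp
qed simp

end

section \<open>The potential near the maximum of \<open>h\<close>\<close>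

text \<open>The difference equals (M - h) (M + h) / (h^2 M^2), and the second factor tends to 2 /
  M^3. This is the origin of the constant in \<open>q_pot\<close>.\<close>

lemma tendsto_difference_quotient:
  fixes h :: "real \<Rightarrow> real"
  assumes hM: "(h \<longlongrightarrow> M) F" and M: "M > 0" and g: "((\<lambda>x. (M - h x) / g x) \<longlongrightarrow> c) F"
  shows "((\<lambda>x. (1 / (h x)\<^sup>2 - 1 / M\<^sup>2) / g x) \<longlongrightarrow> 2 * c / M ^ 3) F"
proof (rule Lim_transform_eventually)
  show "((\<lambda>x. ((M - h x) / g x) * ((M + h x) / ((h x)\<^sup>2 * M\<^sup>2))) \<longlongrightarrow> 2 * c / M ^ 3) F"
  proof -
    have "((\<lambda>x. ((M - h x) / g x) * ((M + h x) / ((h x)\<^sup>2 * M\<^sup>2))) \<longlongrightarrow> c * ((M + M) / (M\<^sup>2 * M\<^sup>2))) F"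
      using M by (intro tendsto_mult g tendsto_divide tendsto_add hM tendsto_const tendsto_power) auto
    moreover have "c * ((M + M) / (M\<^sup>2 * M\<^sup>2)) = 2 * c / M ^ 3"
      using M by (simp add: field_simps power2_eq_square power3_eq_cube)
    ultimately show ?thesis by simp
  qed
  have "\<forall>\<^sub>F x in F. h x > 0" by (rule order_tendstoD(1)[OF hM M])
  then show "\<forall>\<^sub>F x in F. ((M - h x) / g x) * ((M + h x) / ((h x)\<^sup>2 * M\<^sup>2)) = (1 / (h x)\<^sup>2 - 1 / M\<^sup>2) / g x"
  proof eventually_elim
    case (elim x)
    have "1 / (h x)\<^sup>2 - 1 / M\<^sup>2 = (M - h x) * (M + h x) / ((h x)\<^sup>2 * M\<^sup>2)"
      using elim M by (simp add: field_simps power2_eq_square)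
    then show ?case by simp
  qed
qed

text \<open>Stated for an abstract filter so that both one-sided expansions of h are covered.
  Dividing the remainder by |x|^m leaves a quantity of order |x|.\<close>

lemma tendsto_expansion:
  fixes h :: "real \<Rightarrow> real"
  assumes m: "m \<ge> 1" and F: "F \<noteq> bot" "(abs \<longlongrightarrow> 0) F" "\<forall>\<^sub>F x in F. x \<noteq> 0"
    and big: "(\<lambda>x. h x - (M - c * \<bar>x\<bar> powr m)) \<in> O[F](\<lambda>x. \<bar>x\<bar> powr (m + 1))"
  shows "(h \<longlongrightarrow> M) F" "((\<lambda>x. (M - h x) / \<bar>x\<bar> powr m) \<longlongrightarrow> c) F"
proof -
  obtain C where C: "\<forall>\<^sub>F x in F. norm (h x - (M - c * \<bar>x\<bar> powr m)) \<le> C * norm (\<bar>x\<bar> powr (m + 1))"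
    using landau_o.bigE[OF big] by blast
  have pm: "((\<lambda>x. \<bar>x\<bar> powr m) \<longlongrightarrow> 0 powr m) F" "((\<lambda>x. \<bar>x\<bar> powr (m + 1)) \<longlongrightarrow> 0 powr (m + 1)) F"
    using m by (intro tendsto_powr' F tendsto_const; simp add: F)+
  have r: "((\<lambda>x. h x - (M - c * \<bar>x\<bar> powr m)) \<longlongrightarrow> 0) F"
  proof (rule Lim_null_comparison[OF C])
    show "((\<lambda>x. C * norm (\<bar>x\<bar> powr (m + 1))) \<longlongrightarrow> 0) F"
      using tendsto_mult_left[OF pm(2), of C] m by simp
  qed
  have "((\<lambda>x. (h x - (M - c * \<bar>x\<bar> powr m)) + (M - c * \<bar>x\<bar> powr m)) \<longlongrightarrow> 0 + (M - c * 0 powr m)) F"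
    by (intro tendsto_intros r pm)
  then show "(h \<longlongrightarrow> M) F" using m by simp
  have "((\<lambda>x. (h x - (M - c * \<bar>x\<bar> powr m)) / \<bar>x\<bar> powr m) \<longlongrightarrow> 0) F"
  proof (rule Lim_null_comparison)
    show "((\<lambda>x. C * \<bar>x\<bar>) \<longlongrightarrow> 0) F" using tendsto_mult_left[OF F(2), of C] by simp
    show "\<forall>\<^sub>F x in F. norm ((h x - (M - c * \<bar>x\<bar> powr m)) / \<bar>x\<bar> powr m) \<le> C * \<bar>x\<bar>"
      using C F(3)
    proof eventually_elim
      case (elim x)
      have pos: "\<bar>x\<bar> powr m > 0" using elim by simp
      have "\<bar>x\<bar> powr (m + 1) = \<bar>x\<bar> powr m * \<bar>x\<bar>" using elim by (simp add: powr_add)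
      then have "norm (h x - (M - c * \<bar>x\<bar> powr m)) \<le> (C * \<bar>x\<bar>) * \<bar>x\<bar> powr m"
        using elim(1) by (simp add: ac_simps)
      then show ?case using pos by (simp add: pos_divide_le_eq)
    qed
  qed
  then have "((\<lambda>x. c - (h x - (M - c * \<bar>x\<bar> powr m)) / \<bar>x\<bar> powr m) \<longlongrightarrow> c - 0) F" by (intro tendsto_intros)
  then have "((\<lambda>x. (M - h x) / \<bar>x\<bar> powr m) \<longlongrightarrow> c - 0) F"
    by (rule Lim_transform_eventually) (use F(3) in \<open>eventually_elim, simp add: field_simps\<close>)
  then show "((\<lambda>x. (M - h x) / \<bar>x\<bar> powr m) \<longlongrightarrow> c) F" unfolding diff_zero .
qed

section \<open>Bounds and integrability of the potential\<close>

lemma continuous_positive_bounds: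
  fixes f :: "real \<Rightarrow> real"
  assumes "continuous_on {p..r} f" "\<And>x. x \<in> {p..r} \<Longrightarrow> 0 < f x" "p \<le> r"
  obtains c d where "0 < c" "\<And>x. x \<in> {p..r} \<Longrightarrow> c \<le> f x" "\<And>x. x \<in> {p..r} \<Longrightarrow> f x \<le> d"
proof -
  have "{p..r} \<noteq> {}" using assms(3) by simp
  obtain x where x: "x \<in> {p..r}" "\<forall>y\<in>{p..r}. f x \<le> f y"
    using continuous_attains_inf[OF compact_Icc \<open>{p..r} \<noteq> {}\<close> assms(1)] by blast
  obtain z where "z \<in> {p..r}" "\<forall>y\<in>{p..r}. f y \<le> f z"
    using continuous_attains_sup[OF compact_Icc \<open>{p..r} \<noteq> {}\<close> assms(1)] by blast
  then show ?thesis using that[of "f x" "f z"] assms(2)[OF x(1)] x(2) by blast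
qed

lemma continuous_on_Icc_extend:
  fixes f :: "real \<Rightarrow> real"
  assumes c: "continuous_on ({p..r} - {z}) f" and l: "(f \<longlongrightarrow> f z) (at z within {p..r})"
  shows "continuous_on {p..r} f"
  unfolding continuous_on_def
proof
  fix x assume x: "x \<in> {p..r}"
  show "(f \<longlongrightarrow> f x) (at x within {p..r})"
  proof (cases "x = z")
    case True
    then show ?thesis using l by simp
  next
    case False
    have "(f \<longlongrightarrow> f x) (at x within {p..r} - {z})" using c x False by (auto simp: continuous_on_def)
    moreover have "at x within {p..r} - {z} = at x within {p..r}"
    proof (rule at_within_nhd[of x "- {z}"])
      show "({p..r} - {z}) \<inter> - {z} - {x} = {p..r} \<inter> - {z} - {x}" by blast
    qed (use False in auto)
    ultimately show ?thesis by simp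
  qed
qed

lemma continuous_off_0_measurable:
  fixes f :: "real \<Rightarrow> real"
  assumes "continuous_on (T - {0}) f" "T \<in> sets borel"
  shows "set_borel_measurable lborel T f"
proof -
  have "(\<lambda>x. indicator (T - {0}) x *\<^sub>R f x) \<in> borel_measurable borel"
    by (rule borel_measurable_continuous_on_indicator[OF _ assms(1)]) (use assms(2) in auto)
  then have "(\<lambda>x. indicator (T - {0}) x *\<^sub>R f x + indicator (T \<inter> {0}) x * f 0) \<in> borel_measurable borel"
    using assms(2) by (intro borel_measurable_add borel_measurable_times borel_measurable_const borel_measurable_indicator) auto
  moreover have "(\<lambda>x. indicator (T - {0}) x *\<^sub>R f x + indicator (T \<inter> {0}) x * f 0) = (\<lambda>x. indicator T x *\<^sub>R f x)"
    by (rule ext) (simp add: indicator_def)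
  ultimately show ?thesis by (simp add: set_borel_measurable_def)
qed

text \<open>Near the end points, where the weight vanishes, v is continuous on a compact set and so
  bounded; on [-a/2, b/2], which contains the possible singularity at 0, the weight is at least the
  constant \<open>c\<close>, so v is at most 1 / c times the weighted W.\<close>

lemma integrable_off_0_if_weighted:
  assumes ab: "a > 0" "b > 0" and v: "continuous_on ({-a..b} - {0}) v" "\<And>x. x \<in> {-a<..<b} \<Longrightarrow> 0 \<le> v x"
    and Wv: "\<And>x. x \<in> {-a<..<b} \<Longrightarrow> v x \<le> W x"
    and int: "set_integrable lborel {-a<..<b} (\<lambda>x. W x * ((x + a) * (b - x))\<^sup>2)"
  shows "set_integrable lborel {-a<..<b::real} v"
proof -
  have b1: "\<exists>C. \<forall>x\<in>T. \<bar>v x\<bar> \<le> C" if T: "compact T" "T \<subseteq> {-a..b} - {0}" for T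
  proof -
    have "compact (v ` T)" using continuous_on_subset[OF v(1) T(2)] T(1) by (rule compact_continuous_image)
    then show ?thesis using compact_imp_bounded bounded_real by (metis imageI)
  qed
  have "\<exists>C. \<forall>x\<in>{-a..-a/2}. \<bar>v x\<bar> \<le> C" by (rule b1) (use ab in auto)
  then obtain C1 where C1: "\<forall>x\<in>{-a..-a/2}. \<bar>v x\<bar> \<le> C1" ..
  have "\<exists>C. \<forall>x\<in>{b/2..b}. \<bar>v x\<bar> \<le> C" by (rule b1) (use ab in auto)
  then obtain C2 where C2: "\<forall>x\<in>{b/2..b}. \<bar>v x\<bar> \<le> C2" ..
  define c where "c = ((a / 2) * (b / 2))\<^sup>2"
  have c: "c > 0" using ab by (simp add: c_def)
  show ?thesis
  proof (rule set_integrable_bound)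
    have "integrable lborel (indicat_real {-a<..<b})" by (rule integrable_real_indicator) (use ab in simp_all)
    then show "set_integrable lborel {-a<..<b} (\<lambda>x. (1 / c) * (W x * ((x + a) * (b - x))\<^sup>2) + (\<bar>C1\<bar> + \<bar>C2\<bar>))"
      using int by (intro set_integral_add(1) set_integrable_mult_right) (auto simp: set_integrable_def)
    show "set_borel_measurable lborel {-a<..<b} v"
      by (rule continuous_off_0_measurable[OF continuous_on_subset[OF v(1)]]) auto
    show "AE x in lborel. x \<in> {-a<..<b} \<longrightarrow>
        norm (v x) \<le> norm ((1 / c) * (W x * ((x + a) * (b - x))\<^sup>2) + (\<bar>C1\<bar> + \<bar>C2\<bar>))"
    proof (intro AE_I2 impI)
      fix x assume x: "x \<in> {-a<..<b}"
      have W0: "0 \<le> W x" using v(2)[OF x] Wv[OF x] by linarith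
      then have n: "0 \<le> (1 / c) * (W x * ((x + a) * (b - x))\<^sup>2)" using c by simp
      have "v x \<le> (1 / c) * (W x * ((x + a) * (b - x))\<^sup>2) + (\<bar>C1\<bar> + \<bar>C2\<bar>)"
      proof (cases "x \<in> {-a/2..b/2}")
        case True
        have "(a / 2) * (b / 2) \<le> (x + a) * (b - x)" using True ab by (intro mult_mono) auto
        then have "c \<le> ((x + a) * (b - x))\<^sup>2" unfolding c_def using ab by (intro power_mono) auto
        then have "W x * c \<le> W x * ((x + a) * (b - x))\<^sup>2" by (rule mult_left_mono[OF _ W0])
        then have "W x \<le> (1 / c) * (W x * ((x + a) * (b - x))\<^sup>2)" using c by (simp add: field_simps)
        then show ?thesis using Wv[OF x] by linarith
      next
        case False
        then have "x \<in> {-a..-a/2} \<or> x \<in> {b/2..b}" using x by auto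
        then have "\<bar>v x\<bar> \<le> \<bar>C1\<bar> + \<bar>C2\<bar>" using bspec[OF C1, of x] bspec[OF C2, of x] by fastforce
        then show ?thesis using n by linarith
      qed
      then show "norm (v x) \<le> norm ((1 / c) * (W x * ((x + a) * (b - x))\<^sup>2) + (\<bar>C1\<bar> + \<bar>C2\<bar>))"
        using v(2)[OF x] by simp
    qed
  qed
qed

text \<open>The test element for \<open>form_defined\<close>: it is positive on the open interval,
  so integrability of the form at this one function bounds the potential near 0.\<close>

lemma parabola_H10:
  assumes "a > 0" "b > 0"
  shows "(\<lambda>x. (x + a) * (b - x)) \<in> H10 {-a<..<b::real}"
proof (rule H10_approx_imp_H10(1)[OF H10_approx_C1])
  show "primitive_on {-a..b} (\<lambda>x. (x + a) * (b - x)) (\<lambda>x. b - a - 2 * x)"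
    by (rule primitive_on_DERIV) (auto intro!: derivative_eq_intros continuous_intros simp: algebra_simps)
qed (use assms in \<open>auto intro!: continuous_intros\<close>)

theorem mainTheorem4:
  fixes a b M m cp cm :: real
    and h h' :: "real \<Rightarrow> real"
    and lam :: "real \<Rightarrow> nat \<Rightarrow> real" and \<Psi> :: "real \<Rightarrow> nat \<Rightarrow> real \<Rightarrow> real"
    and mu :: "nat \<Rightarrow> real" and X :: "nat \<Rightarrow> real \<Rightarrow> real"
    and j :: nat
  assumes ab: "a > 0" "b > 0"
    and h_cont: "continuous_on {-a..b} h"
    and h_pos: "\<And>x. x \<in> {-a..b} \<Longrightarrow> h x > 0"
    and h_max: "\<And>x. x \<in> {-a..b} - {0} \<Longrightarrow> h x < h 0"
    and h_deriv: "\<And>x. x \<in> {-a..b} - {0} \<Longrightarrow>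
                    (h has_real_derivative h' x) (at x within {-a..b})"
    and h'_cont: "continuous_on ({-a..b} - {0}) h'"
    and params: "M > 0" "cp > 0" "cm > 0" "m \<ge> 1"
    and h_right: "(\<lambda>x. h x - (M - cp * x powr m)) \<in> O[at_right 0](\<lambda>x. x powr (m + 1))"
    and h_left: "(\<lambda>x. h x - (M - cm * \<bar>x\<bar> powr m)) \<in> O[at_left 0](\<lambda>x. \<bar>x\<bar> powr (m + 1))"
      (* The quadratic form of the operator is defined on all of H^1_0. The other assumptions do
         not imply this, since h' may oscillate near 0. *)
    and form_defined: "\<And>\<epsilon> w. \<epsilon> > 0 \<Longrightarrow> w \<in> H10 {-a<..<b} \<Longrightarrow>
                    set_integrable lborel {-a<..<b} (\<lambda>x. W_pot h h' M \<epsilon> x * (w x)\<^sup>2)"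
    and \<Psi>: "\<And>\<epsilon>. \<epsilon> > 0 \<Longrightarrow> eigen_enumeration {-a<..<b} (Q_op a b h h' M \<epsilon>) (lam \<epsilon>) (\<Psi> \<epsilon>)"
    and X: "eigen_enumeration UNIV (H_op M m cp cm) mu X"
    and j: "j \<ge> 1"
  shows "let \<alpha> = 2 / (m + 2) in
    \<exists>\<sigma> :: real \<Rightarrow> real. (\<forall>\<epsilon>. \<sigma> \<epsilon> \<in> {-1, 1}) \<and>
      ((\<lambda>\<epsilon>. LINT x:{-a..b}|lborel.
          \<bar>\<sigma> \<epsilon> * \<Psi> \<epsilon> j x - \<epsilon> powr (- \<alpha> / 2) * X j (x * \<epsilon> powr (- \<alpha>))\<bar>\<^sup>2)
        \<longlongrightarrow> 0) (at_right 0)"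
proof -
  define \<alpha> where "\<alpha> = 2 / (m + 2)"
  define I0 where "I0 = {-a<..<b}"
  \<comment> \<open>The value at 0 is the limit from the right, which makes K continuous on [0, b]
    and hence bounded there by compactness.\<close>
  define K where "K x = (if x = 0 then pi\<^sup>2 * (2 * cp / M ^ 3) else pi\<^sup>2 * ((1 / (h x)\<^sup>2 - 1 / M\<^sup>2) / \<bar>x\<bar> powr m))" for x
  define \<kappa>p \<kappa>m where "\<kappa>p = pi\<^sup>2 * (2 * cp / M ^ 3)" and "\<kappa>m = pi\<^sup>2 * (2 * cm / M ^ 3)"
  have m: "m > 0" using params by simp
  have absR: "(abs \<longlongrightarrow> (0::real)) (at_right 0)" "(abs \<longlongrightarrow> (0::real)) (at_left 0)"
    using tendsto_rabs[OF tendsto_ident_at, of "0::real"] by auto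
  have ne0: "\<forall>\<^sub>F x in at_right (0::real). x \<noteq> 0" "\<forall>\<^sub>F x in at_left (0::real). x \<noteq> 0"
    by (auto simp: eventually_at_filter)
  have bigR: "(\<lambda>x. h x - (M - cp * \<bar>x\<bar> powr m)) \<in> O[at_right 0](\<lambda>x. \<bar>x\<bar> powr (m + 1))"
  proof -
    have pos: "\<forall>\<^sub>F x in at_right (0::real). x > 0" by (simp add: eventually_at_right_less)
    have "(\<lambda>x. h x - (M - cp * \<bar>x\<bar> powr m)) \<in> O[at_right 0](\<lambda>x. \<bar>x\<bar> powr (m + 1)) \<longleftrightarrow>
        (\<lambda>x. h x - (M - cp * x powr m)) \<in> O[at_right 0](\<lambda>x. x powr (m + 1))"
      by (rule landau_o.big.cong_ex) (use pos in \<open>eventually_elim, auto\<close>)+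
    then show ?thesis using h_right by blast
  qed
  have nb: "at_right (0::real) \<noteq> bot" "at_left (0::real) \<noteq> bot" by simp_all
  note expR = tendsto_expansion[OF params(4) nb(1) absR(1) ne0(1) bigR]
  note expL = tendsto_expansion[OF params(4) nb(2) absR(2) ne0(2) h_left]
  have hR: "(h \<longlongrightarrow> h 0) (at_right 0)"
  proof -
    have "(h \<longlongrightarrow> h 0) (at 0 within {-a..b})" using h_cont ab by (auto simp: continuous_on_def)
    then have "(h \<longlongrightarrow> h 0) (at 0 within {0..b})" by (rule tendsto_within_subset) (use ab in auto)
    moreover have "at 0 within {0..b} = at_right 0" using ab(2) by (rule at_within_Icc_at_right)
    ultimately show ?thesis by simp
  qed
  \<comment> \<open>The limit of h from the right is h 0 by continuity and M by the
    expansion.\<close>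
  have h0: "h 0 = M" using tendsto_unique[OF nb(1) hR expR(1)] .
  have KR: "(K \<longlongrightarrow> \<kappa>p) (at_right 0)" and KL: "(K \<longlongrightarrow> \<kappa>m) (at_left 0)"
  proof -
    have "((\<lambda>x. pi\<^sup>2 * ((1 / (h x)\<^sup>2 - 1 / M\<^sup>2) / \<bar>x\<bar> powr m)) \<longlongrightarrow> \<kappa>p) (at_right 0)"
      unfolding \<kappa>p_def by (intro tendsto_mult_left tendsto_difference_quotient[OF expR(1) params(1) expR(2)])
    then show "(K \<longlongrightarrow> \<kappa>p) (at_right 0)"
      by (rule Lim_transform_eventually) (use ne0(1) in \<open>eventually_elim, simp add: K_def\<close>)
    have "((\<lambda>x. pi\<^sup>2 * ((1 / (h x)\<^sup>2 - 1 / M\<^sup>2) / \<bar>x\<bar> powr m)) \<longlongrightarrow> \<kappa>m) (at_left 0)"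
      unfolding \<kappa>m_def by (intro tendsto_mult_left tendsto_difference_quotient[OF expL(1) params(1) expL(2)])
    then show "(K \<longlongrightarrow> \<kappa>m) (at_left 0)"
      by (rule Lim_transform_eventually) (use ne0(2) in \<open>eventually_elim, simp add: K_def\<close>)
  qed
  have \<kappa>: "0 < \<kappa>p" "0 < \<kappa>m" using params by (simp_all add: \<kappa>p_def \<kappa>m_def)
  have hM: "h x \<le> M" if "x \<in> {-a..b}" for x using h_max[of x] h0 that by (cases "x = 0") auto
  have diff_nonneg: "0 \<le> 1 / (h x)\<^sup>2 - 1 / M\<^sup>2" if x: "x \<in> {-a..b}" for x
  proof -
    have "(h x)\<^sup>2 \<le> M\<^sup>2" by (rule power_mono[OF hM[OF x]]) (use h_pos[OF x] in simp)
    then have "1 / M\<^sup>2 \<le> 1 / (h x)\<^sup>2" using h_pos[OF x] by (intro divide_left_mono) (auto simp: zero_less_mult_iff params)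
    then show ?thesis by simp
  qed
  have Kpos: "K x > 0" if x: "x \<in> {-a..b}" "x \<noteq> 0" for x
  proof -
    have "(h x)\<^sup>2 < M\<^sup>2" using h_max[of x] h0 h_pos[OF x(1)] x by (intro power_strict_mono) auto
    then have "1 / M\<^sup>2 < 1 / (h x)\<^sup>2" using h_pos[OF x(1)] by (intro divide_strict_left_mono) (auto simp: zero_less_mult_iff params)
    then show ?thesis using x by (simp add: K_def)
  qed
  have Kc: "continuous_on ({-a..b} - {0}) K"
  proof -
    have "continuous_on ({-a..b} - {0}) (\<lambda>x. pi\<^sup>2 * ((1 / (h x)\<^sup>2 - 1 / M\<^sup>2) / \<bar>x\<bar> powr m))"
    proof (intro continuous_intros continuous_on_subset[OF h_cont])
      show "\<forall>x\<in>{-a..b} - {0}. (h x)\<^sup>2 \<noteq> 0" using h_pos by fastforce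
    qed auto
    then show ?thesis by (rule continuous_on_eq) (simp add: K_def)
  qed
  obtain c1 d1 where K1: "0 < c1" "\<And>x. x \<in> {0..b} \<Longrightarrow> c1 \<le> K x" "\<And>x. x \<in> {0..b} \<Longrightarrow> K x \<le> d1"
  proof (rule continuous_positive_bounds[of 0 b K])
    show "continuous_on {0..b} K"
    proof (rule continuous_on_Icc_extend[where z = 0])
      show "continuous_on ({0..b} - {0}) K" by (rule continuous_on_subset[OF Kc]) (use ab in auto)
      have "at 0 within {0..b} = at_right 0" using ab(2) by (rule at_within_Icc_at_right)
      then show "(K \<longlongrightarrow> K 0) (at 0 within {0..b})" using KR by (simp add: K_def \<kappa>p_def)
    qed
    show "0 < K x" if "x \<in> {0..b}" for x
      using Kpos[of x] that ab \<kappa> by (cases "x = 0") (auto simp: K_def \<kappa>p_def)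
  qed (use ab in auto)
  \<comment> \<open>The same function with the limit from the left as its value at 0, for the bounds
    on [-a, 0].\<close>
  define K2 where "K2 x = (if x = 0 then \<kappa>m else K x)" for x
  obtain c2 d2 where K2: "0 < c2" "\<And>x. x \<in> {-a..0} \<Longrightarrow> c2 \<le> K2 x" "\<And>x. x \<in> {-a..0} \<Longrightarrow> K2 x \<le> d2"
  proof (rule continuous_positive_bounds[of "-a" 0 K2])
    show "continuous_on {-a..0} K2"
    proof (rule continuous_on_Icc_extend[where z = 0])
      have "continuous_on ({-a..0} - {0}) K" by (rule continuous_on_subset[OF Kc]) (use ab in auto)
      then show "continuous_on ({-a..0} - {0}) K2" by (rule continuous_on_eq) (simp add: K2_def)
      have "at 0 within {-a..0} = at_left 0" using ab(1) by (intro at_within_Icc_at_left) simp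
      moreover have "(K2 \<longlongrightarrow> \<kappa>m) (at_left 0)"
        by (rule Lim_transform_eventually[OF KL]) (use ne0(2) in \<open>eventually_elim, simp add: K2_def\<close>)
      ultimately show "(K2 \<longlongrightarrow> K2 0) (at 0 within {-a..0})" by (simp add: K2_def)
    qed
    show "0 < K2 x" if "x \<in> {-a..0}" for x
      using Kpos[of x] that ab \<kappa> by (cases "x = 0") (auto simp: K2_def)
  qed (use ab in auto)
  have Kb: "min c1 c2 \<le> K x" "K x \<le> max d1 d2" if x: "x \<in> {-a<..<b}" for x
  proof -
    have "min c1 c2 \<le> K x \<and> K x \<le> max d1 d2"
    proof (cases "0 \<le> x")
      case True
      then show ?thesis using K1(2,3)[of x] x by auto
    next
      case False
      then show ?thesis using K2(2,3)[of x] x by (auto simp: K2_def)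
    qed
    then show "min c1 c2 \<le> K x" "K x \<le> max d1 d2" by auto
  qed
  have v0: "0 \<le> v_pot h h' x" for x by (simp add: v_pot_def)
  have vc: "continuous_on ({-a..b} - {0}) (v_pot h h')"
    unfolding v_pot_def
  proof (intro continuous_intros h'_cont continuous_on_subset[OF h_cont])
    show "\<forall>x\<in>{-a..b} - {0}. (h x)\<^sup>2 \<noteq> 0" using h_pos by fastforce
  qed auto
  \<comment> \<open>The form at \<epsilon> = 1, evaluated on the parabola; \<open>W_pot\<close>
    dominates \<open>v_pot\<close> because h \<le> M.\<close>
  have vint: "set_integrable lborel {-a<..<b} (v_pot h h')"
  proof (rule integrable_off_0_if_weighted[OF ab vc v0])
    show "v_pot h h' x \<le> W_pot h h' M 1 x" if "x \<in> {-a<..<b}" for x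
      using diff_nonneg[of x] that by (simp add: W_pot_def)
    show "set_integrable lborel {-a<..<b} (\<lambda>x. W_pot h h' M 1 x * ((x + a) * (b - x))\<^sup>2)"
      by (rule form_defined[OF _ parabola_H10[OF ab]]) simp
  qed
  interpret semiclassical_limit a b m "min c1 c2" "max d1 d2" \<kappa>p \<kappa>m K "v_pot h h'"
  proof unfold_locales
    show "set_borel_measurable lborel {-a<..<b} K"
      by (rule continuous_off_0_measurable[OF continuous_on_subset[OF Kc]]) auto
  qed (use ab m K1(1) K2(1) Kb KR KL \<kappa> v0 vint in \<open>auto simp: min_le_iff_disj le_max_iff_disj\<close>)
  \<comment> \<open>Inverse of \<epsilon> \<mapsto> \<epsilon> powr \<alpha>, since \<alpha> (m + 2)
    / 2 = 1. Its square is s powr (m + 2), the denominator in \<open>W\<close>.\<close>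
  define ee where "ee s = s powr ((m + 2) / 2)" for s :: real
  have W_eq: "W s = W_pot h h' M (ee s)" if s: "s > 0" for s
  proof
    fix x
    have e2: "(ee s)\<^sup>2 = s powr (m + 2)"
      using s by (simp add: ee_def power2_eq_square powr_add[symmetric])
    have "K x * \<bar>x\<bar> powr m = pi\<^sup>2 * (1 / (h x)\<^sup>2 - 1 / M\<^sup>2)"
      using m h0 by (cases "x = 0") (simp_all add: K_def)
    then show "W s x = W_pot h h' M (ee s) x"
      unfolding W_def W_pot_def e2 by simp
  qed
  have q_eq: "q = q_pot M m cp cm"
    by (rule ext) (simp only: q_def q_pot_def, simp add: \<kappa>p_def \<kappa>m_def)
  interpret semiclassical_eigen a b m "min c1 c2" "max d1 d2" \<kappa>p \<kappa>m K "v_pot h h'"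
    "\<lambda>s. lam (ee s)" "\<lambda>s. \<Psi> (ee s)" mu X
  proof unfold_locales
    show "eigen_enumeration {-a<..<b} (form_operator {-a<..<b} (H10 {-a<..<b}) (schroedinger_form {-a<..<b} (W s))) (lam (ee s)) (\<Psi> (ee s))"
      if s: "s > 0" for s
      using \<Psi>[of "ee s"] s unfolding W_eq[OF s] Q_op_def by (simp add: ee_def)
    show "eigen_enumeration UNIV (form_operator UNIV fdom QL) mu X"
      using X unfolding H_op_def q_eq .
  qed
  define c where "c \<epsilon> = (LINT x:{-a<..<b}|lborel. \<Psi> \<epsilon> j x * (X j (x / \<epsilon> powr \<alpha>) / sqrt (\<epsilon> powr \<alpha>)))" for \<epsilon>
  have am: "\<alpha> * ((m + 2) / 2) = 1" "\<alpha> > 0" using m by (simp_all add: \<alpha>_def)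
  have ee: "ee (\<epsilon> powr \<alpha>) = \<epsilon>" if "\<epsilon> > 0" for \<epsilon>
    using that am by (simp add: ee_def powr_powr)
  have "filterlim (\<lambda>\<epsilon>. \<epsilon> powr \<alpha>) (at_right 0) (at_right (0::real))"
    unfolding filterlim_at
  proof
    have "\<forall>\<^sub>F \<epsilon> in at_right (0::real). \<epsilon> > 0" by (simp add: eventually_at_right_less)
    then show "\<forall>\<^sub>F \<epsilon> in at_right (0::real). \<epsilon> powr \<alpha> \<in> {0<..} \<and> \<epsilon> powr \<alpha> \<noteq> 0"
      by eventually_elim simp
    have "((\<lambda>\<epsilon>::real. \<epsilon> powr \<alpha>) \<longlongrightarrow> 0 powr \<alpha>) (at_right 0)"
      by (rule tendsto_powr'[OF tendsto_ident_at tendsto_const]) (use am \<open>\<forall>\<^sub>F \<epsilon> in at_right (0::real). \<epsilon> > 0\<close> in \<open>auto elim: eventually_mono\<close>)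
    then show "((\<lambda>\<epsilon>::real. \<epsilon> powr \<alpha>) \<longlongrightarrow> 0) (at_right 0)" by simp
  qed
  from filterlim_compose[OF eigenfunctions_converge[OF j] this]
  have "((\<lambda>\<epsilon>. \<bar>LINT x:{-a<..<b}|lborel. \<Psi> (ee (\<epsilon> powr \<alpha>)) j x * (X j (x / \<epsilon> powr \<alpha>) / sqrt (\<epsilon> powr \<alpha>))\<bar>) \<longlongrightarrow> 1) (at_right 0)" .
  then have clim: "((\<lambda>\<epsilon>. \<bar>c \<epsilon>\<bar>) \<longlongrightarrow> 1) (at_right 0)"
    by (rule Lim_transform_eventually) (simp add: eventually_at_filter ee c_def)
  \<comment> \<open>The sign of the inner product, so that the cross term in the expanded square is
    - 2 |c \<epsilon>|.\<close>
  define \<sigma> :: "real \<Rightarrow> real" where "\<sigma> \<epsilon> = (if 0 \<le> c \<epsilon> then 1 else -1)" for \<epsilon>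
  have XL: "X j \<in> L2 UNIV" by (rule XsD(4)[OF j])
  have Xm: "X j \<in> borel_measurable borel" by (rule L2_UNIV_measurable[OF XL])
  have X1: "L2_inner UNIV (X j) (X j) = 1" using X j unfolding eigen_enumeration_def by simp
  \<comment> \<open>Expansion of the square: the eigenfunction of the interval problem has norm 1,
    and the rescaled X j has norm 1 on the line, hence at most 1 on the interval.\<close>
  have est: "(LINT x:{-a..b}|lborel. \<bar>\<sigma> \<epsilon> * \<Psi> \<epsilon> j x - \<epsilon> powr (- \<alpha> / 2) * X j (x * \<epsilon> powr (- \<alpha>))\<bar>\<^sup>2) \<le> 2 - 2 * \<bar>c \<epsilon>\<bar>"
    if \<epsilon>: "\<epsilon> > 0" for \<epsilon>
  proof -
    define s where "s = \<epsilon> powr \<alpha>"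
    have s: "s > 0" using \<epsilon> by (simp add: s_def)
    interpret schroedinger_interval "-a" b "W s" by (rule interval[OF s])
    define Xe where "Xe x = X j (x / s) / sqrt s" for x
    have sq: "\<epsilon> powr (- \<alpha> / 2) = 1 / sqrt s" "\<epsilon> powr (- \<alpha>) = 1 / s"
    proof -
      have "sqrt s = \<epsilon> powr (\<alpha> / 2)" using s by (simp add: powr_half_sqrt[symmetric] s_def powr_powr)
      then show "\<epsilon> powr (- \<alpha> / 2) = 1 / sqrt s" by (simp add: powr_minus_divide)
      show "\<epsilon> powr (- \<alpha>) = 1 / s" by (simp add: s_def powr_minus_divide)
    qed
    have "eigen_enumeration S (form_operator S (H10 S) Q) (lam \<epsilon>) (\<Psi> \<epsilon>)"
      using E[OF s] ee[OF \<epsilon>] by (simp add: s_def)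
    note d = eigen_enumerationD[OF this j]
    have PL: "\<Psi> \<epsilon> j \<in> L2 S" by (rule H10_L2[OF d(1)])
    have XXi: "integrable lborel (\<lambda>y. X j y * X j y)" by (rule L2_UNIV_integrable_mult[OF XL XL])
    have XeXe: "Xe (s * y) * Xe (s * y) = (X j y * X j y) / s" for y using s by (simp add: Xe_def)
    have Xei: "integrable lborel (\<lambda>x. Xe x * Xe x)" "(LINT x|lborel. Xe x * Xe x) = 1"
      using integral_scale[OF s, of "\<lambda>x. Xe x * Xe x"] XXi X1 s unfolding XeXe by (simp_all add: ipl_eq)
    have Xem: "Xe \<in> borel_measurable borel" unfolding Xe_def[abs_def] using Xm by measurable
    have XeU: "Xe \<in> L2 UNIV"
      using Xei(1) Xem by (simp add: L2_def set_borel_measurable_def set_integrable_def power2_eq_square)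
    have XeL: "Xe \<in> L2 S" by (rule L2_subset[OF XeU]) auto
    have Xe1: "L2_inner S Xe Xe \<le> 1"
      using L2_inner_mono_set[OF XeU subset_UNIV, of S] Xei(2) by (simp add: ipl_eq)
    have ip: "L2_inner S Xe (\<Psi> \<epsilon> j) = c \<epsilon>"
      by (simp add: c_def L2_inner_def Xe_def s_def mult.commute)
    have "(LINT x:{-a..b}|lborel. \<bar>\<sigma> \<epsilon> * \<Psi> \<epsilon> j x - \<epsilon> powr (- \<alpha> / 2) * X j (x * \<epsilon> powr (- \<alpha>))\<bar>\<^sup>2) =
        (LINT x:S|lborel. \<bar>\<sigma> \<epsilon> * \<Psi> \<epsilon> j x - \<epsilon> powr (- \<alpha> / 2) * X j (x * \<epsilon> powr (- \<alpha>))\<bar>\<^sup>2)"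
      by (rule set_integral_discrete_difference[where X = "{-a, b}"]) auto
    also have "\<dots> = L2_inner S (\<lambda>x. Xe x + (- \<sigma> \<epsilon>) * \<Psi> \<epsilon> j x) (\<lambda>x. Xe x + (- \<sigma> \<epsilon>) * \<Psi> \<epsilon> j x)"
      unfolding L2_inner_def sq
    proof (rule set_lebesgue_integral_cong)
      have "\<bar>\<sigma> \<epsilon> * \<Psi> \<epsilon> j x - 1 / sqrt s * X j (x * (1 / s))\<bar>\<^sup>2 =
          (Xe x + - \<sigma> \<epsilon> * \<Psi> \<epsilon> j x) * (Xe x + - \<sigma> \<epsilon> * \<Psi> \<epsilon> j x)" for x
        by (simp add: Xe_def power2_eq_square algebra_simps)
      then show "\<forall>x. x \<in> S \<longrightarrow> \<bar>\<sigma> \<epsilon> * \<Psi> \<epsilon> j x - 1 / sqrt s * X j (x * (1 / s))\<bar>\<^sup>2 =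
          (Xe x + - \<sigma> \<epsilon> * \<Psi> \<epsilon> j x) * (Xe x + - \<sigma> \<epsilon> * \<Psi> \<epsilon> j x)" by blast
    qed simp
    also have "\<dots> = L2_inner S Xe Xe + 2 * c \<epsilon> * (- \<sigma> \<epsilon>) + 1 * (- \<sigma> \<epsilon>)\<^sup>2"
      unfolding L2_inner_add_cmult[OF XeL PL] ip d(3) ..
    also have "\<dots> \<le> 1 + 2 * c \<epsilon> * (- \<sigma> \<epsilon>) + 1 * (- \<sigma> \<epsilon>)\<^sup>2" using Xe1 by simp
    also have "\<dots> = 2 - 2 * \<bar>c \<epsilon>\<bar>" by (simp add: \<sigma>_def)
    finally show ?thesis .
  qed
  have "((\<lambda>\<epsilon>. LINT x:{-a..b}|lborel. \<bar>\<sigma> \<epsilon> * \<Psi> \<epsilon> j x - \<epsilon> powr (- \<alpha> / 2) * X j (x * \<epsilon> powr (- \<alpha>))\<bar>\<^sup>2) \<longlongrightarrow> 0) (at_right 0)"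
  proof (rule Lim_null_comparison)
    show "((\<lambda>\<epsilon>. 2 - 2 * \<bar>c \<epsilon>\<bar>) \<longlongrightarrow> 0) (at_right 0)"
      using tendsto_diff[OF tendsto_const[of 2] tendsto_mult_left[OF clim, of 2]] by simp
    have nn: "0 \<le> (LINT x:{-a..b}|lborel. \<bar>f x\<bar>\<^sup>2)" for f :: "real \<Rightarrow> real"
      unfolding set_lebesgue_integral_def by (intro integral_nonneg_AE AE_I2) simp
    have "\<forall>\<^sub>F \<epsilon> in at_right (0::real). \<epsilon> > 0" by (simp add: eventually_at_right_less)
    then show "\<forall>\<^sub>F \<epsilon> in at_right 0. norm (LINT x:{-a..b}|lborel. \<bar>\<sigma> \<epsilon> * \<Psi> \<epsilon> j x - \<epsilon> powr (- \<alpha> / 2) * X j (x * \<epsilon> powr (- \<alpha>))\<bar>\<^sup>2) \<le> 2 - 2 * \<bar>c \<epsilon>\<bar>"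
    proof eventually_elim
      case (elim \<epsilon>)
      show ?case unfolding real_norm_def abs_of_nonneg[OF nn] by (rule est[OF elim])
    qed
  qed
  moreover have "\<sigma> \<epsilon> \<in> {-1, 1}" for \<epsilon> by (simp add: \<sigma>_def)
  ultimately show ?thesis unfolding Let_def \<alpha>_def[symmetric] by blast
qed

end
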